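(* Let $A$ be a homogeneous matrix, $w$ a generic direction, $v$ a fake exponent of $H_A(\beta)$ in the direction $w$, and $\mathcal N$ a negative support family for $v$ (not assumed ordered unless stated). For a fixed Gale dual $B$ and the resulting map $\Phi$ there are natural $\widehat S$-module isomorphisms $$\mathfrak D_{\mathcal N}(e)\;\simeq\;\frac{\Pi_{\mathcal N}:m_{v,\mathcal N}}{\Phi(Q_{\mathcal N}(t):e)}\;\simeq\;\frac{e\widehat R\cap\bigl((U\cap M_{\mathcal N})+P_{\mathcal N}(t)\bigr)}{e\widehat R\cap\bigl(UM_{\mathcal N}+P_{\mathcal N}(t)\bigr)}.$$ If $\mathcal N$ is ordered, the intrinsic coefficient space at $v$ for $\mathcal N$ equals the ambient coefficient space at $v$ for $\mathcal N$ if and only if $\mathfrak D_{\mathcal N}(e)=0$. Moreover, the second isomorphism identifies $\mathfrak D_{\mathcal N}(e)$ with the submodule of $\mathfrak T_{\mathcal N}$ consisting of the classes represented by multiples of $e$. The module $\mathfrak T_{\mathcal N}$ is a quotient of $$\operatorname{Tor}^{\widehat R}_1\bigl(\widehat R/U,\widehat R/M_{\mathcal N}\bigr)\simeq\frac{U\cap M_{\mathcal N}}{UM_{\mathcal N}}.$$ In particular, if $U\cap M_{\mathcal N}\subseteq UM_{\mathcal N}+P_{\mathcal N}(t)$, then $\mathfrak D_{\mathcal N}(e)=0$.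
   Context: System. $\mathbb N=\{0,1,2,\dots\}$. $A=(a_{ij})\in\mathbb Z^{d\times n}$ has rank $d$ and its columns lie in an affine hyperplane not containing the origin ("homogeneous"). $L=\ker_{\mathbb Z}(A)$, $r=\operatorname{rank}L=n-d$. For $u\in L$ write $u=u_+-u_-$ with $u_\pm\in\mathbb N^n$ of disjoint support. $I_A=\langle\partial^{u_+}-\partial^{u_-}\mid u\in L\rangle\subseteq\mathbb C[\partial_1,\dots,\partial_n]$. For $\beta\in\mathbb C^d$, $H_A(\beta)$ is the left ideal of the Weyl algebra in $x_1,\dots,x_n$ generated by $I_A$ and $\sum_j a_{ij}x_j\partial_j-\beta_i$ $(1\le i\le d)$. $\operatorname{in}_w$ takes terms of largest $w$-weight; $\operatorname{in}_{(-w,w)}$ is the initial ideal in the Weyl algebra for weights $-w$ on $x$, $w$ on $\partial$. A direction $w\in\mathbb R^n$ is generic if $\operatorname{in}_w(I_A)$ is a monomial ideal and $w$ lies in the interior of a full-dimensional cone of the small Gröbner fan of $H_A(\beta)$ (so $\operatorname{in}_{(-w',w')}(H_A(\beta))$ is constant for $w'$ in that interior). For $z\in\mathbb C^n$, $p\in\mathbb N^n$: $[z]_p=\prod_j z_j(z_j-1)\cdots(z_j-p_j+1)$. A fake exponent of $H_A(\beta)$ in the direction $w$ is $v\in\mathbb C^n$ with $Av=\beta$ and $[v]_p=0$ for every monomial $\partial^p\in\operatorname{in}_w(I_A)$. Negative supports. $\operatorname{nsupp}(z)=\{j\mid z_j\in\mathbb Z_{<0}\}$. For $u\in L$, $I_u=\operatorname{nsupp}(v+u)$;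 $I_0=\operatorname{nsupp}(v)$; $\mathcal S(v)=\{I_u\mid u\in L\}$. The distinguished collection is $\mathcal N_v=\{I\in\mathcal S(v)\mid w\cdot u\ge0\text{ for every }u\in L\text{ with }I_u=I\}$. A negative support family for $v$ is a set $\mathcal N$ with $I_0\in\mathcal N\subseteq\mathcal N_v$; it is ordered if $I\in\mathcal N$, $J\in\mathcal S(v)$, $J\subseteq I$ imply $J\in\mathcal N$. $K_{\mathcal N}=\bigcap_{I\in\mathcal N}I$. Ideals. $\widehat R=\mathbb C[[t_1,\dots,t_n]]$, $t^J=\prod_{j\in J}t_j$ ($t^\varnothing=1$), $e=t^{I_0\setminus K_{\mathcal N}}$. $U=\langle At\rangle$ is generated by the entries $\sum_j a_{ij}t_j$; $M_{\mathcal N}=\langle t^{I\setminus K_{\mathcal N}}\mid I\in\mathcal N\rangle$; $P_{\mathcal N}(t)=\langle t^{(I\cup J)\setminus K_{\mathcal N}}\mid I\in\mathcal N,\ J\in\mathcal S(v)\setminus\mathcal N\rangle$; $Q_{\mathcal N}(t)=UM_{\mathcal N}+P_{\mathcal N}(t)$. A Gale dual $B$ is an $n\times r$ integer matrix whose columns form a $\mathbb Z$-basis of $L$. $\widehat S=\mathbb C[[s_1,\dots,s_r]]$; $\Phi:\widehat R\to\widehat S$, $t_j\mapsto(Bs)_j$, is surjective with kernel $U$. $\Pi_{\mathcal N}=\Phi(P_{\mathcal N}(t))$, $m_{v,\mathcal N}=\Phi(e)=\prod_{j\in I_0\setminus K_{\mathcal N}}(Bs)_j$. $$\mathfrak D_{\mathcal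 N}(e)=\frac{(U+P_{\mathcal N}(t)):e}{(UM_{\mathcal N}+P_{\mathcal N}(t)):e},\qquad \mathfrak T_{\mathcal N}=\frac{(U\cap M_{\mathcal N})+P_{\mathcal N}(t)}{UM_{\mathcal N}+P_{\mathcal N}(t)}.$$ Coefficient spaces (for $\mathcal N$ ordered). The ambient coefficient space at $v$ for $\mathcal N$ (the coefficients of $x^v$ obtained by the Okuyama–Saito ambient perturbation) is the full coefficient space: all polynomials $p_0(\log x)$ for which there is a formal series $\sum_{u\in L}x^{v+u}p_u(\log x)$, $p_u\in\mathbb C[y_1,\dots,y_n]$, annihilated by $H_A(\beta)$, with $I_u\in\mathcal N$ whenever $p_u\ne0$. For the intrinsic one, put $a_u(s)=[v+Bs]_{u_-}/[v+Bs+u]_{u_+}$ and $\Psi_{\mathcal N}(x,s)=m_{v,\mathcal N}(s)\sum_{u\in L,\,I_u\in\mathcal N}a_u(s)x^{v+Bs+u}$, and let $\mathcal P_{v,\mathcal N}\subseteq\mathbb C[s_1,\dots,s_r]$ be the ideal generated by the products $\prod_{j\in(I\cup J)\setminus K_{\mathcal N}}(Bs)_j$, $I\in\mathcal N$, $J\in\mathcal S(v)\setminus\mathcal N$. For a homogeneous ideal $I\subseteq\mathbb C[s]$, $I^\perp=\{q(\partial_s)\in\mathbb C[\partial_{s_1},\dots,\partial_{s_r}]\mid (q(\partial_s)f)|_{s=0}=0\ \forall f\in I\}$. The intrinsic coefficient space at $v$ for $\mathcal N$ is the space of coefficients of $x^v$ (polynomials in $\log x$) in the series $q(\partial_s)\Psi_{\mathcal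 N}(x,s)|_{s=0}$, $q\in\mathcal P_{v,\mathcal N}^\perp$. *)

theory Defs
  imports
    "HOL-Library.Poly_Mapping"
    "HOL-Analysis.Analysis"
    "HOL-Algebra.Module"
    "HOL-Algebra.Ideal_Product"
begin

section \<open>Power series and polynomials in several variables\<close>

text \<open>A series in variables indexed by \<open>'i\<close> is its family of coefficients, indexed by
  exponent vectors of finite support.  The set \<open>V\<close> cuts out the series in which only
  variables from \<open>V\<close> occur; this allows zero variables (\<open>V = {}\<close>), which an index type does not.\<close>

type_synonym 'i series = "('i \<Rightarrow>\<^sub>0 nat) \<Rightarrow> complex"

abbreviation "lookup \<equiv> Poly_Mapping.lookup"

definition mps_ring :: "'i set \<Rightarrow> 'i series ring" where
  "mps_ring V = \<lparr>carrier = {f. \<forall>m. f m \<noteq> 0 \<longrightarrow> Poly_Mapping.keys m \<subseteq> V},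
     mult = (\<lambda>f g m. \<Sum>(a, b) | a + b = m. f a * g b),
     one = (\<lambda>m. if m = 0 then 1 else 0),
     zero = (\<lambda>m. 0),
     add = (\<lambda>f g m. f m + g m)\<rparr>"

definition mpoly_ring :: "'i set \<Rightarrow> 'i series ring" where
  "mpoly_ring V = (mps_ring V)\<lparr>carrier := {f \<in> carrier (mps_ring V). finite {m. f m \<noteq> 0}}\<rparr>"

definition mon :: "('i \<Rightarrow>\<^sub>0 nat) \<Rightarrow> 'i series" where
  "mon p = (\<lambda>m. if m = p then 1 else 0)"

definition var :: "'i \<Rightarrow> 'i series" where
  "var j = mon (Poly_Mapping.single j 1)"

definition const :: "complex \<Rightarrow> 'i series" where
  "const c = (\<lambda>m. if m = 0 then c else 0)"

definition total_degree :: "('i \<Rightarrow>\<^sub>0 nat) \<Rightarrow> nat" where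
  "total_degree m = (\<Sum>j\<in>Poly_Mapping.keys m. lookup m j)"

definition mfact :: "('i \<Rightarrow>\<^sub>0 nat) \<Rightarrow> nat" where
  "mfact m = (\<Prod>j\<in>Poly_Mapping.keys m. fact (lookup m j))"

text \<open>The terms of largest weight; the zero series has initial form zero.\<close>

definition init_form :: "('m \<Rightarrow> real) \<Rightarrow> ('m \<Rightarrow> complex) \<Rightarrow> ('m \<Rightarrow> complex)" where
  "init_form wt f = (\<lambda>m. if f m \<noteq> 0 \<and> (\<forall>m'. f m' \<noteq> 0 \<longrightarrow> wt m' \<le> wt m) then f m else 0)"


section \<open>Modules over a commutative ring\<close>

definition colon_ideal :: "('a, 'c) ring_scheme \<Rightarrow> 'a set \<Rightarrow> 'a \<Rightarrow> 'a set" where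
  "colon_ideal R I x = {f \<in> carrier R. f \<otimes>\<^bsub>R\<^esub> x \<in> I}"

text \<open>The record of modules extends the record of rings; the fields \<open>mult\<close> and \<open>one\<close> play no
  role in the locale of modules and are left unspecified below.\<close>

definition ring_mod :: "('a, 'c) ring_scheme \<Rightarrow> ('a, 'a) module" where
  "ring_mod R = \<lparr>carrier = carrier R, mult = undefined, one = undefined,
     zero = \<zero>\<^bsub>R\<^esub>, add = add R, smult = mult R\<rparr>"

definition quot_module :: "('a, 'b) module \<Rightarrow> 'b set \<Rightarrow> ('a, 'b set) module" where
  "quot_module M K = \<lparr>carrier = a_rcosets\<^bsub>M\<^esub> K, mult = undefined, one = undefined,
     zero = K, add = set_add M, smult = (\<lambda>r X. \<Union>x\<in>X. K +>\<^bsub>M\<^esub> (r \<odot>\<^bsub>M\<^esub> x))\<rparr>"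

text \<open>The quotient \<open>J / K\<close> of two ideals \<open>K \<subseteq> J\<close>.\<close>

definition ideal_quot :: "('a, 'c) ring_scheme \<Rightarrow> 'a set \<Rightarrow> 'a set \<Rightarrow> ('a, 'a set) module" where
  "ideal_quot R J K = quot_module ((ring_mod R)\<lparr>carrier := J\<rparr>) K"

text \<open>An \<open>R\<close>-module annihilated by the kernel of a surjection \<open>\<phi>\<close> from \<open>R\<close> to \<open>S\<close> is an
  \<open>S\<close>-module: \<open>s\<close> acts as any of its preimages.\<close>

definition module_via ::
    "('a, 'c) ring_scheme \<Rightarrow> ('a \<Rightarrow> 's) \<Rightarrow> ('a, 'b) module \<Rightarrow> ('s, 'b) module" where
  "module_via R \<phi> M = \<lparr>carrier = carrier M, mult = mult M, one = one M,
     zero = zero M, add = add M, smult = (\<lambda>s x. inv_into (carrier R) \<phi> s \<odot>\<^bsub>M\<^esub> x)\<rparr>"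

definition mod_hom ::
    "('a, 'c) ring_scheme \<Rightarrow> ('a, 'b) module \<Rightarrow> ('a, 'd) module \<Rightarrow> ('b \<Rightarrow> 'd) set" where
  "mod_hom R M N = {h \<in> hom (add_monoid M) (add_monoid N).
     \<forall>r\<in>carrier R. \<forall>x\<in>carrier M. h (r \<odot>\<^bsub>M\<^esub> x) = r \<odot>\<^bsub>N\<^esub> h x}"

definition mod_iso ::
    "('a, 'c) ring_scheme \<Rightarrow> ('a, 'b) module \<Rightarrow> ('a, 'd) module \<Rightarrow> ('b \<Rightarrow> 'd) set" where
  "mod_iso R M N = {h \<in> mod_hom R M N. bij_betw h (carrier M) (carrier N)}"

definition free_mod :: "('a, 'c) ring_scheme \<Rightarrow> 'x set \<Rightarrow> ('a, 'x \<Rightarrow> 'a) module" where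
  "free_mod R X = \<lparr>carrier = {f. (\<forall>x. f x \<in> carrier R) \<and> finite {x. f x \<noteq> \<zero>\<^bsub>R\<^esub>}
       \<and> {x. f x \<noteq> \<zero>\<^bsub>R\<^esub>} \<subseteq> X},
     mult = undefined, one = undefined,
     zero = (\<lambda>x. \<zero>\<^bsub>R\<^esub>),
     add = (\<lambda>f g x. f x \<oplus>\<^bsub>R\<^esub> g x),
     smult = (\<lambda>r f x. r \<otimes>\<^bsub>R\<^esub> f x)\<rparr>"

definition free_gen :: "('a, 'c) ring_scheme \<Rightarrow> 'x \<Rightarrow> ('x \<Rightarrow> 'a)" where
  "free_gen R x = (\<lambda>y. if y = x then \<one>\<^bsub>R\<^esub> else \<zero>\<^bsub>R\<^esub>)"

text \<open>The linear map from the free module on elements of \<open>M\<close> to \<open>M\<close> evaluating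
  formal linear combinations.\<close>

definition free_eval :: "('a, 'c) ring_scheme \<Rightarrow> ('a, 'b) module \<Rightarrow> ('b \<Rightarrow> 'a) \<Rightarrow> 'b" where
  "free_eval R M f = finsum M (\<lambda>x. f x \<odot>\<^bsub>M\<^esub> x) {x. f x \<noteq> \<zero>\<^bsub>R\<^esub>}"

definition submod_gen :: "('a, 'c) ring_scheme \<Rightarrow> ('a, 'b) module \<Rightarrow> 'b set \<Rightarrow> 'b set" where
  "submod_gen R M X = \<Inter>{H. submodule H R M \<and> X \<subseteq> H}"

definition tensor_rel ::
    "('a, 'c) ring_scheme \<Rightarrow> ('a, 'b) module \<Rightarrow> ('a, 'd) module \<Rightarrow> ('b \<times> 'd \<Rightarrow> 'a) set" where
  "tensor_rel R M N = (let F = free_mod R (carrier M \<times> carrier N); g = free_gen R in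
     submod_gen R F
      ({g (x \<oplus>\<^bsub>M\<^esub> x', y) \<ominus>\<^bsub>F\<^esub> (g (x, y) \<oplus>\<^bsub>F\<^esub> g (x', y)) |x x' y.
          x \<in> carrier M \<and> x' \<in> carrier M \<and> y \<in> carrier N}
     \<union> {g (x, y \<oplus>\<^bsub>N\<^esub> y') \<ominus>\<^bsub>F\<^esub> (g (x, y) \<oplus>\<^bsub>F\<^esub> g (x, y')) |x y y'.
          x \<in> carrier M \<and> y \<in> carrier N \<and> y' \<in> carrier N}
     \<union> {g (r \<odot>\<^bsub>M\<^esub> x, y) \<ominus>\<^bsub>F\<^esub> r \<odot>\<^bsub>F\<^esub> g (x, y) |r x y.
          r \<in> carrier R \<and> x \<in> carrier M \<and> y \<in> carrier N}
     \<union> {g (x, r \<odot>\<^bsub>N\<^esub> y) \<ominus>\<^bsub>F\<^esub> r \<odot>\<^bsub>F\<^esub> g (x, y) |r x y.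
          r \<in> carrier R \<and> x \<in> carrier M \<and> y \<in> carrier N}))"

definition tensor ::
    "('a, 'c) ring_scheme \<Rightarrow> ('a, 'b) module \<Rightarrow> ('a, 'd) module \<Rightarrow> ('a, ('b \<times> 'd \<Rightarrow> 'a) set) module"
  where
  "tensor R M N = quot_module (free_mod R (carrier M \<times> carrier N)) (tensor_rel R M N)"

definition pure_tensor ::
    "('a, 'c) ring_scheme \<Rightarrow> ('a, 'b) module \<Rightarrow> ('a, 'd) module \<Rightarrow> 'b \<Rightarrow> 'd \<Rightarrow> ('b \<times> 'd \<Rightarrow> 'a) set"
  where
  "pure_tensor R M N x y =
     tensor_rel R M N +>\<^bsub>free_mod R (carrier M \<times> carrier N)\<^esub> free_gen R (x, y)"

text \<open>\<open>h \<otimes> id\<^sub>N\<close>, where \<open>h\<close> takes values in \<open>M'\<close>, evaluated on a representative of the class.\<close>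

definition tensor_map ::
    "('a, 'c) ring_scheme \<Rightarrow> ('a, 'b') module \<Rightarrow> ('a, 'd) module \<Rightarrow> ('b \<Rightarrow> 'b')
      \<Rightarrow> ('b \<times> 'd \<Rightarrow> 'a) set \<Rightarrow> ('b' \<times> 'd \<Rightarrow> 'a) set" where
  "tensor_map R M' N h X = (let f = (SOME f. f \<in> X) in
     finsum (tensor R M' N) (\<lambda>(x, y). f (x, y) \<odot>\<^bsub>tensor R M' N\<^esub> pure_tensor R M' N (h x) y)
       {p. f p \<noteq> \<zero>\<^bsub>R\<^esub>})"

text \<open>\<open>Tor\<^sub>1(M, N)\<close> is the first homology of \<open>F \<otimes> N\<close>, where
  \<open>F\<^sub>2 \<rightarrow> F\<^sub>1 \<rightarrow> F\<^sub>0 \<rightarrow> M \<rightarrow> 0\<close> is the standard free resolution of \<open>M\<close>: every term is free on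
  the underlying set of the kernel before it, and the differentials evaluate formal linear
  combinations.\<close>

definition tor_F0 :: "('a, 'c) ring_scheme \<Rightarrow> ('a, 'b) module \<Rightarrow> ('a, 'b \<Rightarrow> 'a) module" where
  "tor_F0 R M = free_mod R (carrier M)"

definition tor_F1 ::
    "('a, 'c) ring_scheme \<Rightarrow> ('a, 'b) module \<Rightarrow> ('a, ('b \<Rightarrow> 'a) \<Rightarrow> 'a) module" where
  "tor_F1 R M = free_mod R (a_kernel (tor_F0 R M) M (free_eval R M))"

definition tor_F2 ::
    "('a, 'c) ring_scheme \<Rightarrow> ('a, 'b) module \<Rightarrow> ('a, (('b \<Rightarrow> 'a) \<Rightarrow> 'a) \<Rightarrow> 'a) module" where
  "tor_F2 R M = free_mod R (a_kernel (tor_F1 R M) (tor_F0 R M) (free_eval R (tor_F0 R M)))"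

definition Tor1 ::
    "('a, 'c) ring_scheme \<Rightarrow> ('a, 'b) module \<Rightarrow> ('a, 'd) module
      \<Rightarrow> ('a, ((('b \<Rightarrow> 'a) \<Rightarrow> 'a) \<times> 'd \<Rightarrow> 'a) set set) module" where
  "Tor1 R M N = (let
     F0 = tor_F0 R M; F1 = tor_F1 R M; F2 = tor_F2 R M;
     d1 = tensor_map R F0 N (free_eval R F0);
     d2 = tensor_map R F1 N (free_eval R F1)
   in quot_module
       ((tensor R F1 N)\<lparr>carrier := a_kernel (tensor R F1 N) (tensor R F0 N) d1\<rparr>)
       (d2 ` carrier (tensor R F2 N)))"


section \<open>Toric ideals and hypergeometric ideals\<close>

definition homogeneous_matrix :: "int ^ 'n ^ 'd \<Rightarrow> bool" where
  "homogeneous_matrix A \<longleftrightarrow> rank (map_matrix real_of_int A) = CARD('d) \<and>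
     (\<exists>(h :: real ^ 'd) c. c \<noteq> 0 \<and> (\<forall>j. (\<Sum>i\<in>UNIV. h $ i * real_of_int (A $ i $ j)) = c))"

definition lattice :: "int ^ 'n ^ 'd \<Rightarrow> (int ^ 'n) set" where
  "lattice A = {u. A *v u = 0}"

definition pos_part :: "int ^ 'n::finite \<Rightarrow> ('n \<Rightarrow>\<^sub>0 nat)" where
  "pos_part u = Abs_poly_mapping (\<lambda>j. nat (u $ j))"

definition neg_part :: "int ^ 'n::finite \<Rightarrow> ('n \<Rightarrow>\<^sub>0 nat)" where
  "neg_part u = Abs_poly_mapping (\<lambda>j. nat (- (u $ j)))"

definition toric_ideal :: "int ^ 'n ^ 'd \<Rightarrow> 'n::finite series set" where
  "toric_ideal A = genideal (mpoly_ring UNIV)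
     {mon (pos_part u) \<ominus>\<^bsub>mpoly_ring UNIV\<^esub> mon (neg_part u) |u. u \<in> lattice A}"

text \<open>The Weyl algebra in normally ordered form: the coefficient at \<open>(a, b)\<close> belongs to
  \<open>x\<^sup>a \<partial>\<^sup>b\<close>, and the product is given by the Leibniz rule
  \<open>x\<^sup>a \<partial>\<^sup>b x\<^sup>c \<partial>\<^sup>d = \<Sum>\<^sub>k (\<Prod>\<^sub>j (b\<^sub>j choose k\<^sub>j) (c\<^sub>j choose k\<^sub>j) k\<^sub>j!) x\<^bsup>a+c-k\<^esup> \<partial>\<^bsup>b+d-k\<^esup>\<close>.  The condition
  \<open>k \<le> b, c\<close> is written out componentwise since the library order on
  finitely supported functions is not the componentwise one.\<close>

type_synonym 'n weyl = "('n \<Rightarrow>\<^sub>0 nat) \<times> ('n \<Rightarrow>\<^sub>0 nat) \<Rightarrow> complex"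

definition weyl_algebra :: "'n::finite weyl ring" where
  "weyl_algebra = \<lparr>carrier = {P. finite {m. P m \<noteq> 0}},
     mult = (\<lambda>P Q (e, f). \<Sum>(a, b) | P (a, b) \<noteq> 0. \<Sum>(c, d) | Q (c, d) \<noteq> 0.
       \<Sum>k | (\<forall>j. lookup k j \<le> lookup b j \<and> lookup k j \<le> lookup c j)
            \<and> a + (c - k) = e \<and> (b - k) + d = f.
         P (a, b) * Q (c, d) * of_nat (\<Prod>j\<in>UNIV.
           (lookup b j choose lookup k j) * (lookup c j choose lookup k j) * fact (lookup k j))),
     one = (\<lambda>m. if m = (0, 0) then 1 else 0),
     zero = (\<lambda>m. 0),
     add = (\<lambda>P Q m. P m + Q m)\<rparr>"

definition left_ideal_gen :: "('a, 'c) ring_scheme \<Rightarrow> 'a set \<Rightarrow> 'a set" where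
  "left_ideal_gen R X = \<Inter>{I. additive_subgroup I R
     \<and> (\<forall>a\<in>carrier R. \<forall>x\<in>I. a \<otimes>\<^bsub>R\<^esub> x \<in> I) \<and> X \<subseteq> I}"

definition weyl_of_partials :: "'n series \<Rightarrow> 'n weyl" where
  "weyl_of_partials f = (\<lambda>(a, b). if a = 0 then f b else 0)"

definition euler_op :: "int ^ 'n ^ 'd \<Rightarrow> complex ^ 'd \<Rightarrow> 'd \<Rightarrow> 'n::finite weyl" where
  "euler_op A \<beta> i = (\<lambda>(a, b).
     (\<Sum>j\<in>UNIV. if a = Poly_Mapping.single j 1 \<and> b = Poly_Mapping.single j 1
        then of_int (A $ i $ j) else 0)
     - (if a = 0 \<and> b = 0 then \<beta> $ i else 0))"

definition hypergeometric_ideal ::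
    "int ^ 'n ^ 'd \<Rightarrow> complex ^ 'd \<Rightarrow> 'n::finite weyl set" where
  "hypergeometric_ideal A \<beta> = left_ideal_gen weyl_algebra
     (weyl_of_partials ` toric_ideal A \<union> range (euler_op A \<beta>))"

definition weight :: "real ^ 'n \<Rightarrow> ('n::finite \<Rightarrow>\<^sub>0 nat) \<Rightarrow> real" where
  "weight w m = (\<Sum>j\<in>UNIV. w $ j * real (lookup m j))"

definition initial_ideal :: "real ^ 'n \<Rightarrow> 'n::finite series set \<Rightarrow> 'n series set" where
  "initial_ideal w I = genideal (mpoly_ring UNIV) (init_form (weight w) ` I)"

definition monomial_ideal :: "'n::finite series set \<Rightarrow> bool" where
  "monomial_ideal I \<longleftrightarrow> (\<exists>E. I = genideal (mpoly_ring UNIV) (mon ` E))"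

text \<open>The initial ideal for the weights \<open>-w\<close> on \<open>x\<close> and \<open>w\<close> on \<open>\<partial>\<close>.  The associated graded
  ring for these weights is the Weyl algebra itself.\<close>

definition weyl_initial_ideal :: "real ^ 'n \<Rightarrow> 'n::finite weyl set \<Rightarrow> 'n weyl set" where
  "weyl_initial_ideal w H = left_ideal_gen weyl_algebra
     (init_form (\<lambda>(a, b). weight w b - weight w a) ` H)"

text \<open>The cones of the small Groebner fan are the closures of the classes of weight
  vectors with the same initial ideal.\<close>

definition small_groebner_fan :: "'n::finite weyl set \<Rightarrow> (real ^ 'n) set set" where
  "small_groebner_fan H =
     {closure {w'. weyl_initial_ideal w' H = weyl_initial_ideal w H} |w. True}"

definition generic_direction ::
    "int ^ 'n ^ 'd \<Rightarrow> complex ^ 'd \<Rightarrow> real ^ 'n::finite \<Rightarrow> bool" where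
  "generic_direction A \<beta> w \<longleftrightarrow> monomial_ideal (initial_ideal w (toric_ideal A)) \<and>
     (\<exists>C\<in>small_groebner_fan (hypergeometric_ideal A \<beta>). w \<in> interior C \<and>
        (\<forall>w'\<in>interior C. weyl_initial_ideal w' (hypergeometric_ideal A \<beta>)
                       = weyl_initial_ideal w (hypergeometric_ideal A \<beta>)))"

definition ffact_vec :: "complex ^ 'n \<Rightarrow> ('n::finite \<Rightarrow>\<^sub>0 nat) \<Rightarrow> complex" where
  "ffact_vec z p = (\<Prod>j\<in>UNIV. \<Prod>i<lookup p j. z $ j - of_nat i)"

definition fake_exponent ::
    "int ^ 'n ^ 'd \<Rightarrow> complex ^ 'd \<Rightarrow> real ^ 'n \<Rightarrow> complex ^ 'n::finite \<Rightarrow> bool" where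
  "fake_exponent A \<beta> w v \<longleftrightarrow> map_matrix of_int A *v v = \<beta> \<and>
     (\<forall>p. mon p \<in> initial_ideal w (toric_ideal A) \<longrightarrow> ffact_vec v p = 0)"


section \<open>Negative supports\<close>

definition nsupp :: "complex ^ 'n \<Rightarrow> 'n set" where
  "nsupp z = {j. \<exists>k::int. k < 0 \<and> z $ j = of_int k}"

definition shift :: "complex ^ 'n \<Rightarrow> int ^ 'n \<Rightarrow> complex ^ 'n" where
  "shift v u = (\<chi> j. v $ j + of_int (u $ j))"

definition nsupps :: "int ^ 'n ^ 'd \<Rightarrow> complex ^ 'n \<Rightarrow> 'n::finite set set" where
  "nsupps A v = {nsupp (shift v u) |u. u \<in> lattice A}"

definition distinguished_nsupps ::
    "int ^ 'n ^ 'd \<Rightarrow> real ^ 'n \<Rightarrow> complex ^ 'n \<Rightarrow> 'n::finite set set" where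
  "distinguished_nsupps A w v = {I \<in> nsupps A v. \<forall>u\<in>lattice A. nsupp (shift v u) = I \<longrightarrow>
     0 \<le> (\<Sum>j\<in>UNIV. w $ j * real_of_int (u $ j))}"

definition nsupp_family ::
    "int ^ 'n ^ 'd \<Rightarrow> real ^ 'n \<Rightarrow> complex ^ 'n \<Rightarrow> 'n::finite set set \<Rightarrow> bool" where
  "nsupp_family A w v N \<longleftrightarrow> nsupp v \<in> N \<and> N \<subseteq> distinguished_nsupps A w v"

definition ordered_family ::
    "int ^ 'n ^ 'd \<Rightarrow> complex ^ 'n \<Rightarrow> 'n::finite set set \<Rightarrow> bool" where
  "ordered_family A v N \<longleftrightarrow> (\<forall>I\<in>N. \<forall>J\<in>nsupps A v. J \<subseteq> I \<longrightarrow> J \<in> N)"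


section \<open>The ideals in the variables \<open>t\<close>\<close>

abbreviation Rhat :: "'n series ring" where
  "Rhat \<equiv> mps_ring UNIV"

definition t_prod :: "'n set \<Rightarrow> 'n series" where
  "t_prod J = (\<Otimes>\<^bsub>Rhat\<^esub>j\<in>J. var j)"

definition e_elem :: "complex ^ 'n \<Rightarrow> 'n set set \<Rightarrow> 'n::finite series" where
  "e_elem v N = t_prod (nsupp v - \<Inter>N)"

definition U_ideal :: "int ^ 'n ^ 'd \<Rightarrow> 'n::finite series set" where
  "U_ideal A = genideal Rhat
     (range (\<lambda>i. \<Oplus>\<^bsub>Rhat\<^esub>j\<in>UNIV. const (of_int (A $ i $ j)) \<otimes>\<^bsub>Rhat\<^esub> var j))"

definition M_ideal :: "'n set set \<Rightarrow> 'n::finite series set" where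
  "M_ideal N = genideal Rhat {t_prod (I - \<Inter>N) |I. I \<in> N}"

definition P_ideal :: "int ^ 'n ^ 'd \<Rightarrow> complex ^ 'n \<Rightarrow> 'n set set \<Rightarrow> 'n::finite series set" where
  "P_ideal A v N = genideal Rhat
     {t_prod ((I \<union> J) - \<Inter>N) |I J. I \<in> N \<and> J \<in> nsupps A v - N}"

definition Q_ideal :: "int ^ 'n ^ 'd \<Rightarrow> complex ^ 'n \<Rightarrow> 'n set set \<Rightarrow> 'n::finite series set" where
  "Q_ideal A v N = ideal_prod Rhat (U_ideal A) (M_ideal N) <+>\<^bsub>Rhat\<^esub> P_ideal A v N"

definition D_module ::
    "int ^ 'n ^ 'd \<Rightarrow> complex ^ 'n \<Rightarrow> 'n set set \<Rightarrow> ('n::finite series, 'n series set) module" where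
  "D_module A v N = ideal_quot Rhat
     (colon_ideal Rhat (U_ideal A <+>\<^bsub>Rhat\<^esub> P_ideal A v N) (e_elem v N))
     (colon_ideal Rhat (Q_ideal A v N) (e_elem v N))"

definition T_module ::
    "int ^ 'n ^ 'd \<Rightarrow> complex ^ 'n \<Rightarrow> 'n set set \<Rightarrow> ('n::finite series, 'n series set) module" where
  "T_module A v N = ideal_quot Rhat
     ((U_ideal A \<inter> M_ideal N) <+>\<^bsub>Rhat\<^esub> P_ideal A v N) (Q_ideal A v N)"

text \<open>\<open>(e R \<inter> ((U \<inter> M) + P)) / (e R \<inter> (U M + P))\<close>.\<close>

definition E_module ::
    "int ^ 'n ^ 'd \<Rightarrow> complex ^ 'n \<Rightarrow> 'n set set \<Rightarrow> ('n::finite series, 'n series set) module" where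
  "E_module A v N = ideal_quot Rhat
     (cgenideal Rhat (e_elem v N) \<inter> ((U_ideal A \<inter> M_ideal N) <+>\<^bsub>Rhat\<^esub> P_ideal A v N))
     (cgenideal Rhat (e_elem v N) \<inter> Q_ideal A v N)"


section \<open>Gale duals\<close>

text \<open>A Gale dual is given by its columns \<open>B k\<close>, \<open>k < r\<close>; the values \<open>B k\<close>
  for \<open>k \<ge> r\<close> are irrelevant.\<close>

definition gale_dual :: "int ^ 'n ^ 'd \<Rightarrow> nat \<Rightarrow> (nat \<Rightarrow> int ^ 'n) \<Rightarrow> bool" where
  "gale_dual A r B \<longleftrightarrow> (\<forall>k<r. B k \<in> lattice A) \<and>
     (\<forall>u\<in>lattice A. \<exists>!c :: nat \<Rightarrow> int. (\<forall>k\<ge>r. c k = 0) \<and> u = (\<Sum>k<r. c k *s B k))"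

abbreviation Shat :: "nat \<Rightarrow> nat series ring" where
  "Shat r \<equiv> mps_ring {..<r}"

text \<open>The linear form \<open>(B s)\<^sub>j\<close>.\<close>

definition gale_form :: "nat \<Rightarrow> (nat \<Rightarrow> int ^ 'n) \<Rightarrow> 'n \<Rightarrow> nat series" where
  "gale_form r B j = (\<Oplus>\<^bsub>Shat r\<^esub>k\<in>{..<r}. const (of_int (B k $ j)) \<otimes>\<^bsub>Shat r\<^esub> var k)"

text \<open>Substitution of \<open>(B s)\<^sub>j\<close> for \<open>t\<^sub>j\<close> in a power series.  Since the forms are
  homogeneous of degree one, only the finitely many monomials \<open>t\<^sup>m\<close> of degree
  \<open>|q|\<close> contribute to the coefficient of \<open>s\<^sup>q\<close>.\<close>

definition Phi :: "nat \<Rightarrow> (nat \<Rightarrow> int ^ 'n) \<Rightarrow> 'n::finite series \<Rightarrow> nat series" where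
  "Phi r B f = (\<lambda>q. \<Sum>m | total_degree m = total_degree q.
     f m * (\<Otimes>\<^bsub>Shat r\<^esub>j\<in>UNIV. gale_form r B j [^]\<^bsub>Shat r\<^esub> lookup m j) q)"

definition m_elem :: "nat \<Rightarrow> (nat \<Rightarrow> int ^ 'n) \<Rightarrow> complex ^ 'n \<Rightarrow> 'n::finite set set \<Rightarrow> nat series" where
  "m_elem r B v N = Phi r B (e_elem v N)"

definition Pi_ideal ::
    "int ^ 'n ^ 'd \<Rightarrow> nat \<Rightarrow> (nat \<Rightarrow> int ^ 'n) \<Rightarrow> complex ^ 'n \<Rightarrow> 'n::finite set set \<Rightarrow> nat series set"
  where "Pi_ideal A r B v N = Phi r B ` P_ideal A v N"

text \<open>\<open>(\<Pi> : m) / \<Phi>(Q : e)\<close>.\<close>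

definition G_module ::
    "int ^ 'n ^ 'd \<Rightarrow> nat \<Rightarrow> (nat \<Rightarrow> int ^ 'n) \<Rightarrow> complex ^ 'n \<Rightarrow> 'n::finite set set
      \<Rightarrow> (nat series, nat series set) module" where
  "G_module A r B v N = ideal_quot (Shat r)
     (colon_ideal (Shat r) (Pi_ideal A r B v N) (m_elem r B v N))
     (Phi r B ` colon_ideal Rhat (Q_ideal A v N) (e_elem v N))"


section \<open>Coefficient spaces\<close>

text \<open>A formal series \<open>\<Sum>\<^sub>z x\<^bsup>v+z\<^esup> p\<^sub>z(log x)\<close>, with \<open>z\<close> ranging over integer vectors, is the
  family of the coefficients of the \<open>p\<^sub>z\<close>, which are polynomials in variables \<open>y\<^sub>j = log x\<^sub>j\<close>.
  On it \<open>\<partial>\<^sub>j\<close> acts by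
  \<open>\<partial>\<^sub>j (x\<^bsup>c\<^esup> p(log x)) = x\<^bsup>c - e\<^sub>j\<^esup> (c\<^sub>j p + \<partial>p/\<partial>y\<^sub>j)(log x)\<close>.\<close>

type_synonym 'n log_series = "int ^ 'n \<Rightarrow> 'n series"

definition log_partial ::
    "complex ^ 'n \<Rightarrow> 'n \<Rightarrow> 'n::finite log_series \<Rightarrow> 'n log_series" where
  "log_partial v j \<phi> = (\<lambda>z c.
     (v $ j + of_int (z $ j) + 1) * \<phi> (z + axis j 1) c
     + of_nat (lookup c j + 1) * \<phi> (z + axis j 1) (c + Poly_Mapping.single j 1))"

text \<open>The fold below composes the commuting operators \<open>\<partial>\<^sub>j\<close>, each iterated \<open>b\<^sub>j\<close> times.\<close>

definition weyl_act ::
    "complex ^ 'n \<Rightarrow> 'n::finite weyl \<Rightarrow> 'n log_series \<Rightarrow> 'n log_series" where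
  "weyl_act v P \<phi> = (\<lambda>z c. \<Sum>(a, b) | P (a, b) \<noteq> 0. P (a, b) *
     Finite_Set.fold (\<lambda>j \<psi>. (log_partial v j ^^ lookup b j) \<psi>) \<phi> UNIV
       (z - (\<chi> j. int (lookup a j))) c)"

definition ambient_space ::
    "int ^ 'n ^ 'd \<Rightarrow> complex ^ 'd \<Rightarrow> complex ^ 'n \<Rightarrow> 'n set set \<Rightarrow> 'n::finite series set" where
  "ambient_space A \<beta> v N = {\<phi> 0 |\<phi>.
     (\<forall>z. \<phi> z \<in> carrier (mpoly_ring UNIV)) \<and>
     (\<forall>z. \<phi> z \<noteq> (\<lambda>c. 0) \<longrightarrow> z \<in> lattice A \<and> nsupp (shift v z) \<in> N) \<and>
     (\<forall>P\<in>hypergeometric_ideal A \<beta>. weyl_act v P \<phi> = (\<lambda>z c. 0))}"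

text \<open>\<open>[z + B s]\<^sub>p\<close> as a power series in \<open>s\<close>.\<close>

definition ffact_series ::
    "nat \<Rightarrow> (nat \<Rightarrow> int ^ 'n) \<Rightarrow> complex ^ 'n \<Rightarrow> ('n::finite \<Rightarrow>\<^sub>0 nat) \<Rightarrow> nat series" where
  "ffact_series r B z p = (\<Otimes>\<^bsub>Shat r\<^esub>j\<in>UNIV. \<Otimes>\<^bsub>Shat r\<^esub>i\<in>{..<lookup p j}.
     const (z $ j - of_nat i) \<oplus>\<^bsub>Shat r\<^esub> gale_form r B j)"

text \<open>The product \<open>m(s) a\<^sub>u(s)\<close>.  For negative supports \<open>I\<^sub>u\<close> in the family, the factor
  \<open>m(s)\<close> cancels the poles of the rational function
  \<open>a\<^sub>u(s) = [v + B s]\<^bsub>u\<^sub>-\<^esub> / [v + B s + u]\<^bsub>u\<^sub>+\<^esub>\<close> at \<open>s = 0\<close>, so the product is a power series.\<close>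

definition m_a_series ::
    "nat \<Rightarrow> (nat \<Rightarrow> int ^ 'n) \<Rightarrow> complex ^ 'n \<Rightarrow> 'n::finite set set \<Rightarrow> int ^ 'n \<Rightarrow> nat series" where
  "m_a_series r B v N u = (THE f. f \<in> carrier (Shat r) \<and>
     f \<otimes>\<^bsub>Shat r\<^esub> ffact_series r B (shift v u) (pos_part u)
       = m_elem r B v N \<otimes>\<^bsub>Shat r\<^esub> ffact_series r B v (neg_part u))"

text \<open>The coefficient, a polynomial in \<open>y = log x\<close>, of \<open>s\<^sup>\<alpha>\<close> in
  \<open>x\<^bsup>B s\<^esup> = exp (\<Sum>\<^sub>k s\<^sub>k (\<Sum>\<^sub>j B\<^sub>j\<^sub>k y\<^sub>j))\<close>.\<close>

definition x_pow_Bs ::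
    "nat \<Rightarrow> (nat \<Rightarrow> int ^ 'n) \<Rightarrow> (nat \<Rightarrow>\<^sub>0 nat) \<Rightarrow> 'n::finite series" where
  "x_pow_Bs r B \<alpha> = (\<lambda>c. if Poly_Mapping.keys \<alpha> \<subseteq> {..<r} then
     (\<Otimes>\<^bsub>mpoly_ring UNIV\<^esub>k\<in>{..<r}.
        (\<Oplus>\<^bsub>mpoly_ring UNIV\<^esub>j\<in>UNIV. const (of_int (B k $ j)) \<otimes>\<^bsub>mpoly_ring UNIV\<^esub> var j)
          [^]\<^bsub>mpoly_ring UNIV\<^esub> lookup \<alpha> k) c / of_nat (mfact \<alpha>)
     else 0)"

text \<open>\<open>\<Psi>(x, s)\<close>: the value at \<open>z\<close>, \<open>\<alpha>\<close> is the coefficient of \<open>x\<^bsup>v+z\<^esup> s\<^sup>\<alpha>\<close>, a polynomial in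
  \<open>log x\<close>.\<close>

definition Psi ::
    "int ^ 'n ^ 'd \<Rightarrow> nat \<Rightarrow> (nat \<Rightarrow> int ^ 'n) \<Rightarrow> complex ^ 'n \<Rightarrow> 'n::finite set set
      \<Rightarrow> int ^ 'n \<Rightarrow> (nat \<Rightarrow>\<^sub>0 nat) \<Rightarrow> 'n series" where
  "Psi A r B v N z \<alpha> = (\<lambda>c. if z \<in> lattice A \<and> nsupp (shift v z) \<in> N
     then \<Sum>(\<alpha>1, \<alpha>2) | \<alpha>1 + \<alpha>2 = \<alpha>. m_a_series r B v N z \<alpha>1 * x_pow_Bs r B \<alpha>2 c
     else 0)"

text \<open>\<open>(q(\<partial>\<^sub>s) f)|\<^bsub>s=0\<^esub>\<close>, where \<open>q\<close> is given by its coefficients.\<close>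

definition diff_at_0 :: "'i series \<Rightarrow> 'i series \<Rightarrow> complex" where
  "diff_at_0 q f = (\<Sum>\<alpha> | q \<alpha> \<noteq> 0. q \<alpha> * of_nat (mfact \<alpha>) * f \<alpha>)"

definition perp :: "nat \<Rightarrow> nat series set \<Rightarrow> nat series set" where
  "perp r I = {q \<in> carrier (mpoly_ring {..<r}). \<forall>f\<in>I. diff_at_0 q f = 0}"

definition P_poly_ideal ::
    "int ^ 'n ^ 'd \<Rightarrow> nat \<Rightarrow> (nat \<Rightarrow> int ^ 'n) \<Rightarrow> complex ^ 'n \<Rightarrow> 'n::finite set set \<Rightarrow> nat series set"
  where
  "P_poly_ideal A r B v N = genideal (mpoly_ring {..<r})
     {\<Otimes>\<^bsub>mpoly_ring {..<r}\<^esub>j\<in>(I \<union> J) - \<Inter>N. gale_form r B j |I J. I \<in> N \<and> J \<in> nsupps A v - N}"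

text \<open>\<open>q(\<partial>\<^sub>s) \<Psi>|\<^bsub>s=0\<^esub>\<close> as a formal series.\<close>

definition diff_Psi ::
    "int ^ 'n ^ 'd \<Rightarrow> nat \<Rightarrow> (nat \<Rightarrow> int ^ 'n) \<Rightarrow> complex ^ 'n \<Rightarrow> 'n::finite set set
      \<Rightarrow> nat series \<Rightarrow> 'n log_series" where
  "diff_Psi A r B v N q = (\<lambda>z c. diff_at_0 q (\<lambda>\<alpha>. Psi A r B v N z \<alpha> c))"

definition intrinsic_space ::
    "int ^ 'n ^ 'd \<Rightarrow> nat \<Rightarrow> (nat \<Rightarrow> int ^ 'n) \<Rightarrow> complex ^ 'n \<Rightarrow> 'n::finite set set
      \<Rightarrow> 'n series set" where
  "intrinsic_space A r B v N =
     {diff_Psi A r B v N q 0 |q. q \<in> perp r (P_poly_ideal A r B v N)}"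

end

theory Submission imports Defs begin

text \<open>The statement has an algebraic half, which holds over any commutative ring, and an analytic half,
  which identifies two spaces of polynomials in \<open>log x\<close> with inverse systems of ideals.

  For the algebraic half, \<open>P \<subseteq> M\<close> and \<open>e \<in> M\<close> imply that a multiple of \<open>e\<close> in \<open>U + P\<close> already lies in
  \<open>(U \<inter> M) + P\<close> (lemma \<open>J_eq\<close>).  Multiplication by \<open>e\<close> therefore identifies the quotient of
  colon ideals with \<open>(eR \<inter> ((U \<inter> M) + P)) / (eR \<inter> Q)\<close>, and the surjection \<open>\<Phi>\<close> with kernel \<open>U\<close> identifies
  it with the quotient over \<open>S\<close>; this is lemma \<open>comparison\<close>.  For the Tor module, tensoring with
  a cyclic module \<open>R/I\<close> is \<open>M \<mapsto> M/IM\<close>, so the homology of the tensored standard resolution of \<open>R/U\<close> can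
  be computed by hand (lemma \<open>Tor1_cyclic_cyclic\<close>).

  For the analytic half, polynomials in \<open>log x\<close> are written as functionals on \<open>\<complex>[[t]]\<close>: with
  factorials absorbed, \<open>\<partial>/\<partial>y\<^sub>j\<close> becomes contraction with \<open>t\<^sub>j\<close>.  A polynomial \<open>p(log x)\<close> is a
  coefficient of \<open>x\<^sup>v\<close> in the intrinsic series exactly if it is the contraction with \<open>e\<close> of a
  functional killing \<open>U + P\<close> (theorem \<open>intrinsic_space_eq\<close>), because \<open>\<Phi>\<close> is substitution of the linear
  forms \<open>(B s)\<^sub>j\<close> and its transpose produces \<open>x\<^bsup>B s\<^esup>\<close>.  It is a coefficient of an arbitrary
  logarithmic solution supported on the family exactly if it is the contraction with \<open>e\<close> of a
  functional killing \<open>Q = U M + P\<close> (theorem \<open>ambient_space_eq\<close>).  The second fact is the heart of the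
  matter.  The operator \<open>\<partial>\<^sup>b\<close> acts on the coefficient of \<open>x\<^bsup>v+z\<^esup>\<close> as contraction with the falling
  factorial \<open>[v + z + t]\<^sub>b\<close>, which is a unit of \<open>\<complex>[[t]]\<close> times the product of the \<open>t\<^sub>j\<close> for which
  the \<open>j\<close>-th exponent turns into a negative integer.  After removal of the units, the toric equations
  depend only on negative supports and say precisely that the coefficients glue to a single
  functional on the monomial ideal \<open>M\<close>.

  The two spaces are thus equal exactly if every functional killing \<open>Q\<close> agrees on multiples of \<open>e\<close>
  with one killing \<open>U + P\<close>.  Because the ideals are homogeneous, polynomial functionals separate them
  from series outside (\<open>separation\<close>) and can be extended from multiples of \<open>e\<close>
  (\<open>extend_annihilator\<close>), so the condition is \<open>(U + P) : e = Q : e\<close>.\<close>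

section \<open>Quotient modules\<close>

lemma abelian_group_cong:
  assumes "abelian_group M" "carrier M' = carrier M" "add M' = add M" "\<zero>\<^bsub>M'\<^esub> = \<zero>\<^bsub>M\<^esub>"
  shows "abelian_group M'"
proof -
  interpret abelian_group M by fact
  show ?thesis
    by (rule abelian_groupI) (use assms a_ac l_neg in \<open>auto intro!: bexI[of _ "\<ominus>\<^bsub>M\<^esub> _"]\<close>)
qed

lemma abelian_subgroup_of_submodule:
  assumes "Module.module R M" "submodule K R M"
  shows "abelian_subgroup K M"
proof -
  interpret Module.module R M by fact
  interpret submodule K R M by fact
  show ?thesis
    by (rule abelian_subgroupI3) (auto intro: additive_subgroupI subgroup_axioms abelian_group_axioms)
qed

lemma quot_coset_eq_iff:
  assumes "Module.module R M" "submodule K R M" "x \<in> carrier M" "y \<in> carrier M"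
  shows "K +>\<^bsub>M\<^esub> x = K +>\<^bsub>M\<^esub> y \<longleftrightarrow> x \<ominus>\<^bsub>M\<^esub> y \<in> K"
proof -
  interpret Module.module R M by fact
  interpret abelian_subgroup K M
    by (rule abelian_subgroup_of_submodule) fact+
  have "K +>\<^bsub>M\<^esub> x = K +>\<^bsub>M\<^esub> y \<longleftrightarrow> x \<in> K +>\<^bsub>M\<^esub> y"
    using a_repr_independenceD[of x y] a_repr_independence'[of x y] a_rcos_self assms by metis
  also have "\<dots> \<longleftrightarrow> x \<ominus>\<^bsub>M\<^esub> y \<in> K"
    using a_rcos_module[of y x] assms by (simp add: a_minus_def)
  finally show ?thesis .
qed

lemma quot_module_carrier:
  "carrier (quot_module M K) = (\<lambda>x. K +>\<^bsub>M\<^esub> x) ` carrier M"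
  by (auto simp: quot_module_def A_RCOSETS_def')

lemma quot_module_zero: "\<zero>\<^bsub>quot_module M K\<^esub> = K"
  by (simp add: quot_module_def)

lemma quot_module_add:
  assumes "Module.module R M" "submodule K R M" "x \<in> carrier M" "y \<in> carrier M"
  shows "(K +>\<^bsub>M\<^esub> x) \<oplus>\<^bsub>quot_module M K\<^esub> (K +>\<^bsub>M\<^esub> y) = K +>\<^bsub>M\<^esub> (x \<oplus>\<^bsub>M\<^esub> y)"
proof -
  interpret abelian_subgroup K M
    by (rule abelian_subgroup_of_submodule) fact+
  show ?thesis
    using assms by (simp add: quot_module_def a_rcos_sum)
qed

lemma quot_module_smult:
  assumes "Module.module R M" "submodule K R M" "r \<in> carrier R" "x \<in> carrier M"
  shows "r \<odot>\<^bsub>quot_module M K\<^esub> (K +>\<^bsub>M\<^esub> x) = K +>\<^bsub>M\<^esub> (r \<odot>\<^bsub>M\<^esub> x)"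
proof -
  interpret Module.module R M by fact
  interpret S: submodule K R M by fact
  interpret K: abelian_subgroup K M
    by (rule abelian_subgroup_of_submodule) fact+
  have "K +>\<^bsub>M\<^esub> (r \<odot>\<^bsub>M\<^esub> y) = K +>\<^bsub>M\<^esub> (r \<odot>\<^bsub>M\<^esub> x)" if y: "y \<in> K +>\<^bsub>M\<^esub> x" for y
  proof -
    obtain k where k: "k \<in> K" "y = k \<oplus>\<^bsub>M\<^esub> x"
      using y by (auto simp: a_r_coset_def')
    have kM: "k \<in> carrier M" using k by simp
    have "r \<odot>\<^bsub>M\<^esub> y \<ominus>\<^bsub>M\<^esub> r \<odot>\<^bsub>M\<^esub> x = r \<odot>\<^bsub>M\<^esub> k"
      using k kM assms by (simp add: smult_r_distr a_minus_def M.a_assoc M.r_neg)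
    then show ?thesis
      using k kM assms by (subst quot_coset_eq_iff[of R M]) auto
  qed
  then have "(\<Union>y\<in>K +>\<^bsub>M\<^esub> x. K +>\<^bsub>M\<^esub> (r \<odot>\<^bsub>M\<^esub> y)) = (\<Union>y\<in>K +>\<^bsub>M\<^esub> x. K +>\<^bsub>M\<^esub> (r \<odot>\<^bsub>M\<^esub> x))"
    by (rule SUP_cong[OF refl])
  also have "\<dots> = K +>\<^bsub>M\<^esub> (r \<odot>\<^bsub>M\<^esub> x)"
    using K.a_rcos_self[OF assms(4)] by blast
  finally show ?thesis by (simp add: quot_module_def)
qed

lemma submodule_coset_self:
  assumes "Module.module R M" "submodule K R M" "k \<in> K"
  shows "K +>\<^bsub>M\<^esub> k = K"
proof -
  interpret abelian_subgroup K M
    by (rule abelian_subgroup_of_submodule) fact+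
  show ?thesis using a_rcos_const assms by simp
qed

lemma quot_module_module:
  assumes M: "Module.module R M" and K: "submodule K R M"
  shows "Module.module R (quot_module M K)"
proof -
  interpret Module.module R M by fact
  interpret K: abelian_subgroup K M
    by (rule abelian_subgroup_of_submodule) fact+
  have zero: "\<zero>\<^bsub>quot_module M K\<^esub> = K +>\<^bsub>M\<^esub> \<zero>\<^bsub>M\<^esub>"
    by (simp add: quot_module_zero submodule_coset_self[OF M K])
  show ?thesis
  proof (rule moduleI)
    show "cring R" by (rule R.cring_axioms)
    show "abelian_group (quot_module M K)"
    proof (rule abelian_groupI)
      fix X assume "X \<in> carrier (quot_module M K)"
      then obtain x where x: "x \<in> carrier M" "X = K +>\<^bsub>M\<^esub> x" by (auto simp: quot_module_carrier)
      then have "(K +>\<^bsub>M\<^esub> (\<ominus>\<^bsub>M\<^esub> x)) \<oplus>\<^bsub>quot_module M K\<^esub> X = \<zero>\<^bsub>quot_module M K\<^esub>"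
        by (simp add: quot_module_add[OF M K] zero M.l_neg)
      then show "\<exists>Y\<in>carrier (quot_module M K). Y \<oplus>\<^bsub>quot_module M K\<^esub> X = \<zero>\<^bsub>quot_module M K\<^esub>"
        using x by (auto simp: quot_module_carrier)
    qed (auto simp: quot_module_carrier quot_module_add[OF M K] zero M.a_ac)
  qed (auto simp: quot_module_carrier quot_module_add[OF M K] quot_module_smult[OF M K]
         smult_l_distr smult_r_distr smult_assoc1)
qed

text \<open>A homomorphism of additive groups that kills the submodule factors through the quotient;
  linearity over the acting ring is inherited because a coset is acted upon through any of its
  representatives.\<close>

lemma quot_module_lift:
  assumes M: "Module.module R M" and K: "submodule K R M" and N: "abelian_group N"
    and F: "\<And>x. x \<in> carrier M \<Longrightarrow> F x \<in> carrier N"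
    and add: "\<And>x y. x \<in> carrier M \<Longrightarrow> y \<in> carrier M \<Longrightarrow> F (x \<oplus>\<^bsub>M\<^esub> y) = F x \<oplus>\<^bsub>N\<^esub> F y"
    and ker: "\<And>x. x \<in> K \<Longrightarrow> F x = \<zero>\<^bsub>N\<^esub>"
  obtains f where "f \<in> hom (add_monoid (quot_module M K)) (add_monoid N)"
    "\<And>x. x \<in> carrier M \<Longrightarrow> f (K +>\<^bsub>M\<^esub> x) = F x"
    "f ` carrier (quot_module M K) = F ` carrier M"
    "(\<And>x. x \<in> carrier M \<Longrightarrow> F x = \<zero>\<^bsub>N\<^esub> \<Longrightarrow> x \<in> K) \<Longrightarrow> inj_on f (carrier (quot_module M K))"
proof -
  interpret Module.module R M by fact
  interpret N: abelian_group N by fact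
  interpret S: submodule K R M by fact
  interpret h: abelian_group_hom M N F
    by (rule abelian_group_homI)
      (auto simp: F add N abelian_group_axioms hom_def group_hom_def group_hom_axioms_def M.a_group N.a_group)
  define f where "f X = F (SOME x. x \<in> carrier M \<and> X = K +>\<^bsub>M\<^esub> x)" for X
  have diff: "F x = F y \<longleftrightarrow> F (x \<ominus>\<^bsub>M\<^esub> y) = \<zero>\<^bsub>N\<^esub>" if "x \<in> carrier M" "y \<in> carrier M" for x y
    using that by (simp add: a_minus_def) (metis F N.minus_equality N.r_neg N.a_inv_closed N.minus_minus)
  have f: "f (K +>\<^bsub>M\<^esub> x) = F x" if x: "x \<in> carrier M" for x
  proof -
    define y where "y = (SOME y. y \<in> carrier M \<and> K +>\<^bsub>M\<^esub> x = K +>\<^bsub>M\<^esub> y)"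
    have "y \<in> carrier M \<and> K +>\<^bsub>M\<^esub> x = K +>\<^bsub>M\<^esub> y"
      unfolding y_def by (rule someI) (use x in auto)
    then have "x \<ominus>\<^bsub>M\<^esub> y \<in> K" "y \<in> carrier M"
      using quot_coset_eq_iff[OF M K x] by auto
    then have "F x = F y" using diff x ker by simp
    then show ?thesis by (simp add: f_def y_def)
  qed
  show ?thesis
  proof
    show "f \<in> hom (add_monoid (quot_module M K)) (add_monoid N)"
      by (auto simp: hom_def quot_module_carrier f F quot_module_add[OF M K] add)
    show "f (K +>\<^bsub>M\<^esub> x) = F x" if "x \<in> carrier M" for x using f that .
    show "f ` carrier (quot_module M K) = F ` carrier M"
      by (auto simp: quot_module_carrier f image_image intro!: image_eqI)
    show "inj_on f (carrier (quot_module M K))"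
      if k: "\<And>x. x \<in> carrier M \<Longrightarrow> F x = \<zero>\<^bsub>N\<^esub> \<Longrightarrow> x \<in> K"
    proof (rule inj_onI)
      fix X Y assume "X \<in> carrier (quot_module M K)" "Y \<in> carrier (quot_module M K)" "f X = f Y"
      then obtain x y where xy: "x \<in> carrier M" "y \<in> carrier M" "X = K +>\<^bsub>M\<^esub> x" "Y = K +>\<^bsub>M\<^esub> y" "F x = F y"
        by (auto simp: quot_module_carrier f)
      then show "X = Y" using diff k by (simp add: quot_coset_eq_iff[OF M K])
    qed
  qed
qed

lemma mod_isoI:
  assumes "f \<in> hom (add_monoid M) (add_monoid N)" "inj_on f (carrier M)" "f ` carrier M = carrier N"
    "\<And>r x. r \<in> carrier R \<Longrightarrow> x \<in> carrier M \<Longrightarrow> f (r \<odot>\<^bsub>M\<^esub> x) = r \<odot>\<^bsub>N\<^esub> f x"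
  shows "f \<in> mod_iso R M N"
  using assms by (auto simp: mod_iso_def mod_hom_def bij_betw_def)

lemma mod_iso_inv:
  assumes "Module.module R M" "f \<in> mod_iso R M N"
  shows "inv_into (carrier M) f \<in> mod_iso R N M"
proof -
  interpret Module.module R M by fact
  have bij: "bij_betw f (carrier M) (carrier N)" and hom: "f \<in> hom (add_monoid M) (add_monoid N)"
    and lin: "\<And>r x. r \<in> carrier R \<Longrightarrow> x \<in> carrier M \<Longrightarrow> f (r \<odot>\<^bsub>M\<^esub> x) = r \<odot>\<^bsub>N\<^esub> f x"
    using assms by (auto simp: mod_iso_def mod_hom_def)
  let ?g = "inv_into (carrier M) f"
  have inj: "inj_on f (carrier M)" and im: "f ` carrier M = carrier N"
    using bij by (auto simp: bij_betw_def)
  have g: "?g y \<in> carrier M" "f (?g y) = y" if "y \<in> carrier N" for y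
    using that im by (auto simp: f_inv_into_f inv_into_into)
  show ?thesis
  proof (rule mod_isoI)
    show "?g \<in> hom (add_monoid N) (add_monoid M)"
    proof (rule homI)
      fix x y assume "x \<in> carrier (add_monoid N)" "y \<in> carrier (add_monoid N)"
      then have xy: "x \<in> carrier N" "y \<in> carrier N" by auto
      have "x \<oplus>\<^bsub>N\<^esub> y = f (?g x \<oplus>\<^bsub>M\<^esub> ?g y)"
        using hom g xy by (simp add: hom_def)
      then show "?g (x \<otimes>\<^bsub>add_monoid N\<^esub> y) = ?g x \<otimes>\<^bsub>add_monoid M\<^esub> ?g y"
        using inv_into_f_f[OF inj] g xy by simp
    qed (use g in auto)
    show "inj_on ?g (carrier N)" using im by (metis inj_on_inv_into order_refl)
    show "?g ` carrier N = carrier M" using im inj by (metis inv_into_image_cancel order_refl)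
    fix r y assume ry: "r \<in> carrier R" "y \<in> carrier N"
    have "r \<odot>\<^bsub>N\<^esub> y = f (r \<odot>\<^bsub>M\<^esub> ?g y)" using lin g ry by simp
    then show "?g (r \<odot>\<^bsub>N\<^esub> y) = r \<odot>\<^bsub>M\<^esub> ?g y"
      using inv_into_f_f[OF inj] g ry by simp
  qed
qed

lemma mod_hom_comp:
  assumes "f \<in> mod_hom R M N" "g \<in> mod_hom R N Q"
  shows "g \<circ> f \<in> mod_hom R M Q"
  using assms by (auto simp: mod_hom_def hom_def Pi_iff)

lemma mod_iso_comp:
  assumes "f \<in> mod_iso R M N" "g \<in> mod_iso R N Q"
  shows "g \<circ> f \<in> mod_iso R M Q"
  using assms mod_hom_comp[of f R M N g Q] bij_betw_trans[of f _ _ g]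
  by (auto simp: mod_iso_def)

lemma submodule_image:
  assumes M: "Module.module R M" and N: "Module.module R N" and h: "h \<in> mod_hom R M N"
  shows "submodule (h ` carrier M) R N"
proof -
  interpret M: Module.module R M by fact
  interpret N: Module.module R N by fact
  have cl: "\<And>x. x \<in> carrier M \<Longrightarrow> h x \<in> carrier N"
    and add: "\<And>x y. x \<in> carrier M \<Longrightarrow> y \<in> carrier M \<Longrightarrow> h (x \<oplus>\<^bsub>M\<^esub> y) = h x \<oplus>\<^bsub>N\<^esub> h y"
    and sm: "\<And>r x. r \<in> carrier R \<Longrightarrow> x \<in> carrier M \<Longrightarrow> h (r \<odot>\<^bsub>M\<^esub> x) = r \<odot>\<^bsub>N\<^esub> h x"
    using h by (auto simp: mod_hom_def hom_def)
  interpret h: abelian_group_hom M N h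
    by (rule abelian_group_homI)
      (auto simp: cl add hom_def M.abelian_group_axioms N.abelian_group_axioms
        group_hom_def group_hom_axioms_def M.M.a_group N.M.a_group)
  show ?thesis
  proof (rule N.submoduleI)
    show "\<zero>\<^bsub>N\<^esub> \<in> h ` carrier M" using h.hom_zero M.M.zero_closed by (metis image_eqI)
  next
    fix a assume "a \<in> h ` carrier M"
    then obtain x where x: "x \<in> carrier M" "a = h x" by auto
    then have "\<ominus>\<^bsub>N\<^esub> a = h (\<ominus>\<^bsub>M\<^esub> x)" by simp
    then show "\<ominus>\<^bsub>N\<^esub> a \<in> h ` carrier M" using x by blast
  next
    fix a b assume "a \<in> h ` carrier M" "b \<in> h ` carrier M"
    then show "a \<oplus>\<^bsub>N\<^esub> b \<in> h ` carrier M"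
      by (auto simp flip: add)
  next
    fix a x assume "a \<in> carrier R" "x \<in> h ` carrier M"
    then show "a \<odot>\<^bsub>N\<^esub> x \<in> h ` carrier M" by (auto simp flip: sm)
  qed (use cl in auto)
qed


section \<open>Quotients of ideals\<close>

lemma ring_mod_simps [simp]:
  "carrier (ring_mod R) = carrier R" "\<zero>\<^bsub>ring_mod R\<^esub> = \<zero>\<^bsub>R\<^esub>" "add (ring_mod R) = add R"
  "smult (ring_mod R) = mult R"
  by (simp_all add: ring_mod_def)

lemma ring_mod_module:
  assumes "cring R"
  shows "Module.module R (ring_mod R)"
proof -
  interpret cring R by fact
  have "abelian_group (ring_mod R)"
    by (rule abelian_group_cong[OF abelian_group_axioms]) simp_all
  then show ?thesis
    by (intro moduleI) (auto simp: assms l_distr r_distr m_assoc)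
qed

lemma ideal_submodule:
  assumes "cring R" "ideal J R"
  shows "submodule J R (ring_mod R)"
proof -
  interpret cring R by fact
  interpret ideal J R by fact
  interpret M: Module.module R "ring_mod R" by (rule ring_mod_module) fact
  show ?thesis
  proof (rule M.submoduleI)
    fix a assume a: "a \<in> J"
    then have "\<ominus>\<^bsub>ring_mod R\<^esub> a = \<ominus>\<^bsub>R\<^esub> a"
      using M.M.minus_equality[of "\<ominus>\<^bsub>R\<^esub> a" a] by (simp add: l_neg)
    then show "\<ominus>\<^bsub>ring_mod R\<^esub> a \<in> J" using a by simp
  qed (auto intro: I_l_closed)
qed

lemma ideal_module:
  assumes "cring R" "ideal J R"
  shows "Module.module R ((ring_mod R)\<lparr>carrier := J\<rparr>)"
  by (rule submodule.submodule_is_module) (use assms ring_mod_module ideal_submodule in auto)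

lemma ideal_submodule_of_ideal:
  assumes "cring R" "ideal J R" "ideal K R" "K \<subseteq> J"
  shows "submodule K R ((ring_mod R)\<lparr>carrier := J\<rparr>)"
proof -
  interpret cring R by fact
  interpret J: Module.module R "(ring_mod R)\<lparr>carrier := J\<rparr>" by (rule ideal_module) fact+
  have "Module.module R ((ring_mod R)\<lparr>carrier := J\<rparr>\<lparr>carrier := K\<rparr>)"
    using ideal_module[OF assms(1,3)] by simp
  with J.module_incl_imp_submodule show ?thesis using assms by simp
qed

context
  fixes R :: "('a, 'c) ring_scheme" (structure) and J K
  assumes R: "cring R" and J: "ideal J R" and K: "ideal K R" and KJ: "K \<subseteq> J"
begin

lemma ideal_quot_module: "Module.module R (ideal_quot R J K)"
  unfolding ideal_quot_def
  by (rule quot_module_module) (use R J K KJ ideal_module ideal_submodule_of_ideal in auto)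

lemma ideal_quot_carrier: "carrier (ideal_quot R J K) = (\<lambda>a. K +> a) ` J"
  by (simp add: ideal_quot_def quot_module_carrier a_r_coset_def')

lemma ideal_quot_zero: "\<zero>\<^bsub>ideal_quot R J K\<^esub> = K"
  by (simp add: ideal_quot_def quot_module_zero)

lemma ideal_quot_add:
  "a \<in> J \<Longrightarrow> b \<in> J \<Longrightarrow> (K +> a) \<oplus>\<^bsub>ideal_quot R J K\<^esub> (K +> b) = K +> (a \<oplus> b)"
  using quot_module_add[OF ideal_module[OF R J] ideal_submodule_of_ideal[OF R J K KJ], of a b]
  by (simp add: ideal_quot_def a_r_coset_def')

lemma ideal_quot_smult:
  "r \<in> carrier R \<Longrightarrow> a \<in> J \<Longrightarrow> r \<odot>\<^bsub>ideal_quot R J K\<^esub> (K +> a) = K +> (r \<otimes> a)"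
  using quot_module_smult[OF ideal_module[OF R J] ideal_submodule_of_ideal[OF R J K KJ], of r a]
  by (simp add: ideal_quot_def a_r_coset_def')

lemma ideal_coset_self: "a \<in> K \<Longrightarrow> K +> a = K"
  using ring.a_rcos_zero[OF cring.axioms(1)[OF R] K] by simp

lemma ideal_quot_trivial_iff: "carrier (ideal_quot R J K) = {\<zero>\<^bsub>ideal_quot R J K\<^esub>} \<longleftrightarrow> J \<subseteq> K"
proof
  assume *: "carrier (ideal_quot R J K) = {\<zero>\<^bsub>ideal_quot R J K\<^esub>}"
  show "J \<subseteq> K"
  proof
    fix a assume a: "a \<in> J"
    then have "K +> a = K" using * by (auto simp: ideal_quot_carrier ideal_quot_zero)
    moreover have "a \<in> carrier R" using a ideal.Icarr[OF J] by simp
    ultimately show "a \<in> K" using ideal.rcos_const_imp_mem[OF K] by blast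
  qed
next
  assume "J \<subseteq> K"
  moreover have "\<zero> \<in> J" using J by (simp add: additive_subgroup.zero_closed ideal.axioms(1))
  ultimately show "carrier (ideal_quot R J K) = {\<zero>\<^bsub>ideal_quot R J K\<^esub>}"
    using ideal_coset_self by (auto simp: ideal_quot_carrier ideal_quot_zero image_iff)
qed

lemma ideal_quot_lift:
  assumes N: "abelian_group N"
    and F: "\<And>x. x \<in> J \<Longrightarrow> F x \<in> carrier N"
    and add: "\<And>x y. x \<in> J \<Longrightarrow> y \<in> J \<Longrightarrow> F (x \<oplus> y) = F x \<oplus>\<^bsub>N\<^esub> F y"
    and ker: "\<And>x. x \<in> K \<Longrightarrow> F x = \<zero>\<^bsub>N\<^esub>"
  obtains f where "f \<in> hom (add_monoid (ideal_quot R J K)) (add_monoid N)"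
    "\<And>x. x \<in> J \<Longrightarrow> f (K +> x) = F x"
    "f ` carrier (ideal_quot R J K) = F ` J"
    "(\<And>x. x \<in> J \<Longrightarrow> F x = \<zero>\<^bsub>N\<^esub> \<Longrightarrow> x \<in> K) \<Longrightarrow> inj_on f (carrier (ideal_quot R J K))"
proof -
  let ?M = "(ring_mod R)\<lparr>carrier := J\<rparr>"
  show ?thesis
    by (rule quot_module_lift[OF ideal_module[OF R J] ideal_submodule_of_ideal[OF R J K KJ] N, of F])
      (use assms in \<open>auto simp: a_r_coset_def' ideal_quot_def intro!: that\<close>)
qed

end

lemma module_via_simps [simp]:
  "carrier (module_via R \<phi> M) = carrier M" "add (module_via R \<phi> M) = add M"
  "\<zero>\<^bsub>module_via R \<phi> M\<^esub> = \<zero>\<^bsub>M\<^esub>"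
  "s \<odot>\<^bsub>module_via R \<phi> M\<^esub> x = inv_into (carrier R) \<phi> s \<odot>\<^bsub>M\<^esub> x"
  by (simp_all add: module_via_def)

text \<open>The chosen preimage of a sum is only a sum of preimages up to an element of the kernel, so
  the axioms hold exactly because the kernel acts as zero.\<close>

lemma module_via_smult:
  assumes M: "Module.module R M" and \<phi>: "ring_hom_cring R S \<phi>"
    and kill: "\<And>r x. r \<in> carrier R \<Longrightarrow> \<phi> r = \<zero>\<^bsub>S\<^esub> \<Longrightarrow> x \<in> carrier M \<Longrightarrow> r \<odot>\<^bsub>M\<^esub> x = \<zero>\<^bsub>M\<^esub>"
    and r: "r \<in> carrier R" and x: "x \<in> carrier M"
  shows "\<phi> r \<odot>\<^bsub>module_via R \<phi> M\<^esub> x = r \<odot>\<^bsub>M\<^esub> x"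
proof -
  interpret Module.module R M by fact
  interpret \<phi>: ring_hom_cring R S \<phi> by fact
  let ?r = "inv_into (carrier R) \<phi> (\<phi> r)"
  have *: "?r \<in> carrier R" "\<phi> ?r = \<phi> r"
    using r by (auto simp: inv_into_into f_inv_into_f)
  then have "\<phi> (?r \<ominus>\<^bsub>R\<^esub> r) = \<zero>\<^bsub>S\<^esub>" using r by (simp add: a_minus_def \<phi>.S.r_neg)
  then have "(?r \<ominus>\<^bsub>R\<^esub> r) \<odot>\<^bsub>M\<^esub> x = \<zero>\<^bsub>M\<^esub>" using kill * r x by simp
  then have "?r \<odot>\<^bsub>M\<^esub> x \<oplus>\<^bsub>M\<^esub> \<ominus>\<^bsub>M\<^esub> (r \<odot>\<^bsub>M\<^esub> x) = \<zero>\<^bsub>M\<^esub>"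
    using * r x by (simp add: a_minus_def smult_l_distr smult_l_minus)
  then show ?thesis
    using * r x by simp (metis M.minus_equality M.minus_minus M.a_inv_closed smult_closed)
qed

lemma module_via_module:
  assumes M: "Module.module R M" and \<phi>: "ring_hom_cring R S \<phi>" and surj: "\<phi> ` carrier R = carrier S"
    and kill: "\<And>r x. r \<in> carrier R \<Longrightarrow> \<phi> r = \<zero>\<^bsub>S\<^esub> \<Longrightarrow> x \<in> carrier M \<Longrightarrow> r \<odot>\<^bsub>M\<^esub> x = \<zero>\<^bsub>M\<^esub>"
  shows "Module.module S (module_via R \<phi> M)"
proof -
  interpret Module.module R M by fact
  interpret \<phi>: ring_hom_cring R S \<phi> by fact
  have via: "\<phi> r \<odot>\<^bsub>module_via R \<phi> M\<^esub> x = r \<odot>\<^bsub>M\<^esub> x" if "r \<in> carrier R" "x \<in> carrier M" for r x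
    using that by (intro module_via_smult[OF M \<phi> kill])
  have ag: "abelian_group (module_via R \<phi> M)"
    by (rule abelian_group_cong[OF abelian_group_axioms]) simp_all

  show ?thesis
  proof (rule moduleI)
    fix a x assume "a \<in> carrier S" and x: "x \<in> carrier (module_via R \<phi> M)"
    then show "a \<odot>\<^bsub>module_via R \<phi> M\<^esub> x \<in> carrier (module_via R \<phi> M)"
      using surj by (auto simp: inv_into_into)
  next
    fix a b x assume "a \<in> carrier S" "b \<in> carrier S" and x: "x \<in> carrier (module_via R \<phi> M)"
    then obtain a' b' where ab: "a' \<in> carrier R" "b' \<in> carrier R" "a = \<phi> a'" "b = \<phi> b'"
      using surj by blast
    show "(a \<oplus>\<^bsub>S\<^esub> b) \<odot>\<^bsub>module_via R \<phi> M\<^esub> x =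
        a \<odot>\<^bsub>module_via R \<phi> M\<^esub> x \<oplus>\<^bsub>module_via R \<phi> M\<^esub> b \<odot>\<^bsub>module_via R \<phi> M\<^esub> x"
      using ab x via[of "a' \<oplus>\<^bsub>R\<^esub> b'" x] via[of a' x] via[of b' x]
      by (simp add: smult_l_distr del: module_via_simps(4))
    show "(a \<otimes>\<^bsub>S\<^esub> b) \<odot>\<^bsub>module_via R \<phi> M\<^esub> x =
        a \<odot>\<^bsub>module_via R \<phi> M\<^esub> (b \<odot>\<^bsub>module_via R \<phi> M\<^esub> x)"
      using ab x via[of "a' \<otimes>\<^bsub>R\<^esub> b'" x] via[of a' "b' \<odot>\<^bsub>M\<^esub> x"] via[of b' x]
      by (simp add: smult_assoc1 del: module_via_simps(4))
  next
    fix a x y assume "a \<in> carrier S" and x: "x \<in> carrier (module_via R \<phi> M)" "y \<in> carrier (module_via R \<phi> M)"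
    then show "a \<odot>\<^bsub>module_via R \<phi> M\<^esub> (x \<oplus>\<^bsub>module_via R \<phi> M\<^esub> y) =
        a \<odot>\<^bsub>module_via R \<phi> M\<^esub> x \<oplus>\<^bsub>module_via R \<phi> M\<^esub> a \<odot>\<^bsub>module_via R \<phi> M\<^esub> y"
      using surj smult_r_distr by (auto simp: inv_into_into)
  next
    fix x assume "x \<in> carrier (module_via R \<phi> M)"
    then show "\<one>\<^bsub>S\<^esub> \<odot>\<^bsub>module_via R \<phi> M\<^esub> x = x"
      using via[of "\<one>\<^bsub>R\<^esub>" x] by (simp del: module_via_simps(4))
  qed (use ag \<phi>.S.cring_axioms in auto)
qed


section \<open>Colon ideals and the three descriptions of the discrepancy module\<close>

lemma colon_ideal_ideal:
  assumes "cring R" "ideal I R" "x \<in> carrier R"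
  shows "ideal (colon_ideal R I x) R"
proof -
  interpret cring R by fact
  interpret I: ideal I R by fact
  show ?thesis
  proof (rule idealI)
    show "ring R" by (rule ring_axioms)
    show "subgroup (colon_ideal R I x) (add_monoid R)"
    proof (rule add.subgroupI)
      fix a assume "a \<in> colon_ideal R I x"
      then show "\<ominus>\<^bsub>R\<^esub> a \<in> colon_ideal R I x"
        using assms by (auto simp: colon_ideal_def l_minus)
    qed (use assms in \<open>auto simp: colon_ideal_def l_distr intro!: exI[of _ "\<zero>\<^bsub>R\<^esub>"]\<close>)
    fix a y assume a: "a \<in> colon_ideal R I x" and y: "y \<in> carrier R"
    have "y \<otimes>\<^bsub>R\<^esub> (a \<otimes>\<^bsub>R\<^esub> x) \<in> I" using a y by (auto simp: colon_ideal_def intro: I.I_l_closed)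
    then show "y \<otimes>\<^bsub>R\<^esub> a \<in> colon_ideal R I x" "a \<otimes>\<^bsub>R\<^esub> y \<in> colon_ideal R I x"
      using a y assms by (auto simp: colon_ideal_def m_ac)
  qed
qed

lemma (in ring_hom_cring) surj_image_ideal:
  assumes I: "ideal I R" and surj: "h ` carrier R = carrier S"
  shows "ideal (h ` I) S"
proof -
  interpret I: ideal I R by fact
  show ?thesis
  proof (rule idealI)
    show "ring S" by (rule S.ring_axioms)
    show "subgroup (h ` I) (add_monoid S)"
    proof (rule S.add.subgroupI)
      show "h ` I \<noteq> {}" using I.zero_closed by blast
    next
      fix a assume "a \<in> h ` I"
      then obtain b where "b \<in> I" "a = h b" by auto
      then show "\<ominus>\<^bsub>S\<^esub> a \<in> h ` I" by (auto intro!: image_eqI[of _ _ "\<ominus>\<^bsub>R\<^esub> b"])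
    next
      fix a a' assume "a \<in> h ` I" "a' \<in> h ` I"
      then obtain b b' where "b \<in> I" "a = h b" "b' \<in> I" "a' = h b'" by auto
      then show "a \<oplus>\<^bsub>S\<^esub> a' \<in> h ` I" by (auto intro!: image_eqI[of _ _ "b \<oplus>\<^bsub>R\<^esub> b'"])
    qed auto
    fix a x assume "a \<in> h ` I" and "x \<in> carrier S"
    then obtain b y where *: "b \<in> I" "a = h b" "y \<in> carrier R" "x = h y" using surj by blast
    have "h (y \<otimes>\<^bsub>R\<^esub> b) \<in> h ` I" "h (b \<otimes>\<^bsub>R\<^esub> y) \<in> h ` I"
      using * I.I_l_closed I.I_r_closed by blast+
    then show "x \<otimes>\<^bsub>S\<^esub> a \<in> h ` I" "a \<otimes>\<^bsub>S\<^esub> x \<in> h ` I"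
      using * by simp_all
  qed
qed

lemma set_add_memI: "a \<in> A \<Longrightarrow> b \<in> B \<Longrightarrow> a \<oplus>\<^bsub>R\<^esub> b \<in> A <+>\<^bsub>R\<^esub> B"
  by (auto simp: set_add_def')

lemma set_add_memE:
  assumes "x \<in> A <+>\<^bsub>R\<^esub> B" obtains a b where "a \<in> A" "b \<in> B" "x = a \<oplus>\<^bsub>R\<^esub> b"
  using assms by (auto simp: set_add_def')

text \<open>The comparison of the three modules is independent of power series: \<open>S\<close> stands for \<open>R/U\<close>,
  and the ideals enter through \<open>P \<subseteq> M\<close> and \<open>e \<in> M\<close> alone.\<close>

locale ideal_comparison = ring_hom_cring R S \<phi>
  for R :: "('a, 'c) ring_scheme" (structure) and S :: "('b, 'd) ring_scheme" (structure) and \<phi> +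
  fixes U M P :: "'a set" and e :: 'a
  assumes surj: "\<phi> ` carrier R = carrier S"
    and kernel: "\<And>r. r \<in> carrier R \<Longrightarrow> \<phi> r = \<zero>\<^bsub>S\<^esub> \<longleftrightarrow> r \<in> U"
    and U: "ideal U R" and M: "ideal M R" and P: "ideal P R"
    and PM: "P \<subseteq> M" and eM: "e \<in> M"
begin

definition "Q = ideal_prod R U M <+>\<^bsub>R\<^esub> P"
definition "W = (U \<inter> M) <+>\<^bsub>R\<^esub> P"
definition "J = colon_ideal R (U <+>\<^bsub>R\<^esub> P) e"
definition "K = colon_ideal R Q e"
definition "D = ideal_quot R J K"
definition "G = ideal_quot S (colon_ideal S (\<phi> ` P) (\<phi> e)) (\<phi> ` K)"
definition "E = ideal_quot R (cgenideal R e \<inter> W) (cgenideal R e \<inter> Q)"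
definition "T = ideal_quot R W Q"

lemma e_carrier [simp]: "e \<in> carrier R"
  using ideal.Icarr[OF M eM] .

lemma mem_carrier: "a \<in> U \<Longrightarrow> a \<in> carrier R" "a \<in> M \<Longrightarrow> a \<in> carrier R" "a \<in> P \<Longrightarrow> a \<in> carrier R"
  using ideal.Icarr[OF U] ideal.Icarr[OF M] ideal.Icarr[OF P] by auto

lemma Q_ideal: "ideal Q R"
  unfolding Q_def using R.add_ideals R.ideal_prod_is_ideal U M P by blast

lemma W_ideal: "ideal W R"
  unfolding W_def using R.add_ideals R.i_intersect U M P by blast

lemma Q_subset_W: "Q \<subseteq> W"
  using R.ideal_prod_inter[OF U M] by (auto simp: Q_def W_def set_add_def')

lemma P_subset_Q: "P \<subseteq> Q"
proof
  fix p assume "p \<in> P"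
  then have "\<zero>\<^bsub>R\<^esub> \<oplus>\<^bsub>R\<^esub> p \<in> Q"
    unfolding Q_def using R.ideal_prod_is_ideal[OF U M]
    by (intro set_add_memI) (auto intro: additive_subgroup.zero_closed ideal.axioms(1))
  then show "p \<in> Q" using mem_carrier(3)[OF \<open>p \<in> P\<close>] by simp
qed

lemma UM_subset_Q: "ideal_prod R U M \<subseteq> Q"
proof
  fix p assume p: "p \<in> ideal_prod R U M"
  then have "p \<oplus>\<^bsub>R\<^esub> \<zero>\<^bsub>R\<^esub> \<in> Q"
    unfolding Q_def using P
    by (intro set_add_memI) (auto intro: additive_subgroup.zero_closed ideal.axioms(1))
  moreover have "p \<in> carrier R" using p R.ideal_prod_in_carrier[OF U M] by auto
  ultimately show "p \<in> Q" by simp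
qed

lemma W_subset_M: "W \<subseteq> M"
  using PM M by (auto simp: W_def set_add_def' additive_subgroup.a_closed ideal.axioms(1))

lemma U_times_W: "u \<in> U \<Longrightarrow> b \<in> W \<Longrightarrow> u \<otimes>\<^bsub>R\<^esub> b \<in> Q"
  using W_subset_M UM_subset_Q by (auto intro!: ideal_prod.prod)

lemma U_subset_K: "U \<subseteq> K"
  using UM_subset_Q eM mem_carrier by (auto simp: K_def colon_ideal_def intro!: ideal_prod.prod)

text \<open>Since \<open>e\<close> and \<open>P\<close> lie in \<open>M\<close>, the part in \<open>U\<close> of a multiple of \<open>e\<close> in \<open>U + P\<close> lies in \<open>M\<close>.\<close>

lemma J_eq: "J = colon_ideal R W e"
proof
  show "J \<subseteq> colon_ideal R W e"
  proof
    fix a assume "a \<in> J"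
    then obtain u p where a: "a \<in> carrier R" and up: "u \<in> U" "p \<in> P" "a \<otimes>\<^bsub>R\<^esub> e = u \<oplus>\<^bsub>R\<^esub> p"
      by (auto simp: J_def colon_ideal_def set_add_def')
    have "a \<otimes>\<^bsub>R\<^esub> e \<ominus>\<^bsub>R\<^esub> p \<in> M"
      using ideal.I_l_closed[OF M eM a] up PM M
      by (auto simp: a_minus_def intro!: additive_subgroup.a_closed additive_subgroup.a_inv_closed ideal.axioms(1))
    moreover have "a \<otimes>\<^bsub>R\<^esub> e \<ominus>\<^bsub>R\<^esub> p = u"
      using up mem_carrier by (simp add: a_minus_def R.a_assoc R.r_neg)
    ultimately show "a \<in> colon_ideal R W e"
      using up a by (auto simp: colon_ideal_def W_def intro!: set_add_memI)
  qed
  show "colon_ideal R W e \<subseteq> J"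
    by (auto simp: colon_ideal_def W_def J_def set_add_def')
qed

lemma J_ideal: "ideal J R" and K_ideal: "ideal K R"
  unfolding J_eq K_def using W_ideal Q_ideal by (auto intro!: colon_ideal_ideal R.is_cring)

lemma K_subset_J: "K \<subseteq> J"
  using Q_subset_W by (auto simp: J_eq K_def colon_ideal_def)

lemma J_carrier: "a \<in> J \<Longrightarrow> a \<in> carrier R"
  by (auto simp: J_eq colon_ideal_def)

text \<open>An element \<open>\<phi> a\<close> multiplies \<open>\<phi> e\<close> into \<open>\<phi> P\<close> exactly if \<open>a e\<close> lies in
  \<open>P\<close> up to the kernel \<open>U\<close>.\<close>

lemma image_J: "\<phi> ` J = colon_ideal S (\<phi> ` P) (\<phi> e)"
proof
  show "\<phi> ` J \<subseteq> colon_ideal S (\<phi> ` P) (\<phi> e)"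
  proof
    fix s assume "s \<in> \<phi> ` J"
    then obtain a u p where a: "s = \<phi> a" "a \<in> carrier R" and up: "u \<in> U" "p \<in> P" "a \<otimes>\<^bsub>R\<^esub> e = u \<oplus>\<^bsub>R\<^esub> p"
      by (auto simp: J_def colon_ideal_def set_add_def')
    have "\<phi> a \<otimes>\<^bsub>S\<^esub> \<phi> e = \<phi> (u \<oplus>\<^bsub>R\<^esub> p)" using a up by (metis e_carrier hom_mult)
    also have "\<dots> = \<phi> p" using kernel[of u] up mem_carrier by simp
    finally show "s \<in> colon_ideal S (\<phi> ` P) (\<phi> e)" using a up by (auto simp: colon_ideal_def)
  qed
  show "colon_ideal S (\<phi> ` P) (\<phi> e) \<subseteq> \<phi> ` J"
  proof
    fix s assume "s \<in> colon_ideal S (\<phi> ` P) (\<phi> e)"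
    then obtain p where s: "s \<in> carrier S" "s \<otimes>\<^bsub>S\<^esub> \<phi> e = \<phi> p" "p \<in> P"
      by (auto simp: colon_ideal_def)
    obtain a where a: "a \<in> carrier R" "s = \<phi> a" using s surj by blast
    have "\<phi> (a \<otimes>\<^bsub>R\<^esub> e \<ominus>\<^bsub>R\<^esub> p) = \<zero>\<^bsub>S\<^esub>"
      using a s mem_carrier by (simp add: a_minus_def S.r_neg)
    then have "a \<otimes>\<^bsub>R\<^esub> e \<ominus>\<^bsub>R\<^esub> p \<in> U" using kernel a s mem_carrier by simp
    then have "(a \<otimes>\<^bsub>R\<^esub> e \<ominus>\<^bsub>R\<^esub> p) \<oplus>\<^bsub>R\<^esub> p \<in> U <+>\<^bsub>R\<^esub> P"
      using s by (intro set_add_memI)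
    moreover have "(a \<otimes>\<^bsub>R\<^esub> e \<ominus>\<^bsub>R\<^esub> p) \<oplus>\<^bsub>R\<^esub> p = a \<otimes>\<^bsub>R\<^esub> e"
      using a s mem_carrier by (simp add: a_minus_def R.a_assoc R.l_neg)
    ultimately show "s \<in> \<phi> ` J" using a by (auto simp: J_def colon_ideal_def)
  qed
qed

lemma image_K_ideal: "ideal (\<phi> ` K) S" and image_J_ideal: "ideal (\<phi> ` J) S"
  using surj_image_ideal surj J_ideal K_ideal by auto

lemma G_eq: "G = ideal_quot S (\<phi> ` J) (\<phi> ` K)"
  by (simp add: G_def image_J)

lemma eW_ideal: "ideal (cgenideal R e \<inter> W) R" and eQ_ideal: "ideal (cgenideal R e \<inter> Q) R"
  using R.i_intersect R.cgenideal_ideal W_ideal Q_ideal by auto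

lemma eW_eq: "cgenideal R e \<inter> W = (\<lambda>a. e \<otimes>\<^bsub>R\<^esub> a) ` J"
  by (auto simp: cgenideal_def J_eq colon_ideal_def R.m_comm image_iff)

lemmas D_mod = ideal_quot_module[OF R.is_cring J_ideal K_ideal K_subset_J, folded D_def]
  and D_carrier = ideal_quot_carrier[OF R.is_cring J_ideal K_ideal K_subset_J, folded D_def]
  and D_smult = ideal_quot_smult[OF R.is_cring J_ideal K_ideal K_subset_J, folded D_def]
  and D_zero = ideal_quot_zero[OF R.is_cring J_ideal K_ideal K_subset_J, folded D_def]
  and D_lift = ideal_quot_lift[OF R.is_cring J_ideal K_ideal K_subset_J, folded D_def]
  and D_trivial = ideal_quot_trivial_iff[OF R.is_cring J_ideal K_ideal K_subset_J, folded D_def]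

lemmas G_facts = S.is_cring image_J_ideal image_K_ideal image_mono[OF K_subset_J]
lemmas G_mod = ideal_quot_module[OF G_facts, folded G_eq]
  and G_carrier = ideal_quot_carrier[OF G_facts, folded G_eq]
  and G_add = ideal_quot_add[OF G_facts, folded G_eq]
  and G_smult = ideal_quot_smult[OF G_facts, folded G_eq]
  and G_zero = ideal_quot_zero[OF G_facts, folded G_eq]

lemmas E_facts = R.is_cring eW_ideal eQ_ideal Int_mono[OF subset_refl Q_subset_W]
lemmas E_mod = ideal_quot_module[OF E_facts, folded E_def]
  and E_carrier = ideal_quot_carrier[OF E_facts, folded E_def]
  and E_add = ideal_quot_add[OF E_facts, folded E_def]
  and E_smult = ideal_quot_smult[OF E_facts, folded E_def]
  and E_zero = ideal_quot_zero[OF E_facts, folded E_def]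
  and E_lift = ideal_quot_lift[OF E_facts, folded E_def]

lemmas T_facts = R.is_cring W_ideal Q_ideal Q_subset_W
lemmas T_mod = ideal_quot_module[OF T_facts, folded T_def]
  and T_carrier = ideal_quot_carrier[OF T_facts, folded T_def]
  and T_add = ideal_quot_add[OF T_facts, folded T_def]
  and T_smult = ideal_quot_smult[OF T_facts, folded T_def]
  and T_zero = ideal_quot_zero[OF T_facts, folded T_def]

lemma coset_zero_iff: "ideal I A \<Longrightarrow> cring A \<Longrightarrow> a \<in> carrier A \<Longrightarrow> I +>\<^bsub>A\<^esub> a = I \<longleftrightarrow> a \<in> I"
  using ideal_coset_self ideal.rcos_const_imp_mem cring.axioms(1) ring.a_rcos_zero by metis

lemma
  D_via: "Module.module S (module_via R \<phi> D)" and
  E_via: "Module.module S (module_via R \<phi> E)" and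
  T_via: "Module.module S (module_via R \<phi> T)"
proof -
  have u: "r \<in> U" if "r \<in> carrier R" "\<phi> r = \<zero>\<^bsub>S\<^esub>" for r using kernel that by simp
  show "Module.module S (module_via R \<phi> D)"
  proof (rule module_via_module[OF D_mod ring_hom_cring_axioms surj])
    fix r x assume r: "r \<in> carrier R" "\<phi> r = \<zero>\<^bsub>S\<^esub>" and x: "x \<in> carrier D"
    then obtain a where a: "a \<in> J" "x = K +>\<^bsub>R\<^esub> a" by (auto simp: D_carrier)
    have "r \<otimes>\<^bsub>R\<^esub> a \<in> K"
      using ideal.I_r_closed[OF K_ideal, of r a] u[OF r] U_subset_K J_carrier a by auto
    then show "r \<odot>\<^bsub>D\<^esub> x = \<zero>\<^bsub>D\<^esub>"
      using a r by (simp add: D_smult D_zero R.a_rcos_zero[OF K_ideal])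
  qed
  show "Module.module S (module_via R \<phi> T)"
  proof (rule module_via_module[OF T_mod ring_hom_cring_axioms surj])
    fix r x assume r: "r \<in> carrier R" "\<phi> r = \<zero>\<^bsub>S\<^esub>" and x: "x \<in> carrier T"
    then obtain a where a: "a \<in> W" "x = Q +>\<^bsub>R\<^esub> a" by (auto simp: T_carrier)
    then show "r \<odot>\<^bsub>T\<^esub> x = \<zero>\<^bsub>T\<^esub>"
      using a r by (simp add: T_smult T_zero R.a_rcos_zero[OF Q_ideal] U_times_W u)
  qed
  show "Module.module S (module_via R \<phi> E)"
  proof (rule module_via_module[OF E_mod ring_hom_cring_axioms surj])
    fix r x assume r: "r \<in> carrier R" "\<phi> r = \<zero>\<^bsub>S\<^esub>" and x: "x \<in> carrier E"
    then obtain a where a: "a \<in> cgenideal R e \<inter> W" "x = (cgenideal R e \<inter> Q) +>\<^bsub>R\<^esub> a"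
      by (auto simp: E_carrier)
    have "r \<otimes>\<^bsub>R\<^esub> a \<in> cgenideal R e \<inter> Q"
      using a r U_times_W u ideal.I_l_closed[OF R.cgenideal_ideal[OF e_carrier]] by auto
    then show "r \<odot>\<^bsub>E\<^esub> x = \<zero>\<^bsub>E\<^esub>"
      using a r by (simp add: E_smult E_zero R.a_rcos_zero[OF eQ_ideal])
  qed
qed

lemma inv_carrier: "s \<in> carrier S \<Longrightarrow> inv_into (carrier R) \<phi> s \<in> carrier R"
  and phi_inv: "s \<in> carrier S \<Longrightarrow> \<phi> (inv_into (carrier R) \<phi> s) = s"
  using surj by (auto intro: inv_into_into f_inv_into_f)

text \<open>The kernel \<open>U\<close> of \<open>\<phi>\<close> lies in \<open>K\<close>, so passing from \<open>R\<close> to \<open>S\<close> loses nothing in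
  \<open>J / K\<close>.\<close>

lemma D_iso_G:
  obtains f where "f \<in> mod_iso S (module_via R \<phi> D) G"
    "\<And>a. a \<in> J \<Longrightarrow> f (K +>\<^bsub>R\<^esub> a) = \<phi> ` K +>\<^bsub>S\<^esub> \<phi> a"
proof -
  interpret G: Module.module S G by (rule G_mod)
  let ?F = "\<lambda>a. \<phi> ` K +>\<^bsub>S\<^esub> \<phi> a"
  have *: "?F x \<in> carrier G" if "x \<in> J" for x
    using that by (auto simp: G_carrier)
  obtain f where hom: "f \<in> hom (add_monoid D) (add_monoid G)"
    and f: "\<And>a. a \<in> J \<Longrightarrow> f (K +>\<^bsub>R\<^esub> a) = ?F a"
    and im: "f ` carrier D = ?F ` J"
    and inj: "(\<And>x. x \<in> J \<Longrightarrow> ?F x = \<zero>\<^bsub>G\<^esub> \<Longrightarrow> x \<in> K) \<Longrightarrow> inj_on f (carrier D)"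
  proof (rule D_lift[OF G.M.abelian_group_axioms, of ?F])
    show "?F (x \<oplus>\<^bsub>R\<^esub> y) = ?F x \<oplus>\<^bsub>G\<^esub> ?F y" if "x \<in> J" "y \<in> J" for x y
      using that by (simp add: G_add J_carrier)
    show "?F x = \<zero>\<^bsub>G\<^esub>" if "x \<in> K" for x
      using that by (simp add: G_zero S.a_rcos_zero[OF image_K_ideal])
  qed (use * in auto)
  have "f \<in> mod_iso S (module_via R \<phi> D) G"
  proof (rule mod_isoI)
    have "inj_on f (carrier D)"
    proof (rule inj)
      fix a assume a: "a \<in> J" "?F a = \<zero>\<^bsub>G\<^esub>"
      then have "\<phi> a \<in> \<phi> ` K"
        using coset_zero_iff[OF image_K_ideal S.is_cring, of "\<phi> a"] J_carrier by (simp add: G_zero)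
      then obtain k where k: "k \<in> K" "\<phi> a = \<phi> k" by auto
      have kc: "k \<in> carrier R" using ideal.Icarr[OF K_ideal] k by simp
      have "\<phi> (a \<ominus>\<^bsub>R\<^esub> k) = \<zero>\<^bsub>S\<^esub>" using k kc a J_carrier by (simp add: a_minus_def S.r_neg)
      then have "a \<ominus>\<^bsub>R\<^esub> k \<in> K" using kernel U_subset_K kc a J_carrier by auto
      then have "(a \<ominus>\<^bsub>R\<^esub> k) \<oplus>\<^bsub>R\<^esub> k \<in> K"
        using k K_ideal by (intro additive_subgroup.a_closed) (auto simp: ideal.axioms(1))
      then show "a \<in> K" using kc a J_carrier by (simp add: a_minus_def R.a_assoc R.l_neg)
    qed
    then show "inj_on f (carrier (module_via R \<phi> D))" by simp
    show "f ` carrier (module_via R \<phi> D) = carrier G"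
      using im by (simp add: G_carrier image_image)
    show "f \<in> hom (add_monoid (module_via R \<phi> D)) (add_monoid G)"
      using hom by (simp add: hom_def)
    fix r x assume r: "r \<in> carrier S" and "x \<in> carrier (module_via R \<phi> D)"
    then obtain a where a: "a \<in> J" "x = K +>\<^bsub>R\<^esub> a" by (auto simp: D_carrier)
    let ?r = "inv_into (carrier R) \<phi> r"
    have "?r \<otimes>\<^bsub>R\<^esub> a \<in> J" using ideal.I_l_closed[OF J_ideal] a inv_carrier[OF r] by simp
    then show "f (r \<odot>\<^bsub>module_via R \<phi> D\<^esub> x) = r \<odot>\<^bsub>G\<^esub> f x"
      using a r inv_carrier[OF r] J_carrier phi_inv by (simp add: D_smult f G_smult)
  qed
  then show thesis using f that by blast
qed

text \<open>Multiplication by \<open>e\<close> maps \<open>J\<close> onto the multiples of \<open>e\<close> in \<open>W\<close> and takes exactly the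
  elements of \<open>K\<close> into \<open>Q\<close>.\<close>

lemma D_iso_E:
  obtains k where "k \<in> mod_iso S (module_via R \<phi> D) (module_via R \<phi> E)"
    "\<And>a. a \<in> J \<Longrightarrow> k (K +>\<^bsub>R\<^esub> a) = (cgenideal R e \<inter> Q) +>\<^bsub>R\<^esub> (e \<otimes>\<^bsub>R\<^esub> a)"
proof -
  interpret E: Module.module R E by (rule E_mod)
  let ?F = "\<lambda>a. (cgenideal R e \<inter> Q) +>\<^bsub>R\<^esub> (e \<otimes>\<^bsub>R\<^esub> a)"
  have eJ: "e \<otimes>\<^bsub>R\<^esub> a \<in> cgenideal R e \<inter> W" if "a \<in> J" for a
    using that eW_eq by blast
  obtain k where hom: "k \<in> hom (add_monoid D) (add_monoid E)"
    and k: "\<And>a. a \<in> J \<Longrightarrow> k (K +>\<^bsub>R\<^esub> a) = ?F a"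
    and im: "k ` carrier D = ?F ` J"
    and inj: "(\<And>x. x \<in> J \<Longrightarrow> ?F x = \<zero>\<^bsub>E\<^esub> \<Longrightarrow> x \<in> K) \<Longrightarrow> inj_on k (carrier D)"
  proof (rule D_lift[OF E.M.abelian_group_axioms, of ?F])
    show "?F x \<in> carrier E" if "x \<in> J" for x
      using eJ that by (auto simp: E_carrier)
    show "?F (x \<oplus>\<^bsub>R\<^esub> y) = ?F x \<oplus>\<^bsub>E\<^esub> ?F y" if "x \<in> J" "y \<in> J" for x y
      using that eJ by (simp add: E_add J_carrier R.r_distr)
    show "?F x = \<zero>\<^bsub>E\<^esub>" if "x \<in> K" for x
    proof -
      have "e \<otimes>\<^bsub>R\<^esub> x \<in> cgenideal R e \<inter> Q"
        using that R.m_comm[OF e_carrier] by (auto simp: K_def colon_ideal_def cgenideal_def)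
      then show ?thesis by (simp add: E_zero R.a_rcos_zero[OF eQ_ideal])
    qed
  qed auto
  have "k \<in> mod_iso S (module_via R \<phi> D) (module_via R \<phi> E)"
  proof (rule mod_isoI)
    have "inj_on k (carrier D)"
    proof (rule inj)
      fix a assume a: "a \<in> J" "?F a = \<zero>\<^bsub>E\<^esub>"
      then have "e \<otimes>\<^bsub>R\<^esub> a \<in> cgenideal R e \<inter> Q"
        using coset_zero_iff[OF eQ_ideal R.is_cring, of "e \<otimes>\<^bsub>R\<^esub> a"] J_carrier by (simp add: E_zero)
      then show "a \<in> K" using a J_carrier by (simp add: K_def colon_ideal_def R.m_comm)
    qed
    then show "inj_on k (carrier (module_via R \<phi> D))" by simp
    show "k ` carrier (module_via R \<phi> D) = carrier (module_via R \<phi> E)"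
      using im by (simp add: E_carrier eW_eq image_image)
    show "k \<in> hom (add_monoid (module_via R \<phi> D)) (add_monoid (module_via R \<phi> E))"
      using hom by (simp add: hom_def)
    fix r x assume r: "r \<in> carrier S" and "x \<in> carrier (module_via R \<phi> D)"
    then obtain a where a: "a \<in> J" "x = K +>\<^bsub>R\<^esub> a" by (auto simp: D_carrier)
    let ?r = "inv_into (carrier R) \<phi> r"
    have "?r \<otimes>\<^bsub>R\<^esub> a \<in> J" using ideal.I_l_closed[OF J_ideal] a inv_carrier[OF r] by simp
    then show "k (r \<odot>\<^bsub>module_via R \<phi> D\<^esub> x) = r \<odot>\<^bsub>module_via R \<phi> E\<^esub> k x"
      using a eJ[OF a(1)] inv_carrier[OF r] J_carrier[OF a(1)] by (simp add: D_smult k E_smult R.m_lcomm)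
  qed
  then show thesis using k that by blast
qed

text \<open>The inclusion of \<open>eR \<inter> W\<close> in \<open>W\<close> has kernel \<open>eR \<inter> Q\<close> modulo \<open>Q\<close>, and its image consists of the
  cosets that meet \<open>eR\<close>.\<close>

lemma E_embeds_T:
  obtains h where "h \<in> mod_hom S (module_via R \<phi> E) (module_via R \<phi> T)" "inj_on h (carrier E)"
    "\<And>b. b \<in> cgenideal R e \<inter> W \<Longrightarrow> h ((cgenideal R e \<inter> Q) +>\<^bsub>R\<^esub> b) = Q +>\<^bsub>R\<^esub> b"
    "h ` carrier E = {Y \<in> carrier T. \<exists>c\<in>carrier R. e \<otimes>\<^bsub>R\<^esub> c \<in> Y}"
proof -
  interpret T: Module.module R T by (rule T_mod)
  let ?F = "\<lambda>b. Q +>\<^bsub>R\<^esub> b"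
  have Wc: "b \<in> carrier R" if "b \<in> W" for b using that ideal.Icarr[OF W_ideal] by simp
  obtain h where hom: "h \<in> hom (add_monoid E) (add_monoid T)"
    and h: "\<And>b. b \<in> cgenideal R e \<inter> W \<Longrightarrow> h ((cgenideal R e \<inter> Q) +>\<^bsub>R\<^esub> b) = ?F b"
    and im: "h ` carrier E = ?F ` (cgenideal R e \<inter> W)"
    and inj: "(\<And>x. x \<in> cgenideal R e \<inter> W \<Longrightarrow> ?F x = \<zero>\<^bsub>T\<^esub> \<Longrightarrow> x \<in> cgenideal R e \<inter> Q) \<Longrightarrow> inj_on h (carrier E)"
  proof (rule E_lift[OF T.M.abelian_group_axioms, of ?F])
    show "?F x \<in> carrier T" if "x \<in> cgenideal R e \<inter> W" for x
      using that by (auto simp: T_carrier)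
    show "?F (x \<oplus>\<^bsub>R\<^esub> y) = ?F x \<oplus>\<^bsub>T\<^esub> ?F y" if "x \<in> cgenideal R e \<inter> W" "y \<in> cgenideal R e \<inter> W" for x y
      using that by (simp add: T_add)
    show "?F x = \<zero>\<^bsub>T\<^esub>" if "x \<in> cgenideal R e \<inter> Q" for x
      using that by (simp add: T_zero R.a_rcos_zero[OF Q_ideal])
  qed auto
  show thesis
  proof
    show "h \<in> mod_hom S (module_via R \<phi> E) (module_via R \<phi> T)"
    proof -
      have "h (r \<odot>\<^bsub>module_via R \<phi> E\<^esub> x) = r \<odot>\<^bsub>module_via R \<phi> T\<^esub> h x"
        if r: "r \<in> carrier S" and x: "x \<in> carrier E" for r x
      proof -
        obtain b where b: "b \<in> cgenideal R e \<inter> W" "x = (cgenideal R e \<inter> Q) +>\<^bsub>R\<^esub> b"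
          using x by (auto simp: E_carrier)
        let ?r = "inv_into (carrier R) \<phi> r"
        have "?r \<otimes>\<^bsub>R\<^esub> b \<in> cgenideal R e \<inter> W" using ideal.I_l_closed[OF eW_ideal] b inv_carrier[OF r] by simp
        then show ?thesis
          using b inv_carrier[OF r] by (simp add: E_smult h T_smult)
      qed
      then show ?thesis using hom by (simp add: mod_hom_def hom_def)
    qed
    show "inj_on h (carrier E)"
    proof (rule inj)
      fix b assume b: "b \<in> cgenideal R e \<inter> W" "?F b = \<zero>\<^bsub>T\<^esub>"
      then show "b \<in> cgenideal R e \<inter> Q"
        using coset_zero_iff[OF Q_ideal R.is_cring, of b] Wc by (simp add: T_zero)
    qed
    show "h ((cgenideal R e \<inter> Q) +>\<^bsub>R\<^esub> b) = Q +>\<^bsub>R\<^esub> b" if "b \<in> cgenideal R e \<inter> W" for b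
      using h that .
    show "h ` carrier E = {Y \<in> carrier T. \<exists>c\<in>carrier R. e \<otimes>\<^bsub>R\<^esub> c \<in> Y}"
    proof (intro subset_antisym subsetI)
      fix Y assume "Y \<in> h ` carrier E"
      then obtain b where b: "b \<in> cgenideal R e \<inter> W" "Y = Q +>\<^bsub>R\<^esub> b" by (auto simp: im)
      then obtain c where "c \<in> carrier R" "b = e \<otimes>\<^bsub>R\<^esub> c" by (auto simp: cgenideal_def R.m_comm)
      moreover have "b \<in> Q +>\<^bsub>R\<^esub> b"
        using abelian_subgroup.a_rcos_self[OF abelian_subgroupI3[OF ideal.axioms(1)[OF Q_ideal] R.is_abelian_group]]
          b Wc by auto
      ultimately show "Y \<in> {Y \<in> carrier T. \<exists>c\<in>carrier R. e \<otimes>\<^bsub>R\<^esub> c \<in> Y}"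
        using b by (auto simp: T_carrier)
    next
      fix Y assume "Y \<in> {Y \<in> carrier T. \<exists>c\<in>carrier R. e \<otimes>\<^bsub>R\<^esub> c \<in> Y}"
      then obtain b c where b: "b \<in> W" "Y = Q +>\<^bsub>R\<^esub> b" and c: "c \<in> carrier R" "e \<otimes>\<^bsub>R\<^esub> c \<in> Y"
        by (auto simp: T_carrier)
      obtain q where q: "q \<in> Q" "e \<otimes>\<^bsub>R\<^esub> c = q \<oplus>\<^bsub>R\<^esub> b"
        using c b by (auto simp: a_r_coset_def')
      then have W: "e \<otimes>\<^bsub>R\<^esub> c \<in> W"
        using Q_subset_W W_ideal b by (auto intro!: additive_subgroup.a_closed ideal.axioms(1))
      have "Y = Q +>\<^bsub>R\<^esub> (e \<otimes>\<^bsub>R\<^esub> c)"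
        using abelian_subgroup.a_repr_independence'[OF abelian_subgroupI3[OF ideal.axioms(1)[OF Q_ideal] R.is_abelian_group]]
          b c Wc by auto
      then show "Y \<in> h ` carrier E"
        using W c by (auto simp: im cgenideal_def R.m_comm)
    qed
  qed
qed

lemma comparison:
  "Module.module S (module_via R \<phi> D) \<and> Module.module S G \<and> Module.module S (module_via R \<phi> E) \<and>
   Module.module S (module_via R \<phi> T) \<and>
   (\<exists>f\<in>mod_iso S (module_via R \<phi> D) G. \<exists>g\<in>mod_iso S G (module_via R \<phi> E).
    \<exists>h\<in>mod_hom S (module_via R \<phi> E) (module_via R \<phi> T).
      (\<forall>a\<in>J. f (K +>\<^bsub>R\<^esub> a) = \<phi> ` K +>\<^bsub>S\<^esub> \<phi> a) \<and>
      (\<forall>a\<in>J. g (\<phi> ` K +>\<^bsub>S\<^esub> \<phi> a) = (cgenideal R e \<inter> Q) +>\<^bsub>R\<^esub> (e \<otimes>\<^bsub>R\<^esub> a)) \<and>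
      (\<forall>b \<in> cgenideal R e \<inter> W. h ((cgenideal R e \<inter> Q) +>\<^bsub>R\<^esub> b) = Q +>\<^bsub>R\<^esub> b) \<and>
      inj_on h (carrier (module_via R \<phi> E)) \<and>
      submodule {Y \<in> carrier (module_via R \<phi> T). \<exists>c\<in>carrier R. e \<otimes>\<^bsub>R\<^esub> c \<in> Y} S (module_via R \<phi> T) \<and>
      bij_betw (h \<circ> g \<circ> f) (carrier (module_via R \<phi> D))
        {Y \<in> carrier (module_via R \<phi> T). \<exists>c\<in>carrier R. e \<otimes>\<^bsub>R\<^esub> c \<in> Y})"
proof -
  obtain f where f: "f \<in> mod_iso S (module_via R \<phi> D) G"
    "\<And>a. a \<in> J \<Longrightarrow> f (K +>\<^bsub>R\<^esub> a) = \<phi> ` K +>\<^bsub>S\<^esub> \<phi> a" by (rule D_iso_G) blast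
  obtain k where k: "k \<in> mod_iso S (module_via R \<phi> D) (module_via R \<phi> E)"
    "\<And>a. a \<in> J \<Longrightarrow> k (K +>\<^bsub>R\<^esub> a) = (cgenideal R e \<inter> Q) +>\<^bsub>R\<^esub> (e \<otimes>\<^bsub>R\<^esub> a)" by (rule D_iso_E) blast
  obtain h where h: "h \<in> mod_hom S (module_via R \<phi> E) (module_via R \<phi> T)" "inj_on h (carrier E)"
    "\<And>b. b \<in> cgenideal R e \<inter> W \<Longrightarrow> h ((cgenideal R e \<inter> Q) +>\<^bsub>R\<^esub> b) = Q +>\<^bsub>R\<^esub> b"
    "h ` carrier E = {Y \<in> carrier T. \<exists>c\<in>carrier R. e \<otimes>\<^bsub>R\<^esub> c \<in> Y}" by (rule E_embeds_T) blast
  let ?D = "module_via R \<phi> D" and ?E = "module_via R \<phi> E" and ?T = "module_via R \<phi> T"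
  define g where "g = k \<circ> inv_into (carrier ?D) f"
  have g: "g \<in> mod_iso S G ?E"
    unfolding g_def using mod_iso_inv[OF D_via f(1)] k(1) by (rule mod_iso_comp)
  have inj_f: "inj_on f (carrier D)" and bij_f: "bij_betw f (carrier D) (carrier G)"
    using f(1) by (auto simp: mod_iso_def bij_betw_def)
  have ga: "g (\<phi> ` K +>\<^bsub>S\<^esub> \<phi> a) = (cgenideal R e \<inter> Q) +>\<^bsub>R\<^esub> (e \<otimes>\<^bsub>R\<^esub> a)" if a: "a \<in> J" for a
  proof -
    have "inv_into (carrier D) f (f (K +>\<^bsub>R\<^esub> a)) = K +>\<^bsub>R\<^esub> a"
      by (rule inv_into_f_f[OF inj_f]) (use a in \<open>auto simp: D_carrier\<close>)
    then show ?thesis using f(2)[OF a] k(2)[OF a] by (simp add: g_def)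
  qed
  have "bij_betw g (carrier G) (carrier E)" using g by (simp add: mod_iso_def)
  moreover have "bij_betw h (carrier E) {Y \<in> carrier T. \<exists>c\<in>carrier R. e \<otimes>\<^bsub>R\<^esub> c \<in> Y}"
    using h by (simp add: bij_betw_def)
  ultimately have "bij_betw (h \<circ> (g \<circ> f)) (carrier D) {Y \<in> carrier T. \<exists>c\<in>carrier R. e \<otimes>\<^bsub>R\<^esub> c \<in> Y}"
    using bij_f by (blast intro: bij_betw_trans)
  moreover have "submodule {Y \<in> carrier T. \<exists>c\<in>carrier R. e \<otimes>\<^bsub>R\<^esub> c \<in> Y} S ?T"
    using submodule_image[OF E_via T_via h(1)] h(4) by simp
  ultimately have "inj_on h (carrier ?E) \<and>
      submodule {Y \<in> carrier ?T. \<exists>c\<in>carrier R. e \<otimes>\<^bsub>R\<^esub> c \<in> Y} S ?T \<and>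
      bij_betw (h \<circ> g \<circ> f) (carrier ?D) {Y \<in> carrier ?T. \<exists>c\<in>carrier R. e \<otimes>\<^bsub>R\<^esub> c \<in> Y}"
    using h(2) by (simp add: comp_assoc)
  then show ?thesis
    using D_via G_mod E_via T_via f g h(1,3) ga
    by (intro conjI bexI[of _ f] bexI[of _ g] bexI[of _ h] ballI) simp_all
qed

text \<open>The hypothesis gives \<open>W = Q\<close>, so that the ambient module \<open>W / Q\<close> is already zero.\<close>

lemma trivial_if_intersection_small: "U \<inter> M \<subseteq> Q \<Longrightarrow> carrier D = {\<zero>\<^bsub>D\<^esub>}"
proof -
  assume *: "U \<inter> M \<subseteq> Q"
  have "W \<subseteq> Q"
    using * P_subset_Q Q_ideal
    by (auto simp: W_def set_add_def' intro!: additive_subgroup.a_closed ideal.axioms(1))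
  then show "carrier D = {\<zero>\<^bsub>D\<^esub>}"
    by (auto simp: D_trivial J_eq K_def colon_ideal_def)
qed

text \<open>The inclusion of \<open>U \<inter> M\<close> in \<open>W\<close> is onto modulo \<open>Q\<close>, because \<open>W\<close> is the sum of \<open>U \<inter> M\<close> and
  \<open>P\<close>, and \<open>P \<subseteq> Q\<close>.\<close>

lemma quotient_of_intersection:
  obtains \<pi> where "\<pi> \<in> mod_hom R (ideal_quot R (U \<inter> M) (ideal_prod R U M)) T"
    "\<And>a. a \<in> U \<inter> M \<Longrightarrow> \<pi> (ideal_prod R U M +>\<^bsub>R\<^esub> a) = Q +>\<^bsub>R\<^esub> a"
    "\<pi> ` carrier (ideal_quot R (U \<inter> M) (ideal_prod R U M)) = carrier T"
proof -
  interpret T: Module.module R T by (rule T_mod)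
  let ?X = "ideal_quot R (U \<inter> M) (ideal_prod R U M)" and ?F = "\<lambda>b. Q +>\<^bsub>R\<^esub> b"
  note X_facts = R.is_cring R.i_intersect[OF U M] R.ideal_prod_is_ideal[OF U M] R.ideal_prod_inter[OF U M]
  have UMW: "U \<inter> M \<subseteq> W"
  proof
    fix a assume a: "a \<in> U \<inter> M"
    have "a \<oplus>\<^bsub>R\<^esub> \<zero>\<^bsub>R\<^esub> \<in> W" unfolding W_def using a P
      by (intro set_add_memI) (auto intro: additive_subgroup.zero_closed ideal.axioms(1))
    then show "a \<in> W" using a mem_carrier by simp
  qed
  obtain \<pi> where hom: "\<pi> \<in> hom (add_monoid ?X) (add_monoid T)"
    and \<pi>: "\<And>b. b \<in> U \<inter> M \<Longrightarrow> \<pi> (ideal_prod R U M +>\<^bsub>R\<^esub> b) = ?F b"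
    and im: "\<pi> ` carrier ?X = ?F ` (U \<inter> M)"
  proof (rule ideal_quot_lift[OF X_facts T.M.abelian_group_axioms, of ?F])
    show "?F x \<in> carrier T" if "x \<in> U \<inter> M" for x
      using that UMW by (auto simp: T_carrier)
    show "?F (x \<oplus>\<^bsub>R\<^esub> y) = ?F x \<oplus>\<^bsub>T\<^esub> ?F y" if "x \<in> U \<inter> M" "y \<in> U \<inter> M" for x y
      using that UMW by (subst T_add) auto
    show "?F x = \<zero>\<^bsub>T\<^esub>" if "x \<in> ideal_prod R U M" for x
      using that UM_subset_Q by (auto simp: T_zero R.a_rcos_zero[OF Q_ideal])
  qed auto
  show thesis
  proof
    show "\<pi> \<in> mod_hom R ?X T"
    proof -
      have "\<pi> (r \<odot>\<^bsub>?X\<^esub> x) = r \<odot>\<^bsub>T\<^esub> \<pi> x" if r: "r \<in> carrier R" and x: "x \<in> carrier ?X" for r x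
      proof -
        obtain b where b: "b \<in> U \<inter> M" "x = ideal_prod R U M +>\<^bsub>R\<^esub> b"
          using x by (auto simp: ideal_quot_carrier[OF X_facts])
        have "r \<otimes>\<^bsub>R\<^esub> b \<in> U \<inter> M" using ideal.I_l_closed[OF X_facts(2)] b r by simp
        then show ?thesis
          using b r UMW by (auto simp: ideal_quot_smult[OF X_facts] \<pi> T_smult)
      qed
      then show ?thesis using hom by (simp add: mod_hom_def)
    qed
    show "\<pi> (ideal_prod R U M +>\<^bsub>R\<^esub> a) = Q +>\<^bsub>R\<^esub> a" if "a \<in> U \<inter> M" for a using \<pi> that .
    have "Q +>\<^bsub>R\<^esub> b \<in> ?F ` (U \<inter> M)" if bW: "b \<in> W" for b
    proof -
      obtain a p where a: "a \<in> U \<inter> M" "p \<in> P" "b = a \<oplus>\<^bsub>R\<^esub> p"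
        using bW unfolding W_def by (rule set_add_memE)
      have "b \<ominus>\<^bsub>R\<^esub> a = p" using a mem_carrier by (simp add: R.a_comm[of a p] a_minus_def R.a_assoc R.r_neg)
      then have "Q +>\<^bsub>R\<^esub> b = Q +>\<^bsub>R\<^esub> a"
        using R.quotient_eq_iff_same_a_r_cos[OF Q_ideal, of b a] a mem_carrier P_subset_Q by auto
      then show ?thesis using a by auto
    qed
    then show "\<pi> ` carrier ?X = carrier T" using UMW by (auto simp: im T_carrier)
  qed
qed

end


section \<open>Free modules\<close>

lemma mod_homD:
  assumes "h \<in> mod_hom R M N"
  shows "x \<in> carrier M \<Longrightarrow> h x \<in> carrier N"
    "x \<in> carrier M \<Longrightarrow> y \<in> carrier M \<Longrightarrow> h (x \<oplus>\<^bsub>M\<^esub> y) = h x \<oplus>\<^bsub>N\<^esub> h y"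
    "r \<in> carrier R \<Longrightarrow> x \<in> carrier M \<Longrightarrow> h (r \<odot>\<^bsub>M\<^esub> x) = r \<odot>\<^bsub>N\<^esub> h x"
  using assms by (auto simp: mod_hom_def hom_def)

lemma mod_homI:
  assumes "\<And>x. x \<in> carrier M \<Longrightarrow> h x \<in> carrier N"
    "\<And>x y. x \<in> carrier M \<Longrightarrow> y \<in> carrier M \<Longrightarrow> h (x \<oplus>\<^bsub>M\<^esub> y) = h x \<oplus>\<^bsub>N\<^esub> h y"
    "\<And>r x. r \<in> carrier R \<Longrightarrow> x \<in> carrier M \<Longrightarrow> h (r \<odot>\<^bsub>M\<^esub> x) = r \<odot>\<^bsub>N\<^esub> h x"
  shows "h \<in> mod_hom R M N"
  using assms by (auto simp: mod_hom_def hom_def)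

lemma mod_hom_minus_zero:
  assumes M: "Module.module R M" and N: "Module.module R N" and h: "h \<in> mod_hom R M N"
  shows "h \<zero>\<^bsub>M\<^esub> = \<zero>\<^bsub>N\<^esub>"
    and "x \<in> carrier M \<Longrightarrow> h (\<ominus>\<^bsub>M\<^esub> x) = \<ominus>\<^bsub>N\<^esub> h x"
    and "x \<in> carrier M \<Longrightarrow> y \<in> carrier M \<Longrightarrow> h (x \<ominus>\<^bsub>M\<^esub> y) = h x \<ominus>\<^bsub>N\<^esub> h y"
proof -
  interpret M: Module.module R M by fact
  interpret N: Module.module R N by fact
  interpret h: abelian_group_hom M N h
    by (rule abelian_group_homI)
      (auto simp: mod_homD[OF h] hom_def M.abelian_group_axioms N.abelian_group_axioms
        group_hom_def group_hom_axioms_def M.M.a_group N.M.a_group)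
  show "h \<zero>\<^bsub>M\<^esub> = \<zero>\<^bsub>N\<^esub>" by simp
  show "x \<in> carrier M \<Longrightarrow> h (\<ominus>\<^bsub>M\<^esub> x) = \<ominus>\<^bsub>N\<^esub> h x" by simp
  then show "x \<in> carrier M \<Longrightarrow> y \<in> carrier M \<Longrightarrow> h (x \<ominus>\<^bsub>M\<^esub> y) = h x \<ominus>\<^bsub>N\<^esub> h y"
    using mod_homD[OF h] by (simp add: a_minus_def)
qed

lemma preimage_submodule:
  assumes M: "Module.module R M" and N: "Module.module R N" and h: "h \<in> mod_hom R M N"
    and H: "submodule H R N"
  shows "submodule {x \<in> carrier M. h x \<in> H} R M"
proof -
  interpret M: Module.module R M by fact
  interpret N: Module.module R N by fact
  note HE = N.submoduleE[OF H]
  have "\<zero>\<^bsub>N\<^esub> \<in> H" using subgroup.one_closed[OF submodule.axioms(1)[OF H]] by simp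
  then show ?thesis
    using mod_hom_minus_zero[OF M N h] mod_homD[OF h] HE by (intro M.submoduleI) auto
qed

lemma zero_submodule:
  assumes M: "Module.module R M"
  shows "submodule {\<zero>\<^bsub>M\<^esub>} R M"
proof -
  interpret M: Module.module R M by fact
  show ?thesis by (rule M.submoduleI) (auto simp: M.smult_r_null)
qed

lemma submoduleD:
  assumes M: "Module.module R M" and H: "submodule H R M"
  shows "\<zero>\<^bsub>M\<^esub> \<in> H" "x \<in> H \<Longrightarrow> x \<in> carrier M" "x \<in> H \<Longrightarrow> y \<in> H \<Longrightarrow> x \<oplus>\<^bsub>M\<^esub> y \<in> H"
    "x \<in> H \<Longrightarrow> y \<in> H \<Longrightarrow> x \<ominus>\<^bsub>M\<^esub> y \<in> H" "r \<in> carrier R \<Longrightarrow> x \<in> H \<Longrightarrow> r \<odot>\<^bsub>M\<^esub> x \<in> H"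
    "x \<in> H \<Longrightarrow> \<ominus>\<^bsub>M\<^esub> x \<in> H"
proof -
  interpret M: Module.module R M by fact
  note HE = M.submoduleE[OF H]
  show "\<zero>\<^bsub>M\<^esub> \<in> H" using subgroup.one_closed[OF submodule.axioms(1)[OF H]] by simp
  show "x \<in> H \<Longrightarrow> y \<in> H \<Longrightarrow> x \<ominus>\<^bsub>M\<^esub> y \<in> H" using HE by (simp add: a_minus_def)
qed (use Module.module.submoduleE[OF M H] in auto)

lemma submod_gen_submodule:
  assumes M: "Module.module R M" and X: "X \<subseteq> carrier M"
  shows "submodule (submod_gen R M X) R M"
proof -
  interpret M: Module.module R M by fact
  note D = submoduleD[OF M]
  show ?thesis
  proof (rule M.submoduleI)
    show "submod_gen R M X \<subseteq> carrier M"
      using M.carrier_is_submodule X by (auto simp: submod_gen_def)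
  qed (use D in \<open>auto simp: submod_gen_def\<close>)
qed

lemma submod_gen_least: "submodule H R M \<Longrightarrow> X \<subseteq> H \<Longrightarrow> submod_gen R M X \<subseteq> H"
  by (auto simp: submod_gen_def)

lemma submod_gen_incl: "X \<subseteq> submod_gen R M X"
  by (auto simp: submod_gen_def)

lemma free_mod_simps:
  "\<zero>\<^bsub>free_mod R X\<^esub> = (\<lambda>x. \<zero>\<^bsub>R\<^esub>)"
  "f \<oplus>\<^bsub>free_mod R X\<^esub> g = (\<lambda>x. f x \<oplus>\<^bsub>R\<^esub> g x)"
  "r \<odot>\<^bsub>free_mod R X\<^esub> f = (\<lambda>x. r \<otimes>\<^bsub>R\<^esub> f x)"
  by (simp_all add: free_mod_def)

lemma free_mod_carrier:
  "f \<in> carrier (free_mod R X) \<longleftrightarrow> (\<forall>x. f x \<in> carrier R) \<and> finite {x. f x \<noteq> \<zero>\<^bsub>R\<^esub>} \<and> {x. f x \<noteq> \<zero>\<^bsub>R\<^esub>} \<subseteq> X"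
  by (simp add: free_mod_def)

lemma (in cring) free_mod_module: "Module.module R (free_mod R X)"
proof (rule moduleI)
  show "abelian_group (free_mod R X)"
  proof (rule abelian_groupI)
    fix f g assume "f \<in> carrier (free_mod R X)" "g \<in> carrier (free_mod R X)"
    moreover have "{x. f x \<oplus> g x \<noteq> \<zero>} \<subseteq> {x. f x \<noteq> \<zero>} \<union> {x. g x \<noteq> \<zero>}" by auto
    ultimately show "f \<oplus>\<^bsub>free_mod R X\<^esub> g \<in> carrier (free_mod R X)"
      unfolding free_mod_carrier free_mod_simps
      by (meson Un_least a_closed finite_Un finite_subset subset_trans)
  next
    fix f assume "f \<in> carrier (free_mod R X)"
    then show "\<exists>g\<in>carrier (free_mod R X). g \<oplus>\<^bsub>free_mod R X\<^esub> f = \<zero>\<^bsub>free_mod R X\<^esub>"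
      by (intro bexI[of _ "\<lambda>x. \<ominus> f x"]) (auto simp: free_mod_carrier free_mod_simps l_neg)
  qed (auto simp: free_mod_carrier free_mod_simps a_ac)
  fix r f assume "r \<in> carrier R" "f \<in> carrier (free_mod R X)"
  then show "r \<odot>\<^bsub>free_mod R X\<^esub> f \<in> carrier (free_mod R X)"
    by (auto simp: free_mod_carrier free_mod_simps elim!: rev_finite_subset)
qed (auto simp: is_cring free_mod_carrier free_mod_simps l_distr r_distr m_assoc)

lemma (in cring) free_gen_carrier: "x \<in> X \<Longrightarrow> free_gen R x \<in> carrier (free_mod R X)"
  by (auto simp: free_mod_carrier free_gen_def elim!: rev_finite_subset[of "{x}", rotated])

definition lin_ext :: "('a, 'c) ring_scheme \<Rightarrow> ('a, 'b) module \<Rightarrow> ('x \<Rightarrow> 'b) \<Rightarrow> ('x \<Rightarrow> 'a) \<Rightarrow> 'b" where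
  "lin_ext R M h f = finsum M (\<lambda>x. f x \<odot>\<^bsub>M\<^esub> h x) {x. f x \<noteq> \<zero>\<^bsub>R\<^esub>}"

lemma free_eval_eq_lin_ext: "free_eval R M = lin_ext R M (\<lambda>x. x)"
  by (simp add: fun_eq_iff free_eval_def lin_ext_def)

lemma lin_ext_superset:
  assumes M: "Module.module R M" and f: "f \<in> carrier (free_mod R X)" and h: "h \<in> X \<rightarrow> carrier M"
    and A: "finite A" "A \<subseteq> X" "{x. f x \<noteq> \<zero>\<^bsub>R\<^esub>} \<subseteq> A"
  shows "lin_ext R M h f = finsum M (\<lambda>x. f x \<odot>\<^bsub>M\<^esub> h x) A"
proof -
  interpret M: Module.module R M by fact
  have hx: "x \<in> A \<Longrightarrow> h x \<in> carrier M" for x using h A by auto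
  show ?thesis
    unfolding lin_ext_def
    by (rule M.add.finprod_mono_neutral_cong_left)
      (use A f hx in \<open>auto simp: free_mod_carrier\<close>)
qed

lemma lin_ext_hom:
  assumes M: "Module.module R M" and h: "h \<in> X \<rightarrow> carrier M"
  shows "lin_ext R M h \<in> mod_hom R (free_mod R X) M"
proof -
  interpret M: Module.module R M by fact
  have fin: "finite {x. f x \<noteq> \<zero>\<^bsub>R\<^esub>}" "{x. f x \<noteq> \<zero>\<^bsub>R\<^esub>} \<subseteq> X" "f x \<in> carrier R" if "f \<in> carrier (free_mod R X)" for f x
    using that by (auto simp: free_mod_carrier)
  interpret F: Module.module R "free_mod R X" by (rule M.free_mod_module)
  show ?thesis
  proof (rule mod_homI)
    fix f assume f: "f \<in> carrier (free_mod R X)"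
    then show "lin_ext R M h f \<in> carrier M"
      using fin[OF f] h by (auto simp: lin_ext_def intro!: M.finsum_closed)
  next
    fix f g assume f: "f \<in> carrier (free_mod R X)" and g: "g \<in> carrier (free_mod R X)"
    let ?A = "{x. f x \<noteq> \<zero>\<^bsub>R\<^esub>} \<union> {x. g x \<noteq> \<zero>\<^bsub>R\<^esub>}"
    have A: "finite ?A" "?A \<subseteq> X" using fin(1,2)[OF f] fin(1,2)[OF g] by auto
    have hA: "h x \<in> carrier M" if "x \<in> ?A" for x using h A that by blast
    have sub: "{x. (f \<oplus>\<^bsub>free_mod R X\<^esub> g) x \<noteq> \<zero>\<^bsub>R\<^esub>} \<subseteq> ?A"
      by (auto simp: free_mod_simps)
    have "lin_ext R M h (f \<oplus>\<^bsub>free_mod R X\<^esub> g) = finsum M (\<lambda>x. (f \<oplus>\<^bsub>free_mod R X\<^esub> g) x \<odot>\<^bsub>M\<^esub> h x) ?A"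
      using lin_ext_superset[OF M F.M.a_closed[OF f g] h A sub] .
    also have "\<dots> = finsum M (\<lambda>x. f x \<odot>\<^bsub>M\<^esub> h x \<oplus>\<^bsub>M\<^esub> g x \<odot>\<^bsub>M\<^esub> h x) ?A"
      by (rule M.finsum_cong') (use hA fin(3)[OF f] fin(3)[OF g] in \<open>auto simp: free_mod_simps M.smult_l_distr\<close>)
    also have "\<dots> = finsum M (\<lambda>x. f x \<odot>\<^bsub>M\<^esub> h x) ?A \<oplus>\<^bsub>M\<^esub> finsum M (\<lambda>x. g x \<odot>\<^bsub>M\<^esub> h x) ?A"
      by (rule M.finsum_addf) (use hA fin(3)[OF f] fin(3)[OF g] in auto)
    also have "\<dots> = lin_ext R M h f \<oplus>\<^bsub>M\<^esub> lin_ext R M h g"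
      using lin_ext_superset[OF M f h A] lin_ext_superset[OF M g h A] by simp
    finally show "lin_ext R M h (f \<oplus>\<^bsub>free_mod R X\<^esub> g) = lin_ext R M h f \<oplus>\<^bsub>M\<^esub> lin_ext R M h g" .
  next
    fix r f assume r: "r \<in> carrier R" and f: "f \<in> carrier (free_mod R X)"
    let ?A = "{x. f x \<noteq> \<zero>\<^bsub>R\<^esub>}"
    have hA: "h x \<in> carrier M" if "x \<in> ?A" for x using h fin(2)[OF f] that by blast
    have sub: "{x. (r \<odot>\<^bsub>free_mod R X\<^esub> f) x \<noteq> \<zero>\<^bsub>R\<^esub>} \<subseteq> ?A"
      using r by (auto simp: free_mod_simps)
    have "lin_ext R M h (r \<odot>\<^bsub>free_mod R X\<^esub> f) = finsum M (\<lambda>x. (r \<odot>\<^bsub>free_mod R X\<^esub> f) x \<odot>\<^bsub>M\<^esub> h x) ?A"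
      using lin_ext_superset[OF M F.smult_closed[OF r f] h fin(1,2)[OF f] sub] .
    also have "\<dots> = finsum M (\<lambda>x. r \<odot>\<^bsub>M\<^esub> (f x \<odot>\<^bsub>M\<^esub> h x)) ?A"
      by (rule M.finsum_cong') (use hA fin(3)[OF f] r in \<open>auto simp: free_mod_simps M.smult_assoc1\<close>)
    also have "\<dots> = r \<odot>\<^bsub>M\<^esub> lin_ext R M h f"
      unfolding lin_ext_def by (rule M.finsum_smult_ldistr[symmetric]) (use hA fin[OF f] r in auto)
    finally show "lin_ext R M h (r \<odot>\<^bsub>free_mod R X\<^esub> f) = r \<odot>\<^bsub>M\<^esub> lin_ext R M h f" .
  qed
qed

lemma lin_ext_gen:
  assumes M: "Module.module R M" and h: "h \<in> X \<rightarrow> carrier M" and x: "x \<in> X"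
  shows "lin_ext R M h (free_gen R x) = h x"
proof -
  interpret M: Module.module R M by fact
  have "lin_ext R M h (free_gen R x) = finsum M (\<lambda>y. free_gen R x y \<odot>\<^bsub>M\<^esub> h y) {x}"
    by (rule lin_ext_superset[OF M M.free_gen_carrier[OF x] h]) (use x in \<open>auto simp: free_gen_def\<close>)
  then show ?thesis using h x by (simp add: free_gen_def Pi_iff)
qed

lemma free_mod_generated:
  assumes R: "cring R" and H: "submodule H R (free_mod R X)" and gen: "\<And>x. x \<in> X \<Longrightarrow> free_gen R x \<in> H"
  shows "carrier (free_mod R X) \<subseteq> H"
proof
  interpret cring R by fact
  let ?F = "free_mod R X"
  interpret F: Module.module R ?F by (rule free_mod_module)
  note D = submoduleD[OF F.module_axioms H]
  have *: "f \<in> H" if "finite A" "A \<subseteq> X" "\<And>x. f x \<in> carrier R" "{x. f x \<noteq> \<zero>\<^bsub>R\<^esub>} \<subseteq> A" for A f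
    using that
  proof (induction A arbitrary: f)
    case empty
    then have "f = \<zero>\<^bsub>?F\<^esub>" by (simp add: free_mod_simps fun_eq_iff)
    then show ?case using D(1) by simp
  next
    case (insert a A)
    define g where "g = f(a := \<zero>\<^bsub>R\<^esub>)"
    have "g \<in> H" by (rule insert.IH) (use insert in \<open>auto simp: g_def\<close>)
    moreover have "f a \<odot>\<^bsub>?F\<^esub> free_gen R a \<in> H"
      using D(5) gen insert.prems by auto
    ultimately have "g \<oplus>\<^bsub>?F\<^esub> f a \<odot>\<^bsub>?F\<^esub> free_gen R a \<in> H" using D(3) by simp
    moreover have "g \<oplus>\<^bsub>?F\<^esub> f a \<odot>\<^bsub>?F\<^esub> free_gen R a = f"
      using insert.prems by (auto simp: free_mod_simps fun_eq_iff g_def free_gen_def)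
    ultimately show ?case by simp
  qed
  fix f assume "f \<in> carrier ?F"
  then show "f \<in> H" using *[of "{x. f x \<noteq> \<zero>\<^bsub>R\<^esub>}" f] by (auto simp: free_mod_carrier)
qed

lemma free_mod_hom_eqI:
  assumes R: "cring R" and M: "Module.module R M" and f: "f \<in> mod_hom R (free_mod R X) M" and g: "g \<in> mod_hom R (free_mod R X) M"
    and eq: "\<And>x. x \<in> X \<Longrightarrow> f (free_gen R x) = g (free_gen R x)"
    and y: "y \<in> carrier (free_mod R X)"
  shows "f y = g y"
proof -
  interpret cring R by fact
  interpret F: Module.module R "free_mod R X" by (rule free_mod_module)
  interpret M: Module.module R M by fact
  note zm = mod_hom_minus_zero[OF F.module_axioms M]
  have sub: "submodule {y \<in> carrier (free_mod R X). f y = g y} R (free_mod R X)"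
    by (rule F.submoduleI)
      (simp_all add: zm[OF f] zm[OF g] mod_homD[OF f] mod_homD[OF g] subset_eq)
  have "free_gen R x \<in> {y \<in> carrier (free_mod R X). f y = g y}" if "x \<in> X" for x
    using eq[OF that] free_gen_carrier[OF that] by simp
  from free_mod_generated[OF R sub this] show ?thesis using y by auto
qed


section \<open>Tensor products with a cyclic module\<close>

definition ideal_smult :: "('a, 'c) ring_scheme \<Rightarrow> 'a set \<Rightarrow> ('a, 'b) module \<Rightarrow> 'b set" where
  "ideal_smult R I M = submod_gen R M {i \<odot>\<^bsub>M\<^esub> m |i m. i \<in> I \<and> m \<in> carrier M}"

lemma ideal_smult_memI: "i \<in> I \<Longrightarrow> m \<in> carrier M \<Longrightarrow> i \<odot>\<^bsub>M\<^esub> m \<in> ideal_smult R I M"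
  unfolding ideal_smult_def by (rule subsetD[OF submod_gen_incl]) auto

lemma ideal_smult_least:
  "submodule H R M \<Longrightarrow> (\<And>i m. i \<in> I \<Longrightarrow> m \<in> carrier M \<Longrightarrow> i \<odot>\<^bsub>M\<^esub> m \<in> H) \<Longrightarrow> ideal_smult R I M \<subseteq> H"
  unfolding ideal_smult_def by (rule submod_gen_least) auto

text \<open>Tensoring with \<open>R/I\<close> is the functor \<open>M \<mapsto> M/IM\<close>.  The point of this section is that the
  submodule of tensor relations is the full preimage of \<open>IM\<close> under the evaluation of formal
  combinations of pairs.\<close>

locale cyclic_module = cring R for R (structure) + fixes I
  assumes I: "ideal I R"
begin

definition "C = quot_module (ring_mod R) I"
definition "rep n = (SOME r. r \<in> carrier R \<and> n = I +> r)"

lemma Icarr: "i \<in> I \<Longrightarrow> i \<in> carrier R"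
  using ideal.Icarr[OF I] .

lemma ideal_smult_submodule:
  assumes M: "Module.module R M"
  shows "submodule (ideal_smult R I M) R M"
proof -
  interpret M: Module.module R M by fact
  show ?thesis unfolding ideal_smult_def by (rule submod_gen_submodule[OF M]) (auto intro: Icarr)
qed

lemma ideal_smult_image:
  assumes M: "Module.module R M" and M': "Module.module R M'" and h: "h \<in> mod_hom R M M'"
    and x: "x \<in> ideal_smult R I M"
  shows "h x \<in> ideal_smult R I M'"
proof -
  have "ideal_smult R I M \<subseteq> {x \<in> carrier M. h x \<in> ideal_smult R I M'}"
  proof (rule ideal_smult_least)
    interpret M: Module.module R M by fact
    show "submodule {x \<in> carrier M. h x \<in> ideal_smult R I M'} R M"
      using preimage_submodule[OF M M' h ideal_smult_submodule[OF M']] .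
    show "i \<odot>\<^bsub>M\<^esub> m \<in> {x \<in> carrier M. h x \<in> ideal_smult R I M'}" if "i \<in> I" "m \<in> carrier M" for i m
      using that mod_homD[OF h] ideal_smult_memI[of i I "h m" M' R] Icarr by auto
  qed
  then show ?thesis using x by auto
qed

lemma coset_ring_mod: "I +>\<^bsub>ring_mod R\<^esub> a = I +> a"
  by (simp add: a_r_coset_def')

lemma C_module: "Module.module R C"
  unfolding C_def by (rule quot_module_module) (auto simp: I is_cring intro: ring_mod_module ideal_submodule)

lemma C_carrier: "carrier C = (\<lambda>a. I +> a) ` carrier R"
  unfolding C_def by (simp add: quot_module_carrier coset_ring_mod)

lemma C_add: "a \<in> carrier R \<Longrightarrow> b \<in> carrier R \<Longrightarrow> (I +> a) \<oplus>\<^bsub>C\<^esub> (I +> b) = I +> (a \<oplus> b)"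
  using quot_module_add[OF ring_mod_module[OF is_cring] ideal_submodule[OF is_cring I], of a b]
  unfolding C_def by (simp add: coset_ring_mod)

lemma C_smult: "r \<in> carrier R \<Longrightarrow> a \<in> carrier R \<Longrightarrow> r \<odot>\<^bsub>C\<^esub> (I +> a) = I +> (r \<otimes> a)"
  using quot_module_smult[OF ring_mod_module[OF is_cring] ideal_submodule[OF is_cring I], of r a]
  unfolding C_def by (simp add: coset_ring_mod)

lemma C_zero: "\<zero>\<^bsub>C\<^esub> = I"
  by (simp add: C_def quot_module_zero)

lemma C_coset: "a \<in> carrier R \<Longrightarrow> I +> a \<in> carrier C"
  by (simp add: C_carrier)

lemma rep: assumes "n \<in> carrier C" shows "rep n \<in> carrier R" "I +> rep n = n"
proof -
  have "rep n \<in> carrier R \<and> n = I +> rep n"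
    unfolding rep_def by (rule someI_ex) (use assms in \<open>auto simp: C_carrier\<close>)
  then show "rep n \<in> carrier R" "I +> rep n = n" by auto
qed

lemma rep_diff:
  assumes "n \<in> carrier C" "a \<in> carrier R" "n = I +> a"
  shows "rep n \<ominus> a \<in> I"
  using rep[OF assms(1)] quotient_eq_iff_same_a_r_cos[OF I, of "rep n" a] assms by simp

text \<open>The isomorphism of \<open>M \<otimes> R/I\<close> with \<open>M/IM\<close> on formal linear combinations of pairs.\<close>

definition "tval M = lin_ext R M (\<lambda>(m, n). rep n \<odot>\<^bsub>M\<^esub> m)"

context
  fixes M :: "('a, 'm) module"
  assumes M: "Module.module R M"
begin

interpretation M: Module.module R M by (rule M)
interpretation C: Module.module R C by (rule C_module)

abbreviation "FP \<equiv> free_mod R (carrier M \<times> carrier C)"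
abbreviation "gen \<equiv> free_gen R :: 'm \<times> 'a set \<Rightarrow> 'm \<times> 'a set \<Rightarrow> 'a"
abbreviation "TR \<equiv> tensor_rel R M C"
abbreviation "IM \<equiv> ideal_smult R I M"
abbreviation "un \<equiv> I +> \<one>"

interpretation FP: Module.module R FP by (rule free_mod_module)

lemma tval_hom: "tval M \<in> mod_hom R FP M"
  unfolding tval_def by (rule lin_ext_hom[OF M]) (auto intro: rep)

lemma tval_gen: "m \<in> carrier M \<Longrightarrow> n \<in> carrier C \<Longrightarrow> tval M (gen (m, n)) = rep n \<odot>\<^bsub>M\<^esub> m"
  unfolding tval_def by (subst lin_ext_gen[OF M, of _ "carrier M \<times> carrier C"]) (auto intro: rep)

lemma gen_carrier: "m \<in> carrier M \<Longrightarrow> n \<in> carrier C \<Longrightarrow> gen (m, n) \<in> carrier FP"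
  by (rule free_gen_carrier) auto

lemma tensor_rel_submodule: "submodule TR R FP"
  unfolding tensor_rel_def Let_def
  by (rule submod_gen_submodule[OF free_mod_module]) (auto intro!: gen_carrier)

lemmas TRD = submoduleD[OF free_mod_module tensor_rel_submodule]

lemma tensor_relI:
  "x \<in> carrier M \<Longrightarrow> x' \<in> carrier M \<Longrightarrow> y \<in> carrier C \<Longrightarrow>
     gen (x \<oplus>\<^bsub>M\<^esub> x', y) \<ominus>\<^bsub>FP\<^esub> (gen (x, y) \<oplus>\<^bsub>FP\<^esub> gen (x', y)) \<in> TR"
  "x \<in> carrier M \<Longrightarrow> r \<in> carrier R \<Longrightarrow> y \<in> carrier C \<Longrightarrow>
     gen (r \<odot>\<^bsub>M\<^esub> x, y) \<ominus>\<^bsub>FP\<^esub> r \<odot>\<^bsub>FP\<^esub> gen (x, y) \<in> TR"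
  "x \<in> carrier M \<Longrightarrow> r \<in> carrier R \<Longrightarrow> y \<in> carrier C \<Longrightarrow>
     gen (x, r \<odot>\<^bsub>C\<^esub> y) \<ominus>\<^bsub>FP\<^esub> r \<odot>\<^bsub>FP\<^esub> gen (x, y) \<in> TR"
  unfolding tensor_rel_def Let_def by (rule subsetD[OF submod_gen_incl]; blast)+

lemma IMD: "submodule IM R M" by (rule ideal_smult_submodule[OF M])

lemma minus_zero_FP: "a \<in> carrier FP \<Longrightarrow> a \<ominus>\<^bsub>FP\<^esub> \<zero>\<^bsub>FP\<^esub> = a"
  using FP.M.minus_equality[of "\<zero>\<^bsub>FP\<^esub>" "\<zero>\<^bsub>FP\<^esub>"] by (simp add: a_minus_def)

lemma tval_kills_relations: "TR \<subseteq> {f \<in> carrier FP. tval M f \<in> IM}"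
proof -
  note h = mod_homD[OF tval_hom] and hm = mod_hom_minus_zero(3)[OF free_mod_module M tval_hom]
  note I0 = submoduleD(1)[OF M IMD]
  have mem: "r \<odot>\<^bsub>M\<^esub> x \<in> IM" if "r \<in> I" "x \<in> carrier M" for r x
    using ideal_smult_memI that by fast
  have rdiff: "a \<odot>\<^bsub>M\<^esub> x \<ominus>\<^bsub>M\<^esub> b \<odot>\<^bsub>M\<^esub> x = (a \<ominus> b) \<odot>\<^bsub>M\<^esub> x" if "a \<in> carrier R" "b \<in> carrier R" "x \<in> carrier M" for a b x
    using that by (simp add: a_minus_def M.smult_l_distr M.smult_l_minus)
  show ?thesis
    unfolding tensor_rel_def Let_def
  proof (rule submod_gen_least, rule preimage_submodule[OF free_mod_module M tval_hom IMD], intro Un_least subsetI)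
    fix f assume "f \<in> {gen (x \<oplus>\<^bsub>M\<^esub> x', y) \<ominus>\<^bsub>FP\<^esub> (gen (x, y) \<oplus>\<^bsub>FP\<^esub> gen (x', y)) |x x' y.
          x \<in> carrier M \<and> x' \<in> carrier M \<and> y \<in> carrier C}"
    then obtain x x' y where f: "f = gen (x \<oplus>\<^bsub>M\<^esub> x', y) \<ominus>\<^bsub>FP\<^esub> (gen (x, y) \<oplus>\<^bsub>FP\<^esub> gen (x', y))"
      and *: "x \<in> carrier M" "x' \<in> carrier M" "y \<in> carrier C" by blast
    have "tval M f = \<zero>\<^bsub>M\<^esub>"
      using * rep[OF *(3)] by (simp add: f hm h gen_carrier tval_gen M.smult_r_distr) (simp add: a_minus_def M.M.r_neg)
    then show "f \<in> {f \<in> carrier FP. tval M f \<in> IM}" using I0 f gen_carrier * by auto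
  next
    fix f assume "f \<in> {gen (x, y \<oplus>\<^bsub>C\<^esub> y') \<ominus>\<^bsub>FP\<^esub> (gen (x, y) \<oplus>\<^bsub>FP\<^esub> gen (x, y')) |x y y'.
          x \<in> carrier M \<and> y \<in> carrier C \<and> y' \<in> carrier C}"
    then obtain x y y' where f: "f = gen (x, y \<oplus>\<^bsub>C\<^esub> y') \<ominus>\<^bsub>FP\<^esub> (gen (x, y) \<oplus>\<^bsub>FP\<^esub> gen (x, y'))"
      and *: "x \<in> carrier M" "y \<in> carrier C" "y' \<in> carrier C" by blast
    have yy: "y \<oplus>\<^bsub>C\<^esub> y' = I +> (rep y \<oplus> rep y')"
      using rep[OF *(2)] rep[OF *(3)] C_add[of "rep y" "rep y'"] by simp
    have "tval M f = (rep (y \<oplus>\<^bsub>C\<^esub> y') \<ominus> (rep y \<oplus> rep y')) \<odot>\<^bsub>M\<^esub> x"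
      using * rep[OF *(2)] rep[OF *(3)] rep[of "y \<oplus>\<^bsub>C\<^esub> y'"]
      by (simp add: f hm h gen_carrier tval_gen flip: M.smult_l_distr rdiff)
    moreover have "rep (y \<oplus>\<^bsub>C\<^esub> y') \<ominus> (rep y \<oplus> rep y') \<in> I"
      using yy * rep by (intro rep_diff) (auto simp flip: yy)
    ultimately show "f \<in> {f \<in> carrier FP. tval M f \<in> IM}" using mem f gen_carrier * by auto
  next
    fix f assume "f \<in> {gen (r \<odot>\<^bsub>M\<^esub> x, y) \<ominus>\<^bsub>FP\<^esub> r \<odot>\<^bsub>FP\<^esub> gen (x, y) |r x y.
          r \<in> carrier R \<and> x \<in> carrier M \<and> y \<in> carrier C}"
    then obtain r x y where f: "f = gen (r \<odot>\<^bsub>M\<^esub> x, y) \<ominus>\<^bsub>FP\<^esub> r \<odot>\<^bsub>FP\<^esub> gen (x, y)"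
      and *: "r \<in> carrier R" "x \<in> carrier M" "y \<in> carrier C" by blast
    have "tval M f = \<zero>\<^bsub>M\<^esub>"
      using * rep[OF *(3)]
      by (simp add: f hm h gen_carrier tval_gen m_comm flip: M.smult_assoc1) (simp add: a_minus_def M.M.r_neg)
    then show "f \<in> {f \<in> carrier FP. tval M f \<in> IM}" using I0 f gen_carrier * by auto
  next
    fix f assume "f \<in> {gen (x, r \<odot>\<^bsub>C\<^esub> y) \<ominus>\<^bsub>FP\<^esub> r \<odot>\<^bsub>FP\<^esub> gen (x, y) |r x y.
          r \<in> carrier R \<and> x \<in> carrier M \<and> y \<in> carrier C}"
    then obtain r x y where f: "f = gen (x, r \<odot>\<^bsub>C\<^esub> y) \<ominus>\<^bsub>FP\<^esub> r \<odot>\<^bsub>FP\<^esub> gen (x, y)"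
      and *: "r \<in> carrier R" "x \<in> carrier M" "y \<in> carrier C" by blast
    have ry: "r \<odot>\<^bsub>C\<^esub> y = I +> (r \<otimes> rep y)"
      using rep[OF *(3)] C_smult[of r "rep y"] * by simp
    have "tval M f = (rep (r \<odot>\<^bsub>C\<^esub> y) \<ominus> r \<otimes> rep y) \<odot>\<^bsub>M\<^esub> x"
      using * rep[OF *(3)] rep[of "r \<odot>\<^bsub>C\<^esub> y"]
      by (simp add: f hm h gen_carrier tval_gen flip: M.smult_assoc1 rdiff)
    moreover have "rep (r \<odot>\<^bsub>C\<^esub> y) \<ominus> r \<otimes> rep y \<in> I"
      using ry * rep by (intro rep_diff) (auto simp flip: ry)
    ultimately show "f \<in> {f \<in> carrier FP. tval M f \<in> IM}" using mem f gen_carrier * by auto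
  qed
qed

lemma FP_cancel:
  assumes "a \<in> carrier FP" "b \<in> carrier FP" "c \<in> carrier FP"
    "a \<ominus>\<^bsub>FP\<^esub> b \<in> TR" "b \<ominus>\<^bsub>FP\<^esub> c \<in> TR"
  shows "a \<ominus>\<^bsub>FP\<^esub> c \<in> TR"
proof -
  have "a \<ominus>\<^bsub>FP\<^esub> c = (a \<ominus>\<^bsub>FP\<^esub> b) \<oplus>\<^bsub>FP\<^esub> (b \<ominus>\<^bsub>FP\<^esub> c)"
    using assms by (simp add: a_minus_def FP.M.a_assoc FP.M.r_neg1 FP.M.r_neg2)
  then show ?thesis using assms TRD(3) by simp
qed

lemma FP_sym: "a \<in> carrier FP \<Longrightarrow> b \<in> carrier FP \<Longrightarrow> a \<ominus>\<^bsub>FP\<^esub> b \<in> TR \<Longrightarrow> b \<ominus>\<^bsub>FP\<^esub> a \<in> TR"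
  using TRD(6)[of "a \<ominus>\<^bsub>FP\<^esub> b"] by (simp add: a_minus_def FP.M.minus_add FP.M.a_comm)

lemma un_carrier: "un \<in> carrier C" by (rule C_coset) simp

text \<open>Since \<open>n = rep n \<cdot> 1\<close> in \<open>R/I\<close>, every tensor can be moved to the first factor.\<close>

lemma tensor_normal_form:
  assumes f: "f \<in> carrier FP"
  shows "f \<ominus>\<^bsub>FP\<^esub> gen (tval M f, un) \<in> TR"
proof -
  let ?H = "{f \<in> carrier FP. f \<ominus>\<^bsub>FP\<^esub> gen (tval M f, un) \<in> TR}"
  note h = mod_homD[OF tval_hom]
  note hz = mod_hom_minus_zero[OF free_mod_module M tval_hom]
  have scal: "r \<odot>\<^bsub>FP\<^esub> f \<in> ?H" if r: "r \<in> carrier R" and f: "f \<in> ?H" for r f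
  proof -
    have fc: "f \<in> carrier FP" "tval M f \<in> carrier M" using f h by auto
    have "r \<odot>\<^bsub>FP\<^esub> (f \<ominus>\<^bsub>FP\<^esub> gen (tval M f, un)) \<in> TR" using f r TRD(5) by auto
    moreover have "r \<odot>\<^bsub>FP\<^esub> (f \<ominus>\<^bsub>FP\<^esub> gen (tval M f, un)) = r \<odot>\<^bsub>FP\<^esub> f \<ominus>\<^bsub>FP\<^esub> r \<odot>\<^bsub>FP\<^esub> gen (tval M f, un)"
      using fc r gen_carrier un_carrier by (simp add: a_minus_def FP.smult_r_distr FP.smult_r_minus)
    moreover have "r \<odot>\<^bsub>FP\<^esub> gen (tval M f, un) \<ominus>\<^bsub>FP\<^esub> gen (r \<odot>\<^bsub>M\<^esub> tval M f, un) \<in> TR"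
      using tensor_relI(2)[OF fc(2) r un_carrier] fc r gen_carrier un_carrier by - (rule FP_sym, auto)
    ultimately have "r \<odot>\<^bsub>FP\<^esub> f \<ominus>\<^bsub>FP\<^esub> gen (r \<odot>\<^bsub>M\<^esub> tval M f, un) \<in> TR"
      using fc r gen_carrier un_carrier by - (rule FP_cancel[of "r \<odot>\<^bsub>FP\<^esub> f" "r \<odot>\<^bsub>FP\<^esub> gen (tval M f, un)"], simp_all)
    then show ?thesis using fc r h by simp
  qed
  have add: "f \<oplus>\<^bsub>FP\<^esub> g \<in> ?H" if f: "f \<in> ?H" and g: "g \<in> ?H" for f g
  proof -
    have c: "f \<in> carrier FP" "tval M f \<in> carrier M" "g \<in> carrier FP" "tval M g \<in> carrier M" using f g h by auto
    note gc = gen_carrier[OF c(2) un_carrier] gen_carrier[OF c(4) un_carrier] gen_carrier[OF M.M.a_closed[OF c(2,4)] un_carrier]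
    have "(f \<ominus>\<^bsub>FP\<^esub> gen (tval M f, un)) \<oplus>\<^bsub>FP\<^esub> (g \<ominus>\<^bsub>FP\<^esub> gen (tval M g, un)) \<in> TR"
      using f g TRD(3) by auto
    moreover have "(f \<ominus>\<^bsub>FP\<^esub> gen (tval M f, un)) \<oplus>\<^bsub>FP\<^esub> (g \<ominus>\<^bsub>FP\<^esub> gen (tval M g, un)) =
       (f \<oplus>\<^bsub>FP\<^esub> g) \<ominus>\<^bsub>FP\<^esub> (gen (tval M f, un) \<oplus>\<^bsub>FP\<^esub> gen (tval M g, un))"
      using c gc by (simp add: a_minus_def FP.M.minus_add FP.M.a_ac)
    moreover have "(gen (tval M f, un) \<oplus>\<^bsub>FP\<^esub> gen (tval M g, un)) \<ominus>\<^bsub>FP\<^esub> gen (tval M f \<oplus>\<^bsub>M\<^esub> tval M g, un) \<in> TR"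
      using tensor_relI(1)[OF c(2,4) un_carrier] gc by - (rule FP_sym, auto)
    ultimately have "(f \<oplus>\<^bsub>FP\<^esub> g) \<ominus>\<^bsub>FP\<^esub> gen (tval M f \<oplus>\<^bsub>M\<^esub> tval M g, un) \<in> TR"
      using c gc by - (rule FP_cancel[of "f \<oplus>\<^bsub>FP\<^esub> g" "gen (tval M f, un) \<oplus>\<^bsub>FP\<^esub> gen (tval M g, un)"], simp_all)
    then show ?thesis using c h by simp
  qed
  have gen: "gen (m, n) \<in> ?H" if mn: "m \<in> carrier M" "n \<in> carrier C" for m n
  proof -
    note r = rep[OF mn(2)]
    have "n = rep n \<odot>\<^bsub>C\<^esub> un" using r C_smult[of "rep n" \<one>] by simp
    then have "gen (m, n) \<ominus>\<^bsub>FP\<^esub> rep n \<odot>\<^bsub>FP\<^esub> gen (m, un) \<in> TR"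
      using tensor_relI(3)[OF mn(1) r(1) un_carrier] by simp
    moreover have "rep n \<odot>\<^bsub>FP\<^esub> gen (m, un) \<ominus>\<^bsub>FP\<^esub> gen (rep n \<odot>\<^bsub>M\<^esub> m, un) \<in> TR"
      using tensor_relI(2)[OF mn(1) r(1) un_carrier] mn r gen_carrier un_carrier by - (rule FP_sym, auto)
    ultimately have "gen (m, n) \<ominus>\<^bsub>FP\<^esub> gen (rep n \<odot>\<^bsub>M\<^esub> m, un) \<in> TR"
      using mn r gen_carrier un_carrier
      by - (rule FP_cancel[of "gen (m, n)" "rep n \<odot>\<^bsub>FP\<^esub> gen (m, un)"], simp_all)
    then show ?thesis using mn by (simp add: gen_carrier tval_gen)
  qed
  have "submodule ?H R FP"
  proof (rule FP.submoduleI)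
    have "\<zero>\<^bsub>R\<^esub> \<odot>\<^bsub>FP\<^esub> gen (\<zero>\<^bsub>M\<^esub>, un) \<in> ?H"
      by (rule scal) (use gen un_carrier in auto)
    then show "\<zero>\<^bsub>FP\<^esub> \<in> ?H" using gen_carrier[OF M.M.zero_closed un_carrier] by simp
    show "\<ominus>\<^bsub>FP\<^esub> a \<in> ?H" if "a \<in> ?H" for a
      using scal[OF _ that, of "\<ominus> \<one>"] that by (simp add: FP.smult_l_minus)
  qed (use scal add in auto)
  then have "carrier FP \<subseteq> ?H" by (rule free_mod_generated[OF is_cring]) (use gen in auto)
  then show ?thesis using f by blast
qed

text \<open>By the normal form it is enough to treat the generator at \<open>(m, 1)\<close> with \<open>m \<in> IM\<close>; this is a
  relation because \<open>i m \<otimes> 1 = m \<otimes> i 1\<close> and \<open>i 1 = 0\<close> in \<open>R/I\<close>.\<close>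

lemma tensor_rel_eq: "TR = {f \<in> carrier FP. tval M f \<in> IM}"
proof (rule subset_antisym[OF tval_kills_relations], safe)
  fix f assume f: "f \<in> carrier FP" "tval M f \<in> IM"
  let ?H = "{m \<in> carrier M. gen (m, un) \<in> TR}"
  have smult: "r \<odot>\<^bsub>M\<^esub> m \<in> ?H" if "r \<in> carrier R" "m \<in> ?H" for r m
  proof -
    have "(gen (r \<odot>\<^bsub>M\<^esub> m, un) \<ominus>\<^bsub>FP\<^esub> r \<odot>\<^bsub>FP\<^esub> gen (m, un)) \<oplus>\<^bsub>FP\<^esub> r \<odot>\<^bsub>FP\<^esub> gen (m, un) \<in> TR"
      using tensor_relI(2)[of m r un] that un_carrier TRD(3,5) by auto
    then show ?thesis
      using that gen_carrier un_carrier by (simp add: a_minus_def FP.M.a_assoc FP.M.l_neg)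
  qed
  have zero: "gen (m, I) \<in> TR" if m: "m \<in> carrier M" for m
  proof -
    have "\<zero> \<odot>\<^bsub>C\<^esub> un = I" using un_carrier C_zero by simp
    then have "gen (m, I) \<ominus>\<^bsub>FP\<^esub> \<zero> \<odot>\<^bsub>FP\<^esub> gen (m, un) \<in> TR"
      using tensor_relI(3)[OF m zero_closed un_carrier] by simp
    moreover have "I \<in> carrier C" using C.M.zero_closed C_zero by simp
    ultimately show ?thesis
      using gen_carrier[OF m] un_carrier by (simp add: minus_zero_FP)
  qed
  have "IM \<subseteq> ?H"
  proof (rule ideal_smult_least)
    show "submodule ?H R M"
    proof (rule M.submoduleI)
      have "\<zero> \<odot>\<^bsub>C\<^esub> un = I" using un_carrier C_zero by simp
      show "\<zero>\<^bsub>M\<^esub> \<in> ?H"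
        using tensor_relI(2)[OF M.M.zero_closed zero_closed un_carrier] gen_carrier un_carrier
        by (simp add: minus_zero_FP)
      fix a assume a: "a \<in> ?H"
      show "\<ominus>\<^bsub>M\<^esub> a \<in> ?H" using smult[OF _ a, of "\<ominus> \<one>"] a by (simp add: M.smult_l_minus)
      fix b assume b: "b \<in> ?H"
      have "(gen (a \<oplus>\<^bsub>M\<^esub> b, un) \<ominus>\<^bsub>FP\<^esub> (gen (a, un) \<oplus>\<^bsub>FP\<^esub> gen (b, un))) \<oplus>\<^bsub>FP\<^esub> (gen (a, un) \<oplus>\<^bsub>FP\<^esub> gen (b, un)) \<in> TR"
        using tensor_relI(1)[of a b un] a b un_carrier TRD(3) by auto
      then show "a \<oplus>\<^bsub>M\<^esub> b \<in> ?H"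
        using a b gen_carrier un_carrier by (simp add: a_minus_def FP.M.a_assoc FP.M.l_neg)
    qed (use smult in auto)
    show "i \<odot>\<^bsub>M\<^esub> m \<in> ?H" if im: "i \<in> I" "m \<in> carrier M" for i m
    proof -
      have ic: "i \<in> carrier R" using im Icarr by simp
      have "i \<odot>\<^bsub>C\<^esub> un = I"
        using C_smult[OF ic one_closed] ic im a_rcos_zero[OF I] by simp
      then have "gen (m, I) \<ominus>\<^bsub>FP\<^esub> i \<odot>\<^bsub>FP\<^esub> gen (m, un) \<in> TR"
        using tensor_relI(3)[OF im(2) ic un_carrier] by simp
      then have "i \<odot>\<^bsub>FP\<^esub> gen (m, un) \<ominus>\<^bsub>FP\<^esub> gen (m, I) \<in> TR"
        using gen_carrier[OF im(2)] un_carrier ic C.M.zero_closed C_zero by - (rule FP_sym, auto)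
      then have "gen (i \<odot>\<^bsub>M\<^esub> m, un) \<ominus>\<^bsub>FP\<^esub> gen (m, I) \<in> TR"
        using tensor_relI(2)[OF im(2) ic un_carrier] gen_carrier im ic un_carrier C.M.zero_closed C_zero
        by - (rule FP_cancel[of "gen (i \<odot>\<^bsub>M\<^esub> m, un)" "i \<odot>\<^bsub>FP\<^esub> gen (m, un)"], simp_all)
      then have "(gen (i \<odot>\<^bsub>M\<^esub> m, un) \<ominus>\<^bsub>FP\<^esub> gen (m, I)) \<oplus>\<^bsub>FP\<^esub> gen (m, I) \<in> TR"
        using zero im TRD(3) by auto
      then show ?thesis
        using im ic gen_carrier un_carrier C.M.zero_closed C_zero by (simp add: a_minus_def FP.M.a_assoc FP.M.l_neg)
    qed
  qed
  then have "gen (tval M f, un) \<in> TR" using f by auto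
  then have "(f \<ominus>\<^bsub>FP\<^esub> gen (tval M f, un)) \<oplus>\<^bsub>FP\<^esub> gen (tval M f, un) \<in> TR"
    using tensor_normal_form[OF f(1)] TRD(3) by auto
  then show "f \<in> TR"
    using f mod_homD(1)[OF tval_hom f(1)] gen_carrier un_carrier by (simp add: a_minus_def FP.M.a_assoc FP.M.l_neg)
qed

lemma tensor_module: "Module.module R (tensor R M C)"
  unfolding tensor_def by (rule quot_module_module[OF free_mod_module tensor_rel_submodule])

lemma tensor_carrier: "carrier (tensor R M C) = (\<lambda>f. TR +>\<^bsub>FP\<^esub> f) ` carrier FP"
  by (simp add: tensor_def quot_module_carrier)

lemma tensor_coset_mem:
  assumes "Y \<in> carrier (tensor R M C)" "f \<in> Y"
  shows "f \<in> carrier FP" "Y = TR +>\<^bsub>FP\<^esub> f"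
proof -
  interpret T: abelian_subgroup TR FP
    by (rule abelian_subgroup_of_submodule[OF free_mod_module tensor_rel_submodule])
  obtain g where g: "g \<in> carrier FP" "Y = TR +>\<^bsub>FP\<^esub> g" using assms by (auto simp: tensor_carrier)
  show "Y = TR +>\<^bsub>FP\<^esub> f" using T.a_repr_independence' g assms by simp
  show "f \<in> carrier FP" using T.a_elemrcos_carrier g assms by blast
qed

lemma tensor_coset_self: "f \<in> carrier FP \<Longrightarrow> f \<in> TR +>\<^bsub>FP\<^esub> f"
  using abelian_subgroup.a_rcos_self[OF abelian_subgroup_of_submodule[OF free_mod_module tensor_rel_submodule]] .

text \<open>The value of a tensor in \<open>M\<close>, well defined modulo \<open>IM\<close>.\<close>

definition "tv Y = tval M (SOME f. f \<in> Y)"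

lemma tensor_some:
  assumes "Y \<in> carrier (tensor R M C)"
  shows "(SOME f. f \<in> Y) \<in> carrier FP" "Y = TR +>\<^bsub>FP\<^esub> (SOME f. f \<in> Y)"
proof -
  obtain g where "g \<in> carrier FP" "Y = TR +>\<^bsub>FP\<^esub> g"
    using assms by (auto simp: tensor_carrier)
  then have "g \<in> Y" using tensor_coset_self by simp
  then have "(SOME f. f \<in> Y) \<in> Y" by (rule someI[of "\<lambda>f. f \<in> Y"])
  then show "(SOME f. f \<in> Y) \<in> carrier FP" "Y = TR +>\<^bsub>FP\<^esub> (SOME f. f \<in> Y)"
    using tensor_coset_mem[OF assms] by auto
qed

lemma tv_carrier: "Y \<in> carrier (tensor R M C) \<Longrightarrow> tv Y \<in> carrier M"
  unfolding tv_def using tensor_some mod_homD(1)[OF tval_hom] by blast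

lemma tv_coset:
  assumes f: "f \<in> carrier FP"
  shows "tv (TR +>\<^bsub>FP\<^esub> f) \<ominus>\<^bsub>M\<^esub> tval M f \<in> IM"
proof -
  let ?g = "SOME g. g \<in> TR +>\<^bsub>FP\<^esub> f"
  have "TR +>\<^bsub>FP\<^esub> f \<in> carrier (tensor R M C)" using f by (auto simp: tensor_carrier)
  note g = tensor_some[OF this]
  have "?g \<ominus>\<^bsub>FP\<^esub> f \<in> TR"
    using quot_coset_eq_iff[OF free_mod_module tensor_rel_submodule g(1) f] g(2) by simp
  then have "tval M (?g \<ominus>\<^bsub>FP\<^esub> f) \<in> IM" by (auto simp: tensor_rel_eq)
  then show ?thesis unfolding tv_def
    using mod_hom_minus_zero(3)[OF free_mod_module M tval_hom g(1) f] by simp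
qed

lemma tv_surj:
  assumes m: "m \<in> carrier M"
  obtains Y where "Y \<in> carrier (tensor R M C)" "tv Y \<ominus>\<^bsub>M\<^esub> m \<in> IM"
proof -
  let ?Y = "TR +>\<^bsub>FP\<^esub> gen (m, un)"
  note g = gen_carrier[OF m un_carrier]
  have Y: "?Y \<in> carrier (tensor R M C)" using g by (auto simp: tensor_carrier)
  have "(rep un \<ominus> \<one>) \<odot>\<^bsub>M\<^esub> m \<in> IM"
    by (rule ideal_smult_memI[OF rep_diff m]) (use un_carrier in auto)
  moreover have "(rep un \<ominus> \<one>) \<odot>\<^bsub>M\<^esub> m = tval M (gen (m, un)) \<ominus>\<^bsub>M\<^esub> m"
    using m un_carrier rep[OF un_carrier] by (simp add: tval_gen a_minus_def M.smult_l_distr M.smult_l_minus)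
  ultimately have "(tv ?Y \<ominus>\<^bsub>M\<^esub> tval M (gen (m, un))) \<oplus>\<^bsub>M\<^esub> (tval M (gen (m, un)) \<ominus>\<^bsub>M\<^esub> m) \<in> IM"
    using tv_coset[OF g] submoduleD(3)[OF M IMD] by simp
  then have "tv ?Y \<ominus>\<^bsub>M\<^esub> m \<in> IM"
    using m tv_carrier[OF Y] mod_homD(1)[OF tval_hom g] by (simp add: a_minus_def M.M.a_assoc M.M.r_neg1 M.M.r_neg2)
  then show ?thesis using that Y by blast
qed

lemma tv_zero_iff:
  assumes "Y \<in> carrier (tensor R M C)"
  shows "Y = \<zero>\<^bsub>tensor R M C\<^esub> \<longleftrightarrow> tv Y \<in> IM"
proof -
  note s = tensor_some[OF assms]
  have "Y = \<zero>\<^bsub>tensor R M C\<^esub> \<longleftrightarrow> TR +>\<^bsub>FP\<^esub> (SOME f. f \<in> Y) = TR +>\<^bsub>FP\<^esub> \<zero>\<^bsub>FP\<^esub>"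
    using s(2) submodule_coset_self[OF free_mod_module tensor_rel_submodule TRD(1)]
    by (simp add: tensor_def quot_module_zero)
  also have "\<dots> \<longleftrightarrow> (SOME f. f \<in> Y) \<in> TR"
    using quot_coset_eq_iff[OF free_mod_module tensor_rel_submodule s(1) FP.M.zero_closed] s(1)
    by (simp add: minus_zero_FP)
  also have "\<dots> \<longleftrightarrow> tv Y \<in> IM" using s(1) by (simp add: tensor_rel_eq tv_def)
  finally show ?thesis .
qed

lemma tv_add:
  assumes "Y \<in> carrier (tensor R M C)" "Z \<in> carrier (tensor R M C)"
  shows "tv (Y \<oplus>\<^bsub>tensor R M C\<^esub> Z) \<ominus>\<^bsub>M\<^esub> (tv Y \<oplus>\<^bsub>M\<^esub> tv Z) \<in> IM"
proof -
  note s = tensor_some[OF assms(1)] and t = tensor_some[OF assms(2)]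
  have "Y \<oplus>\<^bsub>tensor R M C\<^esub> Z = TR +>\<^bsub>FP\<^esub> ((SOME f. f \<in> Y) \<oplus>\<^bsub>FP\<^esub> (SOME f. f \<in> Z))"
    using quot_module_add[OF free_mod_module tensor_rel_submodule s(1) t(1)] s(2) t(2)
    by (simp add: tensor_def)
  then show ?thesis
    using tv_coset[OF FP.M.a_closed[OF s(1) t(1)]] mod_homD(2)[OF tval_hom s(1) t(1)] by (simp add: tv_def)
qed

lemma tv_smult:
  assumes "Y \<in> carrier (tensor R M C)" "r \<in> carrier R"
  shows "tv (r \<odot>\<^bsub>tensor R M C\<^esub> Y) \<ominus>\<^bsub>M\<^esub> r \<odot>\<^bsub>M\<^esub> tv Y \<in> IM"
proof -
  note s = tensor_some[OF assms(1)]
  have "r \<odot>\<^bsub>tensor R M C\<^esub> Y = TR +>\<^bsub>FP\<^esub> (r \<odot>\<^bsub>FP\<^esub> (SOME f. f \<in> Y))"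
    using quot_module_smult[OF free_mod_module tensor_rel_submodule assms(2) s(1)] s(2)
    by (simp add: tensor_def)
  then show ?thesis
    using tv_coset[OF FP.smult_closed[OF assms(2) s(1)]] mod_homD(3)[OF tval_hom assms(2) s(1)] by (simp add: tv_def)
qed

end

end


lemma submodule_restrict:
  assumes M: "Module.module R M" and Z: "submodule Z R M" and H: "submodule H R M" and sub: "H \<subseteq> Z"
  shows "submodule H R (M\<lparr>carrier := Z\<rparr>)"
proof -
  interpret Z: Module.module R "M\<lparr>carrier := Z\<rparr>" using submodule.submodule_is_module[OF Z M] .
  have "Module.module R (M\<lparr>carrier := Z\<rparr>\<lparr>carrier := H\<rparr>)"
    using submodule.submodule_is_module[OF H M] by simp
  with Z.module_incl_imp_submodule show ?thesis using sub by simp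
qed

lemma submodule_image_of_submodule:
  assumes M: "Module.module R M" and N: "Module.module R N" and h: "h \<in> mod_hom R M N"
    and H: "submodule H R M"
  shows "submodule (h ` H) R N"
proof -
  have "submodule (h ` carrier (M\<lparr>carrier := H\<rparr>)) R N"
  proof (rule submodule_image[OF submodule.submodule_is_module[OF H M] N])
    show "h \<in> mod_hom R (M\<lparr>carrier := H\<rparr>) N"
      using mod_homD[OF h] submoduleD(2)[OF M H] by (intro mod_homI) simp_all
  qed
  then show ?thesis by simp
qed

lemma mod_hom_compose: "f \<in> mod_hom R M N \<Longrightarrow> g \<in> mod_hom R N Q \<Longrightarrow> (\<lambda>x. g (f x)) \<in> mod_hom R M Q"
  using mod_hom_comp[of f R M N g Q] by (simp add: comp_def)

context cyclic_module
begin

lemma quot_map_hom: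
  assumes M: "Module.module R M" and K: "submodule K R M"
  shows "(\<lambda>x. K +>\<^bsub>M\<^esub> x) \<in> mod_hom R M (quot_module M K)"
  by (rule mod_homI)
    (auto simp: quot_module_carrier quot_module_add[OF M K] quot_module_smult[OF M K])

text \<open>A linear map \<open>h\<close> acts on the values modulo \<open>I\<close> just as \<open>h \<otimes> id\<close> acts on tensors.\<close>

lemma tensor_map_value:
  assumes M: "Module.module R M" and M': "Module.module R M'" and h: "h \<in> mod_hom R M M'"
    and Y: "Y \<in> carrier (tensor R M C)"
  shows "tensor_map R M' C h Y \<in> carrier (tensor R M' C)"
    and "tv M' (tensor_map R M' C h Y) \<ominus>\<^bsub>M'\<^esub> h (tv M Y) \<in> ideal_smult R I M'"
proof -
  interpret M: Module.module R M by (rule M)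
  interpret M': Module.module R M' by (rule M')
  let ?X = "carrier M \<times> carrier C" and ?X' = "carrier M' \<times> carrier C"
  let ?F = "free_mod R ?X" and ?F' = "free_mod R ?X'" and ?T' = "tensor R M' C"
  let ?q = "\<lambda>f. tensor_rel R M' C +>\<^bsub>?F'\<^esub> f"
  let ?pt = "\<lambda>(x, y). pure_tensor R M' C (h x) y"
  let ?\<delta> = "lin_ext R ?F' (\<lambda>(x, y). free_gen R (h x, y))"
  define f where "f = (SOME f. f \<in> Y)"
  have f: "f \<in> carrier ?F" unfolding f_def by (rule tensor_some(1)[OF M Y])
  have T': "Module.module R ?T'" by (rule tensor_module[OF M'])
  have F': "Module.module R ?F'" by (rule free_mod_module)
  have q: "?q \<in> mod_hom R ?F' ?T'"
    unfolding tensor_def by (rule quot_map_hom[OF F' tensor_rel_submodule[OF M']])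
  have g: "(\<lambda>(x, y). free_gen R (h x, y)) \<in> ?X \<rightarrow> carrier ?F'"
    using mod_homD(1)[OF h] by (auto intro!: free_gen_carrier)
  have \<delta>: "?\<delta> \<in> mod_hom R ?F ?F'" by (rule lin_ext_hom[OF F' g])
  have ptc: "?pt \<in> ?X \<rightarrow> carrier ?T'"
    using mod_homD(1)[OF q] mod_homD(1)[OF h] by (auto simp: pure_tensor_def intro!: free_gen_carrier)
  have pt: "lin_ext R ?T' ?pt \<in> mod_hom R ?F ?T'"
    by (rule lin_ext_hom[OF T' ptc])
  have "tensor_map R M' C h Y = lin_ext R ?T' ?pt f"
    by (simp add: tensor_map_def f_def[symmetric] lin_ext_def Let_def case_prod_unfold)
  also have "\<dots> = ?q (?\<delta> f)"
  proof (rule free_mod_hom_eqI[OF is_cring T' pt _ _ f])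
    show "(\<lambda>f. ?q (?\<delta> f)) \<in> mod_hom R ?F ?T'" by (rule mod_hom_compose[OF \<delta> q])
    fix x assume x: "x \<in> ?X"
    show "lin_ext R ?T' ?pt (free_gen R x) = ?q (?\<delta> (free_gen R x))"
      unfolding lin_ext_gen[OF T' ptc x] lin_ext_gen[OF F' g x] by (cases x) (simp add: pure_tensor_def)
  qed
  finally have eq: "tensor_map R M' C h Y = ?q (?\<delta> f)" .
  then show "tensor_map R M' C h Y \<in> carrier (tensor R M' C)"
    using mod_homD(1)[OF \<delta> f] mod_homD(1)[OF q] by simp
  have "tval M' (?\<delta> f) = h (tval M f)"
  proof (rule free_mod_hom_eqI[OF is_cring M' _ _ _ f])
    show "(\<lambda>f. tval M' (?\<delta> f)) \<in> mod_hom R ?F M'" by (rule mod_hom_compose[OF \<delta> tval_hom[OF M']])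
    show "(\<lambda>f. h (tval M f)) \<in> mod_hom R ?F M'" by (rule mod_hom_compose[OF tval_hom[OF M] h])
    fix x assume x: "x \<in> ?X"
    then obtain m n where mn: "x = (m, n)" "m \<in> carrier M" "n \<in> carrier C" by auto
    show "tval M' (?\<delta> (free_gen R x)) = h (tval M (free_gen R x))"
      using mn x mod_homD(1)[OF h] rep[OF mn(3)] mod_homD(3)[OF h]
      by (simp add: lin_ext_gen[OF F' g] tval_gen[OF M] tval_gen[OF M'])
  qed
  then have "h (tv M Y) = tval M' (?\<delta> f)" by (simp add: tv_def[OF M] f_def)
  then show "tv M' (tensor_map R M' C h Y) \<ominus>\<^bsub>M'\<^esub> h (tv M Y) \<in> ideal_smult R I M'"
    using tv_coset[OF M' mod_homD(1)[OF \<delta> f]] eq by simp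
qed

lemma minus_trans:
  assumes M: "Module.module R M" and H: "submodule H R M"
    and c: "a \<in> carrier M" "b \<in> carrier M" "c \<in> carrier M" and ab: "a \<ominus>\<^bsub>M\<^esub> b \<in> H" and bc: "b \<ominus>\<^bsub>M\<^esub> c \<in> H"
  shows "a \<ominus>\<^bsub>M\<^esub> c \<in> H"
proof -
  interpret M: Module.module R M by fact
  have "a \<ominus>\<^bsub>M\<^esub> c = (a \<ominus>\<^bsub>M\<^esub> b) \<oplus>\<^bsub>M\<^esub> (b \<ominus>\<^bsub>M\<^esub> c)"
    using c by (simp add: a_minus_def M.M.a_assoc M.M.r_neg1 M.M.r_neg2)
  then show ?thesis using submoduleD(3)[OF M H ab bc] by simp
qed

lemma minus_sym:
  assumes M: "Module.module R M" and H: "submodule H R M"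
    and c: "a \<in> carrier M" "b \<in> carrier M" and ab: "a \<ominus>\<^bsub>M\<^esub> b \<in> H"
  shows "b \<ominus>\<^bsub>M\<^esub> a \<in> H"
proof -
  interpret M: Module.module R M by fact
  show ?thesis using submoduleD(6)[OF M H ab] c by (simp add: a_minus_def M.M.minus_add M.M.a_comm)
qed

lemma minus_mem:
  assumes M: "Module.module R M" and H: "submodule H R M"
    and c: "a \<in> carrier M" "b \<in> carrier M" and ab: "a \<ominus>\<^bsub>M\<^esub> b \<in> H"
  shows "a \<in> H \<longleftrightarrow> b \<in> H"
proof -
  interpret M: Module.module R M by fact
  have 1: "a = (a \<ominus>\<^bsub>M\<^esub> b) \<oplus>\<^bsub>M\<^esub> b" using c by (simp add: a_minus_def M.M.a_assoc M.M.l_neg)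
  have 2: "b = (b \<ominus>\<^bsub>M\<^esub> a) \<oplus>\<^bsub>M\<^esub> a" using c by (simp add: a_minus_def M.M.a_assoc M.M.l_neg)
  show ?thesis
    using submoduleD(3)[OF M H ab] submoduleD(3)[OF M H minus_sym[OF assms]] 1 2 by metis
qed

lemma tv_preimage_submodule:
  assumes M: "Module.module R M" and H: "submodule H R M" and IH: "ideal_smult R I M \<subseteq> H"
  shows "submodule {Y \<in> carrier (tensor R M C). tv M Y \<in> H} R (tensor R M C)"
proof -
  interpret M: Module.module R M by (rule M)
  let ?T = "tensor R M C"
  interpret T: Module.module R ?T by (rule tensor_module[OF M])
  note HD = submoduleD[OF M H] and tc = tv_carrier[OF M]
  have smult: "tv M (r \<odot>\<^bsub>?T\<^esub> Y) \<in> H" if "r \<in> carrier R" "Y \<in> carrier ?T" "tv M Y \<in> H" for r Y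
    using minus_mem[OF M H, of "tv M (r \<odot>\<^bsub>?T\<^esub> Y)" "r \<odot>\<^bsub>M\<^esub> tv M Y"] tv_smult[OF M that(2,1)] that IH HD tc by auto
  show ?thesis
  proof (rule T.submoduleI)
    have "\<zero>\<^bsub>?T\<^esub> \<in> carrier ?T" by simp
    from tv_zero_iff[OF M this] IH show "\<zero>\<^bsub>?T\<^esub> \<in> {Y \<in> carrier ?T. tv M Y \<in> H}" by auto
    fix a assume a: "a \<in> {Y \<in> carrier ?T. tv M Y \<in> H}"
    show "\<ominus>\<^bsub>?T\<^esub> a \<in> {Y \<in> carrier ?T. tv M Y \<in> H}"
      using smult[of "\<ominus> \<one>" a] a by (simp add: T.smult_l_minus)
    fix b assume b: "b \<in> {Y \<in> carrier ?T. tv M Y \<in> H}"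
    show "a \<oplus>\<^bsub>?T\<^esub> b \<in> {Y \<in> carrier ?T. tv M Y \<in> H}"
      using minus_mem[OF M H, of "tv M (a \<oplus>\<^bsub>?T\<^esub> b)" "tv M a \<oplus>\<^bsub>M\<^esub> tv M b"] tv_add[OF M, of a b] a b IH HD tc by auto
  qed (use smult in auto)
qed

lemma tv_eqI:
  assumes M: "Module.module R M" and Y: "Y \<in> carrier (tensor R M C)" and Z: "Z \<in> carrier (tensor R M C)"
    and d: "tv M Y \<ominus>\<^bsub>M\<^esub> tv M Z \<in> ideal_smult R I M"
  shows "Y = Z"
proof -
  interpret M: Module.module R M by (rule M)
  let ?T = "tensor R M C" and ?IM = "ideal_smult R I M"
  interpret T: Module.module R ?T by (rule tensor_module[OF M])
  note IMD = ideal_smult_submodule[OF M] and tc = tv_carrier[OF M]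
  have nZ: "\<ominus>\<^bsub>?T\<^esub> Z \<in> carrier ?T" using Z by simp
  have *: "(\<ominus> \<one>) \<odot>\<^bsub>?T\<^esub> Z = \<ominus>\<^bsub>?T\<^esub> Z" "(\<ominus> \<one>) \<odot>\<^bsub>M\<^esub> tv M Z = \<ominus>\<^bsub>M\<^esub> tv M Z"
    using Z tc by (simp_all add: T.smult_l_minus M.smult_l_minus)
  have n: "tv M (\<ominus>\<^bsub>?T\<^esub> Z) \<ominus>\<^bsub>M\<^esub> (\<ominus>\<^bsub>M\<^esub> tv M Z) \<in> ?IM"
    using tv_smult[OF M Z, of "\<ominus> \<one>"] * by simp
  have "(tv M Y \<oplus>\<^bsub>M\<^esub> tv M (\<ominus>\<^bsub>?T\<^esub> Z)) \<ominus>\<^bsub>M\<^esub> (tv M Y \<ominus>\<^bsub>M\<^esub> tv M Z) = tv M (\<ominus>\<^bsub>?T\<^esub> Z) \<ominus>\<^bsub>M\<^esub> (\<ominus>\<^bsub>M\<^esub> tv M Z)"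
    using tc[OF Y] tc[OF Z] tc[OF nZ]
    by (simp add: a_minus_def M.M.minus_add M.M.a_comm[of "tv M Y" "tv M (\<ominus>\<^bsub>?T\<^esub> Z)"] M.M.a_assoc M.M.r_neg1 M.M.r_neg2)
  then have "(tv M Y \<oplus>\<^bsub>M\<^esub> tv M (\<ominus>\<^bsub>?T\<^esub> Z)) \<in> ?IM"
    using minus_mem[OF M IMD, of "tv M Y \<oplus>\<^bsub>M\<^esub> tv M (\<ominus>\<^bsub>?T\<^esub> Z)" "tv M Y \<ominus>\<^bsub>M\<^esub> tv M Z"] n d
      tc[OF Y] tc[OF Z] tc[OF nZ] by simp
  then have "tv M (Y \<oplus>\<^bsub>?T\<^esub> \<ominus>\<^bsub>?T\<^esub> Z) \<in> ?IM"
    using minus_mem[OF M IMD, of "tv M (Y \<oplus>\<^bsub>?T\<^esub> \<ominus>\<^bsub>?T\<^esub> Z)" "tv M Y \<oplus>\<^bsub>M\<^esub> tv M (\<ominus>\<^bsub>?T\<^esub> Z)"] tv_add[OF M Y nZ]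
      tc[OF Y] tc[OF nZ] tc[of "Y \<oplus>\<^bsub>?T\<^esub> \<ominus>\<^bsub>?T\<^esub> Z"] Y nZ by simp
  then have "Y \<oplus>\<^bsub>?T\<^esub> \<ominus>\<^bsub>?T\<^esub> Z = \<zero>\<^bsub>?T\<^esub>" using tv_zero_iff[OF M] Y nZ by simp
  then show "Y = Z" using Y Z by (metis T.M.minus_equality T.M.minus_minus T.M.a_inv_closed)
qed

end


section \<open>The first Tor module of two cyclic modules\<close>

text \<open>After tensoring the standard resolution of \<open>R/U\<close> with \<open>R/I\<close>, the cycles in degree one are the
  \<open>m \<in> F1\<close> with \<open>\<delta>1 m \<in> I F0\<close>, and the boundaries are the elements of \<open>K1 + I F1\<close>, both modulo
  \<open>I F1\<close>.  The map \<open>\<epsilon>\<close> chooses representatives in \<open>R\<close> for the augmentation to \<open>R/U\<close>, so that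
  \<open>\<theta> = \<epsilon> \<delta>1\<close> takes values in \<open>U\<close>; it sends cycles to \<open>U \<inter> I\<close> and boundaries to \<open>U I\<close>.\<close>

locale cyclic_tor = cyclic_module R I for R (structure) and I + fixes U
  assumes U: "ideal U R"
begin

interpretation U: cyclic_module R U
  by (intro cyclic_module.intro cyclic_module_axioms.intro U is_cring)

abbreviation "A \<equiv> U.C"
definition "F0 = tor_F0 R A"
definition "F1 = tor_F1 R A"
definition "F2 = tor_F2 R A"
definition "\<epsilon> = lin_ext R (ring_mod R) U.rep"
definition "\<delta>1 = free_eval R F0"
definition "\<delta>2 = free_eval R F1"
definition "K0 = a_kernel F0 A (free_eval R A)"
definition "K1 = a_kernel F1 F0 \<delta>1"
definition "\<theta> m = \<epsilon> (\<delta>1 m)"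

lemma modules: "Module.module R F0" "Module.module R F1" "Module.module R F2" "Module.module R (ring_mod R)"
  by (simp_all add: F0_def F1_def F2_def tor_F0_def tor_F1_def tor_F2_def free_mod_module ring_mod_module is_cring)

interpretation F0: Module.module R F0 by (rule modules)
interpretation F1: Module.module R F1 by (rule modules)
interpretation F2: Module.module R F2 by (rule modules)
interpretation RM: Module.module R "ring_mod R" by (rule modules)
interpretation A: Module.module R A by (rule U.C_module)

lemma F0_eq: "F0 = free_mod R (carrier A)"
  by (simp add: F0_def tor_F0_def)

lemma F1_eq: "F1 = free_mod R K0"
  by (simp add: F1_def tor_F1_def K0_def F0_def)

lemma F2_eq: "F2 = free_mod R K1"
  by (simp add: F2_def tor_F2_def K1_def F1_def F0_def \<delta>1_def)

lemma rep_fun: "U.rep \<in> carrier A \<rightarrow> carrier (ring_mod R)"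
  by (auto intro: U.rep)

lemma \<epsilon>_hom: "\<epsilon> \<in> mod_hom R F0 (ring_mod R)"
  unfolding \<epsilon>_def F0_eq by (rule lin_ext_hom[OF modules(4) rep_fun])

lemma \<epsilon>_lin: "f \<in> carrier F0 \<Longrightarrow> \<epsilon> f \<in> carrier R"
  "f \<in> carrier F0 \<Longrightarrow> g \<in> carrier F0 \<Longrightarrow> \<epsilon> (f \<oplus>\<^bsub>F0\<^esub> g) = \<epsilon> f \<oplus> \<epsilon> g"
  "r \<in> carrier R \<Longrightarrow> f \<in> carrier F0 \<Longrightarrow> \<epsilon> (r \<odot>\<^bsub>F0\<^esub> f) = r \<otimes> \<epsilon> f"
  using mod_homD[OF \<epsilon>_hom] by simp_all

lemma ring_mod_minus: "a \<in> carrier R \<Longrightarrow> \<ominus>\<^bsub>ring_mod R\<^esub> a = \<ominus> a"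
  using RM.M.minus_equality[of "\<ominus> a" a] by (simp add: l_neg)

lemma \<epsilon>_minus: "f \<in> carrier F0 \<Longrightarrow> g \<in> carrier F0 \<Longrightarrow> \<epsilon> (f \<ominus>\<^bsub>F0\<^esub> g) = \<epsilon> f \<ominus> \<epsilon> g"
  using mod_hom_minus_zero(3)[OF modules(1,4) \<epsilon>_hom, of f g] \<epsilon>_lin(1) ring_mod_minus by (simp add: a_minus_def)

text \<open>The map \<open>\<epsilon>\<close> lifts the augmentation from \<open>R/U\<close> to \<open>R\<close>, so membership in its kernel becomes
  membership of the value of \<open>\<epsilon>\<close> in \<open>U\<close>.\<close>

lemma augmentation: "f \<in> carrier F0 \<Longrightarrow> free_eval R A f = U +> \<epsilon> f"
proof -
  assume f: "f \<in> carrier F0"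
  have q: "(\<lambda>a. U +> a) \<in> mod_hom R (ring_mod R) A"
    by (rule mod_homI) (auto simp: U.C_carrier U.C_add U.C_smult)
  have id: "(\<lambda>x. x) \<in> carrier A \<rightarrow> carrier A" by auto
  show ?thesis unfolding free_eval_eq_lin_ext
  proof (rule free_mod_hom_eqI[OF is_cring U.C_module, of "lin_ext R A (\<lambda>x. x)" "carrier A" "\<lambda>f. U +> \<epsilon> f"])
    show "lin_ext R A (\<lambda>x. x) \<in> mod_hom R (free_mod R (carrier A)) A"
      by (rule lin_ext_hom[OF U.C_module id])
    show "(\<lambda>f. U +> \<epsilon> f) \<in> mod_hom R (free_mod R (carrier A)) A"
      using mod_hom_compose[OF \<epsilon>_hom q] by (simp add: F0_eq)
    show "lin_ext R A (\<lambda>x. x) (free_gen R x) = U +> \<epsilon> (free_gen R x)" if "x \<in> carrier A" for x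
      using that by (simp add: lin_ext_gen[OF U.C_module id] \<epsilon>_def lin_ext_gen[OF modules(4) rep_fun] U.rep)
    show "f \<in> carrier (free_mod R (carrier A))" using f by (simp add: F0_eq)
  qed
qed

lemma K0_iff: "f \<in> K0 \<longleftrightarrow> f \<in> carrier F0 \<and> \<epsilon> f \<in> U"
proof -
  have "U +> \<epsilon> f = U \<longleftrightarrow> \<epsilon> f \<in> U" if "f \<in> carrier F0"
    using ideal.rcos_const_imp_mem[OF U \<epsilon>_lin(1)[OF that]] a_rcos_zero[OF U, of "\<epsilon> f"] by argo
  then show ?thesis
    unfolding K0_def a_kernel_def' mem_Collect_eq U.C_zero using augmentation[of f] by argo
qed

lemma K0_carrier: "K0 \<subseteq> carrier F0" by (auto simp: K0_iff)

lemma K0_submodule: "submodule K0 R F0"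
proof -
  have "K0 = {f \<in> carrier F0. \<epsilon> f \<in> U}" by (auto simp: K0_iff)
  then show ?thesis
    using preimage_submodule[OF modules(1,4) \<epsilon>_hom ideal_submodule[OF is_cring U]] by simp
qed

lemma \<delta>1_hom: "\<delta>1 \<in> mod_hom R F1 F0"
  unfolding \<delta>1_def F1_eq free_eval_eq_lin_ext
  by (rule lin_ext_hom[OF modules(1)]) (use K0_carrier in auto)

lemma \<delta>1_gen: "k \<in> K0 \<Longrightarrow> \<delta>1 (free_gen R k) = k" "k \<in> K0 \<Longrightarrow> free_gen R k \<in> carrier F1"
  unfolding \<delta>1_def free_eval_eq_lin_ext F1_eq
  by (rule lin_ext_gen[OF modules(1)], use K0_carrier in \<open>auto intro: free_gen_carrier\<close>)

lemma \<delta>1_K0: "m \<in> carrier F1 \<Longrightarrow> \<delta>1 m \<in> K0"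
  using free_mod_generated[OF is_cring preimage_submodule[OF modules(2,1) \<delta>1_hom K0_submodule, unfolded F1_eq]]
  by (auto simp: \<delta>1_gen F1_eq free_gen_carrier)

lemma K1_iff: "m \<in> K1 \<longleftrightarrow> m \<in> carrier F1 \<and> \<delta>1 m = \<zero>\<^bsub>F0\<^esub>"
  by (auto simp: K1_def a_kernel_def')

lemma K1_submodule: "submodule K1 R F1"
proof -
  have "K1 = {m \<in> carrier F1. \<delta>1 m \<in> {\<zero>\<^bsub>F0\<^esub>}}" by (auto simp: K1_iff)
  then show ?thesis using preimage_submodule[OF modules(2,1) \<delta>1_hom zero_submodule[OF modules(1)]] by simp
qed

lemma \<delta>2_hom: "\<delta>2 \<in> mod_hom R F2 F1"
  unfolding \<delta>2_def F2_eq free_eval_eq_lin_ext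
  by (rule lin_ext_hom[OF modules(2)]) (auto simp: K1_iff)

lemma \<delta>2_gen: "k \<in> K1 \<Longrightarrow> \<delta>2 (free_gen R k) = k" "k \<in> K1 \<Longrightarrow> free_gen R k \<in> carrier F2"
  unfolding \<delta>2_def free_eval_eq_lin_ext F2_eq
  by (rule lin_ext_gen[OF modules(2)], auto simp: K1_iff intro: free_gen_carrier)

lemma \<delta>2_K1: "m \<in> carrier F2 \<Longrightarrow> \<delta>2 m \<in> K1"
  using free_mod_generated[OF is_cring preimage_submodule[OF modules(3,2) \<delta>2_hom K1_submodule, unfolded F2_eq]]
  by (auto simp: \<delta>2_gen F2_eq free_gen_carrier)

abbreviation "IF0 \<equiv> ideal_smult R I F0"
abbreviation "IF1 \<equiv> ideal_smult R I F1"
abbreviation "IU \<equiv> ideal_prod R U I"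

lemma IU_ideal: "ideal IU R" by (rule ideal_prod_is_ideal[OF U I])

lemma \<theta>_hom: "\<theta> \<in> mod_hom R F1 (ring_mod R)"
  unfolding \<theta>_def[abs_def] by (rule mod_hom_compose[OF \<delta>1_hom \<epsilon>_hom])

lemma \<theta>_lin: "m \<in> carrier F1 \<Longrightarrow> \<theta> m \<in> U"
  "m \<in> carrier F1 \<Longrightarrow> m' \<in> carrier F1 \<Longrightarrow> \<theta> (m \<oplus>\<^bsub>F1\<^esub> m') = \<theta> m \<oplus> \<theta> m'"
  "r \<in> carrier R \<Longrightarrow> m \<in> carrier F1 \<Longrightarrow> \<theta> (r \<odot>\<^bsub>F1\<^esub> m) = r \<otimes> \<theta> m"
  using mod_homD[OF \<theta>_hom] \<delta>1_K0 by (auto simp: \<theta>_def K0_iff)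

lemma \<theta>_minus: "m \<in> carrier F1 \<Longrightarrow> m' \<in> carrier F1 \<Longrightarrow> \<theta> (m \<ominus>\<^bsub>F1\<^esub> m') = \<theta> m \<ominus> \<theta> m'"
  using mod_hom_minus_zero(3)[OF modules(2,4) \<theta>_hom, of m m'] \<theta>_lin(1)[of m'] ring_mod_minus U.Icarr
  by (simp add: a_minus_def)

lemma \<theta>_IF1: "m \<in> IF1 \<Longrightarrow> \<theta> m \<in> IU"
proof -
  have "IF1 \<subseteq> {m \<in> carrier F1. \<theta> m \<in> IU}"
  proof (rule ideal_smult_least)
    show "submodule {m \<in> carrier F1. \<theta> m \<in> IU} R F1"
      by (rule preimage_submodule[OF modules(2,4) \<theta>_hom ideal_submodule[OF is_cring IU_ideal]])
    fix i m assume im: "i \<in> I" "m \<in> carrier F1"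
    then have "\<theta> (i \<odot>\<^bsub>F1\<^esub> m) = \<theta> m \<otimes> i" using \<theta>_lin(1)[of m] Icarr U.Icarr by (simp add: \<theta>_lin(3) m_comm)
    moreover have "\<theta> m \<otimes> i \<in> IU" using \<theta>_lin(1) im by (intro ideal_prod.prod)
    ultimately show "i \<odot>\<^bsub>F1\<^esub> m \<in> {m \<in> carrier F1. \<theta> m \<in> IU}" using im Icarr by auto
  qed
  then show "m \<in> IF1 \<Longrightarrow> \<theta> m \<in> IU" by auto
qed

lemma IF0_\<epsilon>: "f \<in> IF0 \<Longrightarrow> \<epsilon> f \<in> I"
proof -
  have "IF0 \<subseteq> {f \<in> carrier F0. \<epsilon> f \<in> I}"
  proof (rule ideal_smult_least)
    show "submodule {f \<in> carrier F0. \<epsilon> f \<in> I} R F0"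
      by (rule preimage_submodule[OF modules(1,4) \<epsilon>_hom ideal_submodule[OF is_cring I]])
    fix i f assume "i \<in> I" "f \<in> carrier F0"
    then show "i \<odot>\<^bsub>F0\<^esub> f \<in> {f \<in> carrier F0. \<epsilon> f \<in> I}"
      using \<epsilon>_lin Icarr ideal.I_r_closed[OF I, of i "\<epsilon> f"] by auto
  qed
  then show "f \<in> IF0 \<Longrightarrow> \<epsilon> f \<in> I" by auto
qed

text \<open>The basis element of \<open>F0\<close> at \<open>1\<close> splits \<open>\<epsilon>\<close> up to \<open>U\<close>.\<close>

definition "g1 = free_gen R (U +> \<one>)"

lemma g1: "g1 \<in> carrier F0" "\<epsilon> g1 \<in> carrier R" "\<epsilon> g1 \<ominus> \<one> \<in> U"
proof -
  have un: "U +> \<one> \<in> carrier A" by (rule U.C_coset) simp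
  show c: "g1 \<in> carrier F0" unfolding F0_eq g1_def by (rule free_gen_carrier[OF un])
  then show "\<epsilon> g1 \<in> carrier R" by (rule \<epsilon>_lin)
  have "\<epsilon> g1 = U.rep (U +> \<one>)"
    unfolding \<epsilon>_def g1_def by (rule lin_ext_gen[OF modules(4) rep_fun un])
  then show "\<epsilon> g1 \<ominus> \<one> \<in> U" using U.rep_diff[OF un] by simp
qed

lemma mult_g1_K0: "u \<in> U \<Longrightarrow> u \<odot>\<^bsub>F0\<^esub> g1 \<in> K0"
  using g1 U.Icarr ideal.I_r_closed[OF U, of u "\<epsilon> g1"] by (auto simp: K0_iff \<epsilon>_lin)

lemma image_IF1_submodule: "submodule (\<delta>1 ` IF1) R F0"
  by (rule submodule_image_of_submodule[OF modules(2,1) \<delta>1_hom ideal_smult_submodule[OF modules(2)]])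

text \<open>The element \<open>i k\<close> is the image of \<open>i\<close> times the basis element at \<open>k\<close>.\<close>

lemma mult_K0_image: "i \<in> I \<Longrightarrow> k \<in> K0 \<Longrightarrow> i \<odot>\<^bsub>F0\<^esub> k \<in> \<delta>1 ` IF1"
  using mod_homD(3)[OF \<delta>1_hom, of i "free_gen R k"] \<delta>1_gen[of k] Icarr ideal_smult_memI[of i I "free_gen R k" F1 R]
  by (auto intro!: image_eqI[of _ _ "i \<odot>\<^bsub>F1\<^esub> free_gen R k"])

text \<open>The map \<open>f \<mapsto> f - \<epsilon> f \<cdot> g1\<close> takes \<open>F0\<close> to \<open>K0\<close>, hence \<open>I F0\<close> to \<open>I K0\<close>, which consists of
  images of elements of \<open>I F1\<close>.\<close>

lemma IF0_decompose:
  assumes f: "f \<in> IF0"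
  shows "f \<ominus>\<^bsub>F0\<^esub> \<epsilon> f \<odot>\<^bsub>F0\<^esub> g1 \<in> \<delta>1 ` IF1"
proof -
  let ?\<xi> = "\<lambda>f. f \<ominus>\<^bsub>F0\<^esub> \<epsilon> f \<odot>\<^bsub>F0\<^esub> g1"
  have hom: "?\<xi> \<in> mod_hom R F0 F0"
  proof (rule mod_homI)
    fix f g assume "f \<in> carrier F0" "g \<in> carrier F0"
    then show "?\<xi> (f \<oplus>\<^bsub>F0\<^esub> g) = ?\<xi> f \<oplus>\<^bsub>F0\<^esub> ?\<xi> g"
      using g1 \<epsilon>_lin by (simp add: a_minus_def F0.smult_l_distr F0.M.minus_add F0.M.a_ac)
  next
    fix r f assume "r \<in> carrier R" "f \<in> carrier F0"
    then show "?\<xi> (r \<odot>\<^bsub>F0\<^esub> f) = r \<odot>\<^bsub>F0\<^esub> ?\<xi> f"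
      using g1 \<epsilon>_lin by (simp add: a_minus_def F0.smult_r_distr F0.smult_r_minus F0.smult_assoc1)
  qed (use g1 \<epsilon>_lin in auto)
  have \<xi>_K0: "?\<xi> f \<in> K0" if f: "f \<in> carrier F0" for f
  proof -
    have "\<epsilon> (?\<xi> f) = \<epsilon> f \<ominus> \<epsilon> f \<otimes> \<epsilon> g1"
      using f g1 \<epsilon>_lin by (simp add: \<epsilon>_minus)
    also have "\<dots> = \<ominus> (\<epsilon> f \<otimes> (\<epsilon> g1 \<ominus> \<one>))"
      using f g1 \<epsilon>_lin(1) by (simp add: a_minus_def r_distr minus_add r_minus a_comm)
    also have "\<dots> \<in> U"
      using g1 ideal.I_l_closed[OF U, of _ "\<epsilon> f"] \<epsilon>_lin(1)[OF f] U
      by (intro additive_subgroup.a_inv_closed ideal.axioms(1)) auto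
    finally show ?thesis using mod_homD(1)[OF hom f] by (simp add: K0_iff)
  qed
  have "IF0 \<subseteq> {f \<in> carrier F0. ?\<xi> f \<in> \<delta>1 ` IF1}"
  proof (rule ideal_smult_least)
    show "submodule {f \<in> carrier F0. ?\<xi> f \<in> \<delta>1 ` IF1} R F0"
      by (rule preimage_submodule[OF modules(1,1) hom image_IF1_submodule])
    fix i m assume "i \<in> I" "m \<in> carrier F0"
    then show "i \<odot>\<^bsub>F0\<^esub> m \<in> {f \<in> carrier F0. ?\<xi> f \<in> \<delta>1 ` IF1}"
      using mod_homD(3)[OF hom, of i m] mult_K0_image[OF _ \<xi>_K0] Icarr by auto
  qed
  then show ?thesis using f by auto
qed

text \<open>For \<open>u \<in> U\<close> the element \<open>u g1\<close> lies in \<open>K0\<close>, so \<open>i u g1\<close> lies in \<open>I K0\<close>.\<close>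

lemma IU_decompose:
  assumes "a \<in> IU" shows "a \<odot>\<^bsub>F0\<^esub> g1 \<in> \<delta>1 ` IF1"
  using assms
proof (induction rule: ideal_prod.induct)
  case (prod u i)
  then have "(u \<otimes> i) \<odot>\<^bsub>F0\<^esub> g1 = i \<odot>\<^bsub>F0\<^esub> (u \<odot>\<^bsub>F0\<^esub> g1)"
    using g1 U.Icarr Icarr by (simp add: m_comm flip: F0.smult_assoc1)
  then show ?case using mult_K0_image[OF prod(2) mult_g1_K0[OF prod(1)]] by simp
next
  case (sum s t)
  then have "s \<in> carrier R" "t \<in> carrier R" using ideal.Icarr[OF IU_ideal] by auto
  then show ?case
    using sum submoduleD(3)[OF modules(1) image_IF1_submodule] g1 by (simp add: F0.smult_l_distr)
qed

abbreviation "T0 \<equiv> tensor R F0 C"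
abbreviation "T1 \<equiv> tensor R F1 C"
abbreviation "T2 \<equiv> tensor R F2 C"

definition "cycles = a_kernel T1 T0 (tensor_map R F0 C \<delta>1)"
definition "boundaries = tensor_map R F1 C \<delta>2 ` carrier T2"

lemma Tor1_eq: "Tor1 R A C = quot_module (T1\<lparr>carrier := cycles\<rparr>) boundaries"
  by (simp add: Tor1_def Let_def cycles_def boundaries_def \<delta>1_def \<delta>2_def F0_def F1_def F2_def)

lemma IF1_carrier: "m \<in> IF1 \<Longrightarrow> m \<in> carrier F1"
  using submoduleD(2)[OF modules(2) ideal_smult_submodule[OF modules(2)]] .

lemma cycles_eq: "cycles = {Y \<in> carrier T1. tv F1 Y \<in> {m \<in> carrier F1. \<delta>1 m \<in> IF0}}"
proof -
  have "tensor_map R F0 C \<delta>1 Y = \<zero>\<^bsub>T0\<^esub> \<longleftrightarrow> \<delta>1 (tv F1 Y) \<in> IF0" if Y: "Y \<in> carrier T1" for Y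
  proof -
    note v = tensor_map_value[OF modules(2,1) \<delta>1_hom Y]
    show ?thesis
      using tv_zero_iff[OF modules(1) v(1)]
        minus_mem[OF modules(1) ideal_smult_submodule[OF modules(1)] tv_carrier[OF modules(1) v(1)] _ v(2)]
        mod_homD(1)[OF \<delta>1_hom tv_carrier[OF modules(2) Y]] by simp
  qed
  then show ?thesis using tv_carrier[OF modules(2)] by (auto simp: cycles_def a_kernel_def')
qed

lemma cycles_submodule: "submodule cycles R T1"
  unfolding cycles_eq
proof (rule tv_preimage_submodule[OF modules(2)])
  show "submodule {m \<in> carrier F1. \<delta>1 m \<in> IF0} R F1"
    by (rule preimage_submodule[OF modules(2,1) \<delta>1_hom ideal_smult_submodule[OF modules(1)]])
  show "IF1 \<subseteq> {m \<in> carrier F1. \<delta>1 m \<in> IF0}"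
    using ideal_smult_image[OF modules(2,1) \<delta>1_hom] IF1_carrier by auto
qed

definition "H1 = {m \<in> carrier F1. \<exists>k\<in>K1. m \<ominus>\<^bsub>F1\<^esub> k \<in> IF1}"

lemma F1_minus_add: "a \<in> carrier F1 \<Longrightarrow> b \<in> carrier F1 \<Longrightarrow> c \<in> carrier F1 \<Longrightarrow> d \<in> carrier F1 \<Longrightarrow>
    (a \<oplus>\<^bsub>F1\<^esub> b) \<ominus>\<^bsub>F1\<^esub> (c \<oplus>\<^bsub>F1\<^esub> d) = (a \<ominus>\<^bsub>F1\<^esub> c) \<oplus>\<^bsub>F1\<^esub> (b \<ominus>\<^bsub>F1\<^esub> d)"
  by (simp add: a_minus_def F1.M.minus_add F1.M.a_ac)

lemma F1_smult_minus: "r \<in> carrier R \<Longrightarrow> a \<in> carrier F1 \<Longrightarrow> c \<in> carrier F1 \<Longrightarrow>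
    r \<odot>\<^bsub>F1\<^esub> a \<ominus>\<^bsub>F1\<^esub> r \<odot>\<^bsub>F1\<^esub> c = r \<odot>\<^bsub>F1\<^esub> (a \<ominus>\<^bsub>F1\<^esub> c)"
  by (simp add: a_minus_def F1.smult_r_distr F1.smult_r_minus)

lemma H1_submodule: "submodule H1 R F1" and IF1_H1: "IF1 \<subseteq> H1"
proof -
  note KD = submoduleD[OF modules(2) K1_submodule] and ID = submoduleD[OF modules(2) ideal_smult_submodule[OF modules(2)]]
  show sub: "IF1 \<subseteq> H1"
  proof
    fix m assume "m \<in> IF1"
    then show "m \<in> H1" using KD(1) ID(1) ID(4)[of m "\<zero>\<^bsub>F1\<^esub>"] IF1_carrier by (auto simp: H1_def)
  qed
  have smult: "r \<odot>\<^bsub>F1\<^esub> m \<in> H1" if r: "r \<in> carrier R" and m: "m \<in> H1" for r m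
  proof -
    obtain k where k: "k \<in> K1" "m \<ominus>\<^bsub>F1\<^esub> k \<in> IF1" "m \<in> carrier F1" using m by (auto simp: H1_def)
    then have "r \<odot>\<^bsub>F1\<^esub> m \<ominus>\<^bsub>F1\<^esub> r \<odot>\<^bsub>F1\<^esub> k \<in> IF1"
      using F1_smult_minus r KD(2) ID(5) by simp
    then show ?thesis using k r KD(5) by (auto simp: H1_def)
  qed
  show "submodule H1 R F1"
  proof (rule F1.submoduleI)
    show "\<zero>\<^bsub>F1\<^esub> \<in> H1" using sub ID(1) by auto
    fix a assume a: "a \<in> H1"
    show "\<ominus>\<^bsub>F1\<^esub> a \<in> H1" using smult[OF _ a, of "\<ominus> \<one>"] a by (auto simp: F1.smult_l_minus H1_def)
    fix b assume b: "b \<in> H1"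
    obtain k l where kl: "k \<in> K1" "a \<ominus>\<^bsub>F1\<^esub> k \<in> IF1" "a \<in> carrier F1" "l \<in> K1" "b \<ominus>\<^bsub>F1\<^esub> l \<in> IF1" "b \<in> carrier F1"
      using a b by (auto simp: H1_def)
    then have "(a \<oplus>\<^bsub>F1\<^esub> b) \<ominus>\<^bsub>F1\<^esub> (k \<oplus>\<^bsub>F1\<^esub> l) \<in> IF1"
      using F1_minus_add[of a b k l] ID(3) KD(2) by auto
    then show "a \<oplus>\<^bsub>F1\<^esub> b \<in> H1" using kl KD(3) by (auto simp: H1_def)
  qed (use smult in \<open>auto simp: H1_def\<close>)
qed

lemma boundaries_eq: "boundaries = {Y \<in> carrier T1. tv F1 Y \<in> H1}"
proof (intro subset_antisym subsetI)
  fix Y assume "Y \<in> boundaries"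
  then obtain Z where Z: "Z \<in> carrier T2" "Y = tensor_map R F1 C \<delta>2 Z" by (auto simp: boundaries_def)
  note v = tensor_map_value[OF modules(3,2) \<delta>2_hom Z(1)]
  show "Y \<in> {Y \<in> carrier T1. tv F1 Y \<in> H1}"
    using v Z \<delta>2_K1[OF tv_carrier[OF modules(3) Z(1)]] tv_carrier[OF modules(2) v(1)] by (auto simp: H1_def)
next
  fix Y assume "Y \<in> {Y \<in> carrier T1. tv F1 Y \<in> H1}"
  then obtain k where Y: "Y \<in> carrier T1" and k: "k \<in> K1" "tv F1 Y \<ominus>\<^bsub>F1\<^esub> k \<in> IF1" by (auto simp: H1_def)
  note IS = ideal_smult_submodule[OF modules(2)] and g = \<delta>2_gen[OF k(1)]
  obtain Z where Z: "Z \<in> carrier T2" "tv F2 Z \<ominus>\<^bsub>F2\<^esub> free_gen R k \<in> ideal_smult R I F2"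
    by (rule tv_surj[OF modules(3) g(2)])
  note v = tensor_map_value[OF modules(3,2) \<delta>2_hom Z(1)]
  note zc = tv_carrier[OF modules(3) Z(1)] and vc = tv_carrier[OF modules(2) v(1)] and yc = tv_carrier[OF modules(2) Y]
  have kc: "k \<in> carrier F1" using k by (simp add: K1_iff)
  have "\<delta>2 (tv F2 Z) \<ominus>\<^bsub>F1\<^esub> k \<in> IF1"
    using ideal_smult_image[OF modules(3,2) \<delta>2_hom Z(2)] g mod_hom_minus_zero(3)[OF modules(3,2) \<delta>2_hom zc g(2)] by simp
  then have "tv F1 (tensor_map R F1 C \<delta>2 Z) \<ominus>\<^bsub>F1\<^esub> k \<in> IF1"
    by (rule minus_trans[OF modules(2) IS vc mod_homD(1)[OF \<delta>2_hom zc] kc v(2)])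
  then have "tv F1 Y \<ominus>\<^bsub>F1\<^esub> tv F1 (tensor_map R F1 C \<delta>2 Z) \<in> IF1"
    using minus_trans[OF modules(2) IS yc kc vc k(2)] minus_sym[OF modules(2) IS vc kc] by simp
  from tv_eqI[OF modules(2) Y v(1) this] show "Y \<in> boundaries" using Z by (auto simp: boundaries_def)
qed

lemma boundaries_submodule: "submodule boundaries R T1"
  unfolding boundaries_eq by (rule tv_preimage_submodule[OF modules(2) H1_submodule IF1_H1])

lemma boundaries_subset: "boundaries \<subseteq> cycles"
proof
  fix Y assume "Y \<in> boundaries"
  then obtain k where Y: "Y \<in> carrier T1" and k: "k \<in> K1" "tv F1 Y \<ominus>\<^bsub>F1\<^esub> k \<in> IF1"
    by (auto simp: boundaries_eq H1_def)
  note yc = tv_carrier[OF modules(2) Y]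
  have kc: "k \<in> carrier F1" "\<delta>1 k = \<zero>\<^bsub>F0\<^esub>" using k by (simp_all add: K1_iff)
  have "\<delta>1 (tv F1 Y) \<ominus>\<^bsub>F0\<^esub> \<delta>1 k \<in> IF0"
    using ideal_smult_image[OF modules(2,1) \<delta>1_hom k(2)] mod_hom_minus_zero(3)[OF modules(2,1) \<delta>1_hom yc kc(1)] by simp
  then have "\<delta>1 (tv F1 Y) \<in> IF0"
    using minus_mem[OF modules(1) ideal_smult_submodule[OF modules(1)] mod_homD(1)[OF \<delta>1_hom yc] mod_homD(1)[OF \<delta>1_hom kc(1)]]
      kc submoduleD(1)[OF modules(1) ideal_smult_submodule[OF modules(1)]] by simp
  then show "Y \<in> cycles" using Y yc by (auto simp: cycles_eq)
qed

lemma T1_module: "Module.module R T1" by (rule tensor_module[OF modules(2)])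

lemma cycles_module: "Module.module R (T1\<lparr>carrier := cycles\<rparr>)"
  by (rule submodule.submodule_is_module[OF cycles_submodule T1_module])

lemma boundaries_in_cycles: "submodule boundaries R (T1\<lparr>carrier := cycles\<rparr>)"
  by (rule submodule_restrict[OF T1_module cycles_submodule boundaries_submodule boundaries_subset])

lemma Tor1_module: "Module.module R (Tor1 R A C)"
  unfolding Tor1_eq by (rule quot_module_module[OF cycles_module boundaries_in_cycles])

lemma IU_cong:
  assumes "m \<in> carrier F1" "m' \<in> carrier F1" "m \<ominus>\<^bsub>F1\<^esub> m' \<in> IF1"
  shows "IU +> \<theta> m = IU +> \<theta> m'"
  using quotient_eq_iff_same_a_r_cos[OF IU_ideal, of "\<theta> m" "\<theta> m'"] \<theta>_IF1[OF assms(3)] \<theta>_minus[OF assms(1,2)]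
    \<theta>_lin(1) U.Icarr assms by auto

text \<open>The map induced by \<open>\<theta>\<close> is onto, since the basis element at \<open>a g1\<close> is sent to \<open>a\<close> modulo \<open>U I\<close>
  for \<open>a \<in> U \<inter> I\<close>.  It is injective, since \<open>\<theta> m \<in> U I\<close> lets both summands of
  \<open>\<delta>1 m = (\<delta>1 m - \<theta> m \<cdot> g1) + \<theta> m \<cdot> g1\<close> be lifted to \<open>I F1\<close>, whence \<open>m \<in> K1 + I F1\<close>.\<close>

lemma Tor1_iso:
  obtains \<tau> where "\<tau> \<in> mod_iso R (Tor1 R A C) (ideal_quot R (U \<inter> I) IU)"
proof -
  let ?X = "ideal_quot R (U \<inter> I) IU" and ?Z = "T1\<lparr>carrier := cycles\<rparr>" and ?F = "\<lambda>Y. IU +> \<theta> (tv F1 Y)"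
  note X_facts = is_cring i_intersect[OF U I] IU_ideal ideal_prod_inter[OF U I]
  have X: "Module.module R ?X" by (rule ideal_quot_module[OF X_facts])
  interpret X: Module.module R ?X by (rule X)
  have Z: "Y \<in> carrier T1" "tv F1 Y \<in> carrier F1" "\<delta>1 (tv F1 Y) \<in> IF0" "\<theta> (tv F1 Y) \<in> U \<inter> I"
    if "Y \<in> cycles" for Y
    using that \<theta>_lin(1) IF0_\<epsilon> by (auto simp: cycles_eq \<theta>_def)
  interpret T1: Module.module R T1 by (rule T1_module)
  interpret Zm: Module.module R ?Z by (rule cycles_module)
  have lin: "?F (r \<odot>\<^bsub>T1\<^esub> Y) = r \<odot>\<^bsub>?X\<^esub> ?F Y" if r: "r \<in> carrier R" and Y: "Y \<in> cycles" for r Y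
  proof -
    have "?F (r \<odot>\<^bsub>T1\<^esub> Y) = IU +> \<theta> (r \<odot>\<^bsub>F1\<^esub> tv F1 Y)"
      by (rule IU_cong[OF _ _ tv_smult[OF modules(2)]]) (use Z[OF Y] r tv_carrier[OF modules(2)] in auto)
    then show ?thesis using Z[OF Y] r by (simp add: \<theta>_lin ideal_quot_smult[OF X_facts])
  qed
  obtain \<tau> where hom: "\<tau> \<in> hom (add_monoid (quot_module ?Z boundaries)) (add_monoid ?X)"
    and \<tau>: "\<And>Y. Y \<in> cycles \<Longrightarrow> \<tau> (boundaries +>\<^bsub>?Z\<^esub> Y) = ?F Y"
    and im: "\<tau> ` carrier (quot_module ?Z boundaries) = ?F ` cycles"
    and inj: "(\<And>Y. Y \<in> cycles \<Longrightarrow> ?F Y = \<zero>\<^bsub>?X\<^esub> \<Longrightarrow> Y \<in> boundaries) \<Longrightarrow> inj_on \<tau> (carrier (quot_module ?Z boundaries))"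
  proof (rule quot_module_lift[OF cycles_module boundaries_in_cycles X.M.abelian_group_axioms, of ?F])
    show "?F Y \<in> carrier ?X" if "Y \<in> carrier ?Z" for Y
      using Z(4)[of Y] that by (auto simp: ideal_quot_carrier[OF X_facts])
    show "?F (Y \<oplus>\<^bsub>?Z\<^esub> Y') = ?F Y \<oplus>\<^bsub>?X\<^esub> ?F Y'" if "Y \<in> carrier ?Z" "Y' \<in> carrier ?Z" for Y Y'
    proof -
      have c: "Y \<in> cycles" "Y' \<in> cycles" using that by auto
      have "?F (Y \<oplus>\<^bsub>T1\<^esub> Y') = IU +> \<theta> (tv F1 Y \<oplus>\<^bsub>F1\<^esub> tv F1 Y')"
        by (rule IU_cong[OF _ _ tv_add[OF modules(2)]]) (use Z[OF c(1)] Z[OF c(2)] tv_carrier[OF modules(2)] in auto)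
      then show ?thesis using Z[OF c(1)] Z[OF c(2)] by (simp add: \<theta>_lin(2) ideal_quot_add[OF X_facts])
    qed
    show "?F Y = \<zero>\<^bsub>?X\<^esub>" if Y: "Y \<in> boundaries" for Y
    proof -
      obtain k where k: "k \<in> K1" "tv F1 Y \<ominus>\<^bsub>F1\<^esub> k \<in> IF1" "tv F1 Y \<in> carrier F1"
        using Y by (auto simp: boundaries_eq H1_def)
      have kc: "k \<in> carrier F1" and "\<theta> k = \<zero>"
        using k mod_hom_minus_zero(1)[OF modules(1,4) \<epsilon>_hom] by (auto simp: K1_iff \<theta>_def)
      then show ?thesis
        using IU_cong[OF k(3) kc k(2)] by (simp add: ideal_quot_zero[OF X_facts] a_rcos_zero[OF IU_ideal]
           additive_subgroup.zero_closed ideal.axioms(1)[OF IU_ideal])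
    qed
  qed auto
  have "\<tau> \<in> mod_iso R (Tor1 R A C) ?X"
    unfolding Tor1_eq
  proof (rule mod_isoI[OF hom])
    show "inj_on \<tau> (carrier (quot_module ?Z boundaries))"
    proof (rule inj)
      fix Y assume Y: "Y \<in> cycles" and 0: "?F Y = \<zero>\<^bsub>?X\<^esub>"
      let ?m = "tv F1 Y"
      have m: "?m \<in> carrier F1" "\<delta>1 ?m \<in> IF0" using Z[OF Y] by auto
      have \<delta>c: "\<delta>1 ?m \<in> carrier F0" using mod_homD(1)[OF \<delta>1_hom m(1)] .
      have "\<theta> ?m \<in> IU"
        using 0 ideal.rcos_const_imp_mem[OF IU_ideal, of "\<theta> ?m"] Z(4)[OF Y] Icarr by (simp add: ideal_quot_zero[OF X_facts])
      then have "\<epsilon> (\<delta>1 ?m) \<odot>\<^bsub>F0\<^esub> g1 \<in> \<delta>1 ` IF1" by (auto simp: \<theta>_def intro: IU_decompose)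
      then have "(\<delta>1 ?m \<ominus>\<^bsub>F0\<^esub> \<epsilon> (\<delta>1 ?m) \<odot>\<^bsub>F0\<^esub> g1) \<oplus>\<^bsub>F0\<^esub> \<epsilon> (\<delta>1 ?m) \<odot>\<^bsub>F0\<^esub> g1 \<in> \<delta>1 ` IF1"
        using IF0_decompose[OF m(2)] submoduleD(3)[OF modules(1) image_IF1_submodule] by blast
      then have "\<delta>1 ?m \<in> \<delta>1 ` IF1"
        using \<delta>c g1 \<epsilon>_lin(1)[OF \<delta>c] by (simp add: a_minus_def F0.M.a_assoc F0.M.l_neg)
      then obtain m' where m': "m' \<in> IF1" "\<delta>1 ?m = \<delta>1 m'" by auto
      have m'c: "m' \<in> carrier F1" using IF1_carrier m' by auto
      have "?m \<ominus>\<^bsub>F1\<^esub> m' \<in> K1"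
        using mod_hom_minus_zero(3)[OF modules(2,1) \<delta>1_hom m(1) m'c] m' m m'c \<delta>c
        by (simp add: K1_iff) (metis F0.M.r_neg a_minus_def)
      moreover have "?m \<ominus>\<^bsub>F1\<^esub> (?m \<ominus>\<^bsub>F1\<^esub> m') = m'"
        using m m'c by (simp add: a_minus_def F1.M.minus_add F1.M.r_neg1 F1.M.r_neg2)
      ultimately have "?m \<in> H1" using m m' by (auto simp: H1_def intro!: bexI[of _ "?m \<ominus>\<^bsub>F1\<^esub> m'"])
      then show "Y \<in> boundaries" using Z[OF Y] by (simp add: boundaries_eq)
    qed
    have "IU +> a \<in> ?F ` cycles" if a: "a \<in> U \<inter> I" for a
    proof -
      have k: "a \<odot>\<^bsub>F0\<^esub> g1 \<in> K0" using a by (auto intro: mult_g1_K0)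
      note g = \<delta>1_gen[OF k]
      have ac: "a \<in> carrier R" using a Icarr by auto
      obtain Y where Y: "Y \<in> carrier T1" "tv F1 Y \<ominus>\<^bsub>F1\<^esub> free_gen R (a \<odot>\<^bsub>F0\<^esub> g1) \<in> IF1"
        by (rule tv_surj[OF modules(2) g(2)])
      note yc = tv_carrier[OF modules(2) Y(1)]
      have "\<delta>1 (tv F1 Y) \<ominus>\<^bsub>F0\<^esub> a \<odot>\<^bsub>F0\<^esub> g1 \<in> IF0"
        using ideal_smult_image[OF modules(2,1) \<delta>1_hom Y(2)] mod_hom_minus_zero(3)[OF modules(2,1) \<delta>1_hom yc g(2)] g(1) by simp
      moreover have "a \<odot>\<^bsub>F0\<^esub> g1 \<in> IF0" using a g1 ideal_smult_memI by fast
      ultimately have "\<delta>1 (tv F1 Y) \<in> IF0"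
        using minus_mem[OF modules(1) ideal_smult_submodule[OF modules(1)] mod_homD(1)[OF \<delta>1_hom yc], of "a \<odot>\<^bsub>F0\<^esub> g1"]
          k K0_carrier by auto
      then have "Y \<in> cycles" using Y yc by (simp add: cycles_eq)
      moreover have "?F Y = IU +> a"
      proof -
        have "?F Y = IU +> (a \<otimes> \<epsilon> g1)"
          using IU_cong[OF yc g(2) Y(2)] g(1) g1 ac by (simp add: \<theta>_def \<epsilon>_lin)
        moreover have "a \<otimes> \<epsilon> g1 \<ominus> a = (\<epsilon> g1 \<ominus> \<one>) \<otimes> a"
          using ac g1 by (simp add: a_minus_def m_comm[of "\<epsilon> g1 \<oplus> \<ominus> \<one>" a] r_distr r_minus)
        moreover have "(\<epsilon> g1 \<ominus> \<one>) \<otimes> a \<in> IU" using g1 a by (intro ideal_prod.prod) auto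
        ultimately show ?thesis
          using quotient_eq_iff_same_a_r_cos[OF IU_ideal, of "a \<otimes> \<epsilon> g1" a] ac g1 by simp
      qed
      ultimately show ?thesis by (metis image_eqI)
    qed
    then show "\<tau> ` carrier (quot_module ?Z boundaries) = carrier ?X"
      using Z(4) by (auto simp: im ideal_quot_carrier[OF X_facts])
    fix r Y assume r: "r \<in> carrier R" and "Y \<in> carrier (quot_module ?Z boundaries)"
    then obtain Z where Zz: "Z \<in> cycles" "Y = boundaries +>\<^bsub>?Z\<^esub> Z" by (auto simp: quot_module_carrier)
    moreover have "r \<odot>\<^bsub>T1\<^esub> Z \<in> cycles" using Zm.smult_closed[OF r, of Z] Zz by simp
    ultimately show "\<tau> (r \<odot>\<^bsub>quot_module ?Z boundaries\<^esub> Y) = r \<odot>\<^bsub>?X\<^esub> \<tau> Y"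
      using quot_module_smult[OF cycles_module boundaries_in_cycles r, of Z] r by (simp add: \<tau> lin)
  qed
  then show thesis using that by blast
qed

end

lemma Tor1_cyclic_cyclic:
  assumes "cring R" "ideal U R" "ideal I R"
  defines "T \<equiv> Tor1 R (quot_module (ring_mod R) U) (quot_module (ring_mod R) I)"
  shows "Module.module R T"
    and "\<exists>\<tau>. \<tau> \<in> mod_iso R T (ideal_quot R (U \<inter> I) (ideal_prod R U I))"
proof -
  interpret cyclic_tor R I U
    by (intro cyclic_tor.intro cyclic_module.intro cyclic_module_axioms.intro cyclic_tor_axioms.intro assms)
  interpret U: cyclic_module R U
    by (intro cyclic_module.intro cyclic_module_axioms.intro assms)
  have T: "T = Tor1 R U.C C" by (simp add: T_def C_def U.C_def)
  show "Module.module R T" using Tor1_module by (simp add: T)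
  show "\<exists>\<tau>. \<tau> \<in> mod_iso R T (ideal_quot R (U \<inter> I) (ideal_prod R U I))"
    using Tor1_iso unfolding T by blast
qed


section \<open>Formal power series in several variables as a type-class ring\<close>

text \<open>A convolution product has finite coefficient sums if every exponent has finitely many
  decompositions.  Stating this as a class makes series an instance of the commutative rings, so
  that ring normalisation applies to them.\<close>

class finite_decomp = comm_monoid_add +
  assumes finite_decomp: "finite {(a, b). a + b = m}"

class finite_lower = canonically_ordered_monoid_add +
  assumes finite_lower: "finite {..m}"

instance nat :: finite_lower
  by standard simp

lemma finite_lookup_le: "finite {a :: 'i \<Rightarrow>\<^sub>0 'b :: finite_lower. \<forall>j. lookup a j \<le> lookup m j}"
proof -
  let ?F = "{f :: 'i \<Rightarrow> 'b. \<forall>x. (x \<in> Poly_Mapping.keys m \<longrightarrow> f x \<in> (\<Union>j\<in>Poly_Mapping.keys m. {..lookup m j})) \<and>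
    (x \<notin> Poly_Mapping.keys m \<longrightarrow> f x = 0)}"
  have "finite ?F" by (rule finite_set_of_finite_funs) (auto intro: finite_lower)
  then have "finite (lookup -` ?F)" by (rule finite_vimageI) (simp add: inj_def lookup_inject)
  moreover have "{a :: 'i \<Rightarrow>\<^sub>0 'b. \<forall>j. lookup a j \<le> lookup m j} \<subseteq> lookup -` ?F"
  proof (rule subsetI, rule vimageI2, rule CollectI, intro allI conjI impI)
    fix a :: "'i \<Rightarrow>\<^sub>0 'b" and x assume a: "a \<in> {a. \<forall>j. lookup a j \<le> lookup m j}"
    show "lookup a x \<in> (\<Union>j\<in>Poly_Mapping.keys m. {..lookup m j})" if "x \<in> Poly_Mapping.keys m"
      using a that by auto
    show "lookup a x = 0" if "x \<notin> Poly_Mapping.keys m"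
      using a that by (metis (mono_tags) in_keys_iff le_zero_eq mem_Collect_eq)
  qed
  ultimately show ?thesis by (rule finite_subset[rotated])
qed

instance poly_mapping :: (type, finite_lower) finite_decomp
proof
  fix m :: "'a \<Rightarrow>\<^sub>0 'b"
  let ?L = "{a. \<forall>j. lookup a j \<le> lookup m j}"
  have "{(a, b). a + b = m} \<subseteq> ?L \<times> ?L"
    by (auto simp: lookup_add le_iff_add) (metis add.commute)
  then show "finite {(a, b). a + b = m}"
    by (rule finite_subset) (intro finite_cartesian_product finite_lookup_le)
qed

instantiation "fun" :: (type, plus) plus
begin
definition plus_fun_def: "f + g = (\<lambda>x. f x + g x)"
instance ..
end

instantiation "fun" :: (type, zero) zero
begin
definition zero_fun_def: "0 = (\<lambda>x. 0)"
instance ..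
end

text \<open>Multiplication of coefficient families is convolution, not the pointwise product.\<close>

instantiation "fun" :: (finite_decomp, comm_ring_1) times
begin
definition times_fun_def: "f * g = (\<lambda>m. \<Sum>(a, b) | a + b = m. f a * g b)"
instance ..
end

instantiation "fun" :: (finite_decomp, comm_ring_1) one
begin
definition one_fun_def: "1 = (\<lambda>m. if m = 0 then 1 else 0)"
instance ..
end

lemma plus_coeff: "(f + g) m = f m + g m"
  by (simp add: plus_fun_def)

lemma zero_coeff: "0 m = 0"
  by (simp add: zero_fun_def)

lemmas series_eq_iff = fun_eq_iff plus_coeff zero_coeff

lemma times_coeff: "(f * g) m = (\<Sum>(a, b) | a + b = m. f a * g b)"
  by (simp add: times_fun_def)

lemma convolution_assoc:
  fixes f g h :: "'a::finite_decomp \<Rightarrow> 'b::comm_ring_1"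
  shows "f * g * h = f * (g * h)"
proof
  fix m :: 'a
  let ?T = "{(a, b, c). a + b + c = m}"
  have "(f * g * h) m = (\<Sum>p\<in>{(x, c). x + c = m}. \<Sum>q\<in>{(a, b). a + b = fst p}. f (fst q) * g (snd q) * h (snd p))"
    by (simp add: times_coeff sum_distrib_right case_prod_unfold)
  also have "\<dots> = (\<Sum>(p, q)\<in>(SIGMA p:{(x, c). x + c = m}. {(a, b). a + b = fst p}). f (fst q) * g (snd q) * h (snd p))"
    by (rule sum.Sigma) (auto intro: finite_decomp)
  also have "\<dots> = (\<Sum>(a, b, c)\<in>?T. f a * g b * h c)"
    by (rule sum.reindex_bij_witness[of _ "\<lambda>(a, b, c). ((a + b, c), (a, b))" "\<lambda>((x, c), (a, b)). (a, b, c)"]) auto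
  also have "\<dots> = (\<Sum>(p, q)\<in>(SIGMA p:{(a, y). a + y = m}. {(b, c). b + c = snd p}). f (fst p) * (g (fst q) * h (snd q)))"
    by (rule sum.reindex_bij_witness[of _ "\<lambda>((a, y), (b, c)). (a, b, c)" "\<lambda>(a, b, c). ((a, b + c), (b, c))"])
      (auto simp: add.assoc mult.assoc)
  also have "\<dots> = (\<Sum>p\<in>{(a, y). a + y = m}. \<Sum>q\<in>{(b, c). b + c = snd p}. f (fst p) * (g (fst q) * h (snd q)))"
    by (rule sum.Sigma[symmetric]) (auto intro: finite_decomp)
  also have "\<dots> = (f * (g * h)) m"
    by (simp add: times_coeff sum_distrib_left case_prod_unfold)
  finally show "(f * g * h) m = (f * (g * h)) m" .
qed

lemma convolution_commute:
  fixes f g :: "'a::finite_decomp \<Rightarrow> 'b::comm_ring_1"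
  shows "f * g = g * f"
proof
  fix m :: 'a
  show "(f * g) m = (g * f) m" unfolding times_coeff
    by (rule sum.reindex_bij_witness[of _ prod.swap prod.swap]) (auto simp: add.commute mult.commute)
qed

lemma convolution_one:
  fixes f :: "'a::finite_decomp \<Rightarrow> 'b::comm_ring_1"
  shows "1 * f = f"
proof
  fix m :: 'a
  have "(1 * f) m = (\<Sum>(a, b)\<in>{(0 :: 'a, m)}. 1 a * f b)" unfolding times_coeff
    by (rule sum.mono_neutral_right) (auto intro: finite_decomp simp: one_fun_def split: if_splits)
  then show "(1 * f) m = f m" by (simp add: one_fun_def)
qed

instance "fun" :: (type, semigroup_add) semigroup_add
  by standard (simp add: plus_fun_def add.assoc)

instance "fun" :: (type, ab_semigroup_add) ab_semigroup_add
  by standard (simp add: plus_fun_def add.commute)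

instance "fun" :: (type, monoid_add) monoid_add
  by standard (simp_all add: plus_fun_def zero_fun_def)

instance "fun" :: (type, comm_monoid_add) comm_monoid_add
  by standard (simp add: plus_fun_def zero_fun_def)

instance "fun" :: (type, cancel_semigroup_add) cancel_semigroup_add
  by standard (simp_all add: plus_fun_def fun_eq_iff)

instance "fun" :: (type, cancel_ab_semigroup_add) cancel_ab_semigroup_add
  by standard (simp_all add: plus_fun_def fun_eq_iff diff_diff_add)

instance "fun" :: (type, cancel_comm_monoid_add) cancel_comm_monoid_add ..

instance "fun" :: (type, group_add) group_add
  by standard (simp_all add: plus_fun_def zero_fun_def fun_eq_iff)

instance "fun" :: (type, ab_group_add) ab_group_add
  by standard (simp_all add: plus_fun_def zero_fun_def fun_eq_iff)

instance "fun" :: (finite_decomp, comm_ring_1) comm_ring_1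
proof
  fix f g h :: "'a \<Rightarrow> 'b"
  show "f * g * h = f * (g * h)" by (rule convolution_assoc)
  show "f * g = g * f" by (rule convolution_commute)
  show "1 * f = f" by (rule convolution_one)
  show "(f + g) * h = f * h + g * h"
    by (rule ext) (simp add: plus_coeff times_coeff distrib_right sum.distrib case_prod_unfold)
  show "(0 :: 'a \<Rightarrow> 'b) \<noteq> 1" by (auto simp: series_eq_iff one_fun_def)
qed

lemma sum_coeff: "(\<Sum>x\<in>A. f x) m = (\<Sum>x\<in>A. f x m)"
  by (induction A rule: infinite_finite_induct) (simp_all add: plus_coeff zero_coeff)


section \<open>Rings of series as records\<close>

text \<open>Translates the operations of a ring record into those of the type class, where ring
  normalisation is automatic.\<close>

locale subring_record =
  fixes R :: "('a::comm_ring_1) ring"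
  assumes ops: "mult R = (*)" "add R = (+)" "one R = 1" "zero R = 0"
    and closed: "0 \<in> carrier R" "1 \<in> carrier R"
      "\<And>a b. a \<in> carrier R \<Longrightarrow> b \<in> carrier R \<Longrightarrow> a + b \<in> carrier R"
      "\<And>a b. a \<in> carrier R \<Longrightarrow> b \<in> carrier R \<Longrightarrow> a * b \<in> carrier R"
      "\<And>a. a \<in> carrier R \<Longrightarrow> - a \<in> carrier R"
begin

lemma cring: "cring R"
proof (rule cringI)
  show "abelian_group R"
    by (rule abelian_groupI) (auto simp: ops closed add.assoc add.commute intro!: bexI[of _ "- x" for x])
  show "comm_monoid R"
    by (rule comm_monoidI) (auto simp: ops closed mult.assoc mult.commute)
qed (auto simp: ops distrib_right)

sublocale cring R by (rule cring)

lemma a_inv_eq: "a \<in> carrier R \<Longrightarrow> \<ominus>\<^bsub>R\<^esub> a = - a"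
  using minus_equality[of "- a" a] by (simp add: ops closed)

lemma a_minus_eq: "a \<in> carrier R \<Longrightarrow> b \<in> carrier R \<Longrightarrow> a \<ominus>\<^bsub>R\<^esub> b = a - b"
  by (simp add: a_minus_def a_inv_eq ops)

lemma finsum_eq: "f \<in> A \<rightarrow> carrier R \<Longrightarrow> finsum R f A = sum f A"
  by (induction A rule: infinite_finite_induct) (auto simp: ops)

lemma finprod_eq: "f \<in> A \<rightarrow> carrier R \<Longrightarrow> finprod R f A = prod f A"
  by (induction A rule: infinite_finite_induct) (auto simp: ops)

lemma pow_eq: "a \<in> carrier R \<Longrightarrow> a [^]\<^bsub>R\<^esub> (k::nat) = a ^ k"
  by (induction k) (simp_all add: ops mult.commute)

lemma sum_closed: "(\<And>x. x \<in> A \<Longrightarrow> f x \<in> carrier R) \<Longrightarrow> sum f A \<in> carrier R"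
  by (induction A rule: infinite_finite_induct) (auto simp: closed)

lemma prod_closed: "(\<And>x. x \<in> A \<Longrightarrow> f x \<in> carrier R) \<Longrightarrow> prod f A \<in> carrier R"
  by (induction A rule: infinite_finite_induct) (auto simp: closed)

lemma power_closed: "a \<in> carrier R \<Longrightarrow> a ^ (k::nat) \<in> carrier R"
  by (induction k) (auto simp: closed)

lemma idealD:
  assumes "ideal I R"
  shows "0 \<in> I" "a \<in> I \<Longrightarrow> b \<in> I \<Longrightarrow> a + b \<in> I" "a \<in> I \<Longrightarrow> c \<in> carrier R \<Longrightarrow> c * a \<in> I"
    "a \<in> I \<Longrightarrow> - a \<in> I" "a \<in> I \<Longrightarrow> b \<in> I \<Longrightarrow> a - b \<in> I" "a \<in> I \<Longrightarrow> a \<in> carrier R"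
    "(\<And>x. x \<in> A \<Longrightarrow> f x \<in> I) \<Longrightarrow> sum f A \<in> I"
proof -
  interpret ideal I R by fact
  show 0: "0 \<in> I" using zero_closed by (simp add: ops)
  show p: "a + b \<in> I" if "a \<in> I" "b \<in> I" for a b using a_closed that by (simp add: ops)
  show "a \<in> I \<Longrightarrow> c \<in> carrier R \<Longrightarrow> c * a \<in> I" using I_l_closed by (simp add: ops)
  show m: "- a \<in> I" if "a \<in> I" for a using a_inv_closed[OF that] that by (simp add: a_inv_eq)
  show "a \<in> I \<Longrightarrow> b \<in> I \<Longrightarrow> a - b \<in> I" using p m by (metis diff_conv_add_uminus)
  show "a \<in> I \<Longrightarrow> a \<in> carrier R" by simp
  show "(\<And>x. x \<in> A \<Longrightarrow> f x \<in> I) \<Longrightarrow> sum f A \<in> I"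
    by (induction A rule: infinite_finite_induct) (auto simp: 0 p)
qed

lemma idealI_ops:
  assumes "I \<subseteq> carrier R" "0 \<in> I" "\<And>a b. a \<in> I \<Longrightarrow> b \<in> I \<Longrightarrow> a + b \<in> I"
    "\<And>a c. a \<in> I \<Longrightarrow> c \<in> carrier R \<Longrightarrow> c * a \<in> I"
  shows "ideal I R"
proof (rule idealI)
  show "subgroup I (add_monoid R)"
  proof (rule add.subgroupI)
    show "\<ominus>\<^bsub>R\<^esub> a \<in> I" if "a \<in> I" for a
      using assms(4)[OF that, of "- 1"] assms(1) that closed by (auto simp: a_inv_eq subset_eq)
  qed (use assms in \<open>auto simp: ops\<close>)
  fix a x assume "a \<in> I" "x \<in> carrier R"
  then show "x \<otimes>\<^bsub>R\<^esub> a \<in> I" "a \<otimes>\<^bsub>R\<^esub> x \<in> I"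
    using assms(4)[of a x] by (auto simp: ops mult.commute)
qed (rule ring_axioms)

lemma genideal_finite:
  assumes X: "finite X" "X \<subseteq> carrier R"
  shows "genideal R X = {\<Sum>x\<in>X. a x * x |a. a \<in> X \<rightarrow> carrier R}" (is "_ = ?I")
proof
  have Xc: "x \<in> X \<Longrightarrow> x \<in> carrier R" for x using X by auto
  have "ideal ?I R"
  proof (rule idealI_ops)
    show "?I \<subseteq> carrier R" using Xc by (auto intro!: sum_closed closed)
    show "0 \<in> ?I" by (auto intro!: exI[of _ "\<lambda>x. 0"] simp: closed)
    fix f g assume "f \<in> ?I" "g \<in> ?I"
    then obtain a b where "f = (\<Sum>x\<in>X. a x * x)" "g = (\<Sum>x\<in>X. b x * x)" "a \<in> X \<rightarrow> carrier R" "b \<in> X \<rightarrow> carrier R"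
      by auto
    then show "f + g \<in> ?I"
      by (intro CollectI exI[of _ "\<lambda>x. a x + b x"]) (auto simp: distrib_right sum.distrib intro!: closed)
  next
    fix f c assume "f \<in> ?I" and c: "c \<in> carrier R"
    then obtain a where "f = (\<Sum>x\<in>X. a x * x)" "a \<in> X \<rightarrow> carrier R" by auto
    then show "c * f \<in> ?I"
      using c by (intro CollectI exI[of _ "\<lambda>x. c * a x"]) (auto simp: sum_distrib_left mult.assoc intro!: closed)
  qed
  moreover have "X \<subseteq> ?I"
  proof
    fix y assume "y \<in> X"
    then show "y \<in> ?I"
      using X closed by (intro CollectI exI[of _ "\<lambda>x. if x = y then 1 else 0"])
        (auto simp: if_distrib[of "\<lambda>c. c * _"] cong: if_cong)
  qed
  ultimately show "genideal R X \<subseteq> ?I" by (rule genideal_minimal)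
  have gi: "ideal (genideal R X) R" by (rule genideal_ideal[OF X(2)])
  show "?I \<subseteq> genideal R X"
    using genideal_self[OF X(2)] by (auto intro!: idealD(3,7)[OF gi])
qed

end

lemma mps_ring_simps:
  "mult (mps_ring V) = (*)" "add (mps_ring V) = (+)" "one (mps_ring V) = 1" "zero (mps_ring V) = 0"
  "carrier (mps_ring V) = {f. \<forall>m. f m \<noteq> 0 \<longrightarrow> Poly_Mapping.keys m \<subseteq> V}"
  by (auto simp: mps_ring_def times_fun_def plus_fun_def one_fun_def zero_fun_def fun_eq_iff)

lemma mpoly_ring_simps:
  "mult (mpoly_ring V) = (*)" "add (mpoly_ring V) = (+)" "one (mpoly_ring V) = 1" "zero (mpoly_ring V) = 0"
  "carrier (mpoly_ring V) = {f \<in> carrier (mps_ring V). finite {m. f m \<noteq> 0}}"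
  by (auto simp: mpoly_ring_def mps_ring_def times_fun_def plus_fun_def one_fun_def zero_fun_def fun_eq_iff)

lemma Rhat_carrier [simp]: "carrier Rhat = UNIV"
  by (simp add: mps_ring_simps)

lemma times_nonzero:
  assumes "(f * g) m \<noteq> (0 :: complex)"
  obtains a b where "a + b = m" "f a \<noteq> 0" "g b \<noteq> 0"
proof -
  have "\<exists>p\<in>{(a, b). a + b = m}. (case p of (a, b) \<Rightarrow> f a * g b) \<noteq> 0"
    using assms unfolding times_coeff by (rule contrapos_np) (simp add: sum.neutral)
  then show ?thesis using that by auto
qed

interpretation mps: subring_record "mps_ring V" for V :: "'i set"
proof
  fix f g :: "'i series" assume f: "f \<in> carrier (mps_ring V)" and g: "g \<in> carrier (mps_ring V)"
  show "f * g \<in> carrier (mps_ring V)"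
    using f g by (fastforce simp: mps_ring_simps elim!: times_nonzero dest: subsetD[OF Poly_Mapping.keys_add])
  show "f + g \<in> carrier (mps_ring V)"
    using f g by (auto simp: mps_ring_simps plus_coeff) (metis add.right_neutral in_mono)
qed (auto simp: mps_ring_simps one_fun_def zero_coeff split: if_splits)

interpretation mpoly: subring_record "mpoly_ring V" for V :: "'i set"
proof
  fix f g :: "'i series" assume f: "f \<in> carrier (mpoly_ring V)" and g: "g \<in> carrier (mpoly_ring V)"
  have fin: "finite {m. f m \<noteq> 0}" "finite {m. g m \<noteq> 0}" using f g by (auto simp: mpoly_ring_simps)
  have "{m. (f * g) m \<noteq> 0} \<subseteq> (\<lambda>(a, b). a + b) ` ({m. f m \<noteq> 0} \<times> {m. g m \<noteq> 0})"
    by (force elim!: times_nonzero)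
  then have "finite {m. (f * g) m \<noteq> 0}" by (rule finite_subset) (use fin in auto)
  then show "f * g \<in> carrier (mpoly_ring V)"
    using f g mps.closed(4)[of f V g] by (simp add: mpoly_ring_simps)
  have "{m. (f + g) m \<noteq> 0} \<subseteq> {m. f m \<noteq> 0} \<union> {m. g m \<noteq> 0}" by (auto simp: plus_coeff)
  then have "finite {m. (f + g) m \<noteq> 0}" by (rule finite_subset) (use fin in auto)
  then show "f + g \<in> carrier (mpoly_ring V)"
    using f g mps.closed(3)[of f V g] by (simp add: mpoly_ring_simps)
next
  fix f :: "'i series" assume "f \<in> carrier (mpoly_ring V)"
  then show "- f \<in> carrier (mpoly_ring V)" using mps.closed(5)[of f V] by (simp add: mpoly_ring_simps)
next
  show "1 \<in> carrier (mpoly_ring V)" using mps.closed(2)[of V] by (simp add: mpoly_ring_simps one_fun_def)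
  show "0 \<in> carrier (mpoly_ring V)" using mps.closed(1)[of V] by (simp add: mpoly_ring_simps zero_coeff)
qed (simp_all add: mpoly_ring_simps)

lemma mon_times_eq: "mon p * f = (\<lambda>m. \<Sum>(a, b)\<in>{(a, b). a + b = m \<and> a = p}. f b)"
proof
  fix m
  have "(mon p * f) m = (\<Sum>(a, b)\<in>{(a, b). a + b = m \<and> a = p}. mon p a * f b)"
    unfolding times_coeff
    by (rule sum.mono_neutral_right) (auto intro: finite_subset[OF _ finite_decomp] simp: mon_def split: if_splits)
  also have "\<dots> = (\<Sum>(a, b)\<in>{(a, b). a + b = m \<and> a = p}. f b)"
    by (rule sum.cong) (auto simp: mon_def)
  finally show "(mon p * f) m = (\<Sum>(a, b)\<in>{(a, b). a + b = m \<and> a = p}. f b)" .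
qed

lemma mon_times_coeff_add [simp]: "(mon p * f) (p + q) = f q"
proof -
  have "{(a, b). a + b = p + q \<and> a = p} = {(p, q)}" by auto
  then show ?thesis by (simp add: mon_times_eq)
qed

lemma mon_times_coeff_zero: "(\<And>q. m \<noteq> p + q) \<Longrightarrow> (mon p * f) m = 0"
  by (auto simp: mon_times_eq intro!: sum.neutral)

lemma mon_times_mon: "mon p * mon q = mon (p + q)"
proof
  fix m
  show "(mon p * mon q) m = mon (p + q) m"
  proof (cases "\<exists>k. m = p + k")
    case True
    then obtain k where "m = p + k" by auto
    then have "(mon p * mon q) m = mon q k" by simp
    then show ?thesis using \<open>m = p + k\<close> by (simp add: mon_def)
  next
    case False
    then show ?thesis using mon_times_coeff_zero[of m p "mon q"] by (auto simp: mon_def)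
  qed
qed

lemma mon_zero: "mon 0 = 1"
  by (simp add: mon_def one_fun_def)

lemma const_eq: "const c * f = (\<lambda>m. c * f m)"
proof -
  have "const c * f = (\<lambda>m. c * (1 * f) m)"
    unfolding times_fun_def one_fun_def const_def
    by (rule ext) (auto simp: sum_distrib_left intro!: sum.cong)
  then show ?thesis by simp
qed

lemma const_add: "const (a + b) = const a + const b"
  by (auto simp: const_def series_eq_iff)

lemma const_mult: "const (a * b) = const a * const b"
  unfolding const_eq by (auto simp: const_def fun_eq_iff)

lemma const_0 [simp]: "const 0 = 0" and const_1 [simp]: "const 1 = 1"
  by (auto simp: const_def series_eq_iff one_fun_def)

lemma prod_mon: "(\<Prod>x\<in>A. mon (f x)) = mon (\<Sum>x\<in>A. f x)"
  by (induction A rule: infinite_finite_induct) (auto simp: mon_zero mon_times_mon)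


section \<open>Homogeneous ideals\<close>

lemma total_degree_superset:
  assumes "finite S" "Poly_Mapping.keys m \<subseteq> S"
  shows "total_degree m = (\<Sum>j\<in>S. lookup m j)"
  unfolding total_degree_def
  by (rule sum.mono_neutral_left) (use assms in \<open>auto simp: in_keys_iff\<close>)

lemma total_degree_add [simp]: "total_degree (a + b) = total_degree a + total_degree b"
proof -
  let ?S = "Poly_Mapping.keys a \<union> Poly_Mapping.keys b"
  have "total_degree (a + b) = (\<Sum>j\<in>?S. lookup (a + b) j)"
    by (rule total_degree_superset) (auto dest: subsetD[OF Poly_Mapping.keys_add])
  also have "\<dots> = total_degree a + total_degree b"
    by (subst (1 2) total_degree_superset[of ?S]) (auto simp: lookup_add sum.distrib)
  finally show ?thesis .
qed

lemma total_degree_zero [simp]: "total_degree 0 = 0"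
  by (simp add: total_degree_def)

lemma total_degree_single [simp]: "total_degree (Poly_Mapping.single j k) = k"
  by (subst total_degree_superset[of "{j}"]) auto

lemma lookup_le_total_degree: "lookup m j \<le> total_degree m"
proof (cases "j \<in> Poly_Mapping.keys m")
  case True
  then show ?thesis unfolding total_degree_def by (intro member_le_sum) auto
qed (simp add: in_keys_iff)

lemma finite_total_degree_le:
  assumes V: "finite V"
  shows "finite {m :: 'i \<Rightarrow>\<^sub>0 nat. total_degree m \<le> d \<and> Poly_Mapping.keys m \<subseteq> V}"
proof -
  let ?F = "{f :: 'i \<Rightarrow> nat. \<forall>x. (x \<in> V \<longrightarrow> f x \<in> {..d}) \<and> (x \<notin> V \<longrightarrow> f x = 0)}"
  have "finite ?F" using V by (intro finite_set_of_finite_funs) auto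
  then have "finite (lookup -` ?F)" by (rule finite_vimageI) (simp add: inj_def lookup_inject)
  then show ?thesis
    by (rule finite_subset[rotated])
      (auto simp: in_keys_iff intro: order_trans[OF lookup_le_total_degree])
qed

definition hcomp :: "nat \<Rightarrow> 'i series \<Rightarrow> 'i series" where
  "hcomp d f = (\<lambda>m. if total_degree m = d then f m else 0)"

definition homog :: "nat \<Rightarrow> 'i series \<Rightarrow> bool" where
  "homog k f \<longleftrightarrow> (\<forall>m. f m \<noteq> 0 \<longrightarrow> total_degree m = k)"

lemma hcomp_add: "hcomp d (f + g) = hcomp d f + hcomp d g"
  by (auto simp: hcomp_def series_eq_iff)

lemma hcomp_sum: "hcomp d (\<Sum>x\<in>A. f x) = (\<Sum>x\<in>A. hcomp d (f x))"
  by (auto simp: hcomp_def series_eq_iff sum_coeff)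

lemma hcomp_times_homog:
  assumes g: "homog k g"
  shows "hcomp d (f * g) = (if k \<le> d then hcomp (d - k) f * g else 0)"
proof
  fix m
  show "hcomp d (f * g) m = (if k \<le> d then hcomp (d - k) f * g else 0) m"
  proof (cases "k \<le> d")
    case True
    have "hcomp d (f * g) m = (\<Sum>(a, b) | a + b = m. hcomp (d - k) f a * g b)"
    proof (cases "total_degree m = d")
      case True
      then show ?thesis unfolding hcomp_def times_coeff
        using g by (auto simp: homog_def intro!: sum.cong)
    next
      case False
      then have "(\<Sum>(a, b) | a + b = m. hcomp (d - k) f a * g b) = 0"
        using g \<open>k \<le> d\<close> by (intro sum.neutral) (auto simp: homog_def hcomp_def)
      then show ?thesis using False by (simp add: hcomp_def)
    qed
    then show ?thesis using True by (simp add: times_coeff)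
  next
    case False
    have "f a * g b = 0" if "total_degree (a + b) = d" for a b
      using g that False by (auto simp: homog_def)
    then have "hcomp d (f * g) m = 0"
      by (auto simp: hcomp_def times_coeff intro!: sum.neutral)
    then show ?thesis using False by (simp add: zero_coeff)
  qed
qed

lemma homog_times: "homog k f \<Longrightarrow> homog l g \<Longrightarrow> homog (k + l) (f * g)"
  unfolding homog_def by (auto elim!: times_nonzero)

lemma homog_add: "homog k f \<Longrightarrow> homog k g \<Longrightarrow> homog k (f + g)"
  unfolding homog_def plus_coeff by (metis add.right_neutral)

lemma homog_zero: "homog k 0" by (simp add: homog_def zero_coeff)

lemma homog_sum: "(\<And>x. x \<in> A \<Longrightarrow> homog k (f x)) \<Longrightarrow> homog k (\<Sum>x\<in>A. f x)"
  by (induction A rule: infinite_finite_induct) (auto simp: homog_zero homog_add)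

lemma homog_const_times: "homog k f \<Longrightarrow> homog k (const c * f)"
  by (auto simp: homog_def const_eq)

lemma homog_mon: "homog (total_degree p) (mon p)"
  by (auto simp: homog_def mon_def)

lemma homog_one: "homog 0 1"
  using homog_mon[of 0] by (simp add: mon_zero)

lemma homog_prod: "(\<And>x. x \<in> A \<Longrightarrow> homog (k x) (f x)) \<Longrightarrow> homog (\<Sum>x\<in>A. k x) (\<Prod>x\<in>A. f x)"
  by (induction A rule: infinite_finite_induct) (auto simp: homog_one homog_times)

lemma homog_power: "homog k f \<Longrightarrow> homog (n * k) (f ^ n)"
  by (induction n) (auto simp: homog_one homog_times)

definition homog_ideal :: "'i series set \<Rightarrow> bool" where
  "homog_ideal I \<longleftrightarrow> (\<exists>X. finite X \<and> (\<forall>x\<in>X. \<exists>k. homog k x) \<and> I = genideal Rhat X)"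

lemma homog_ideal_ideal: "homog_ideal I \<Longrightarrow> ideal I Rhat"
  by (auto simp: homog_ideal_def intro!: mps.genideal_ideal)

lemma genideal_Rhat: "finite X \<Longrightarrow> genideal Rhat X = {\<Sum>x\<in>X. a x * x |a. True}"
  using mps.genideal_finite[of X UNIV] by simp

text \<open>As the generators are homogeneous, a component of a combination of generators is the
  combination with suitable components of the multipliers.\<close>

lemma homog_ideal_comp:
  assumes "homog_ideal I" "f \<in> I"
  shows "hcomp d f \<in> I"
proof -
  obtain X where X: "finite X" "\<And>x. x \<in> X \<Longrightarrow> \<exists>k. homog k x" "I = genideal Rhat X"
    using assms by (auto simp: homog_ideal_def)
  obtain k where k: "\<And>x. x \<in> X \<Longrightarrow> homog (k x) x" using X(2) by metis
  obtain a where f: "f = (\<Sum>x\<in>X. a x * x)" using assms(2) X by (auto simp: genideal_Rhat)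
  have "hcomp d f = (\<Sum>x\<in>X. (if k x \<le> d then hcomp (d - k x) (a x) else 0) * x)"
    unfolding f hcomp_sum by (rule sum.cong) (auto simp: hcomp_times_homog[OF k])
  then show ?thesis using X by (auto simp: genideal_Rhat)
qed

text \<open>Infinitely many homogeneous components can be collected because each coefficient of the
  multipliers is determined by one of them.\<close>

lemma homog_ideal_closed:
  assumes "homog_ideal I" and comp: "\<And>d. hcomp d f \<in> I"
  shows "f \<in> I"
proof -
  obtain X where X: "finite X" "\<And>x. x \<in> X \<Longrightarrow> \<exists>k. homog k x" "I = genideal Rhat X"
    using assms by (auto simp: homog_ideal_def)
  obtain k where k: "\<And>x. x \<in> X \<Longrightarrow> homog (k x) x" using X(2) by metis
  have "\<exists>a. hcomp d f = (\<Sum>x\<in>X. a x * x)" for d using comp[of d] X by (auto simp: genideal_Rhat)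
  then obtain a where a: "\<And>d. hcomp d f = (\<Sum>x\<in>X. a d x * x)" by metis
  define b where "b x = (\<lambda>m. a (total_degree m + k x) x m)" for x
  have "(b x * x) m = (a (total_degree m) x * x) m" if x: "x \<in> X" for x m
    unfolding times_coeff
    by (rule sum.cong) (use k[OF x] in \<open>auto simp: b_def homog_def\<close>)
  then have "f m = (\<Sum>x\<in>X. b x * x) m" for m
    using fun_cong[OF a[of "total_degree m"], of m] by (simp add: hcomp_def sum_coeff)
  then have "f = (\<Sum>x\<in>X. b x * x)" by (rule ext)
  then show ?thesis using X by (auto simp: genideal_Rhat)
qed

lemma set_add_Rhat: "I <+>\<^bsub>Rhat\<^esub> J = {a + b |a b. a \<in> I \<and> b \<in> J}"
  by (auto simp: set_add_def' mps_ring_simps)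

lemma homog_ideal_add:
  assumes "homog_ideal I" "homog_ideal J"
  shows "homog_ideal (I <+>\<^bsub>Rhat\<^esub> J)"
proof -
  obtain X Y where X: "finite X" "\<forall>x\<in>X. \<exists>k. homog k x" "I = genideal Rhat X"
    and Y: "finite Y" "\<forall>x\<in>Y. \<exists>k. homog k x" "J = genideal Rhat Y"
    using assms unfolding homog_ideal_def by metis
  have I: "ideal I Rhat" and J: "ideal J Rhat" and XY: "ideal (genideal Rhat (X \<union> Y)) Rhat"
    using assms homog_ideal_ideal by (auto intro!: mps.genideal_ideal)
  have "I <+>\<^bsub>Rhat\<^esub> J = genideal Rhat (X \<union> Y)"
  proof
    have "I \<subseteq> genideal Rhat (X \<union> Y)" "J \<subseteq> genideal Rhat (X \<union> Y)"
      unfolding X(3) Y(3) using mps.genideal_self[of "X \<union> Y" UNIV]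
      by (intro mps.genideal_minimal XY; simp)+
    then show "I <+>\<^bsub>Rhat\<^esub> J \<subseteq> genideal Rhat (X \<union> Y)"
      using mps.idealD(2)[OF XY] by (auto simp: set_add_Rhat)
    show "genideal Rhat (X \<union> Y) \<subseteq> I <+>\<^bsub>Rhat\<^esub> J"
    proof (rule mps.genideal_minimal[OF mps.add_ideals[OF I J]], rule subsetI)
      fix x assume "x \<in> X \<union> Y"
      then have "x \<in> I \<or> x \<in> J" using X Y mps.genideal_self[of X UNIV] mps.genideal_self[of Y UNIV] by auto
      then have "\<exists>a b. x = a + b \<and> a \<in> I \<and> b \<in> J"
        using mps.idealD(1)[OF I] mps.idealD(1)[OF J] by (metis add.left_neutral add.right_neutral)
      then show "x \<in> I <+>\<^bsub>Rhat\<^esub> J" by (auto simp: set_add_Rhat)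
    qed
  qed
  then show ?thesis unfolding homog_ideal_def using X Y by (intro exI[of _ "X \<union> Y"]) auto
qed

lemma homog_ideal_prod:
  assumes "homog_ideal I" "homog_ideal J"
  shows "homog_ideal (ideal_prod Rhat I J)"
proof -
  obtain X Y where X: "finite X" "\<forall>x\<in>X. \<exists>k. homog k x" "I = genideal Rhat X"
    and Y: "finite Y" "\<forall>x\<in>Y. \<exists>k. homog k x" "J = genideal Rhat Y"
    using assms unfolding homog_ideal_def by metis
  have I: "ideal I Rhat" and J: "ideal J Rhat"
    using assms homog_ideal_ideal by auto
  let ?Z = "(\<lambda>(x, y). x * y) ` (X \<times> Y)"
  have Z: "ideal (genideal Rhat ?Z) Rhat" by (auto intro!: mps.genideal_ideal)
  have Zs: "x * y \<in> genideal Rhat ?Z" if "x \<in> X" "y \<in> Y" for x y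
    using mps.genideal_self[of ?Z UNIV] that by auto
  have "ideal_prod Rhat I J = genideal Rhat ?Z"
  proof
    show "ideal_prod Rhat I J \<subseteq> genideal Rhat ?Z"
    proof
      fix s assume "s \<in> ideal_prod Rhat I J"
      then show "s \<in> genideal Rhat ?Z"
      proof (induction rule: ideal_prod.induct)
        case (prod i j)
        then obtain a b where "i = (\<Sum>x\<in>X. a x * x)" "j = (\<Sum>y\<in>Y. b y * y)"
          using X Y by (auto simp: genideal_Rhat)
        then have "i * j = (\<Sum>x\<in>X. \<Sum>y\<in>Y. (a x * b y) * (x * y))"
          by (simp add: sum_product mult_ac)
        also have "\<dots> \<in> genideal Rhat ?Z"
          by (intro mps.idealD(7)[OF Z] mps.idealD(3)[OF Z] Zs) auto
        finally show ?case by (simp add: mps_ring_simps)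
      next
        case (sum s t)
        then show ?case unfolding mps_ring_simps by (intro mps.idealD(2)[OF Z])
      qed
    qed
    show "genideal Rhat ?Z \<subseteq> ideal_prod Rhat I J"
    proof (rule mps.genideal_minimal[OF mps.ideal_prod_is_ideal[OF I J]], rule subsetI)
      fix z assume "z \<in> ?Z"
      then obtain x y where "z = x * y" "x \<in> X" "y \<in> Y" by auto
      then have "x \<otimes>\<^bsub>Rhat\<^esub> y \<in> ideal_prod Rhat I J"
        using X Y mps.genideal_self[of X UNIV] mps.genideal_self[of Y UNIV] by (intro ideal_prod.prod) auto
      then show "z \<in> ideal_prod Rhat I J" using \<open>z = x * y\<close> by (simp add: mps_ring_simps)
    qed
  qed
  moreover have "\<exists>k. homog k z" if "z \<in> ?Z" for z using that X Y homog_times by fast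
  ultimately show ?thesis unfolding homog_ideal_def using X Y by (intro exI[of _ ?Z]) auto
qed


section \<open>The contraction action and inverse systems\<close>

type_synonym 'i dual = "('i \<Rightarrow>\<^sub>0 nat) \<Rightarrow>\<^sub>0 complex"

text \<open>Polynomials serve as functionals on power series, as in Macaulay's theory of inverse systems.
  Passing to divided powers, differentiation becomes contraction, so that coefficient spaces can be
  compared with annihilators of ideals.\<close>

definition pair :: "'i series \<Rightarrow> 'i dual \<Rightarrow> complex" where
  "pair f P = (\<Sum>m\<in>Poly_Mapping.keys P. f m * lookup P m)"

lemma pair_superset:
  assumes "finite S" "Poly_Mapping.keys P \<subseteq> S"
  shows "pair f P = (\<Sum>m\<in>S. f m * lookup P m)"
  unfolding pair_def
  by (rule sum.mono_neutral_left) (use assms in \<open>auto simp: in_keys_iff\<close>)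

lemma pair_add_left: "pair (f + g) P = pair f P + pair g P"
  by (simp add: pair_def plus_coeff distrib_right sum.distrib)

lemma pair_zero_left [simp]: "pair 0 P = 0"
  by (simp add: pair_def zero_coeff)

lemma pair_zero_right [simp]: "pair f 0 = 0"
  by (simp add: pair_def)

lemma pair_diff_left: "pair (f - g) P = pair f P - pair g P"
  by (simp add: pair_def left_diff_distrib sum_subtractf)

lemma pair_sum_left: "pair (\<Sum>x\<in>A. f x) P = (\<Sum>x\<in>A. pair (f x) P)"
  by (simp add: pair_def sum_coeff sum_distrib_right sum.swap[of _ A])

lemma pair_const_left: "pair (const c * f) P = c * pair f P"
  by (simp add: pair_def const_eq sum_distrib_left mult.assoc)

lemma pair_mon: "pair (mon p) P = lookup P p"
proof -
  have "pair (mon p) P = (\<Sum>m\<in>insert p (Poly_Mapping.keys P). mon p m * lookup P m)"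
    by (rule pair_superset) auto
  also have "\<dots> = (\<Sum>m\<in>{p}. mon p m * lookup P m)"
    by (rule sum.mono_neutral_right) (auto simp: mon_def)
  finally show ?thesis by (simp add: mon_def)
qed

lemma pair_add_right: "pair f (P + Q) = pair f P + pair f Q"
proof -
  let ?S = "Poly_Mapping.keys P \<union> Poly_Mapping.keys Q"
  have "Poly_Mapping.keys (P + Q) \<subseteq> ?S" by (rule Poly_Mapping.keys_add)
  then show ?thesis
    by (subst (1 2 3) pair_superset[of ?S]) (auto simp: lookup_add distrib_left sum.distrib)
qed

lemma pair_cong: "(\<And>m. m \<in> Poly_Mapping.keys P \<Longrightarrow> f m = g m) \<Longrightarrow> pair f P = pair g P"
  by (simp add: pair_def)

lemma times_coeff_cong: "(\<And>a b. a + b = m \<Longrightarrow> f a = f' a) \<Longrightarrow> (f * g) m = (f' * g) m"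
  unfolding times_coeff by (rule sum.cong) auto

definition below :: "'i dual \<Rightarrow> ('i \<Rightarrow>\<^sub>0 nat) set" where
  "below P = (\<Union>m\<in>Poly_Mapping.keys P. fst ` {(a, b). a + b = m})"

lemma finite_below: "finite (below P)"
  unfolding below_def by (intro finite_UN_I finite_imageI finite_decomp) auto

lemma below_iff: "c \<in> below P \<longleftrightarrow> (\<exists>m\<in>Poly_Mapping.keys P. \<exists>b. c + b = m)"
  by (force simp: below_def)

text \<open>The transpose of multiplication by \<open>f\<close>.\<close>

definition ctr :: "'i series \<Rightarrow> 'i dual \<Rightarrow> 'i dual" where
  "ctr f P = Abs_poly_mapping (\<lambda>c. pair (mon c * f) P)"

lemma pair_mon_times_nonzero: "pair (mon c * f) P \<noteq> 0 \<Longrightarrow> c \<in> below P"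
proof (rule ccontr)
  assume c: "c \<notin> below P" and n: "pair (mon c * f) P \<noteq> 0"
  have "(mon c * f) m = 0" if "m \<in> Poly_Mapping.keys P" for m
    using c that by (intro mon_times_coeff_zero) (auto simp: below_iff)
  then show False using n by (simp add: pair_def)
qed

lemma lookup_ctr: "lookup (ctr f P) c = pair (mon c * f) P"
proof -
  have "finite {c. pair (mon c * f) P \<noteq> 0}"
    by (rule finite_subset[OF _ finite_below]) (use pair_mon_times_nonzero in blast)
  then show ?thesis by (simp add: ctr_def)
qed

text \<open>The action is adjoint to multiplication.  Only the finitely many coefficients of \<open>g\<close> at
  divisors of monomials of \<open>P\<close> matter, so \<open>g\<close> may be replaced by a polynomial.\<close>

lemma pair_ctr: "pair g (ctr f P) = pair (g * f) P"
proof -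
  let ?S = "below P"
  define g' where "g' = (\<Sum>c\<in>?S. const (g c) * mon c)"
  have g': "g' a = (if a \<in> ?S then g a else 0)" for a
    using finite_below[of P] by (auto simp: g'_def sum_coeff const_eq mon_def if_distrib cong: if_cong)
  have "pair g (ctr f P) = (\<Sum>c\<in>?S. g c * lookup (ctr f P) c)"
    by (rule pair_superset[OF finite_below]) (auto simp: in_keys_iff lookup_ctr intro: pair_mon_times_nonzero)
  also have "\<dots> = pair (g' * f) P"
    by (simp add: g'_def sum_distrib_right pair_sum_left mult.assoc pair_const_left lookup_ctr)
  also have "\<dots> = pair (g * f) P"
    by (rule pair_cong, rule times_coeff_cong) (auto simp: g' below_iff)
  finally show ?thesis .
qed

lemma dual_eqI: "(\<And>c. pair (mon c) P = pair (mon c) Q) \<Longrightarrow> P = Q"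
  by (rule poly_mapping_eqI) (simp add: pair_mon)

lemma ctr_times: "ctr (f * g) P = ctr f (ctr g P)"
  by (rule dual_eqI) (simp add: pair_ctr mult.assoc)

lemma ctr_add_left: "ctr (f + g) P = ctr f P + ctr g P"
  by (rule dual_eqI) (simp add: pair_ctr pair_add_right pair_add_left distrib_left)

lemma ctr_add_right: "ctr f (P + Q) = ctr f P + ctr f Q"
  by (rule dual_eqI) (simp add: pair_ctr pair_add_right)

lemma ctr_one [simp]: "ctr 1 P = P"
  by (rule dual_eqI) (simp add: pair_ctr)

lemma ctr_zero_left [simp]: "ctr 0 P = 0" and ctr_zero_right [simp]: "ctr f 0 = 0"
  by (rule dual_eqI, simp add: pair_ctr)+

lemma lookup_ctr_const: "lookup (ctr (const c * f) P) m = c * lookup (ctr f P) m"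
  by (simp add: lookup_ctr mult.left_commute[of _ "const c"] pair_const_left)

lemma ctr_commute: "ctr f (ctr g P) = ctr g (ctr f P)"
  by (metis ctr_times mult.commute)

definition annihil :: "'i series set \<Rightarrow> 'i dual set" where
  "annihil I = {P. \<forall>f\<in>I. pair f P = 0}"

lemma annihil_iff_ctr:
  assumes "ideal I Rhat"
  shows "P \<in> annihil I \<longleftrightarrow> (\<forall>f\<in>I. ctr f P = 0)"
proof
  assume P: "P \<in> annihil I"
  show "\<forall>f\<in>I. ctr f P = 0"
  proof (intro ballI dual_eqI)
    fix f c assume "f \<in> I"
    then have "mon c * f \<in> I" using mps.idealD(3)[OF assms] by simp
    then show "pair (mon c) (ctr f P) = pair (mon c) 0" using P by (simp add: pair_ctr annihil_def)
  qed
next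
  assume *: "\<forall>f\<in>I. ctr f P = 0"
  show "P \<in> annihil I" unfolding annihil_def
  proof (intro CollectI ballI)
    fix f assume "f \<in> I"
    then show "pair f P = 0" using * pair_ctr[of 1 f P] by simp
  qed
qed

lemma annihil_genideal:
  assumes "finite X"
  shows "P \<in> annihil (genideal Rhat X) \<longleftrightarrow> (\<forall>x\<in>X. ctr x P = 0)"
proof
  assume "P \<in> annihil (genideal Rhat X)"
  then show "\<forall>x\<in>X. ctr x P = 0"
    using annihil_iff_ctr[of "genideal Rhat X" P] mps.genideal_self[of X UNIV] mps.genideal_ideal[of X UNIV] by auto
next
  assume *: "\<forall>x\<in>X. ctr x P = 0"
  show "P \<in> annihil (genideal Rhat X)"
    unfolding annihil_def genideal_Rhat[OF assms]
    using * by (auto simp: pair_sum_left pair_ctr[symmetric])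
qed

text \<open>The linear algebra fact that a functional vanishing on the common kernel of finitely many
  functionals is a combination of them.\<close>

lemma functional_combination:
  fixes h :: "'k \<Rightarrow> ('x \<Rightarrow> complex) \<Rightarrow> complex" and lf :: "('x \<Rightarrow> complex) \<Rightarrow> complex"
  assumes "finite F"
    and W: "\<And>c f g. f \<in> W \<Longrightarrow> g \<in> W \<Longrightarrow> (\<lambda>x. c * f x + g x) \<in> W"
    and h: "\<And>k c f g. k \<in> F \<Longrightarrow> f \<in> W \<Longrightarrow> g \<in> W \<Longrightarrow> h k (\<lambda>x. c * f x + g x) = c * h k f + h k g"
    and lf: "\<And>c f g. f \<in> W \<Longrightarrow> g \<in> W \<Longrightarrow> lf (\<lambda>x. c * f x + g x) = c * lf f + lf g"
    and van: "\<And>f. f \<in> W \<Longrightarrow> (\<And>k. k \<in> F \<Longrightarrow> h k f = 0) \<Longrightarrow> lf f = 0"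
  shows "\<exists>a. \<forall>f\<in>W. lf f = (\<Sum>k\<in>F. a k * h k f)"
  using assms
proof (induction F arbitrary: W rule: finite_induct)
  case empty
  then show ?case by simp
next
  case (insert k F)
  show ?case
  proof (cases "\<forall>f\<in>W. h k f = 0")
    case True
    have "\<exists>a. \<forall>f\<in>W. lf f = (\<Sum>k\<in>F. a k * h k f)"
    proof (rule insert.IH)
      show "lf f = 0" if "f \<in> W" "\<And>k. k \<in> F \<Longrightarrow> h k f = 0" for f
        using that True by (intro insert.prems(4)) auto
    qed (use insert.prems in auto)
    then obtain a where "\<forall>f\<in>W. lf f = (\<Sum>k\<in>F. a k * h k f)" by auto
    then show ?thesis using insert.hyps True by (intro exI[of _ a]) simp
  next
    case False
    then obtain g where g: "g \<in> W" "h k g \<noteq> 0" by auto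
    have "\<exists>a. \<forall>f\<in>{f \<in> W. h k f = 0}. lf f = (\<Sum>k\<in>F. a k * h k f)"
    proof (rule insert.IH)
      show "lf f = 0" if "f \<in> {f \<in> W. h k f = 0}" "\<And>k. k \<in> F \<Longrightarrow> h k f = 0" for f
        using insert.prems(4)[of f] that by auto
    qed (use insert.prems in auto)
    then obtain a where a: "\<And>f. f \<in> W \<Longrightarrow> h k f = 0 \<Longrightarrow> lf f = (\<Sum>k\<in>F. a k * h k f)" by auto
    define b where "b = (lf g - (\<Sum>i\<in>F. a i * h i g)) / h k g"
    have "lf f = (\<Sum>i\<in>insert k F. (a(k := b)) i * h i f)" if f: "f \<in> W" for f
    proof -
      define c where "c = - (h k f / h k g)"
      have "h k (\<lambda>x. c * g x + f x) = 0"
        using insert.prems(2)[of k g f c] f g by (simp add: c_def)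
      then have "c * lf g + lf f = (\<Sum>i\<in>F. a i * (c * h i g + h i f))"
        using a[of "\<lambda>x. c * g x + f x"] insert.prems(1)[OF g(1) f] insert.prems(3)[OF g(1) f, of c]
          insert.prems(2)[OF _ g(1) f, of _ c] by simp
      also have "\<dots> = c * (\<Sum>i\<in>F. a i * h i g) + (\<Sum>i\<in>F. a i * h i f)"
        by (simp add: sum.distrib distrib_left sum_distrib_left mult_ac)
      finally have "lf f = - c * (lf g - (\<Sum>i\<in>F. a i * h i g)) + (\<Sum>i\<in>F. a i * h i f)"
        by (simp add: algebra_simps)
      also have "- c * (lf g - (\<Sum>i\<in>F. a i * h i g)) = b * h k f"
        by (simp add: c_def b_def)
      also have "(\<Sum>i\<in>F. a i * h i f) = (\<Sum>i\<in>F. (a(k := b)) i * h i f)"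
        using insert.hyps by (intro sum.cong) auto
      finally show ?thesis using insert.hyps by simp
    qed
    then show ?thesis by blast
  qed
qed

lemma affine_eq: "(\<lambda>x. c * f x + g x) = const c * f + g" for f g :: "'i series"
  by (simp add: const_eq plus_fun_def)

text \<open>A functional on a space of series that only depends on finitely many coefficients is the
  pairing with a dual polynomial.\<close>

lemma functional_as_pair:
  fixes W :: "'i series set"
  assumes "finite F"
    and W: "\<And>c f g. f \<in> W \<Longrightarrow> g \<in> W \<Longrightarrow> const c * f + g \<in> W"
    and lf: "\<And>c f g. f \<in> W \<Longrightarrow> g \<in> W \<Longrightarrow> lf (const c * f + g) = c * lf f + lf g"
    and van: "\<And>f. f \<in> W \<Longrightarrow> (\<And>m. m \<in> F \<Longrightarrow> f m = 0) \<Longrightarrow> lf f = 0"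
  obtains P where "\<And>f. f \<in> W \<Longrightarrow> lf f = pair f P"
proof -
  have "\<exists>a. \<forall>f\<in>W. lf f = (\<Sum>m\<in>F. a m * f m)"
    by (rule functional_combination[where h = "\<lambda>m f. f m"]) (use assms in \<open>auto simp: affine_eq\<close>)
  then obtain a where a: "\<And>f. f \<in> W \<Longrightarrow> lf f = (\<Sum>m\<in>F. a m * f m)" by auto
  define P where "P = Abs_poly_mapping (\<lambda>m. if m \<in> F then a m else 0)"
  have lP: "lookup P m = (if m \<in> F then a m else 0)" for m
    using \<open>finite F\<close> by (simp add: P_def)
  have "lf f = pair f P" if "f \<in> W" for f
  proof -
    have "pair f P = (\<Sum>m\<in>F. f m * lookup P m)"
      by (rule pair_superset[OF \<open>finite F\<close>]) (auto simp: in_keys_iff lP split: if_splits)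
    then show ?thesis using a[OF that] by (simp add: lP mult.commute)
  qed
  then show thesis using that by blast
qed

lemma finite_degree_le: "finite {m :: 'n::finite \<Rightarrow>\<^sub>0 nat. total_degree m \<le> d}"
  using finite_total_degree_le[of "UNIV :: 'n set" d] by simp

lemma hcomp_eq_zero: "(\<And>m. total_degree m \<le> D \<Longrightarrow> f m = 0) \<Longrightarrow> d \<le> D \<Longrightarrow> hcomp d f = 0"
  by (auto simp: hcomp_def series_eq_iff)

lemma hcomp_const_times: "hcomp d (const c * f) = const c * hcomp d f"
  by (auto simp: hcomp_def const_eq series_eq_iff)

text \<open>Some homogeneous component of \<open>f\<close> lies outside \<open>I\<close>.  On \<open>I + \<complex> f\<close> the multiple of \<open>f\<close> can be
  read off modulo \<open>I\<close> from the component of that degree, hence from finitely many coefficients.\<close>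

lemma separation:
  fixes I :: "'n::finite series set"
  assumes hI: "homog_ideal I" and f: "f \<notin> I"
  obtains P where "P \<in> annihil I" "pair f P \<noteq> 0"
proof -
  note D = mps.idealD[OF homog_ideal_ideal[OF hI]]
  obtain d where d: "hcomp d f \<notin> I" using homog_ideal_closed[OF hI] f by auto
  define W where "W = {h. \<exists>c. h - const c * f \<in> I}"
  define lf where "lf h = (SOME c. h - const c * f \<in> I)" for h
  have Icf: "const c * g \<in> I" if "g \<in> I" for c g using D(3)[OF that] by simp
  have zero: "c = 0" if "hcomp d (const c * f) \<in> I" for c
  proof (rule ccontr)
    assume "c \<noteq> 0"
    then have "const (1 / c) * (const c * hcomp d f) = hcomp d f"
      by (simp add: const_mult[symmetric] flip: mult.assoc)
    then show False using Icf[OF that, of "1 / c"] d by (simp add: hcomp_const_times)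
  qed
  have uniq: "lf h = c" if "h - const c * f \<in> I" for h c
  proof -
    have "h - const (lf h) * f \<in> I"
      unfolding lf_def by (rule someI[of "\<lambda>c. h - const c * f \<in> I"], fact that)
    from D(5)[OF this that] have "(const c - const (lf h)) * f \<in> I"
      by (simp add: algebra_simps)
    moreover have "const c - const (lf h) = const (c - lf h)"
      using const_add[of "c - lf h" "lf h"] by (metis add_diff_cancel_right' diff_add_cancel)
    ultimately have "const (c - lf h) * f \<in> I" by metis
    then have "hcomp d (const (c - lf h) * f) \<in> I" by (rule homog_ideal_comp[OF hI])
    then show ?thesis using zero by fastforce
  qed
  obtain P where P: "\<And>h. h \<in> W \<Longrightarrow> lf h = pair h P"
  proof (rule functional_as_pair[OF finite_degree_le[of d], of W lf])
    fix c g h assume g: "g \<in> W" and h: "h \<in> W"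
    obtain a b where a: "g - const a * f \<in> I" and b: "h - const b * f \<in> I" using g h by (auto simp: W_def)
    have "const c * (g - const a * f) + (h - const b * f) \<in> I" by (intro D(2) Icf a b)
    moreover have "const c * (g - const a * f) + (h - const b * f) = (const c * g + h) - const (c * a + b) * f"
      by (simp add: const_add const_mult algebra_simps)
    ultimately have *: "(const c * g + h) - const (c * a + b) * f \<in> I" by simp
    then show "const c * g + h \<in> W" by (auto simp: W_def)
    show "lf (const c * g + h) = c * lf g + lf h"
      using uniq[OF *] uniq[OF a] uniq[OF b] by simp
  next
    fix h assume h: "h \<in> W" and 0: "\<And>m. m \<in> {m. total_degree m \<le> d} \<Longrightarrow> h m = 0"
    obtain c where c: "h - const c * f \<in> I" using h by (auto simp: W_def)
    have "hcomp d h = 0" using 0 by (auto simp: hcomp_def series_eq_iff)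
    moreover have "h = (h - const c * f) + const c * f" by simp
    ultimately have "hcomp d (h - const c * f) + hcomp d (const c * f) = 0" by (metis hcomp_add)
    then have "hcomp d (const c * f) = - hcomp d (h - const c * f)" by (simp add: add_eq_0_iff)
    then have "hcomp d (const c * f) \<in> I" using homog_ideal_comp[OF hI c] D(4) by metis
    then show "lf h = 0" using zero uniq[OF c] by simp
  qed blast
  have "P \<in> annihil I" unfolding annihil_def
  proof (intro CollectI ballI)
    fix g assume "g \<in> I"
    then have *: "g - const 0 * f \<in> I" by simp
    then have "g \<in> W" unfolding W_def by blast
    then show "pair g P = 0" using P[of g] uniq[OF *] by simp
  qed
  moreover have "pair f P \<noteq> 0"
  proof -
    have *: "f - const 1 * f \<in> I" using D(1) by simp
    then have "f \<in> W" unfolding W_def by blast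
    then show ?thesis using P[of f] uniq[OF *] by simp
  qed
  ultimately show thesis using that by blast
qed

lemma pair_hcomp_sum:
  assumes "\<And>m. m \<in> Poly_Mapping.keys P \<Longrightarrow> total_degree m \<le> D"
  shows "pair f P = (\<Sum>d\<le>D. pair (hcomp d f) P)"
proof -
  have "pair f P = pair (\<Sum>d\<le>D. hcomp d f) P"
    by (rule pair_cong) (use assms in \<open>auto simp: sum_coeff hcomp_def\<close>)
  then show ?thesis by (simp add: pair_sum_left)
qed

text \<open>The functional \<open>w + g e \<mapsto> \<langle>g e, P\<rangle>\<close> on \<open>W + eR\<close> is well defined if no multiple of \<open>e\<close>
  in \<open>W\<close> pairs with \<open>P\<close>; by homogeneity it only sees low degrees.\<close>

lemma extend_annihilator:
  fixes W :: "'n::finite series set"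
  assumes hW: "homog_ideal W" and e: "homog k e"
    and P: "\<And>g. g * e \<in> W \<Longrightarrow> pair (g * e) P = 0"
  obtains P' where "P' \<in> annihil W" "ctr e P' = ctr e P"
proof -
  note D = mps.idealD[OF homog_ideal_ideal[OF hW]]
  define V where "V = {h. \<exists>g. h - g * e \<in> W}"
  define lf where "lf h = pair ((SOME g. h - g * e \<in> W) * e) P" for h
  have uniq: "lf h = pair (g * e) P" if g: "h - g * e \<in> W" for h g
  proof -
    let ?g = "SOME g. h - g * e \<in> W"
    have "h - ?g * e \<in> W" by (rule someI[of "\<lambda>g. h - g * e \<in> W"], fact g)
    from D(5)[OF g this] have "(?g - g) * e \<in> W" by (simp add: algebra_simps)
    then have "pair ((?g - g) * e) P = 0" by (rule P)
    then show ?thesis by (simp add: lf_def left_diff_distrib pair_diff_left)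
  qed
  define d where "d = (\<Sum>m\<in>Poly_Mapping.keys P. total_degree m)"
  have degP: "total_degree m \<le> d" if "m \<in> Poly_Mapping.keys P" for m
    unfolding d_def by (rule member_le_sum) (use that in auto)
  obtain P' where P': "\<And>h. h \<in> V \<Longrightarrow> lf h = pair h P'"
  proof (rule functional_as_pair[OF finite_degree_le[of d], of V lf])
    fix c g h assume g: "g \<in> V" and h: "h \<in> V"
    obtain a b where a: "g - a * e \<in> W" and b: "h - b * e \<in> W" using g h by (auto simp: V_def)
    have "const c * (g - a * e) + (h - b * e) \<in> W" by (intro D(2,3) a b) simp
    moreover have "const c * (g - a * e) + (h - b * e) = (const c * g + h) - (const c * a + b) * e"
      by (simp add: algebra_simps)
    ultimately have *: "(const c * g + h) - (const c * a + b) * e \<in> W" by simp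
    then show "const c * g + h \<in> V" by (auto simp: V_def)
    show "lf (const c * g + h) = c * lf g + lf h"
      using uniq[OF *] uniq[OF a] uniq[OF b]
      by (simp add: distrib_right pair_add_left mult.assoc pair_const_left)
  next
    fix h assume h: "h \<in> V" and 0: "\<And>m. m \<in> {m. total_degree m \<le> d} \<Longrightarrow> h m = 0"
    obtain g where g: "h - g * e \<in> W" using h by (auto simp: V_def)
    have "pair (hcomp i (g * e)) P = 0" if i: "i \<le> d" for i
    proof -
      have "hcomp i h = 0" by (rule hcomp_eq_zero[OF _ i]) (use 0 in auto)
      moreover have "h = (h - g * e) + g * e" by simp
      ultimately have "hcomp i (h - g * e) + hcomp i (g * e) = 0" by (metis hcomp_add)
      then have "hcomp i (g * e) = - hcomp i (h - g * e)" by (simp add: add_eq_0_iff)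
      then have "hcomp i (g * e) \<in> W" using homog_ideal_comp[OF hW g] D(4) by metis
      then show ?thesis unfolding hcomp_times_homog[OF e] using P by (auto split: if_splits)
    qed
    then have "pair (g * e) P = 0" using pair_hcomp_sum[where P = P and D = d and f = "g * e"] degP by simp
    then show "lf h = 0" using uniq[OF g] by simp
  qed blast
  have "P' \<in> annihil W" unfolding annihil_def
  proof (intro CollectI ballI)
    fix w assume "w \<in> W"
    then have *: "w - 0 * e \<in> W" by simp
    then have "w \<in> V" unfolding V_def by blast
    then show "pair w P' = 0" using P'[of w] uniq[OF *] by simp
  qed
  moreover have "ctr e P' = ctr e P"
  proof (rule dual_eqI)
    fix c
    have *: "mon c * e - mon c * e \<in> W" using D(1) by simp
    then have "mon c * e \<in> V" unfolding V_def by blast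
    then show "pair (mon c) (ctr e P') = pair (mon c) (ctr e P)"
      using P'[of "mon c * e"] uniq[OF *] by (simp add: pair_ctr)
  qed
  ultimately show thesis using that by blast
qed


lemma const_coeff: "(const c * f) m = c * f m"
  by (simp add: const_eq)

section \<open>Linear substitutions\<close>

definition lmon :: "'i set \<Rightarrow> ('i \<Rightarrow> 'k series) \<Rightarrow> ('i \<Rightarrow>\<^sub>0 nat) \<Rightarrow> 'k series" where
  "lmon V l m = (\<Prod>j\<in>V. l j ^ lookup m j)"

definition lsub :: "'i set \<Rightarrow> ('i \<Rightarrow> 'k series) \<Rightarrow> 'i series \<Rightarrow> 'k series" where
  "lsub V l f = (\<lambda>q. \<Sum>m | total_degree m = total_degree q \<and> Poly_Mapping.keys m \<subseteq> V. f m * lmon V l m q)"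

lemma lmon_zero [simp]: "lmon V l 0 = 1"
  by (simp add: lmon_def)

lemma lmon_add: "lmon V l (a + b) = lmon V l a * lmon V l b"
  by (simp add: lmon_def lookup_add power_add prod.distrib)

lemma lmon_single: "finite V \<Longrightarrow> j \<in> V \<Longrightarrow> lmon V l (Poly_Mapping.single j 1) = l j"
proof -
  assume V: "finite V" "j \<in> V"
  have "(\<Prod>i\<in>V - {j}. l i ^ lookup (Poly_Mapping.single j 1) i) = 1"
    by (rule prod.neutral) (auto simp: lookup_single when_def)
  then show ?thesis
    unfolding lmon_def using prod.remove[OF V, of "\<lambda>i. l i ^ lookup (Poly_Mapping.single j 1) i"] by simp
qed

lemma lmon_cong: "(\<And>j. j \<in> V \<Longrightarrow> l j = l' j) \<Longrightarrow> lmon V l m = lmon V l' m"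
  by (simp add: lmon_def)

lemma var_power: "var j ^ k = mon (Poly_Mapping.single j k)"
  by (induction k) (simp_all add: mon_zero var_def mon_times_mon flip: single_add)

lemma lmon_var:
  assumes "finite V" "Poly_Mapping.keys m \<subseteq> V"
  shows "lmon V var m = mon m"
proof -
  have "m = (\<Sum>j\<in>V. Poly_Mapping.single j (lookup m j))"
    by (rule poly_mapping_eqI)
      (use assms in \<open>auto simp: lookup_sum lookup_single when_def in_keys_iff\<close>)
  then show ?thesis by (simp add: lmon_def var_power prod_mon)
qed

context
  fixes V :: "'i set" and l :: "'i \<Rightarrow> 'k series"
  assumes V: "finite V" and l: "\<And>j. j \<in> V \<Longrightarrow> homog 1 (l j)"
begin

lemma homog_lmon:
  assumes "Poly_Mapping.keys m \<subseteq> V"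
  shows "homog (total_degree m) (lmon V l m)"
  unfolding total_degree_superset[OF V assms] lmon_def
  by (rule homog_prod) (use homog_power[OF l] in auto)

lemma finite_exponents: "finite {m :: 'i \<Rightarrow>\<^sub>0 nat. total_degree m = d \<and> Poly_Mapping.keys m \<subseteq> V}"
  by (rule finite_subset[OF _ finite_total_degree_le[OF V, of d]]) auto

lemma lsub_truncate:
  assumes "total_degree q \<le> d"
  shows "lsub V l f q = (\<Sum>m | total_degree m \<le> d \<and> Poly_Mapping.keys m \<subseteq> V. const (f m) * lmon V l m) q"
proof -
  have "(\<Sum>m | total_degree m \<le> d \<and> Poly_Mapping.keys m \<subseteq> V. const (f m) * lmon V l m) q
      = (\<Sum>m | total_degree m \<le> d \<and> Poly_Mapping.keys m \<subseteq> V. f m * lmon V l m q)"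
    by (simp add: sum_coeff const_eq)
  also have "\<dots> = lsub V l f q" unfolding lsub_def
    by (rule sum.mono_neutral_right[OF finite_total_degree_le[OF V]])
      (use assms homog_lmon in \<open>auto simp: homog_def\<close>)
  finally show ?thesis by simp
qed

lemma lsub_add: "lsub V l (f + g) = lsub V l f + lsub V l g"
  by (simp add: lsub_def series_eq_iff distrib_right sum.distrib)

lemma lsub_const: "lsub V l (const c * f) = const c * lsub V l f"
  by (simp add: lsub_def series_eq_iff const_eq sum_distrib_left mult.assoc)

lemma lsub_zero: "lsub V l 0 = 0"
  by (simp add: lsub_def series_eq_iff)

lemma lsub_uminus: "lsub V l (- f) = - lsub V l f"
  by (simp add: lsub_def series_eq_iff sum_negf)

lemma lsub_diff: "lsub V l (f - g) = lsub V l f - lsub V l g"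
  using lsub_add[of f "- g"] lsub_uminus[of g] by simp

lemma lsub_sum: "lsub V l (\<Sum>x\<in>A. f x) = (\<Sum>x\<in>A. lsub V l (f x))"
  by (induction A rule: infinite_finite_induct) (simp_all add: lsub_add lsub_zero)

lemma lsub_mon:
  assumes "Poly_Mapping.keys p \<subseteq> V"
  shows "lsub V l (mon p) = lmon V l p"
proof
  fix q
  have "lsub V l (mon p) q = (\<Sum>m | total_degree m = total_degree q \<and> Poly_Mapping.keys m \<subseteq> V.
      if m = p then lmon V l p q else 0)"
    unfolding lsub_def by (rule sum.cong) (auto simp: mon_def)
  also have "\<dots> = lmon V l p q"
    using finite_exponents assms homog_lmon[OF assms] by (auto simp: homog_def)
  finally show "lsub V l (mon p) q = lmon V l p q" .
qed

lemma lsub_var: "j \<in> V \<Longrightarrow> lsub V l (var j) = l j"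
  unfolding var_def using lmon_single[OF V, of j l] by (subst lsub_mon) auto

lemma lsub_one: "lsub V l 1 = 1"
  using lsub_mon[of 0] by (simp add: mon_zero)

lemma hcomp_lsub: "hcomp d (lsub V l f) = lsub V l (hcomp d f)"
  by (auto simp: hcomp_def lsub_def series_eq_iff intro!: sum.cong)

lemma homog_lsub: "homog k f \<Longrightarrow> homog k (lsub V l f)"
  by (auto simp: homog_def lsub_def elim!: sum.not_neutral_contains_not_neutral)

lemma lsub_times:
  assumes f: "f \<in> carrier (mps_ring V)" and g: "g \<in> carrier (mps_ring V)"
  shows "lsub V l (f * g) = lsub V l f * lsub V l g"
proof
  fix q :: "'k \<Rightarrow>\<^sub>0 nat"
  define d where "d = total_degree q"
  let ?M = "{m. total_degree m \<le> d \<and> Poly_Mapping.keys m \<subseteq> V}"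
  let ?E = "{m. total_degree m = d \<and> Poly_Mapping.keys m \<subseteq> V}"
  let ?S = "{(a, b). total_degree (a + b) = d \<and> Poly_Mapping.keys a \<subseteq> V \<and> Poly_Mapping.keys b \<subseteq> V}"
  let ?T = "\<lambda>f. \<Sum>m\<in>?M. const (f m) * lmon V l m"
  have fV: "f a = 0 \<or> Poly_Mapping.keys a \<subseteq> V" and gV: "g a = 0 \<or> Poly_Mapping.keys a \<subseteq> V" for a
    using f g by (auto simp: mps_ring_simps)
  have kadd: "Poly_Mapping.keys (a + b) = Poly_Mapping.keys a \<union> Poly_Mapping.keys b" for a b :: "'i \<Rightarrow>\<^sub>0 nat"
    by (auto simp: in_keys_iff lookup_add)
  have fin: "finite ?S"
    by (rule finite_subset[of _ "?M \<times> ?M"]) (use finite_total_degree_le[OF V, of d] in auto)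
  have "lsub V l (f * g) q = (\<Sum>m\<in>?E. \<Sum>p\<in>{(a, b). a + b = m}. f (fst p) * g (snd p) * lmon V l m q)"
    by (simp add: lsub_def d_def times_coeff sum_distrib_right case_prod_unfold)
  also have "\<dots> = (\<Sum>(m, p)\<in>(SIGMA m:?E. {(a, b). a + b = m}). f (fst p) * g (snd p) * lmon V l m q)"
    by (rule sum.Sigma) (auto intro: finite_exponents finite_decomp)
  also have "\<dots> = (\<Sum>(a, b)\<in>?S. f a * g b * lmon V l (a + b) q)"
    by (rule sum.reindex_bij_witness[of _ "\<lambda>(a, b). (a + b, (a, b))" snd]) (auto simp: kadd)
  also have "\<dots> = (\<Sum>(a, b)\<in>?M \<times> ?M. f a * g b * lmon V l (a + b) q)"
  proof (rule sum.mono_neutral_left)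
    show "\<forall>i\<in>?M \<times> ?M - ?S. (case i of (a, b) \<Rightarrow> f a * g b * lmon V l (a + b) q) = 0"
    proof (rule ballI)
      fix p assume "p \<in> ?M \<times> ?M - ?S"
      then obtain a b where p: "p = (a, b)"
        and ab: "Poly_Mapping.keys a \<subseteq> V" "Poly_Mapping.keys b \<subseteq> V" "(a, b) \<notin> ?S" by auto
      then have "total_degree (a + b) \<noteq> total_degree q" by (simp add: d_def)
      moreover have "Poly_Mapping.keys (a + b) \<subseteq> V" using ab by (simp add: kadd)
      ultimately have "lmon V l (a + b) q = 0" using homog_lmon[of "a + b"] by (auto simp: homog_def)
      then show "(case p of (a, b) \<Rightarrow> f a * g b * lmon V l (a + b) q) = 0" by (simp add: p)
    qed
  qed (use finite_total_degree_le[OF V, of d] in auto)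
  also have "\<dots> = (?T f * ?T g) q"
  proof -
    have "const (f a) * lmon V l a * (const (g b) * lmon V l b) = const (f a * g b) * lmon V l (a + b)" for a b
      by (simp add: const_mult lmon_add mult_ac)
    then show ?thesis
      by (simp add: sum_product sum.cartesian_product[symmetric] sum_coeff const_eq)
  qed
  also have "\<dots> = (lsub V l f * lsub V l g) q"
    unfolding times_coeff[of "?T f"] times_coeff[of "lsub V l f"]
  proof (rule sum.cong[OF refl])
    fix p assume "p \<in> {(a, b). a + b = q}"
    then obtain a b where p: "p = (a, b)" "a + b = q" by auto
    then have "total_degree a \<le> d" "total_degree b \<le> d" by (auto simp: d_def)
    then show "(case p of (a, b) \<Rightarrow> ?T f a * ?T g b) = (case p of (a, b) \<Rightarrow> lsub V l f a * lsub V l g b)"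
      by (simp only: p prod.case lsub_truncate)
  qed
  finally show "lsub V l (f * g) q = (lsub V l f * lsub V l g) q" .
qed

lemma lsub_carrier:
  assumes "\<And>j. j \<in> V \<Longrightarrow> l j \<in> carrier (mps_ring W)"
  shows "lsub V l f \<in> carrier (mps_ring W)"
proof -
  have "lmon V l m \<in> carrier (mps_ring W)" for m
    unfolding lmon_def by (intro mps.prod_closed mps.power_closed assms)
  then show ?thesis
    by (fastforce simp: lsub_def mps_ring_simps elim!: sum.not_neutral_contains_not_neutral)
qed

end

lemma lsub_lsub:
  fixes l' :: "'k \<Rightarrow> 'm series"
  assumes V: "finite V" and l: "\<And>j. j \<in> V \<Longrightarrow> homog 1 (l j)"
    and W: "finite W" and l': "\<And>j. j \<in> W \<Longrightarrow> homog 1 (l' j)" and lW: "\<And>j. j \<in> V \<Longrightarrow> l j \<in> carrier (mps_ring W)"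
  shows "lsub W l' (lsub V l f) = lsub V (\<lambda>j. lsub W l' (l j)) f"
proof
  fix q :: "'m \<Rightarrow>\<^sub>0 nat"
  let ?d = "total_degree q" and ?l = "\<lambda>j. lsub W l' (l j)"
  let ?T = "\<Sum>m | total_degree m \<le> total_degree q \<and> Poly_Mapping.keys m \<subseteq> V. const (f m) * lmon V l m"
  have l2: "homog 1 (?l j)" if "j \<in> V" for j using homog_lsub[OF W l' l[OF that]] .
  have pow: "lsub W l' (l j ^ k) = ?l j ^ k" if "j \<in> V" for j k
    by (induction k)
      (simp_all add: lsub_one[OF W l'] lsub_times[OF W l' lW[OF that] mps.power_closed[OF lW[OF that]]])
  have "lsub W l' (\<Prod>j\<in>A. l j ^ lookup m j) = (\<Prod>j\<in>A. ?l j ^ lookup m j)" if "A \<subseteq> V" for A m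
    using finite_subset[OF that V] that
  proof (induction A rule: finite_induct)
    case (insert j A)
    then have "lsub W l' (l j ^ lookup m j * (\<Prod>j\<in>A. l j ^ lookup m j))
        = lsub W l' (l j ^ lookup m j) * lsub W l' (\<Prod>j\<in>A. l j ^ lookup m j)"
      by (intro lsub_times[OF W l'] mps.power_closed mps.prod_closed lW) auto
    then show ?case using insert by (simp add: pow)
  qed (simp add: lsub_one[OF W l'])
  then have lm: "lsub W l' (lmon V l m) = lmon V ?l m" for m by (simp add: lmon_def)
  have "lsub W l' (lsub V l f) q = lsub W l' ?T q"
    unfolding lsub_def[of W] by (rule sum.cong) (simp_all add: lsub_truncate[OF V l, where d = ?d])
  also have "\<dots> = (\<Sum>m | total_degree m \<le> total_degree q \<and> Poly_Mapping.keys m \<subseteq> V. const (f m) * lmon V ?l m) q"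
    by (simp add: lsub_sum[OF W l'] lsub_const[OF W l'] lm)
  also have "\<dots> = lsub V ?l f q" by (rule lsub_truncate[OF V l2, symmetric]) auto
  finally show "lsub W l' (lsub V l f) q = lsub V ?l f q" .
qed

lemma lsub_var_id:
  assumes V: "finite V" and f: "f \<in> carrier (mps_ring V)"
  shows "lsub V var f = f"
proof
  fix q
  have *: "lsub V var f q = (\<Sum>m | total_degree m = total_degree q \<and> Poly_Mapping.keys m \<subseteq> V. if m = q then f q else 0)"
    unfolding lsub_def by (rule sum.cong) (auto simp: lmon_var[OF V] mon_def)
  have fin: "finite {m. total_degree m = total_degree q \<and> Poly_Mapping.keys m \<subseteq> V}"
    by (rule finite_subset[OF _ finite_total_degree_le[OF V, of "total_degree q"]]) auto
  show "lsub V var f q = f q" unfolding * using f fin by (auto simp: mps_ring_simps)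
qed

lemma homog_var: "homog 1 (var j)"
  using homog_mon[of "Poly_Mapping.single j 1"] by (simp add: var_def)


section \<open>Partial derivatives of series\<close>

definition pd :: "'i \<Rightarrow> 'i series \<Rightarrow> 'i series" where
  "pd j f = (\<lambda>m. of_nat (lookup m j + 1) * f (m + Poly_Mapping.single j 1))"

lemma pd_sum: "pd j (\<Sum>x\<in>A. f x) = (\<Sum>x\<in>A. pd j (f x))"
  by (simp add: pd_def series_eq_iff sum_coeff sum_distrib_left)

lemma pd_const: "pd j (const c * f) = const c * pd j f"
  by (simp add: pd_def series_eq_iff const_eq)

lemma pd_times: "pd j (f * g) = pd j f * g + f * pd j g"
proof
  fix m
  let ?e = "Poly_Mapping.single j (1::nat)"
  let ?D = "{(a, b). a + b = m + ?e}"
  have shift: "(\<Sum>(a, b)\<in>?D. of_nat (lookup a j) * f a * g b) = (\<Sum>(a, b) | a + b = m. pd j f a * g b)" for f g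
  proof -
    have "(\<Sum>(a, b)\<in>?D. of_nat (lookup a j) * f a * g b)
        = (\<Sum>(a, b)\<in>{(a, b). a + b = m + ?e \<and> lookup a j \<noteq> 0}. of_nat (lookup a j) * f a * g b)"
      by (rule sum.mono_neutral_right[OF finite_decomp]) auto
    also have "\<dots> = (\<Sum>(a, b) | a + b = m. pd j f a * g b)"
    proof (rule sum.reindex_bij_witness[of _ "\<lambda>(a, b). (a + ?e, b)" "\<lambda>(a, b). (a - ?e, b)"])
      fix p assume p: "p \<in> {(a, b). a + b = m + ?e \<and> lookup a j \<noteq> 0}"
      obtain a b where ab: "p = (a, b)" "a + b = m + ?e" "lookup a j \<noteq> 0" using p by auto
      have "a - ?e + ?e = a"
        by (rule poly_mapping_eqI) (use ab in \<open>auto simp: lookup_add lookup_minus lookup_single when_def\<close>)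
      then have a: "a = (a - ?e) + ?e" by simp
      then have "(a - ?e) + b + ?e = m + ?e" using ab(2) by (metis add.assoc add.commute)
      then have "(a - ?e) + b = m" by simp
      then show "(case p of (a, b) \<Rightarrow> (a - ?e, b)) \<in> {(a, b). a + b = m}" using ab by simp
      show "(case case p of (a, b) \<Rightarrow> (a - ?e, b) of (a, b) \<Rightarrow> (a + ?e, b)) = p"
        using ab a by simp
      have "lookup (a - ?e) j + 1 = lookup a j"
        using ab by (simp add: lookup_minus lookup_single)
      then have L: "complex_of_nat (lookup (a - ?e) j + 1) = of_nat (lookup a j)" by (rule arg_cong)
      show "(case case p of (a, b) \<Rightarrow> (a - ?e, b) of (a, b) \<Rightarrow> pd j f a * g b)
          = (case p of (a, b) \<Rightarrow> of_nat (lookup a j) * f a * g b)"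
        by (simp only: ab prod.case pd_def L a[symmetric])
    next
      fix p assume "p \<in> {(a, b). a + b = m}"
      then show "(case p of (a, b) \<Rightarrow> (a + ?e, b)) \<in> {(a, b). a + b = m + ?e \<and> lookup a j \<noteq> 0}"
        by (auto simp: lookup_add lookup_single ac_simps)
    qed (auto)
    finally show ?thesis .
  qed
  have "pd j (f * g) m = (\<Sum>(a, b)\<in>?D. of_nat (lookup m j + 1) * (f a * g b))"
    by (simp add: pd_def times_coeff sum_distrib_left case_prod_unfold)
  also have "\<dots> = (\<Sum>(a, b)\<in>?D. of_nat (lookup a j) * f a * g b + of_nat (lookup b j) * g b * f a)"
  proof (rule sum.cong[OF refl], clarify)
    fix a b assume "a + b = m + ?e"
    then have "lookup (a + b) j = lookup (m + ?e) j" by simp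
    then have "lookup m j + 1 = lookup a j + lookup b j" by (simp add: lookup_add lookup_single)
    then show "of_nat (lookup m j + 1) * (f a * g b) = of_nat (lookup a j) * f a * g b + of_nat (lookup b j) * g b * f a"
      by (simp add: algebra_simps flip: of_nat_add) (simp add: algebra_simps)
  qed
  also have "\<dots> = (\<Sum>(a, b)\<in>?D. of_nat (lookup a j) * f a * g b) + (\<Sum>(a, b)\<in>?D. of_nat (lookup b j) * g b * f a)"
    by (simp add: sum.distrib case_prod_unfold)
  also have "(\<Sum>(a, b)\<in>?D. of_nat (lookup b j) * g b * f a) = (\<Sum>(a, b)\<in>?D. of_nat (lookup a j) * g a * f b)"
    by (rule sum.reindex_bij_witness[of _ prod.swap prod.swap]) (auto simp: add.commute)
  finally show "pd j (f * g) m = (pd j f * g + f * pd j g) m"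
    unfolding shift by (simp only: times_coeff[symmetric] plus_coeff mult.commute[of f "pd j g"])
qed

lemma pd_one: "pd j 1 = 0"
proof
  fix m :: "'a \<Rightarrow>\<^sub>0 nat"
  have "total_degree (m + Poly_Mapping.single j 1) \<noteq> 0" by (simp only: total_degree_add total_degree_single)
  then have "m + Poly_Mapping.single j 1 \<noteq> 0" by (metis total_degree_zero)
  then show "pd j 1 m = 0 m" by (simp add: pd_def one_fun_def zero_coeff)
qed

lemma pd_var: "pd k (var j) = (if j = k then 1 else 0)"
proof
  fix m :: "'a \<Rightarrow>\<^sub>0 nat"
  have "m + Poly_Mapping.single k 1 = Poly_Mapping.single j 1 \<longleftrightarrow> j = k \<and> m = 0"
  proof
    assume *: "m + Poly_Mapping.single k 1 = Poly_Mapping.single j 1"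
    have "lookup (m + Poly_Mapping.single k 1) k = lookup (Poly_Mapping.single j 1) k" using * by simp
    then have "j = k" by (auto simp: lookup_add lookup_single when_def split: if_splits)
    then show "j = k \<and> m = 0" using * by simp
  qed simp
  then show "pd k (var j) m = (if j = k then 1 else 0) m"
    by (auto simp: pd_def var_def mon_def one_fun_def zero_coeff)
qed

lemma of_nat_series: "of_nat n = const (of_nat n)"
  by (induction n) (simp_all add: const_add)

lemma pd_power: "pd j (f ^ n) = const (of_nat n) * f ^ (n - 1) * pd j f"
proof (induction n)
  case (Suc n)
  have "pd j (f ^ Suc n) = pd j f * f ^ n + f * pd j (f ^ n)" by (simp add: pd_times)
  also have "f * pd j (f ^ n) = const (of_nat n) * f ^ n * pd j f"
    unfolding Suc by (cases n) (simp_all add: mult_ac)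
  also have "pd j f * f ^ n + const (of_nat n) * f ^ n * pd j f = (const 1 + const (of_nat n)) * f ^ n * pd j f"
    by (simp only: distrib_right const_1 mult_1_left) (simp only: mult_ac)
  also have "const 1 + const (of_nat n) = const (of_nat (Suc n))" by (simp only: of_nat_Suc const_add)
  finally show ?case by (simp only: diff_Suc_1)
qed (simp add: pd_one)

lemma pd_lmon:
  assumes J: "finite J" and m: "Poly_Mapping.keys m \<subseteq> J" and b: "\<And>j. j \<in> J \<Longrightarrow> pd k (l j) = const (b j)"
  shows "pd k (lmon J l m) = (\<Sum>j\<in>J. const (of_nat (lookup m j) * b j) * lmon J l (m - Poly_Mapping.single j 1))"
proof -
  have P: "pd k (\<Prod>j\<in>A. l j ^ lookup m j) = (\<Sum>j\<in>A. const (of_nat (lookup m j) * b j) *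
      (l j ^ (lookup m j - 1) * (\<Prod>i\<in>A - {j}. l i ^ lookup m i)))" if "A \<subseteq> J" for A
    using finite_subset[OF that J] that
  proof (induction A rule: finite_induct)
    case empty
    then show ?case by (simp add: pd_one)
  next
    case (insert a A)
    have eq: "(\<Prod>i\<in>insert a A - {j}. l i ^ lookup m i) = l a ^ lookup m a * (\<Prod>i\<in>A - {j}. l i ^ lookup m i)"
      if "j \<in> A" for j
    proof -
      have "insert a A - {j} = insert a (A - {j})" using that insert by auto
      then show ?thesis using insert by simp
    qed
    have "pd k (\<Prod>j\<in>insert a A. l j ^ lookup m j)
        = pd k (l a ^ lookup m a) * (\<Prod>j\<in>A. l j ^ lookup m j) + l a ^ lookup m a * pd k (\<Prod>j\<in>A. l j ^ lookup m j)"
      using insert by (simp add: pd_times)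
    also have "pd k (l a ^ lookup m a) = const (of_nat (lookup m a) * b a) * l a ^ (lookup m a - 1)"
      using b insert.prems by (simp add: pd_power const_mult mult_ac)
    also have "l a ^ lookup m a * pd k (\<Prod>j\<in>A. l j ^ lookup m j) = (\<Sum>j\<in>A. const (of_nat (lookup m j) * b j) *
      (l j ^ (lookup m j - 1) * (\<Prod>i\<in>insert a A - {j}. l i ^ lookup m i)))"
      using insert by (simp add: sum_distrib_left mult_ac eq)
    finally show ?case using insert by (simp add: mult_ac)
  qed
  have "lookup m j * 1 = 0 \<or> lmon J l (m - Poly_Mapping.single j 1) = l j ^ (lookup m j - 1) * (\<Prod>i\<in>J - {j}. l i ^ lookup m i)"
    if "j \<in> J" for j
  proof -
    have "(\<Prod>i\<in>J - {j}. l i ^ lookup (m - Poly_Mapping.single j 1) i) = (\<Prod>i\<in>J - {j}. l i ^ lookup m i)"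
      by (rule prod.cong) (auto simp: lookup_minus lookup_single when_def)
    then show ?thesis unfolding lmon_def
      by (subst prod.remove[OF J that]) (simp add: lookup_minus lookup_single)
  qed
  then show ?thesis unfolding lmon_def[of J l m] P[OF subset_refl]
    by (intro sum.cong) force+
qed

lemma keys_add_nat: "Poly_Mapping.keys (a + b) = Poly_Mapping.keys a \<union> Poly_Mapping.keys (b :: 'i \<Rightarrow>\<^sub>0 nat)"
  by (auto simp: in_keys_iff lookup_add)

lemma mfact_superset:
  assumes "finite S" "Poly_Mapping.keys m \<subseteq> S"
  shows "mfact m = (\<Prod>j\<in>S. fact (lookup m j))"
  unfolding mfact_def
  by (rule prod.mono_neutral_left) (use assms in \<open>auto simp: in_keys_iff\<close>)

lemma mfact_add_single: "mfact (m + Poly_Mapping.single j 1) = (lookup m j + 1) * mfact m"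
proof -
  let ?S = "insert j (Poly_Mapping.keys m)"
  have "mfact (m + Poly_Mapping.single j 1) = (\<Prod>i\<in>?S. fact (lookup (m + Poly_Mapping.single j 1) i))"
    by (rule mfact_superset) (auto simp: keys_add_nat)
  also have "\<dots> = fact (lookup m j + 1) * (\<Prod>i\<in>?S - {j}. fact (lookup m i))"
    by (subst prod.remove[of ?S j]) (auto simp: lookup_add lookup_single when_def intro!: prod.cong split: if_splits)
  also have "\<dots> = (lookup m j + 1) * (\<Prod>i\<in>?S. fact (lookup m i))"
    by (subst prod.remove[of ?S j "\<lambda>i. fact (lookup m i)"]) (auto simp: algebra_simps)
  also have "(\<Prod>i\<in>?S. fact (lookup m i)) = mfact m"
    by (rule mfact_superset[symmetric]) auto
  finally show ?thesis .
qed

lemma mfact_pos: "mfact m > 0"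
  by (simp add: mfact_def prod_pos)

lemma mfact_nonzero [simp]: "of_nat (mfact m) \<noteq> (0 :: complex)"
  using mfact_pos[of m] by simp


lemma exponent_induct [consumes 2, case_names zero add]:
  assumes "finite S" "Poly_Mapping.keys (m :: 'i \<Rightarrow>\<^sub>0 nat) \<subseteq> S" and "P 0"
    and "\<And>m j. Poly_Mapping.keys m \<subseteq> S \<Longrightarrow> j \<in> S \<Longrightarrow> P m \<Longrightarrow> P (m + Poly_Mapping.single j 1)"
  shows "P m"
  using assms(2)
proof (induction "total_degree m" arbitrary: m)
  case 0
  then have "m = 0" by (intro poly_mapping_eqI) (metis le_zero_eq lookup_le_total_degree lookup_zero)
  then show ?case using assms by simp
next
  case (Suc d)
  have "m \<noteq> 0" using Suc.hyps(2) by auto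
  then obtain j where j: "j \<in> Poly_Mapping.keys m" using keys_eq_empty by (metis ex_in_conv)
  have m: "m = (m - Poly_Mapping.single j 1) + Poly_Mapping.single j 1"
    by (rule poly_mapping_eqI) (use j in \<open>auto simp: lookup_add lookup_minus lookup_single when_def in_keys_iff\<close>)
  have "total_degree m = total_degree (m - Poly_Mapping.single j 1) + 1"
    by (subst m) (simp only: total_degree_add total_degree_single)
  moreover have k: "Poly_Mapping.keys (m - Poly_Mapping.single j 1) \<subseteq> S"
    using Suc.prems by (auto simp: in_keys_iff lookup_minus)
  ultimately have "P (m - Poly_Mapping.single j 1)" using Suc by simp
  then show ?case using assms(4)[OF k, of j] j Suc.prems m by auto
qed

text \<open>Both sides are the coefficient of \<open>s\<^sup>\<alpha> y\<^sup>m\<close> in \<open>exp (\<Sum>\<^sub>j\<^sub>k b\<^sub>j\<^sub>k s\<^sub>k y\<^sub>j)\<close>,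
  up to the factor \<open>m! \<alpha>!\<close>.  The two expansions satisfy the same recursion in \<open>\<alpha>\<close>: on one side
  by the Leibniz rule in the variables \<open>s\<close>, on the other by multiplication with a linear form.\<close>

lemma symmetric_expansion:
  fixes b :: "'j \<Rightarrow> 'k \<Rightarrow> complex"
  assumes J: "finite J" and K: "finite K"
    and m: "Poly_Mapping.keys m \<subseteq> J" and \<alpha>: "Poly_Mapping.keys \<alpha> \<subseteq> K"
  shows "of_nat (mfact \<alpha>) * lmon J (\<lambda>j. \<Sum>k\<in>K. const (b j k) * var k) m \<alpha>
    = of_nat (mfact m) * lmon K (\<lambda>k. \<Sum>j\<in>J. const (b j k) * var j) \<alpha> m"
  using K \<alpha> m
proof (induction \<alpha> arbitrary: m rule: exponent_induct)
  case zero
  let ?l = "\<lambda>j. \<Sum>k\<in>K. const (b j k) * var k"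
  have "homog 1 (?l j)" for j by (intro homog_sum homog_const_times homog_var)
  from homog_lmon[OF J this zero] have h: "homog (total_degree m) (lmon J ?l m)" by simp
  show ?case
  proof (cases "m = 0")
    case True
    then show ?thesis by (simp add: one_fun_def mfact_def)
  next
    case False
    then have "total_degree m \<noteq> 0"
      using lookup_le_total_degree[of m] by (metis le_zero_eq lookup_zero poly_mapping_eqI)
    then have "lmon J ?l m 0 = 0" using h by (force simp: homog_def)
    then show ?thesis using False by (simp add: one_fun_def)
  qed
next
  case (add \<alpha> k)
  let ?l = "\<lambda>j. \<Sum>k\<in>K. const (b j k) * var k" and ?l' = "\<lambda>k. \<Sum>j\<in>J. const (b j k) * var j"
  let ?e = "\<lambda>j. Poly_Mapping.single j (1::nat)"
  have pl: "pd k (?l j) = const (b j k)" for j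
    using K add.hyps by (simp add: pd_sum pd_const pd_var if_distrib cong: if_cong)
  have sub: "Poly_Mapping.keys (m - ?e j) \<subseteq> J" for j
    using add.prems by (auto simp: in_keys_iff lookup_minus)
  have mf: "of_nat (lookup m j) * of_nat (mfact (m - ?e j)) = (if lookup m j = 0 then 0 else of_nat (mfact m) :: complex)" for j
  proof (cases "lookup m j = 0")
    case False
    have "m = (m - ?e j) + ?e j"
      by (rule poly_mapping_eqI) (use False in \<open>auto simp: lookup_add lookup_minus lookup_single when_def\<close>)
    then have "mfact m = (lookup (m - ?e j) j + 1) * mfact (m - ?e j)" by (metis mfact_add_single)
    also have "lookup (m - ?e j) j + 1 = lookup m j" using False by (simp add: lookup_minus lookup_single)
    finally show ?thesis using False by simp
  qed simp
  have vc: "(var j * f) m = (if lookup m j = 0 then 0 else f (m - ?e j))" for j and f :: "'j series"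
  proof (cases "lookup m j = 0")
    case True
    have "m \<noteq> ?e j + q" for q using True by (auto simp: lookup_add lookup_single)
    then show ?thesis using True by (simp add: var_def mon_times_coeff_zero)
  next
    case False
    have "m = ?e j + (m - ?e j)"
      by (rule poly_mapping_eqI) (use False in \<open>auto simp: lookup_add lookup_minus lookup_single when_def\<close>)
    then show ?thesis using False unfolding var_def by (metis mon_times_coeff_add)
  qed
  have "of_nat (mfact (\<alpha> + ?e k)) * lmon J ?l m (\<alpha> + ?e k) = of_nat (mfact \<alpha>) * pd k (lmon J ?l m) \<alpha>"
    by (simp only: mfact_add_single pd_def of_nat_mult mult_ac)
  also have "\<dots> = (\<Sum>j\<in>J. of_nat (lookup m j) * b j k * (of_nat (mfact \<alpha>) * lmon J ?l (m - ?e j) \<alpha>))"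
    by (subst pd_lmon[OF J add.prems pl]) (simp add: sum_coeff const_coeff sum_distrib_left mult_ac)
  also have "\<dots> = (\<Sum>j\<in>J. of_nat (lookup m j) * b j k * (of_nat (mfact (m - ?e j)) * lmon K ?l' \<alpha> (m - ?e j)))"
    by (simp only: add.IH[OF sub])
  also have "\<dots> = (\<Sum>j\<in>J. b j k * ((of_nat (lookup m j) * of_nat (mfact (m - ?e j))) * lmon K ?l' \<alpha> (m - ?e j)))"
    by (simp only: mult_ac)
  also have "\<dots> = of_nat (mfact m) * (\<Sum>j\<in>J. b j k * (var j * lmon K ?l' \<alpha>) m)"
    unfolding mf vc sum_distrib_left by (rule sum.cong) auto
  also have "(\<Sum>j\<in>J. b j k * (var j * lmon K ?l' \<alpha>) m) = lmon K ?l' (\<alpha> + ?e k) m"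
  proof -
    have "lmon K ?l' (\<alpha> + ?e k) = (\<Sum>j\<in>J. const (b j k) * var j) * lmon K ?l' \<alpha>"
      unfolding lmon_add lmon_single[OF K \<open>k \<in> K\<close>] by (rule mult.commute)
    also have "\<dots> = (\<Sum>j\<in>J. const (b j k) * (var j * lmon K ?l' \<alpha>))"
      by (simp only: sum_distrib_right mult.assoc)
    finally show ?thesis by (simp only: sum_coeff const_coeff)
  qed
  finally show ?case .
qed


section \<open>Integer linear systems over the complex numbers\<close>

lemma common_denominator:
  assumes "finite K"
  shows "\<exists>d::int. d > 0 \<and> (\<forall>k\<in>K. \<exists>n::int. (f k :: rat) * of_int d = of_int n)"
  using assms
proof (induction K rule: finite_induct)
  case empty
  then show ?case by (auto intro: exI[of _ 1])
next
  case (insert a K)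
  then obtain d :: int where d: "d > 0" "\<forall>k\<in>K. \<exists>n::int. f k * of_int d = of_int n" by auto
  obtain p q where pq: "quotient_of (f a) = (p, q)" by force
  then have q: "q > 0" and fa: "f a = of_int p / of_int q"
    using quotient_of_denom_pos quotient_of_div by auto
  show ?case
  proof (rule exI[of _ "d * q"], intro conjI ballI)
    fix k assume k: "k \<in> insert a K"
    show "\<exists>n::int. f k * of_int (d * q) = of_int n"
    proof (cases "k = a")
      case True
      then show ?thesis using fa q by (intro exI[of _ "p * d"]) simp
    next
      case False
      then have "k \<in> K" using k by simp
      then obtain n :: int where "f k * of_int d = of_int n" using d by auto
      then have "f k * of_int (d * q) = of_int (n * q)" by (simp flip: mult.assoc)
      then show ?thesis by blast
    qed
  qed (use d q in simp)
qed

text \<open>The coordinates of a complex solution in a basis over the rationals are rational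
  solutions.\<close>

lemma complex_solutions_from_integer_solutions:
  fixes C :: "'j \<Rightarrow> 'k \<Rightarrow> int" and x :: "'k \<Rightarrow> complex"
  assumes K: "finite K" and x: "\<And>j. (\<Sum>k\<in>K. of_int (C j k) * x k) = 0"
  obtains T :: "complex set" and \<rho> :: "complex \<Rightarrow> 'k \<Rightarrow> int" and y
  where "\<And>k. k \<in> K \<Longrightarrow> x k = (\<Sum>b\<in>T. of_int (\<rho> b k) * y b)"
    and "\<And>b j. b \<in> T \<Longrightarrow> (\<Sum>k\<in>K. C j k * \<rho> b k) = 0"
proof -
  interpret Q: vector_space "\<lambda>(q::rat) (z::complex). of_rat q * z"
    by unfold_locales (auto simp: of_rat_add of_rat_mult algebra_simps)
  obtain T where T: "T \<subseteq> x ` K" "Q.independent T" "x ` K \<subseteq> Q.span T"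
    using Q.maximal_independent_subset[of "x ` K"] by metis
  have finT: "finite T" using T(1) K finite_surj by blast
  define c where "c k b = Q.representation T (x k) b" for k b
  have xk: "x k = (\<Sum>b\<in>T. of_rat (c k b) * b)" if "k \<in> K" for k
    unfolding c_def using Q.sum_representation_eq[OF T(2) _ finT, of "x k"] T(3) that by auto
  have rel: "(\<Sum>k\<in>K. of_int (C j k) * c k b) = 0" if b: "b \<in> T" for j b
  proof (rule Q.independentD[OF T(2) finT subset_refl _ b])
    have "(\<Sum>b\<in>T. of_rat (\<Sum>k\<in>K. of_int (C j k) * c k b) * b)
        = (\<Sum>b\<in>T. \<Sum>k\<in>K. of_int (C j k) * (of_rat (c k b) * b))"
      by (simp add: of_rat_sum of_rat_mult sum_distrib_right mult.assoc)
    also have "\<dots> = (\<Sum>k\<in>K. of_int (C j k) * (\<Sum>b\<in>T. of_rat (c k b) * b))"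
      by (subst sum.swap) (simp add: sum_distrib_left)
    also have "\<dots> = 0" using x[of j] xk by simp
    finally show "(\<Sum>b\<in>T. of_rat (\<Sum>k\<in>K. of_int (C j k) * c k b) * b) = 0" .
  qed
  have "\<exists>d n. d > 0 \<and> (\<forall>k\<in>K. c k b * of_int d = of_int (n k :: int))" for b
    using common_denominator[OF K, of "\<lambda>k. c k b"] by metis
  then obtain d n where d: "\<And>b. d b > (0::int)" and n: "\<And>b k. k \<in> K \<Longrightarrow> c k b * of_int (d b) = of_int (n b k :: int)"
    by metis
  have eq: "of_rat (c k b) = of_int (n b k) / (of_int (d b) :: complex)" if "k \<in> K" for k b
  proof -
    have "of_rat (c k b) * (of_int (d b) :: complex) = of_int (n b k)"
      using arg_cong[OF n[OF that, of b], of "of_rat :: rat \<Rightarrow> complex"] by (simp add: of_rat_mult)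
    then show ?thesis using d[of b] by (simp add: field_simps)
  qed
  show thesis
  proof
    show "x k = (\<Sum>b\<in>T. of_int (n b k) * (b / of_int (d b)))" if "k \<in> K" for k
      unfolding xk[OF that] using eq[OF that] by simp
    fix b j assume b: "b \<in> T"
    have "(of_int (\<Sum>k\<in>K. C j k * n b k) :: rat) = (\<Sum>k\<in>K. of_int (C j k) * c k b) * of_int (d b)"
      by (simp add: sum_distrib_right n[symmetric] mult.assoc)
    also have "\<dots> = 0" using rel[OF b] by simp
    finally show "(\<Sum>k\<in>K. C j k * n b k) = 0" by (simp only: of_int_eq_0_iff)
  qed
qed


section \<open>The Gale map\<close>

lemma var_carrier: "j \<in> V \<Longrightarrow> var j \<in> carrier (mps_ring V)"
  and const_carrier: "const c \<in> carrier (mps_ring V)"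
  by (auto simp: mps_ring_simps var_def mon_def const_def split: if_splits)

lemma linear_form_carrier: "A \<subseteq> V \<Longrightarrow> (\<Sum>k\<in>A. const (b k) * var k) \<in> carrier (mps_ring V)"
  by (intro mps.sum_closed mps.closed(4) var_carrier const_carrier) auto

lemma homog_linear_form: "homog 1 (\<Sum>k\<in>A. const (b k) * var k)"
  by (intro homog_sum homog_const_times homog_var)

lemma const_sum: "const (\<Sum>x\<in>A. f x) = (\<Sum>x\<in>A. const (f x))"
  by (induction A rule: infinite_finite_induct) (simp_all only: sum.infinite sum.empty sum.insert const_0 const_add not_False_eq_True)

lemma gale_form_eq: "gale_form r B j = (\<Sum>k<r. const (of_int (B k $ j)) * var k)"
  unfolding gale_form_def
  by (subst mps.finsum_eq) (auto simp: mps_ring_simps(1) intro!: mps.closed(4) var_carrier const_carrier)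

lemma gale_form_carrier: "gale_form r B j \<in> carrier (Shat r)"
  unfolding gale_form_eq by (rule linear_form_carrier) simp

lemma Phi_eq: "Phi r B = lsub UNIV (gale_form r B)"
proof (intro ext)
  fix f q
  have "(\<Otimes>\<^bsub>Shat r\<^esub>j\<in>UNIV. gale_form r B j [^]\<^bsub>Shat r\<^esub> lookup m j) = lmon UNIV (gale_form r B) m" for m
    unfolding lmon_def
    by (subst mps.finprod_eq)
      (auto simp: mps.pow_eq gale_form_carrier intro!: prod.cong mps.power_closed)
  then show "Phi r B f q = lsub UNIV (gale_form r B) f q"
    by (simp add: Phi_def lsub_def)
qed

lemma homog_gale_form: "homog 1 (gale_form r B j)"
  unfolding gale_form_eq by (rule homog_linear_form)

lemma mps_UNIV: "f \<in> carrier (mps_ring UNIV)"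
  by (simp add: mps_ring_simps)

context
  fixes r :: nat and B :: "nat \<Rightarrow> int ^ 'n::finite"
begin

private abbreviation (input) "l \<equiv> gale_form r B"

lemmas Phi_add = lsub_add[where V = UNIV and l = l, OF finite_class.finite_UNIV homog_gale_form, folded Phi_eq]
  and Phi_const = lsub_const[where V = UNIV and l = l, OF finite_class.finite_UNIV homog_gale_form, folded Phi_eq]
  and Phi_times = lsub_times[where V = UNIV and l = l, OF finite_class.finite_UNIV homog_gale_form mps_UNIV mps_UNIV, folded Phi_eq]
  and Phi_one = lsub_one[where V = UNIV and l = l, OF finite_class.finite_UNIV homog_gale_form, folded Phi_eq]
  and Phi_sum = lsub_sum[where V = UNIV and l = l, OF finite_class.finite_UNIV homog_gale_form, folded Phi_eq]
  and Phi_var = lsub_var[where V = UNIV and l = l, OF finite_class.finite_UNIV homog_gale_form UNIV_I, folded Phi_eq]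
  and Phi_mon = lsub_mon[where V = UNIV and l = l, OF finite_class.finite_UNIV homog_gale_form subset_UNIV, folded Phi_eq]
  and Phi_diff = lsub_diff[where V = UNIV and l = l, OF finite_class.finite_UNIV homog_gale_form, folded Phi_eq]
  and Phi_carrier = lsub_carrier[where V = UNIV and l = l and W = "{..<r}", OF finite_class.finite_UNIV homog_gale_form gale_form_carrier, folded Phi_eq]

end

lemma Phi_hom: "ring_hom_cring (Rhat :: 'n::finite series ring) (Shat r) (Phi r B)"
proof (intro ring_hom_cring.intro ring_hom_cring_axioms.intro mps.cring)
  show "Phi r B \<in> ring_hom Rhat (Shat r)"
    by (rule ring_hom_memI) (auto simp: mps_ring_simps(1-4) Phi_carrier Phi_times Phi_add Phi_one)
qed

definition linear_rel :: "int ^ 'n::finite ^ 'd \<Rightarrow> 'd \<Rightarrow> 'n series" where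
  "linear_rel A i = (\<Sum>j\<in>UNIV. const (of_int (A $ i $ j)) * var j)"

lemma U_ideal_eq: "U_ideal A = genideal Rhat (range (linear_rel A))"
proof -
  have "(\<Oplus>\<^bsub>Rhat\<^esub>j\<in>UNIV. const (of_int (A $ i $ j)) \<otimes>\<^bsub>Rhat\<^esub> var j) = linear_rel A i" for i
    unfolding linear_rel_def by (subst mps.finsum_eq) (auto simp: mps_ring_simps(1,5))
  then show ?thesis by (simp add: U_ideal_def)
qed

lemma homog_U_ideal: "homog_ideal (U_ideal (A :: int ^ 'n::finite ^ 'd::finite))"
  unfolding homog_ideal_def U_ideal_eq linear_rel_def
  by (intro exI conjI refl) (auto intro: homog_linear_form[unfolded One_nat_def])

lemmas U_ideal_ideal = homog_ideal_ideal[OF homog_U_ideal]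

locale gale =
  fixes A :: "int ^ 'n::finite ^ 'd::finite" and r :: nat and B :: "nat \<Rightarrow> int ^ 'n"
  assumes gale: "gale_dual A r B"
begin

lemma columns_in_lattice: "k < r \<Longrightarrow> (\<Sum>j\<in>UNIV. A $ i $ j * B k $ j) = 0"
  using gale by (auto simp: gale_dual_def lattice_def matrix_vector_mult_def vec_eq_iff)

lemma ex1_implies_unique: "\<exists>!x. P x \<Longrightarrow> P a \<Longrightarrow> P b \<Longrightarrow> a = b"
  by blast

lemma columns_independent_int:
  assumes "\<And>j. (\<Sum>k<r. B k $ j * c k) = 0" and "k < r"
  shows "c k = (0::int)"
proof -
  have "(0 :: int ^ 'n) \<in> lattice A" by (simp add: lattice_def)
  moreover have "\<forall>u\<in>lattice A. \<exists>!c :: nat \<Rightarrow> int. (\<forall>k\<ge>r. c k = 0) \<and> u = (\<Sum>k<r. c k *s B k)"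
    using gale unfolding gale_dual_def by (rule conjunct2)
  ultimately have ex1: "\<exists>!c :: nat \<Rightarrow> int. (\<forall>k\<ge>r. c k = 0) \<and> 0 = (\<Sum>k<r. c k *s B k)"
    by (rule bspec[rotated])
  let ?c = "\<lambda>k. if k < r then c k else 0"
  have "(\<forall>k\<ge>r. ?c k = 0) \<and> 0 = (\<Sum>k<r. ?c k *s B k)"
    using assms(1) by (auto simp: vec_eq_iff mult.commute)
  moreover have "(\<forall>k\<ge>r. (\<lambda>k. 0::int) k = 0) \<and> 0 = (\<Sum>k<r. (\<lambda>k. 0) k *s B k)"
    by (simp add: vec_eq_iff)
  ultimately have "?c = (\<lambda>k. 0)" by (rule ex1_implies_unique[OF ex1])
  from fun_cong[OF this, of k] show ?thesis using assms(2) by simp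
qed

lemma columns_independent:
  assumes x: "\<And>j. (\<Sum>k<r. of_int (B k $ j) * x k) = (0::complex)" and "k < r"
  shows "x k = 0"
proof -
  obtain T \<rho> y where xk: "\<And>k. k \<in> {..<r} \<Longrightarrow> x k = (\<Sum>b\<in>T. of_int (\<rho> b k) * y b)"
    and z: "\<And>b j. b \<in> (T::complex set) \<Longrightarrow> (\<Sum>k<r. B k $ j * \<rho> b k) = (0::int)"
    by (rule complex_solutions_from_integer_solutions[of "{..<r}" "\<lambda>j k. B k $ j" x, OF finite_lessThan x]) blast
  then show ?thesis using columns_independent_int[OF z] \<open>k < r\<close> by simp
qed

lemma left_inverse:
  obtains c :: "nat \<Rightarrow> 'n \<Rightarrow> complex"
  where "\<And>k k'. k < r \<Longrightarrow> k' < r \<Longrightarrow> (\<Sum>j\<in>UNIV. c k j * of_int (B k' $ j)) = (if k = k' then 1 else 0)"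
proof -
  have "\<exists>c :: 'n \<Rightarrow> complex. \<forall>x :: nat \<Rightarrow> complex\<in>UNIV. x k = (\<Sum>j\<in>UNIV. c j * (\<Sum>k<r. of_int (B k $ j) * x k))" if k: "k < r" for k
  proof (rule functional_combination[where h = "\<lambda>j x. \<Sum>k<r. of_int (B k $ j) * x k"])
    show "x k = 0" if "\<And>j. j \<in> UNIV \<Longrightarrow> (\<Sum>k<r. of_int (B k $ j) * x k) = 0" for x :: "nat \<Rightarrow> complex"
      using columns_independent[OF _ k, of x] that by simp
  qed (auto simp: distrib_left sum.distrib sum_distrib_left mult.left_commute)
  then have "\<forall>k. \<exists>c :: 'n \<Rightarrow> complex. k < r \<longrightarrow>
      (\<forall>x :: nat \<Rightarrow> complex. x k = (\<Sum>j\<in>UNIV. c j * (\<Sum>k<r. of_int (B k $ j) * x k)))"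
    by simp
  from choice[OF this] obtain c :: "nat \<Rightarrow> 'n \<Rightarrow> complex" where "\<forall>k. k < r \<longrightarrow>
      (\<forall>x :: nat \<Rightarrow> complex. x k = (\<Sum>j\<in>UNIV. c k j * (\<Sum>k<r. of_int (B k $ j) * x k)))" ..
  then have c: "x k = (\<Sum>j\<in>UNIV. c k j * (\<Sum>k<r. of_int (B k $ j) * x k))" if "k < r" for k and x :: "nat \<Rightarrow> complex"
    using that by simp
  show thesis
  proof
    fix k k' assume k: "k < r" "k' < r"
    have "(\<Sum>i<r. of_int (B i $ j) * (if i = k' then 1 else 0 :: complex)) = of_int (B k' $ j)" for j
      using k by (simp add: if_distrib[of "\<lambda>x. _ * x"] cong: if_cong)
    then show "(\<Sum>j\<in>UNIV. c k j * of_int (B k' $ j)) = (if k = k' then 1 else 0)"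
      using c[OF k(1), of "\<lambda>i. if i = k' then 1 else 0"] by simp
  qed
qed

text \<open>A linear form vanishing on the columns of \<open>B\<close> vanishes on all complex solutions of
  \<open>A x = 0\<close>, hence is a combination of the rows of \<open>A\<close>.\<close>

lemma annihilator_of_columns:
  fixes a :: "'n \<Rightarrow> complex"
  assumes a: "\<And>k. k < r \<Longrightarrow> (\<Sum>j\<in>UNIV. a j * of_int (B k $ j)) = 0"
  obtains \<mu> :: "'d \<Rightarrow> complex" where "\<And>j. a j = (\<Sum>i\<in>UNIV. \<mu> i * of_int (A $ i $ j))"
proof -
  have lat: "(\<Sum>j\<in>UNIV. a j * of_int (u $ j)) = 0" if u: "u \<in> lattice A" for u
  proof -
    obtain c :: "nat \<Rightarrow> int" where c: "u = (\<Sum>k<r. c k *s B k)"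
      using gale u unfolding gale_dual_def by blast
    have "(\<Sum>j\<in>UNIV. a j * of_int (u $ j)) = (\<Sum>j\<in>UNIV. \<Sum>k<r. of_int (c k) * (a j * of_int (B k $ j)))"
      by (simp add: c sum_distrib_left mult_ac)
    also have "\<dots> = (\<Sum>k<r. of_int (c k) * (\<Sum>j\<in>UNIV. a j * of_int (B k $ j)))"
      by (subst sum.swap) (simp add: sum_distrib_left)
    finally show ?thesis using a by simp
  qed
  have "\<exists>\<mu>. \<forall>x\<in>UNIV. (\<Sum>j\<in>UNIV. a j * x j) = (\<Sum>i\<in>UNIV. \<mu> i * (\<Sum>j\<in>UNIV. of_int (A $ i $ j) * x j))"
  proof (rule functional_combination[where h = "\<lambda>i x. \<Sum>j\<in>UNIV. of_int (A $ i $ j) * x j"])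
    fix x :: "'n \<Rightarrow> complex" assume x: "\<And>i. i \<in> UNIV \<Longrightarrow> (\<Sum>j\<in>UNIV. of_int (A $ i $ j) * x j) = 0"
    obtain T \<rho> y where xk: "\<And>k. k \<in> UNIV \<Longrightarrow> x k = (\<Sum>b\<in>T. of_int (\<rho> b k) * y b)"
      and z: "\<And>b i. b \<in> (T::complex set) \<Longrightarrow> (\<Sum>k\<in>UNIV. A $ i $ k * \<rho> b k) = (0::int)"
      by (rule complex_solutions_from_integer_solutions[of "UNIV :: 'n set" "\<lambda>i k. A $ i $ k" x, OF finite_class.finite_UNIV x]) blast+
    have l: "(\<Sum>j\<in>UNIV. a j * of_int (\<rho> b j)) = 0" if "b \<in> T" for b
      using lat[of "\<chi> j. \<rho> b j"] z[OF that] by (simp add: lattice_def matrix_vector_mult_def vec_eq_iff)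
    have "(\<Sum>j\<in>UNIV. a j * x j) = (\<Sum>j\<in>UNIV. \<Sum>b\<in>T. y b * (a j * of_int (\<rho> b j)))"
      by (simp add: xk sum_distrib_left mult_ac)
    also have "\<dots> = (\<Sum>b\<in>T. y b * (\<Sum>j\<in>UNIV. a j * of_int (\<rho> b j)))"
      by (subst sum.swap) (simp add: sum_distrib_left)
    finally show "(\<Sum>j\<in>UNIV. a j * x j) = 0" using l by simp
  qed (auto simp: distrib_left sum.distrib sum_distrib_left mult.left_commute)
  then obtain \<mu> where m: "\<And>x. (\<Sum>j\<in>UNIV. a j * x j) = (\<Sum>i\<in>UNIV. \<mu> i * (\<Sum>j\<in>UNIV. of_int (A $ i $ j) * x j))"
    by auto
  show thesis
  proof
    fix j
    show "a j = (\<Sum>i\<in>UNIV. \<mu> i * of_int (A $ i $ j))"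
      using m[of "\<lambda>k. if k = j then 1 else 0"] by (simp add: if_distrib[of "\<lambda>x. _ * x"] cong: if_cong)
  qed
qed

lemma Phi_linear_rel: "Phi r B (linear_rel A i) = 0"
proof -
  have "Phi r B (linear_rel A i) = (\<Sum>j\<in>UNIV. \<Sum>k<r. const (of_int (A $ i $ j * B k $ j)) * var k)"
    unfolding linear_rel_def Phi_sum Phi_const Phi_var gale_form_eq
    by (simp add: sum_distrib_left const_mult mult.assoc)
  also have "\<dots> = (\<Sum>k<r. const (of_int (\<Sum>j\<in>UNIV. A $ i $ j * B k $ j)) * var k)"
    by (subst sum.swap) (simp add: const_sum sum_distrib_right)
  also have "\<dots> = 0" by (intro sum.neutral) (simp add: columns_in_lattice)
  finally show ?thesis .
qed

lemma Phi_U: "f \<in> U_ideal A \<Longrightarrow> Phi r B f = 0"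
  unfolding U_ideal_eq by (auto simp: genideal_Rhat Phi_sum Phi_times Phi_linear_rel intro!: sum.neutral)

text \<open>A linear section of the Gale map.\<close>

definition sec_coeff :: "nat \<Rightarrow> 'n \<Rightarrow> complex" where
  "sec_coeff = (SOME c. \<forall>k<r. \<forall>k'<r. (\<Sum>j\<in>UNIV. c k j * of_int (B k' $ j)) = (if k = k' then 1 else 0))"

lemma sec_coeff: "k < r \<Longrightarrow> k' < r \<Longrightarrow> (\<Sum>j\<in>UNIV. sec_coeff k j * of_int (B k' $ j)) = (if k = k' then 1 else 0)"
proof -
  have "\<exists>c :: nat \<Rightarrow> 'n \<Rightarrow> complex. \<forall>k<r. \<forall>k'<r. (\<Sum>j\<in>UNIV. c k j * of_int (B k' $ j)) = (if k = k' then 1 else 0)"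
    using left_inverse by metis
  from someI_ex[OF this] show "k < r \<Longrightarrow> k' < r \<Longrightarrow> ?thesis" unfolding sec_coeff_def by blast
qed

definition sec_form :: "nat \<Rightarrow> 'n series" where
  "sec_form k = (\<Sum>j\<in>UNIV. const (sec_coeff k j) * var j)"

definition sec :: "nat series \<Rightarrow> 'n series" where
  "sec = lsub {..<r} sec_form"

lemma homog_sec_form: "homog 1 (sec_form k)"
  unfolding sec_form_def by (rule homog_linear_form)

lemma Phi_sec_form:
  assumes k: "k < r" shows "Phi r B (sec_form k) = var k"
proof -
  have "Phi r B (sec_form k) = (\<Sum>j\<in>UNIV. \<Sum>k'<r. const (sec_coeff k j * of_int (B k' $ j)) * var k')"
    unfolding sec_form_def Phi_sum Phi_const Phi_var gale_form_eq
    by (simp add: sum_distrib_left const_mult mult.assoc)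
  also have "\<dots> = (\<Sum>k'<r. const (\<Sum>j\<in>UNIV. sec_coeff k j * of_int (B k' $ j)) * var k')"
    by (subst sum.swap) (simp add: const_sum sum_distrib_right)
  also have "\<dots> = (\<Sum>k'<r. if k' = k then var k else 0)"
    by (rule sum.cong) (use k in \<open>auto simp: sec_coeff\<close>)
  finally show ?thesis using k by simp
qed

lemma Phi_sec:
  assumes "f \<in> carrier (Shat r)" shows "Phi r B (sec f) = f"
proof -
  have "Phi r B (sec f) = lsub {..<r} (\<lambda>k. Phi r B (sec_form k)) f"
    unfolding sec_def Phi_eq
    by (rule lsub_lsub) (auto intro: homog_sec_form[unfolded One_nat_def] homog_gale_form[unfolded One_nat_def] mps_UNIV)
  also have "\<dots> = lsub {..<r} var f"
  proof -
    have "lmon {..<r} (\<lambda>k. Phi r B (sec_form k)) = lmon {..<r} var"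
      by (intro ext lmon_cong) (simp add: Phi_sec_form)
    then show ?thesis by (simp only: lsub_def)
  qed
  also have "\<dots> = f" by (rule lsub_var_id) (use assms in auto)
  finally show ?thesis .
qed

lemma Phi_surj: "Phi r B ` carrier Rhat = carrier (Shat r)"
proof (intro equalityI subsetI)
  fix f assume "f \<in> carrier (Shat r)"
  then have "f = Phi r B (sec f)" by (simp only: Phi_sec)
  then show "f \<in> Phi r B ` carrier Rhat" by simp
qed (use Phi_carrier in auto)

lemma linear_mod_U:
  fixes a :: "'n \<Rightarrow> complex"
  assumes "Phi r B (\<Sum>j\<in>UNIV. const (a j) * var j) = 0"
  shows "(\<Sum>j\<in>UNIV. const (a j) * var j) \<in> U_ideal A"
proof -
  have "Phi r B (\<Sum>j\<in>UNIV. const (a j) * var j) = (\<Sum>j\<in>UNIV. \<Sum>k<r. const (a j * of_int (B k $ j)) * var k)"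
    unfolding Phi_sum Phi_const Phi_var gale_form_eq
    by (simp add: sum_distrib_left const_mult mult.assoc)
  also have "\<dots> = (\<Sum>k<r. const (\<Sum>j\<in>UNIV. a j * of_int (B k $ j)) * var k)"
    by (subst sum.swap) (simp add: const_sum sum_distrib_right)
  finally have *: "(\<Sum>k<r. const (\<Sum>j\<in>UNIV. a j * of_int (B k $ j)) * var k) = 0" using assms by simp
  have "(\<Sum>j\<in>UNIV. a j * of_int (B k $ j)) = 0" if k: "k < r" for k
  proof -
    have "(\<Sum>k<r. const (\<Sum>j\<in>UNIV. a j * of_int (B k $ j)) * var k) (Poly_Mapping.single k 1)
        = (\<Sum>i<r. if i = k then \<Sum>j\<in>UNIV. a j * of_int (B k $ j) else 0)"
      unfolding sum_coeff const_eq var_def mon_def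
      by (rule sum.cong) (auto simp: poly_mapping_eq_iff series_eq_iff lookup_single when_def split: if_splits)
    then show ?thesis using * k by (simp add: zero_coeff)
  qed
  then obtain \<mu> where \<mu>: "\<And>j. a j = (\<Sum>i\<in>UNIV. \<mu> i * of_int (A $ i $ j))"
    using annihilator_of_columns by blast
  have "(\<Sum>j\<in>UNIV. const (a j) * var j) = (\<Sum>j\<in>UNIV. \<Sum>i\<in>UNIV. const (\<mu> i) * (const (of_int (A $ i $ j)) * var j))"
    by (simp add: \<mu> const_sum const_mult sum_distrib_right mult.assoc)
  also have "\<dots> = (\<Sum>i\<in>UNIV. const (\<mu> i) * linear_rel A i)"
    by (subst sum.swap) (simp add: sum_distrib_left linear_rel_def)
  also have "\<dots> \<in> U_ideal A"
  proof (intro mps.idealD(7)[OF U_ideal_ideal] mps.idealD(3)[OF U_ideal_ideal])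
    show "linear_rel A i \<in> U_ideal A" for i
      unfolding U_ideal_eq using mps.genideal_self[of "range (linear_rel A)" UNIV] by auto
  qed simp
  finally show ?thesis .
qed

text \<open>Substituting linear forms that are congruent to the variables modulo \<open>U\<close> changes a series
  only by an element of \<open>U\<close>.\<close>

lemma sec_Phi_mod_U: "f - sec (Phi r B f) \<in> U_ideal A"
proof -
  note UD = mps.idealD[OF U_ideal_ideal[of A]]
  let ?s = "\<lambda>f. sec (Phi r B f)"
  have s_times: "?s (f * g) = ?s f * ?s g" for f g
    unfolding sec_def Phi_times by (rule lsub_times) (auto intro: homog_sec_form[unfolded One_nat_def] Phi_carrier)
  have s_one: "?s 1 = 1" unfolding sec_def Phi_one by (rule lsub_one) (auto intro: homog_sec_form[unfolded One_nat_def])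
  have s_const: "?s (const c * f) = const c * ?s f" for c f
    unfolding sec_def Phi_const by (rule lsub_const) (auto intro: homog_sec_form[unfolded One_nat_def])
  have s_sum: "?s (\<Sum>x\<in>X. f x) = (\<Sum>x\<in>X. ?s (f x))" for X and f :: "('n \<Rightarrow>\<^sub>0 nat) \<Rightarrow> 'n series"
    unfolding sec_def Phi_sum by (rule lsub_sum) (auto intro: homog_sec_form[unfolded One_nat_def])
  have var: "var j - ?s (var j) \<in> U_ideal A" for j
  proof -
    have "?s (var j) = (\<Sum>k<r. const (of_int (B k $ j)) * sec_form k)"
      unfolding sec_def Phi_var gale_form_eq
      by (subst lsub_sum, simp, rule homog_sec_form, rule sum.cong, simp,
          subst lsub_const, simp, rule homog_sec_form, subst lsub_var, auto intro: homog_sec_form[unfolded One_nat_def])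
    also have "\<dots> = (\<Sum>k<r. \<Sum>i\<in>UNIV. const (of_int (B k $ j) * sec_coeff k i) * var i)"
      by (simp add: sec_form_def sum_distrib_left const_mult mult.assoc)
    also have "\<dots> = (\<Sum>i\<in>UNIV. const (\<Sum>k<r. of_int (B k $ j) * sec_coeff k i) * var i)"
      by (subst sum.swap) (simp add: const_sum sum_distrib_right)
    finally have s: "?s (var j) = (\<Sum>i\<in>UNIV. const (\<Sum>k<r. of_int (B k $ j) * sec_coeff k i) * var i)" .
    have v: "var j = (\<Sum>i\<in>UNIV. const (if i = j then 1 else 0) * var i)"
    proof -
      have "(\<Sum>i\<in>UNIV. const (if i = j then 1 else 0) * var i) = (\<Sum>i\<in>UNIV. if i = j then var j else 0)"
        by (rule sum.cong) auto
      then show ?thesis by simp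
    qed
    have d: "var j - ?s (var j) = (\<Sum>i\<in>UNIV. const ((if i = j then 1 else 0) - (\<Sum>k<r. of_int (B k $ j) * sec_coeff k i)) * var i)"
    proof -
      have cd: "const (x - y) = const x - const y" for x y
        using const_add[of "x - y" y] by (metis add_diff_cancel_right' diff_add_cancel)
      show ?thesis unfolding s by (subst v) (simp only: cd left_diff_distrib sum_subtractf)
    qed
    have "Phi r B (var j - ?s (var j)) = 0"
      unfolding Phi_diff by (subst Phi_sec[OF Phi_carrier]) simp
    then show ?thesis unfolding d by (rule linear_mod_U)
  qed
  have mon: "mon m - ?s (mon m) \<in> U_ideal A" for m
    using finite_class.finite_UNIV subset_UNIV
  proof (induction m rule: exponent_induct)
    case zero
    then show ?case using UD(1) by (simp add: mon_zero s_one)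
  next
    case (add m j)
    have eq: "mon (m + Poly_Mapping.single j 1) - ?s (mon (m + Poly_Mapping.single j 1))
        = var j * (mon m - ?s (mon m)) + ?s (mon m) * (var j - ?s (var j))"
      unfolding mon_times_mon[symmetric] s_times var_def by (simp add: algebra_simps)
    show ?case unfolding eq by (intro UD(2) UD(3)[OF add.IH] UD(3)[OF var]; simp)
  qed
  have fin: "finite {m :: 'n \<Rightarrow>\<^sub>0 nat. total_degree m = d}" for d
    by (rule finite_subset[OF _ finite_degree_le[of d]]) auto
  show ?thesis
  proof (rule homog_ideal_closed[OF homog_U_ideal])
    fix d
    have hd: "hcomp d f = (\<Sum>m | total_degree m = d. const (f m) * mon m)"
    proof
      fix q
      show "hcomp d f q = (\<Sum>m | total_degree m = d. const (f m) * mon m) q"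
        using fin[of d] by (simp add: sum_coeff const_eq mon_def hcomp_def if_distrib[of "\<lambda>x. _ * x"] cong: if_cong)
    qed
    have hs: "hcomp d (?s f) = ?s (hcomp d f)"
      unfolding sec_def Phi_eq
      by (subst hcomp_lsub, simp, rule homog_sec_form, subst hcomp_lsub, simp, rule homog_gale_form, rule refl)
    have "hcomp d (f - ?s f) = hcomp d f - hcomp d (?s f)"
      by (auto simp: hcomp_def series_eq_iff)
    also have "\<dots> = (\<Sum>m | total_degree m = d. const (f m) * (mon m - ?s (mon m)))"
      unfolding hs by (simp only: hd s_sum s_const right_diff_distrib sum_subtractf)
    also have "\<dots> \<in> U_ideal A"
      using UD(3)[OF mon] by (intro UD(7)) simp
    finally show "hcomp d (f - ?s f) \<in> U_ideal A" .
  qed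
qed

lemma Phi_kernel: "Phi r B f = 0 \<longleftrightarrow> f \<in> U_ideal A"
proof
  assume "Phi r B f = 0"
  moreover have "sec 0 = 0" unfolding sec_def by (rule lsub_zero) (auto intro: homog_sec_form[unfolded One_nat_def])
  ultimately show "f \<in> U_ideal A" using sec_Phi_mod_U[of f] by simp
qed (rule Phi_U)

end


section \<open>The intrinsic coefficient space\<close>

lemma mfact_neq_0 [simp]: "mfact m \<noteq> 0"
  using mfact_pos[of m] by simp

text \<open>Differentiation becomes contraction when the coefficients of a polynomial are multiplied
  by factorials.\<close>

definition poly_of :: "'i dual \<Rightarrow> 'i series" where
  "poly_of P = (\<lambda>m. lookup P m / of_nat (mfact m))"

definition dual_of :: "'i series \<Rightarrow> 'i dual" where
  "dual_of p = Abs_poly_mapping (\<lambda>m. of_nat (mfact m) * p m)"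

lemma lookup_dual_of: "finite {m. p m \<noteq> 0} \<Longrightarrow> lookup (dual_of p) m = of_nat (mfact m) * p m"
  by (simp add: dual_of_def)

lemma poly_of_support: "{m. poly_of P m \<noteq> 0} = Poly_Mapping.keys P"
  by (auto simp: poly_of_def in_keys_iff)

lemma poly_of_dual_of: "finite {m. p m \<noteq> 0} \<Longrightarrow> poly_of (dual_of p) = p"
  by (simp add: poly_of_def lookup_dual_of fun_eq_iff)

lemma dual_of_poly_of: "dual_of (poly_of P) = P"
proof (rule poly_mapping_eqI)
  fix m
  have "finite {m. poly_of P m \<noteq> 0}" unfolding poly_of_support by simp
  then show "lookup (dual_of (poly_of P)) m = lookup P m"
    by (simp only: lookup_dual_of) (simp add: poly_of_def)
qed

lemma poly_of_inject: "poly_of P = poly_of Q \<longleftrightarrow> P = Q"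
  by (metis dual_of_poly_of)

lemma poly_of_carrier: "poly_of P \<in> carrier (mpoly_ring V) \<longleftrightarrow> (\<forall>m\<in>Poly_Mapping.keys P. Poly_Mapping.keys m \<subseteq> V)"
  unfolding mpoly_ring_simps mps_ring_simps using poly_of_support[of P] by auto

lemma diff_at_0_pair:
  assumes "finite {m. q m \<noteq> 0}"
  shows "diff_at_0 q f = pair f (dual_of q)"
proof -
  have "pair f (dual_of q) = (\<Sum>\<alpha> | q \<alpha> \<noteq> 0. f \<alpha> * lookup (dual_of q) \<alpha>)"
    by (rule pair_superset[OF assms]) (auto simp: in_keys_iff lookup_dual_of[OF assms])
  then show ?thesis by (simp add: diff_at_0_def lookup_dual_of[OF assms] mult_ac)
qed

text \<open>The transpose of a linear substitution.\<close>

definition adj :: "'i set \<Rightarrow> ('i \<Rightarrow> 'k series) \<Rightarrow> 'k dual \<Rightarrow> 'i dual" where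
  "adj V l P = Abs_poly_mapping (\<lambda>m. if Poly_Mapping.keys m \<subseteq> V then pair (lmon V l m) P else 0)"

lemma
  assumes V: "finite V" and l: "\<And>j. j \<in> V \<Longrightarrow> homog 1 (l j)"
  shows lookup_adj: "lookup (adj V l P) m = (if Poly_Mapping.keys m \<subseteq> V then pair (lmon V l m) P else 0)"
    and pair_adj: "pair f (adj V l P) = pair (lsub V l f) P"
proof -
  define D where "D = (\<Sum>m\<in>Poly_Mapping.keys P. total_degree m)"
  have D: "total_degree m \<le> D" if "m \<in> Poly_Mapping.keys P" for m
    unfolding D_def by (rule member_le_sum) (use that in auto)
  let ?M = "{m. total_degree m \<le> D \<and> Poly_Mapping.keys m \<subseteq> V}"
  note fin = finite_total_degree_le[OF V, of D]
  have sub: "{m. (if Poly_Mapping.keys m \<subseteq> V then pair (lmon V l m) P else 0) \<noteq> 0} \<subseteq> ?M"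
  proof
    fix m assume m: "m \<in> {m. (if Poly_Mapping.keys m \<subseteq> V then pair (lmon V l m) P else 0) \<noteq> 0}"
    then have k: "Poly_Mapping.keys m \<subseteq> V" and "pair (lmon V l m) P \<noteq> 0" by (auto split: if_splits)
    then obtain q where "q \<in> Poly_Mapping.keys P" "lmon V l m q \<noteq> 0"
      unfolding pair_def by (auto elim!: sum.not_neutral_contains_not_neutral)
    then show "m \<in> ?M" using homog_lmon[where l = l, OF V l k] D[of q] k
      unfolding homog_def by (metis (mono_tags, lifting) mem_Collect_eq)
  qed
  show lk: "lookup (adj V l P) m = (if Poly_Mapping.keys m \<subseteq> V then pair (lmon V l m) P else 0)" for m
    using finite_subset[OF sub fin] by (simp add: adj_def)
  have "Poly_Mapping.keys (adj V l P) \<subseteq> ?M"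
  proof
    fix m assume "m \<in> Poly_Mapping.keys (adj V l P)"
    then have "m \<in> {m. (if Poly_Mapping.keys m \<subseteq> V then pair (lmon V l m) P else 0) \<noteq> 0}"
      unfolding in_keys_iff lk by (rule CollectI)
    then show "m \<in> ?M" by (rule subsetD[OF sub])
  qed
  then have "pair f (adj V l P) = (\<Sum>m\<in>?M. f m * lookup (adj V l P) m)"
    by (intro pair_superset[OF fin]) auto
  also have "\<dots> = pair (\<Sum>m\<in>?M. const (f m) * lmon V l m) P"
    by (simp add: pair_sum_left pair_const_left lk)
  also have "\<dots> = pair (lsub V l f) P"
    by (rule pair_cong) (rule lsub_truncate[OF V l D, symmetric])
  finally show "pair f (adj V l P) = pair (lsub V l f) P" .
qed

lemma t_prod_eq: "t_prod J = (\<Prod>j\<in>J. var j)" for J :: "'n::finite set"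
  unfolding t_prod_def by (rule mps.finprod_eq) simp

lemma lookup_pos_part: "lookup (pos_part u) j = nat (u $ j)"
  and lookup_neg_part: "lookup (neg_part u) j = nat (- (u $ j))"
  by (simp_all add: pos_part_def neg_part_def)

lemma m_elem_carrier: "m_elem r B v N \<in> carrier (Shat r)"
  unfolding m_elem_def by (rule Phi_carrier)

lemma m_a_series_zero: "m_a_series r B v N 0 = m_elem r B v N"
proof -
  have z: "pos_part 0 = 0" "neg_part 0 = 0"
    by (rule poly_mapping_eqI, simp add: lookup_pos_part lookup_neg_part)+
  have f: "ffact_series r B z 0 = 1" for z
  proof -
    have "ffact_series r B z 0 = \<one>\<^bsub>Shat r\<^esub>" unfolding ffact_series_def by simp
    then show ?thesis by (simp only: mps_ring_simps)
  qed
  show ?thesis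
    unfolding m_a_series_def z f mps_ring_simps(1)
    by (rule the_equality) (use m_elem_carrier in auto)
qed

lemma x_pow_Bs_eq:
  assumes "Poly_Mapping.keys \<alpha> \<subseteq> {..<r}"
  shows "x_pow_Bs r B \<alpha> c = lmon {..<r} (\<lambda>k. \<Sum>j\<in>UNIV. const (of_int (B k $ j)) * var j) \<alpha> c / of_nat (mfact \<alpha>)"
proof -
  have cv: "const a * var j \<in> carrier (mpoly_ring UNIV)" for a and j :: 'a
  proof -
    have "{m. (const a * var j) m \<noteq> 0} \<subseteq> {Poly_Mapping.single j 1}"
      by (auto simp: const_eq var_def mon_def split: if_splits)
    then show ?thesis by (auto simp: mpoly_ring_simps(5) intro: finite_subset)
  qed
  have "(\<Oplus>\<^bsub>mpoly_ring UNIV\<^esub>j\<in>UNIV. const (of_int (B k $ j)) \<otimes>\<^bsub>mpoly_ring UNIV\<^esub> var j)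
      = (\<Sum>j\<in>UNIV. const (of_int (B k $ j)) * var j)" for k
    by (subst mpoly.finsum_eq) (use cv in \<open>auto simp: mpoly_ring_simps(1)\<close>)
  moreover have "(\<Sum>j\<in>UNIV. const (of_int (B k $ j)) * var j) \<in> carrier (mpoly_ring UNIV)" for k
    by (intro mpoly.sum_closed cv)
  ultimately have "(\<Otimes>\<^bsub>mpoly_ring UNIV\<^esub>k\<in>{..<r}.
        (\<Oplus>\<^bsub>mpoly_ring UNIV\<^esub>j\<in>UNIV. const (of_int (B k $ j)) \<otimes>\<^bsub>mpoly_ring UNIV\<^esub> var j)
          [^]\<^bsub>mpoly_ring UNIV\<^esub> lookup \<alpha> k) = lmon {..<r} (\<lambda>k. \<Sum>j\<in>UNIV. const (of_int (B k $ j)) * var j) \<alpha>"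
    unfolding lmon_def by (subst mpoly.finprod_eq) (auto simp: mpoly.pow_eq intro!: mpoly.power_closed)
  then show ?thesis using assms by (simp add: x_pow_Bs_def)
qed

text \<open>The coefficient of a monomial in \<open>x\<^bsup>B s\<^esup>\<close> is its image under the Gale map, up to a
  factorial.\<close>

lemma x_pow_Bs_Phi: "(\<lambda>\<alpha>. x_pow_Bs r B \<alpha> c) = const (1 / of_nat (mfact c)) * Phi r B (mon c)"
proof
  fix \<alpha>
  show "x_pow_Bs r B \<alpha> c = (const (1 / of_nat (mfact c)) * Phi r B (mon c)) \<alpha>"
  proof (cases "Poly_Mapping.keys \<alpha> \<subseteq> {..<r}")
    case True
    have "of_nat (mfact \<alpha>) * lmon UNIV (gale_form r B) c \<alpha> = of_nat (mfact c) *
        lmon {..<r} (\<lambda>k. \<Sum>j\<in>UNIV. const (of_int (B k $ j)) * var j) \<alpha> c"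
      using symmetric_expansion[of UNIV "{..<r}" c \<alpha> "\<lambda>j k. of_int (B k $ j)"] True
      by (simp add: gale_form_eq[abs_def])
    then have "lmon {..<r} (\<lambda>k. \<Sum>j\<in>UNIV. const (of_int (B k $ j)) * var j) \<alpha> c / of_nat (mfact \<alpha>)
        = lmon UNIV (gale_form r B) c \<alpha> / of_nat (mfact c)"
      unfolding frac_eq_eq[OF mfact_nonzero mfact_nonzero] by (simp only: mult.commute)
    then show ?thesis unfolding x_pow_Bs_eq[OF True] const_coeff Phi_mon by simp
  next
    case False
    then have "Phi r B (mon c) \<alpha> = 0" using Phi_carrier[of r B "mon c"] by (auto simp: mps_ring_simps)
    then show ?thesis using False by (simp add: x_pow_Bs_def const_coeff)
  qed
qed

context gale
begin

definition gale_adj :: "nat dual \<Rightarrow> 'n dual" where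
  "gale_adj Q = adj UNIV (gale_form r B) Q"

lemma pair_gale_adj: "pair f (gale_adj Q) = pair (Phi r B f) Q"
  unfolding gale_adj_def Phi_eq by (rule pair_adj) (auto intro: homog_gale_form[unfolded One_nat_def])

lemma diff_Psi_at_0:
  assumes q: "finite {m. q m \<noteq> 0}" and N: "nsupp v \<in> N"
  shows "diff_Psi A r B v N q 0 = poly_of (ctr (e_elem v N) (gale_adj (dual_of q)))"
proof
  fix c
  have z: "(0 :: int ^ 'n) \<in> lattice A" "shift v 0 = v"
    by (simp_all add: lattice_def shift_def matrix_vector_mult_def vec_eq_iff)
  have "(\<lambda>\<alpha>. Psi A r B v N 0 \<alpha> c) = m_elem r B v N * (\<lambda>\<alpha>. x_pow_Bs r B \<alpha> c)"
    unfolding Psi_def times_fun_def using z N by (simp add: m_a_series_zero)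
  also have "\<dots> = const (1 / of_nat (mfact c)) * Phi r B (mon c * e_elem v N)"
    by (simp add: x_pow_Bs_Phi Phi_times m_elem_def mult_ac)
  finally have "diff_Psi A r B v N q 0 c = 1 / of_nat (mfact c) * pair (mon c * e_elem v N) (gale_adj (dual_of q))"
    by (simp add: diff_Psi_def diff_at_0_pair[OF q] pair_const_left pair_gale_adj)
  then show "diff_Psi A r B v N q 0 c = poly_of (ctr (e_elem v N) (gale_adj (dual_of q))) c"
    by (simp add: poly_of_def lookup_ctr)
qed

lemma gale_adj_annihil_U: "gale_adj Q \<in> annihil (U_ideal A)"
  by (auto simp: annihil_def pair_gale_adj Phi_U)

text \<open>On a functional that kills \<open>U\<close>, the transposes of the Gale map and of its section are
  inverse to each other.\<close>

lemma annihil_U_range: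
  assumes P: "P \<in> annihil (U_ideal A)"
  obtains Q where "gale_adj Q = P" "\<And>m. m \<in> Poly_Mapping.keys Q \<Longrightarrow> Poly_Mapping.keys m \<subseteq> {..<r}"
proof
  let ?Q = "adj {..<r} sec_form P"
  show "gale_adj ?Q = P"
  proof (rule dual_eqI)
    fix c
    have "pair (mon c) (gale_adj ?Q) = pair (sec (Phi r B (mon c))) P"
      unfolding pair_gale_adj sec_def by (rule pair_adj) (auto intro: homog_sec_form[unfolded One_nat_def])
    also have "\<dots> = pair (mon c) P - pair (mon c - sec (Phi r B (mon c))) P"
      by (simp add: pair_diff_left)
    also have "pair (mon c - sec (Phi r B (mon c))) P = 0"
      using P sec_Phi_mod_U by (simp add: annihil_def)
    finally show "pair (mon c) (gale_adj ?Q) = pair (mon c) P" by simp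
  qed
  show "Poly_Mapping.keys m \<subseteq> {..<r}" if "m \<in> Poly_Mapping.keys ?Q" for m
    using that homog_sec_form by (auto simp: in_keys_iff lookup_adj split: if_splits)
qed

definition P_gens :: "complex ^ 'n \<Rightarrow> 'n set set \<Rightarrow> 'n set set" where
  "P_gens v N = {(I \<union> J) - \<Inter>N |I J. I \<in> N \<and> J \<in> nsupps A v - N}"

lemma P_ideal_gens: "P_ideal A v N = genideal Rhat (t_prod ` P_gens v N)"
  unfolding P_ideal_def P_gens_def by (rule arg_cong[of _ _ "genideal Rhat"]) blast

lemma Phi_t_prod: "Phi r B (t_prod X) = (\<Prod>j\<in>X. gale_form r B j)"
proof -
  have "Phi r B (\<Prod>j\<in>X. var j) = (\<Prod>j\<in>X. gale_form r B j)" if "finite X"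
    using that by (induction X rule: finite_induct) (simp_all add: Phi_one Phi_times Phi_var)
  then show ?thesis by (simp add: t_prod_eq)
qed

lemma homog_mps_mpoly:
  assumes "homog d f" "f \<in> carrier (Shat r)"
  shows "f \<in> carrier (mpoly_ring {..<r})"
proof -
  have "{m. f m \<noteq> 0} \<subseteq> {m. total_degree m \<le> d \<and> Poly_Mapping.keys m \<subseteq> {..<r}}"
    using assms by (auto simp: homog_def mps_ring_simps)
  then have "finite {m. f m \<noteq> 0}" by (rule finite_subset) (simp add: finite_total_degree_le)
  then show ?thesis using assms by (simp add: mpoly_ring_simps(5))
qed

lemma gale_form_mpoly: "gale_form r B j \<in> carrier (mpoly_ring {..<r})"
  by (rule homog_mps_mpoly[OF homog_gale_form gale_form_carrier])

lemma P_poly_ideal_gens: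
  "P_poly_ideal A r B v N = genideal (mpoly_ring {..<r}) ((\<lambda>X. Phi r B (t_prod X)) ` P_gens v N)"
proof -
  have "(\<Otimes>\<^bsub>mpoly_ring {..<r}\<^esub>j\<in>X. gale_form r B j) = Phi r B (t_prod X)" for X
    unfolding Phi_t_prod by (rule mpoly.finprod_eq) (simp add: gale_form_mpoly)
  then show ?thesis
    unfolding P_poly_ideal_def P_gens_def by (intro arg_cong[of _ _ "genideal (mpoly_ring {..<r})"]) auto
qed

lemma perp_iff:
  assumes q: "q \<in> carrier (mpoly_ring {..<r})"
  shows "q \<in> perp r (P_poly_ideal A r B v N) \<longleftrightarrow> gale_adj (dual_of q) \<in> annihil (P_ideal A v N)"
proof -
  let ?X = "(\<lambda>X. Phi r B (t_prod X)) ` P_gens v N" and ?Y = "t_prod ` P_gens v N"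
  have fq: "finite {m. q m \<noteq> 0}" using q by (simp add: mpoly_ring_simps)
  have Xc: "?X \<subseteq> carrier (mpoly_ring {..<r})"
    by (auto simp: Phi_t_prod intro!: mpoly.prod_closed gale_form_mpoly)
  have fin: "finite ?X" "finite ?Y" by auto
  have perp: "q \<in> perp r (P_poly_ideal A r B v N) \<longleftrightarrow> (\<forall>f\<in>P_poly_ideal A r B v N. pair f (dual_of q) = 0)"
    using q by (simp add: perp_def diff_at_0_pair[OF fq])
  show ?thesis
  proof
    assume *: "q \<in> perp r (P_poly_ideal A r B v N)"
    have PI: "ideal (P_poly_ideal A r B v N) (mpoly_ring {..<r})"
      unfolding P_poly_ideal_gens by (rule mpoly.genideal_ideal[OF Xc])
    have "ctr (t_prod X) (gale_adj (dual_of q)) = 0" if X: "X \<in> P_gens v N" for X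
    proof (rule dual_eqI)
      fix c
      have "Phi r B (mon c) \<in> carrier (mpoly_ring {..<r})"
        by (rule homog_mps_mpoly[OF _ Phi_carrier])
          (unfold Phi_eq, rule homog_lsub[OF finite_class.finite_UNIV homog_gale_form homog_mon])
      moreover have "Phi r B (t_prod X) \<in> P_poly_ideal A r B v N"
        unfolding P_poly_ideal_gens using mpoly.genideal_self[OF Xc] X by auto
      ultimately have "Phi r B (mon c) * Phi r B (t_prod X) \<in> P_poly_ideal A r B v N"
        using mpoly.idealD(3)[OF PI] by simp
      then show "pair (mon c) (ctr (t_prod X) (gale_adj (dual_of q))) = pair (mon c) 0"
        using * by (simp add: perp pair_ctr pair_gale_adj Phi_times)
    qed
    then show "gale_adj (dual_of q) \<in> annihil (P_ideal A v N)"
      unfolding P_ideal_gens annihil_genideal[OF fin(2)] by auto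
  next
    assume "gale_adj (dual_of q) \<in> annihil (P_ideal A v N)"
    then have *: "ctr (t_prod X) (gale_adj (dual_of q)) = 0" if "X \<in> P_gens v N" for X
      using that unfolding P_ideal_gens annihil_genideal[OF fin(2)] by auto
    have "pair (a * x) (dual_of q) = 0" if a: "a \<in> carrier (mpoly_ring {..<r})" and x: "x \<in> ?X" for a x
    proof -
      obtain X where X: "X \<in> P_gens v N" "x = Phi r B (t_prod X)" using x by auto
      have "a \<in> carrier (Shat r)" using a by (simp add: mpoly_ring_simps(5))
      then have "a * x = Phi r B (sec a * t_prod X)" using X by (simp add: Phi_times Phi_sec)
      then show ?thesis using *[OF X(1)] pair_ctr[of "sec a" "t_prod X" "gale_adj (dual_of q)"]
        by (simp add: pair_gale_adj)
    qed
    then have "pair (\<Sum>x\<in>?X. a x * x) (dual_of q) = 0" if "a \<in> ?X \<rightarrow> carrier (mpoly_ring {..<r})" for a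
      unfolding pair_sum_left using that by (intro sum.neutral ballI) (simp only: Pi_iff)
    then have "\<forall>f\<in>P_poly_ideal A r B v N. pair f (dual_of q) = 0"
      unfolding P_poly_ideal_gens mpoly.genideal_finite[OF fin(1) Xc] by blast
    with perp show "q \<in> perp r (P_poly_ideal A r B v N)" by blast
  qed
qed

lemma annihil_add:
  assumes "ideal I Rhat" "ideal J Rhat"
  shows "annihil (I <+>\<^bsub>Rhat\<^esub> J) = annihil I \<inter> annihil J"
proof (intro equalityI subsetI)
  fix P assume P: "P \<in> annihil (I <+>\<^bsub>Rhat\<^esub> J)"
  have "pair f P = 0" if "f \<in> I" for f
  proof -
    have "f + 0 \<in> I <+>\<^bsub>Rhat\<^esub> J" using that mps.idealD(1)[OF assms(2)] unfolding set_add_Rhat by blast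
    then show ?thesis using P by (simp add: annihil_def)
  qed
  moreover have "pair f P = 0" if "f \<in> J" for f
  proof -
    have "0 + f \<in> I <+>\<^bsub>Rhat\<^esub> J" using that mps.idealD(1)[OF assms(1)] unfolding set_add_Rhat by blast
    then show ?thesis using P by (simp add: annihil_def)
  qed
  ultimately show "P \<in> annihil I \<inter> annihil J" by (simp add: annihil_def)
qed (auto simp: annihil_def set_add_Rhat pair_add_left)

lemma P_ideal_ideal: "ideal (P_ideal A v N) Rhat"
  unfolding P_ideal_gens by (rule mps.genideal_ideal) simp

text \<open>At \<open>u = 0\<close> the coefficient \<open>a\<^sub>u\<close> is one, so the coefficient of \<open>x\<^sup>v\<close> in
  \<open>q(\<partial>\<^sub>s) \<Psi>\<close> pairs \<open>q\<close> with \<open>m(s) x\<^bsup>B s\<^esup>\<close>.  Transposing \<open>\<Phi>\<close> turns this into the contraction of a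
  functional with \<open>e\<close>, and \<open>q\<close> runs through the orthogonal space of the ideal exactly if the
  functional runs through those that kill \<open>U\<close> and \<open>P\<close>.\<close>

theorem intrinsic_space_eq:
  assumes N: "nsupp v \<in> N"
  shows "intrinsic_space A r B v N
    = (\<lambda>P. poly_of (ctr (e_elem v N) P)) ` annihil (U_ideal A <+>\<^bsub>Rhat\<^esub> P_ideal A v N)"
  unfolding annihil_add[OF U_ideal_ideal P_ideal_ideal]
proof (intro equalityI subsetI)
  fix p assume "p \<in> intrinsic_space A r B v N"
  then obtain q where q: "p = diff_Psi A r B v N q 0" "q \<in> perp r (P_poly_ideal A r B v N)"
    by (auto simp: intrinsic_space_def)
  then have qc: "q \<in> carrier (mpoly_ring {..<r})" by (simp add: perp_def)
  then have "finite {m. q m \<noteq> 0}" by (simp add: mpoly_ring_simps)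
  then show "p \<in> (\<lambda>P. poly_of (ctr (e_elem v N) P)) ` (annihil (U_ideal A) \<inter> annihil (P_ideal A v N))"
    using diff_Psi_at_0[OF _ N] q perp_iff[OF qc] gale_adj_annihil_U by auto
next
  fix p assume "p \<in> (\<lambda>P. poly_of (ctr (e_elem v N) P)) ` (annihil (U_ideal A) \<inter> annihil (P_ideal A v N))"
  then obtain P where P: "p = poly_of (ctr (e_elem v N) P)" "P \<in> annihil (U_ideal A)" "P \<in> annihil (P_ideal A v N)"
    by auto
  obtain Q where Q: "gale_adj Q = P" "\<And>m. m \<in> Poly_Mapping.keys Q \<Longrightarrow> Poly_Mapping.keys m \<subseteq> {..<r}"
    using annihil_U_range[OF P(2)] by blast
  have qc: "poly_of Q \<in> carrier (mpoly_ring {..<r})" using Q(2) by (simp add: poly_of_carrier)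
  then have "finite {m. poly_of Q m \<noteq> 0}" by (simp add: mpoly_ring_simps)
  from diff_Psi_at_0[OF this N] have "p = diff_Psi A r B v N (poly_of Q) 0"
    using P Q by (simp add: dual_of_poly_of)
  moreover have "poly_of Q \<in> perp r (P_poly_ideal A r B v N)"
    using perp_iff[OF qc] Q P by (simp add: dual_of_poly_of)
  ultimately show "p \<in> intrinsic_space A r B v N" by (auto simp: intrinsic_space_def)
qed

end


section \<open>The action of the Weyl algebra on logarithmic series\<close>

definition ff :: "'a::comm_ring_1 \<Rightarrow> nat \<Rightarrow> 'a" where
  "ff X n = (\<Prod>i<n. X - of_nat i)"

lemma ff_0 [simp]: "ff X 0 = 1"
  by (simp add: ff_def)

lemma ff_Suc: "ff X (Suc n) = ff X n * (X - of_nat n)"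
  by (simp add: ff_def)

lemma ff_add: "ff X (d + b) = ff X d * ff (X - of_nat d) b"
  by (induction b) (simp_all add: ff_Suc algebra_simps)

lemma ff_plus_one: "ff (X + 1) (Suc n) = (X + 1) * ff X n"
  by (induction n) (simp_all add: ff_Suc algebra_simps)

lemma ff_difference: "ff (X + 1) b = ff X b + of_nat b * ff X (b - 1)"
proof (cases b)
  case (Suc n)
  then show ?thesis by (simp only: ff_plus_one) (simp add: ff_Suc algebra_simps)
qed simp

text \<open>Vandermonde's identity, by induction on \<open>c\<close> from the difference equation of the falling
  factorial.  Applied to \<open>\<partial>\<^sup>b x\<^sup>c\<close>, it is the Leibniz rule.\<close>

lemma ff_Vandermonde:
  "ff (X + of_nat c) b = (\<Sum>k\<le>b. of_nat ((b choose k) * (c choose k) * fact k) * ff X (b - k))"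
proof (induction c arbitrary: X)
  case 0
  have "(\<Sum>k\<le>b. of_nat ((b choose k) * (0 choose k) * fact k) * ff X (b - k))
      = (\<Sum>k\<in>{0}. of_nat ((b choose k) * (0 choose k) * fact k) * ff X (b - k))"
  proof (rule sum.mono_neutral_right)
    show "\<forall>k\<in>{..b} - {0}. of_nat ((b choose k) * (0 choose k) * fact k) * ff X (b - k) = 0"
    proof
      fix k assume "k \<in> {..b} - {0}"
      then have "0 choose k = 0" by (simp add: binomial_eq_0_iff)
      then show "of_nat ((b choose k) * (0 choose k) * fact k) * ff X (b - k) = 0"
        by (simp only: mult_zero_left mult_zero_right of_nat_0)
    qed
  qed auto
  then show ?case by simp
next
  case (Suc c)
  let ?a = "\<lambda>k. of_nat ((b choose k) * (c choose k) * fact k) * ff X (b - k)"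
  let ?b = "\<lambda>k. of_nat ((b choose k) * (c choose (k - 1)) * fact k) * ff X (b - k)"
  have step: "of_nat ((b choose k) * (c choose k) * fact k) * ff (X + 1) (b - k) = ?a k + (if k < b then ?b (Suc k) else 0)"
    if "k \<le> b" for k
  proof (cases "k < b")
    case True
    have absorb0: "(b choose k) * (b - k) = (b choose Suc k) * Suc k"
      using binomial_absorb_comp[of b k] binomial_absorption[of k "b"] True
      by (metis Suc_diff_Suc binomial_absorption mult.commute)
    have "(b choose k) * (c choose k) * fact k * (b - k) = ((b choose k) * (b - k)) * ((c choose k) * fact k)"
      by (simp only: mult_ac)
    also have "\<dots> = (b choose Suc k) * (c choose k) * fact (Suc k)"
      unfolding absorb0 by (simp only: fact_Suc of_nat_id mult_ac)
    finally have absorb: "(b choose k) * (c choose k) * fact k * (b - k) = (b choose Suc k) * (c choose k) * fact (Suc k)" .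
    have "of_nat ((b choose k) * (c choose k) * fact k) * (of_nat (b - k) * ff X (b - k - 1))
        = of_nat ((b choose k) * (c choose k) * fact k * (b - k)) * ff X (b - k - 1)"
      by (simp only: of_nat_mult mult.assoc)
    also have "\<dots> = ?b (Suc k)" unfolding absorb by simp
    finally have "of_nat ((b choose k) * (c choose k) * fact k) * (of_nat (b - k) * ff X (b - k - 1)) = ?b (Suc k)" .
    then show ?thesis using True by (simp only: ff_difference[of X "b - k"] distrib_left) simp
  next
    case False
    then show ?thesis using that by simp
  qed
  have tail: "(\<Sum>k\<le>b. if k < b then g k else 0) = (\<Sum>k<b. g k)" for g :: "nat \<Rightarrow> 'a"
    by (simp add: lessThan_Suc_atMost[symmetric])
  have "ff (X + of_nat (Suc c)) b = ff ((X + 1) + of_nat c) b" by (simp add: algebra_simps)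
  also have "\<dots> = (\<Sum>k\<le>b. ?a k + (if k < b then ?b (Suc k) else 0))"
    unfolding Suc.IH by (rule sum.cong) (use step in auto)
  also have "\<dots> = (\<Sum>k\<le>b. ?a k) + (\<Sum>k<b. ?b (Suc k))"
    unfolding sum.distrib tail ..
  also have "(\<Sum>k<b. ?b (Suc k)) = (\<Sum>k\<in>{1..b}. ?b k)"
    by (rule sum.reindex_bij_witness[of _ "\<lambda>k. k - 1" Suc]) auto
  also have "(\<Sum>k\<le>b. ?a k) = ?a 0 + (\<Sum>k\<in>{1..b}. ?a k)"
    by (simp add: atMost_atLeast0 sum.atLeast_Suc_atMost)
  also have "?a 0 + (\<Sum>k\<in>{1..b}. ?a k) + (\<Sum>k\<in>{1..b}. ?b k)
      = ?a 0 + (\<Sum>k\<in>{1..b}. of_nat ((b choose k) * (Suc c choose k) * fact k) * ff X (b - k))"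
    unfolding add.assoc sum.distrib[symmetric]
  proof (intro arg_cong2[of _ _ _ _ "(+)"] refl sum.cong)
    fix k assume "k \<in> {1..b}"
    then obtain l where k: "k = Suc l" by (cases k) auto
    show "?a k + ?b k = of_nat ((b choose k) * (Suc c choose k) * fact k) * ff X (b - k)"
      unfolding k by (simp add: algebra_simps del: fact_Suc)
  qed
  also have "\<dots> = (\<Sum>k\<le>b. of_nat ((b choose k) * (Suc c choose k) * fact k) * ff X (b - k))"
    by (simp add: atMost_atLeast0 sum.atLeast_Suc_atMost)
  finally show ?case .
qed

definition ivec :: "('n::finite \<Rightarrow>\<^sub>0 nat) \<Rightarrow> int ^ 'n" where
  "ivec b = (\<chi> j. int (lookup b j))"

lemma ivec_nth [simp]: "ivec b $ j = int (lookup b j)"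
  by (simp add: ivec_def)

lemma ivec_0 [simp]: "ivec 0 = 0" and ivec_add: "ivec (a + b) = ivec a + ivec b"
  by (simp_all add: vec_eq_iff lookup_add)

definition leq :: "('n \<Rightarrow>\<^sub>0 nat) \<Rightarrow> ('n \<Rightarrow>\<^sub>0 nat) \<Rightarrow> bool" where
  "leq a b \<longleftrightarrow> (\<forall>j. lookup a j \<le> lookup b j)"

definition lin :: "'n \<Rightarrow> complex \<Rightarrow> 'n series" where
  "lin j x = const x + var j"

lemma lin_shift: "lin j (x + of_nat k) = lin j x + of_nat k" "lin j (x - of_nat k) = lin j x - of_nat k"
proof -
  show *: "lin j (x + of_nat k) = lin j x + of_nat k" for x
    by (simp add: lin_def const_add of_nat_series add_ac)
  show "lin j (x - of_nat k) = lin j x - of_nat k"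
    using *[of "x - of_nat k"] by (simp add: algebra_simps)
qed

text \<open>The falling factorial \<open>[c + t]\<^sub>b\<close>.\<close>

definition fser :: "complex ^ 'n \<Rightarrow> ('n::finite \<Rightarrow>\<^sub>0 nat) \<Rightarrow> 'n series" where
  "fser c b = (\<Prod>j\<in>UNIV. ff (lin j (c $ j)) (lookup b j))"

lemma fser_0 [simp]: "fser c 0 = 1"
  by (simp add: fser_def)

lemma fser_add: "fser (shift v z) (d + b) = fser (shift v z) d * fser (shift v (z - ivec d)) b"
proof -
  have e: "ff (lin j (shift v z $ j)) (lookup (d + b) j)
      = ff (lin j (shift v z $ j)) (lookup d j) * ff (lin j (shift v (z - ivec d) $ j)) (lookup b j)" for j
  proof -
    have "shift v (z - ivec d) $ j = shift v z $ j - of_nat (lookup d j)" by (simp add: shift_def)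
    then show ?thesis by (simp only: lookup_add ff_add lin_shift)
  qed
  show ?thesis unfolding fser_def e prod.distrib ..
qed

definition binom :: "('n \<Rightarrow>\<^sub>0 nat) \<Rightarrow> ('n \<Rightarrow>\<^sub>0 nat) \<Rightarrow> ('n::finite \<Rightarrow>\<^sub>0 nat) \<Rightarrow> nat" where
  "binom b c k = (\<Prod>j\<in>UNIV. (lookup b j choose lookup k j) * (lookup c j choose lookup k j) * fact (lookup k j))"

lemma finite_leq: "finite {k :: 'n::finite \<Rightarrow>\<^sub>0 nat. leq k b}"
  unfolding leq_def by (rule finite_lookup_le)

lemma fser_Vandermonde:
  "fser (shift v (z + ivec c)) b
    = (\<Sum>k | leq k b \<and> leq k c. const (of_nat (binom b c k)) * fser (shift v z) (b - k))"
proof -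
  let ?g = "\<lambda>j k. of_nat ((lookup b j choose k) * (lookup c j choose k) * fact k) * ff (lin j (shift v z $ j)) (lookup b j - k)"
  have "shift v (z + ivec c) $ j = shift v z $ j + of_nat (lookup c j)" for j by (simp add: shift_def)
  then have "fser (shift v (z + ivec c)) b = (\<Prod>j\<in>UNIV. \<Sum>k\<le>lookup b j. ?g j k)"
    unfolding fser_def by (simp only: lin_shift ff_Vandermonde)
  also have "\<dots> = (\<Sum>h\<in>PiE UNIV (\<lambda>j. {..lookup b j}). \<Prod>j\<in>UNIV. ?g j (h j))"
    by (rule prod_sum_PiE) auto
  also have "\<dots> = (\<Sum>k | leq k b. \<Prod>j\<in>UNIV. ?g j (lookup k j))"
    by (rule sum.reindex_bij_witness[of _ lookup Abs_poly_mapping]) (auto simp: leq_def PiE_iff)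
  also have "\<dots> = (\<Sum>k | leq k b. const (of_nat (binom b c k)) * fser (shift v z) (b - k))"
  proof (rule sum.cong[OF refl])
    fix k assume "k \<in> {k. leq k b}"
    show "(\<Prod>j\<in>UNIV. ?g j (lookup k j)) = const (of_nat (binom b c k)) * fser (shift v z) (b - k)"
      by (subst prod.distrib) (simp only: of_nat_series[symmetric] of_nat_prod[symmetric] fser_def binom_def lookup_minus)
  qed
  also have "\<dots> = (\<Sum>k | leq k b \<and> leq k c. const (of_nat (binom b c k)) * fser (shift v z) (b - k))"
  proof (rule sum.mono_neutral_right)
    show "\<forall>k\<in>{k. leq k b} - {k. leq k b \<and> leq k c}. const (of_nat (binom b c k)) * fser (shift v z) (b - k) = 0"
    proof
      fix k assume "k \<in> {k. leq k b} - {k. leq k b \<and> leq k c}"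
      then obtain j where "\<not> lookup k j \<le> lookup c j" unfolding leq_def by blast
      then have "lookup c j < lookup k j" by simp
      then have "binom b c k = 0"
        unfolding binom_def by (intro prod_zero) (auto intro!: bexI[of _ j] simp: binomial_eq_0_iff)
      then show "const (of_nat (binom b c k)) * fser (shift v z) (b - k) = 0" by simp
    qed
  qed (auto simp: finite_leq)
  finally show ?thesis .
qed

text \<open>The operator \<open>x\<^sup>a \<partial>\<^sup>b\<close> for a pair \<open>p = (a, b)\<close>.  Polynomials in \<open>log x\<close> are represented by
  functionals, so that differentiation by \<open>y\<^sub>j\<close> is contraction with \<open>t\<^sub>j\<close> and \<open>\<partial>\<^sup>b\<close> is contraction with a
  falling factorial.\<close>

definition mact :: "complex ^ 'n \<Rightarrow> ('n \<Rightarrow>\<^sub>0 nat) \<times> ('n \<Rightarrow>\<^sub>0 nat) \<Rightarrow> (int ^ 'n \<Rightarrow> 'n dual) \<Rightarrow> int ^ 'n::finite \<Rightarrow> 'n dual" where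
  "mact v p \<Psi> z = (case p of (a, b) \<Rightarrow>
     ctr (fser (shift v (z - ivec a + ivec b)) b) (\<Psi> (z - ivec a + ivec b)))"

definition wact :: "complex ^ 'n \<Rightarrow> 'n weyl \<Rightarrow> (int ^ 'n \<Rightarrow> 'n dual) \<Rightarrow> int ^ 'n::finite \<Rightarrow> 'n dual" where
  "wact v P \<Psi> z = (\<Sum>p | P p \<noteq> 0. ctr (const (P p)) (mact v p \<Psi> z))"

lemma ctr_sum_right: "ctr f (\<Sum>x\<in>A. P x) = (\<Sum>x\<in>A. ctr f (P x))"
  by (induction A rule: infinite_finite_induct) (simp_all add: ctr_add_right)

lemma ctr_sum_left: "ctr (\<Sum>x\<in>A. f x) P = (\<Sum>x\<in>A. ctr (f x) P)"
  by (induction A rule: infinite_finite_induct) (simp_all add: ctr_add_left)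

lemma wact_superset: "finite F \<Longrightarrow> {p. P p \<noteq> 0} \<subseteq> F \<Longrightarrow> wact v P \<Psi> z = (\<Sum>p\<in>F. ctr (const (P p)) (mact v p \<Psi> z))"
  unfolding wact_def by (rule sum.mono_neutral_left) auto

text \<open>The coefficients of a product are sums over the pairs of terms that contribute to the same
  normally ordered monomial.  The action may be computed term by term without collecting them.\<close>

lemma wact_gather:
  assumes T: "finite T" and c: "\<And>x. P x = (\<Sum>t | t \<in> T \<and> H t = x. f t)"
  shows "finite {x. P x \<noteq> 0}" "wact v P \<Psi> z = (\<Sum>t\<in>T. ctr (const (f t)) (mact v (H t) \<Psi> z))"
proof -
  have sub: "{x. P x \<noteq> 0} \<subseteq> H ` T"
  proof
    fix x assume "x \<in> {x. P x \<noteq> 0}"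
    then have "{t. t \<in> T \<and> H t = x} \<noteq> {}" unfolding mem_Collect_eq c by (metis sum.empty)
    then show "x \<in> H ` T" by auto
  qed
  show "finite {x. P x \<noteq> 0}" using finite_subset[OF sub] T by simp
  have "wact v P \<Psi> z = (\<Sum>x\<in>H ` T. \<Sum>t | t \<in> T \<and> H t = x. ctr (const (f t)) (mact v (H t) \<Psi> z))"
    using T by (simp add: wact_superset[OF _ sub] c const_sum ctr_sum_left)
  also have "\<dots> = (\<Sum>t\<in>T. ctr (const (f t)) (mact v (H t) \<Psi> z))"
    by (rule sum.group) (use T in auto)
  finally show "wact v P \<Psi> z = (\<Sum>t\<in>T. ctr (const (f t)) (mact v (H t) \<Psi> z))" .
qed

text \<open>Both sides involve the same value of \<open>\<Psi>\<close>, and the multipliers agree by Vandermonde's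
  identity.\<close>

lemma mact_comp:
  "mact v (a, b) (mact v (c, d) \<Psi>) z = (\<Sum>k | leq k b \<and> leq k c.
     ctr (const (of_nat (binom b c k))) (mact v (a + (c - k), (b - k) + d) \<Psi> z))"
proof -
  let ?y = "z - ivec a + ivec b - ivec c + ivec d"
  have Y: "z - ivec a + ivec b = ?y - ivec d + ivec c" by (simp add: algebra_simps)
  have k: "mact v (a + (c - k), (b - k) + d) \<Psi> z = ctr (fser (shift v ?y) d * fser (shift v (?y - ivec d)) (b - k)) (\<Psi> ?y)"
    if "leq k b" "leq k c" for k
  proof -
    have "z - ivec (a + (c - k)) + ivec ((b - k) + d) = ?y"
      using that by (auto simp: vec_eq_iff lookup_add lookup_minus leq_def of_nat_diff trans_le_add1 trans_le_add2)
    then show ?thesis unfolding mact_def by (simp only: prod.case add.commute[of "b - k" d] fser_add)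
  qed
  have "mact v (a, b) (mact v (c, d) \<Psi>) z
      = ctr (fser (shift v (z - ivec a + ivec b)) b * fser (shift v ?y) d) (\<Psi> ?y)"
    by (simp add: mact_def ctr_times)
  also have "fser (shift v (z - ivec a + ivec b)) b
      = (\<Sum>k | leq k b \<and> leq k c. const (of_nat (binom b c k)) * fser (shift v (?y - ivec d)) (b - k))"
    using fser_Vandermonde[of v "?y - ivec d" c b] by (simp only: Y[symmetric])
  also have "ctr ((\<Sum>k | leq k b \<and> leq k c. const (of_nat (binom b c k)) * fser (shift v (?y - ivec d)) (b - k)) * fser (shift v ?y) d) (\<Psi> ?y)
      = (\<Sum>k | leq k b \<and> leq k c. ctr (const (of_nat (binom b c k))) (mact v (a + (c - k), (b - k) + d) \<Psi> z))"
    unfolding sum_distrib_right ctr_sum_left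
  proof (rule sum.cong[OF refl])
    fix k assume "k \<in> {k. leq k b \<and> leq k c}"
    then show "ctr (const (of_nat (binom b c k)) * fser (shift v (?y - ivec d)) (b - k) * fser (shift v ?y) d) (\<Psi> ?y)
        = ctr (const (of_nat (binom b c k))) (mact v (a + (c - k), (b - k) + d) \<Psi> z)"
      by (simp only: k mem_Collect_eq ctr_times[symmetric] mult_ac)
  qed
  finally show ?thesis .
qed

lemma wact_mult:
  fixes P Q :: "'n::finite weyl"
  assumes "finite {p. P p \<noteq> 0}" "finite {p. Q p \<noteq> 0}"
  shows "finite {p. (P \<otimes>\<^bsub>weyl_algebra\<^esub> Q) p \<noteq> 0}"
    and "wact v (P \<otimes>\<^bsub>weyl_algebra\<^esub> Q) \<Psi> z = wact v P (wact v Q \<Psi>) z"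
proof -
  let ?T = "SIGMA p:{p. P p \<noteq> 0}. SIGMA q:{q. Q q \<noteq> 0}. {k. leq k (snd p) \<and> leq k (fst q)}"
  let ?H = "\<lambda>(p, q, k). (fst p + (fst q - k), (snd p - k) + snd q)"
  let ?f = "\<lambda>(p, q, k). P p * Q q * of_nat (binom (snd p) (fst q) k)"
  have finK: "finite {k. leq k b \<and> leq k c}" for b c :: "'n \<Rightarrow>\<^sub>0 nat"
    using finite_leq[of b] by (rule rev_finite_subset) auto
  have T: "finite ?T" using assms by (intro finite_SigmaI finK)
  have c: "(P \<otimes>\<^bsub>weyl_algebra\<^esub> Q) x = (\<Sum>t | t \<in> ?T \<and> ?H t = x. ?f t)" for x
  proof -
    obtain e f where x: "x = (e, f)" by (cases x)
    have "(P \<otimes>\<^bsub>weyl_algebra\<^esub> Q) x = (\<Sum>p | P p \<noteq> 0. \<Sum>q | Q q \<noteq> 0.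
        \<Sum>k | (leq k (snd p) \<and> leq k (fst q)) \<and> ?H (p, q, k) = x. ?f (p, q, k))"
      by (simp add: weyl_algebra_def x leq_def binom_def case_prod_unfold all_conj_distrib conj_assoc)
    also have "\<dots> = (\<Sum>p | P p \<noteq> 0. \<Sum>q | Q q \<noteq> 0.
        \<Sum>k | leq k (snd p) \<and> leq k (fst q). if ?H (p, q, k) = x then ?f (p, q, k) else 0)"
    proof (rule sum.cong[OF refl], rule sum.cong[OF refl])
      fix p q
      show "(\<Sum>k | (leq k (snd p) \<and> leq k (fst q)) \<and> ?H (p, q, k) = x. ?f (p, q, k))
        = (\<Sum>k | leq k (snd p) \<and> leq k (fst q). if ?H (p, q, k) = x then ?f (p, q, k) else 0)"
        using sum.inter_filter[OF finK, of "\<lambda>k. ?f (p, q, k)" "snd p" "fst q" "\<lambda>k. ?H (p, q, k) = x"]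
        by (simp only: mem_Collect_eq)
    qed
    also have "\<dots> = (\<Sum>t\<in>?T. if ?H t = x then ?f t else 0)"
      using assms finK by (simp add: sum.Sigma finite_SigmaI case_prod_unfold cong: if_cong)
    also have "\<dots> = (\<Sum>t | t \<in> ?T \<and> ?H t = x. ?f t)"
      by (rule sum.inter_filter[OF T, symmetric])
    finally show ?thesis .
  qed
  show "finite {p. (P \<otimes>\<^bsub>weyl_algebra\<^esub> Q) p \<noteq> 0}" by (rule wact_gather(1)[OF T c])
  have "wact v P (wact v Q \<Psi>) z = (\<Sum>p | P p \<noteq> 0. \<Sum>q | Q q \<noteq> 0.
      ctr (const (P p * Q q)) (mact v p (mact v q \<Psi>) z))"
  proof -
    have "mact v p (wact v Q \<Psi>) z = (\<Sum>q | Q q \<noteq> 0. ctr (const (Q q)) (mact v p (mact v q \<Psi>) z))" for p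
      by (cases p) (simp add: mact_def wact_def ctr_sum_right ctr_commute)
    then show ?thesis by (simp add: wact_def[of v P] ctr_sum_right ctr_times const_mult)
  qed
  also have "\<dots> = (\<Sum>p | P p \<noteq> 0. \<Sum>q | Q q \<noteq> 0. \<Sum>k | leq k (snd p) \<and> leq k (fst q).
      ctr (const (?f (p, q, k))) (mact v (?H (p, q, k)) \<Psi> z))"
  proof (intro sum.cong refl)
    fix p q :: "('n \<Rightarrow>\<^sub>0 nat) \<times> ('n \<Rightarrow>\<^sub>0 nat)"
    have "mact v p (mact v q \<Psi>) z = (\<Sum>k | leq k (snd p) \<and> leq k (fst q).
        ctr (const (of_nat (binom (snd p) (fst q) k))) (mact v (?H (p, q, k)) \<Psi> z))"
      using mact_comp[of v "fst p" "snd p" "fst q" "snd q" \<Psi> z] by simp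
    then show "ctr (const (P p * Q q)) (mact v p (mact v q \<Psi>) z) = (\<Sum>k | leq k (snd p) \<and> leq k (fst q).
        ctr (const (?f (p, q, k))) (mact v (?H (p, q, k)) \<Psi> z))"
      by (simp only: ctr_sum_right const_mult ctr_times prod.case)
  qed
  also have "\<dots> = (\<Sum>t\<in>?T. ctr (const (?f t)) (mact v (?H t) \<Psi> z))"
    using assms finK by (simp add: sum.Sigma finite_SigmaI case_prod_unfold)
  finally show "wact v (P \<otimes>\<^bsub>weyl_algebra\<^esub> Q) \<Psi> z = wact v P (wact v Q \<Psi>) z"
    using wact_gather(2)[OF T c] by metis
qed


text \<open>On functionals, \<open>\<partial>\<^sub>j\<close> is contraction with \<open>v\<^sub>j + z\<^sub>j + 1 + t\<^sub>j\<close>, followed by a shift of the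
  exponent.\<close>

abbreviation log_family :: "(int ^ 'n \<Rightarrow> 'n dual) \<Rightarrow> 'n log_series" where
  "log_family \<Psi> \<equiv> \<lambda>z. poly_of (\<Psi> z)"

lemma lookup_ctr_lin: "lookup (ctr (lin j x) P) c = x * lookup P c + lookup P (c + Poly_Mapping.single j 1)"
proof -
  have "mon c * lin j x = const x * mon c + mon (c + Poly_Mapping.single j 1)"
    by (simp add: lin_def distrib_left mult.commute[of _ "const x"] var_def mon_times_mon)
  then show ?thesis by (simp add: lookup_ctr pair_add_left pair_const_left pair_mon)
qed

lemma log_partial_family:
  "log_partial v j (log_family \<Psi>) = log_family (\<lambda>z. ctr (lin j (v $ j + of_int (z $ j) + 1)) (\<Psi> (z + axis j 1)))"
proof (intro ext)
  fix z c
  have f: "of_nat (lookup c j + 1) * (x / of_nat (mfact (c + Poly_Mapping.single j 1))) = x / (of_nat (mfact c) :: complex)" for x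
  proof -
    have "of_nat (lookup c j + 1) \<noteq> (0 :: complex)" unfolding of_nat_eq_0_iff by simp
    then show ?thesis unfolding mfact_add_single of_nat_mult times_divide_eq_right
      by (rule nonzero_mult_divide_mult_cancel_left)
  qed
  show "log_partial v j (log_family \<Psi>) z c = log_family (\<lambda>z. ctr (lin j (v $ j + of_int (z $ j) + 1)) (\<Psi> (z + axis j 1))) z c"
    unfolding log_partial_def poly_of_def f lookup_ctr_lin by (simp add: add_divide_distrib)
qed

lemma log_partial_power:
  fixes v :: "complex ^ 'n::finite"
  shows "(log_partial v j ^^ n) (log_family \<Psi>) = log_family (\<lambda>z.
     ctr (ff (lin j (v $ j + of_int (z $ j + int n))) n) (\<Psi> (z + axis j (int n))))"
proof (induction n)
  case 0
  have ax: "axis j 0 = (0 :: int ^ 'n)" by (simp add: vec_eq_iff axis_def)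
  show ?case by (simp add: ax)
next
  case (Suc n)
  have a: "z + axis j 1 + axis j (int n) = z + axis j (int (Suc n))" for z :: "int ^ 'n"
    by (simp add: vec_eq_iff axis_def)
  have b: "ff (lin j (v $ j + of_int ((z + axis j 1) $ j + int n))) n * lin j (v $ j + of_int (z $ j) + 1)
      = ff (lin j (v $ j + of_int (z $ j + int (Suc n)))) (Suc n)" for z
  proof -
    have "(z + axis j 1) $ j + int n = z $ j + int (Suc n)" by (simp add: axis_def)
    moreover have "v $ j + of_int (z $ j) + 1 = v $ j + of_int (z $ j + int (Suc n)) - of_nat n" by simp
    ultimately show ?thesis by (simp only: ff_Suc lin_shift(2))
  qed
  show ?case unfolding funpow.simps o_apply Suc.IH log_partial_family ctr_times[symmetric] a
    by (simp only: mult.commute[of "lin j _"] b)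
qed

lemma log_partial_commute:
  fixes v :: "complex ^ 'n::finite"
  shows "log_partial v j (log_partial v k \<phi>) = log_partial v k (log_partial v j \<phi>)"
proof (cases "j = k")
  case False
  show ?thesis
  proof (intro ext)
    fix z :: "int ^ 'n" and c
    let ?J = "Poly_Mapping.single j (1 :: nat)" and ?K = "Poly_Mapping.single k (1 :: nat)"
    have l: "lookup (c + ?J) k = lookup c k" "lookup (c + ?K) j = lookup c j"
      "(z + axis j 1) $ k = z $ k" "(z + axis k 1) $ j = z $ j"
      using False by (simp_all add: lookup_add lookup_single axis_def)
    have c: "z + axis k 1 + axis j 1 = z + axis j 1 + axis k 1" "c + ?K + ?J = c + ?J + ?K"
      by (simp_all add: add_ac)
    show "log_partial v j (log_partial v k \<phi>) z c = log_partial v k (log_partial v j \<phi>) z c"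
      unfolding log_partial_def l c by (simp add: algebra_simps)
  qed
qed simp

lemma log_partials_fold:
  fixes v :: "complex ^ 'n::finite"
  assumes "finite S"
  shows "Finite_Set.fold (\<lambda>j \<psi>. (log_partial v j ^^ lookup b j) \<psi>) (log_family \<Psi>) S = log_family (\<lambda>z.
     ctr (\<Prod>j\<in>S. ff (lin j (v $ j + of_int (z $ j + int (lookup b j)))) (lookup b j))
       (\<Psi> (z + (\<Sum>j\<in>S. axis j (int (lookup b j))))))"
  using assms
proof (induction S rule: finite_induct)
  case empty
  then show ?case by simp
next
  case (insert x S)
  have 1: "log_partial v j ((log_partial v k ^^ n) \<phi>) = (log_partial v k ^^ n) (log_partial v j \<phi>)" for j k n \<phi>
    by (induction n) (simp_all add: log_partial_commute[of v j])
  have 2: "(log_partial v j ^^ m) ((log_partial v k ^^ n) \<phi>) = (log_partial v k ^^ n) ((log_partial v j ^^ m) \<phi>)" for j k m n \<phi>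
    by (induction m) (simp_all add: 1)
  interpret comp_fun_commute_on UNIV "\<lambda>j. log_partial v j ^^ lookup b j"
    by unfold_locales (auto simp: fun_eq_iff 2)
  let ?n = "int (lookup b x)"
  have z: "(z + axis x ?n) $ j = z $ j" if "j \<in> S" for z :: "int ^ 'n" and j
    using that insert.hyps(2) by (auto simp: axis_def)
  have p: "(\<Prod>j\<in>S. ff (lin j (v $ j + of_int ((z + axis x ?n) $ j + int (lookup b j)))) (lookup b j))
      = (\<Prod>j\<in>S. ff (lin j (v $ j + of_int (z $ j + int (lookup b j)))) (lookup b j))" for z
    by (rule prod.cong[OF refl]) (simp only: z)
  have "Finite_Set.fold (\<lambda>j. log_partial v j ^^ lookup b j) (log_family \<Psi>) (insert x S)
      = (log_partial v x ^^ lookup b x) (Finite_Set.fold (\<lambda>j. log_partial v j ^^ lookup b j) (log_family \<Psi>) S)"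
    by (rule fold_insert) (use insert.hyps in auto)
  also have "Finite_Set.fold (\<lambda>j. log_partial v j ^^ lookup b j) (log_family \<Psi>) S = log_family (\<lambda>z.
     ctr (\<Prod>j\<in>S. ff (lin j (v $ j + of_int (z $ j + int (lookup b j)))) (lookup b j))
       (\<Psi> (z + (\<Sum>j\<in>S. axis j (int (lookup b j))))))"
    using insert.IH by simp
  finally show ?case
    unfolding log_partial_power p ctr_times[symmetric] prod.insert[OF insert.hyps] sum.insert[OF insert.hyps]
    by (simp add: add.assoc)
qed

text \<open>The factorial in the passage from functionals to polynomials absorbs the factor \<open>c\<^sub>j + 1\<close>
  that differentiation by \<open>y\<^sub>j\<close> produces.\<close>

lemma weyl_act_family:
  fixes v :: "complex ^ 'n::finite"
  shows "weyl_act v P (log_family \<Psi>) = log_family (wact v P \<Psi>)"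
proof (intro ext)
  fix z c
  have vec: "(\<Sum>j\<in>UNIV. axis j (int (lookup b j))) = ivec b" for b :: "'n \<Rightarrow>\<^sub>0 nat"
    by (simp add: vec_eq_iff axis_def)
  have fold: "Finite_Set.fold (\<lambda>j \<psi>. (log_partial v j ^^ lookup b j) \<psi>) (log_family \<Psi>) UNIV (z - (\<chi> j. int (lookup a j)))
      = poly_of (mact v (a, b) \<Psi> z)" for a b
    unfolding log_partials_fold[OF finite_class.finite_UNIV] vec mact_def fser_def shift_def ivec_def by simp
  have sum: "lookup (\<Sum>x\<in>F. f x) c = (\<Sum>x\<in>F. lookup (f x) c)" for f :: "_ \<Rightarrow> 'n dual" and F :: "(('n \<Rightarrow>\<^sub>0 nat) \<times> ('n \<Rightarrow>\<^sub>0 nat)) set"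
    by (induction F rule: infinite_finite_induct) (simp_all add: lookup_add)
  have sc: "lookup (ctr (const x) P) c = x * lookup P c" for x and P :: "'n dual"
    using lookup_ctr_const[of x 1 P c] by simp
  have "weyl_act v P (log_family \<Psi>) z c = (\<Sum>(a, b) | P (a, b) \<noteq> 0. P (a, b) * poly_of (mact v (a, b) \<Psi> z) c)"
    unfolding weyl_act_def fold ..
  also have "\<dots> = log_family (wact v P \<Psi>) z c"
    unfolding wact_def poly_of_def sum sc by (simp add: sum_divide_distrib case_prod_unfold)
  finally show "weyl_act v P (log_family \<Psi>) z c = log_family (wact v P \<Psi>) z c" .
qed

lemma zero_family: "log_family \<Psi> = (\<lambda>z c. 0) \<longleftrightarrow> (\<forall>z. \<Psi> z = 0)"
proof -
  have "poly_of (\<Psi> z) = (\<lambda>c. 0) \<longleftrightarrow> \<Psi> z = 0" for z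
    by (auto simp: poly_of_def fun_eq_iff poly_mapping_eqI)
  then show ?thesis by (simp add: fun_eq_iff[of "log_family \<Psi>"])
qed

lemma weyl_ring: "carrier weyl_algebra = {P. finite {m. P m \<noteq> 0}}" "add weyl_algebra = (+)" "zero weyl_algebra = (\<lambda>m. 0)"
  by (auto simp: weyl_algebra_def plus_fun_def fun_eq_iff)

lemma wact_add:
  assumes "finite {p. P p \<noteq> 0}" "finite {p. Q p \<noteq> 0}"
  shows "wact v (P + Q) \<Psi> z = wact v P \<Psi> z + wact v Q \<Psi> z"
proof -
  let ?F = "{p. P p \<noteq> 0} \<union> {p. Q p \<noteq> 0}"
  have "wact v R \<Psi> z = (\<Sum>p\<in>?F. ctr (const (R p)) (mact v p \<Psi> z))" if "{p. R p \<noteq> 0} \<subseteq> ?F" for R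
    by (rule wact_superset) (use assms that in auto)
  moreover have "{p. (P + Q) p \<noteq> 0} \<subseteq> ?F" by (auto simp: plus_coeff)
  ultimately show ?thesis by (simp add: plus_coeff const_add ctr_add_left sum.distrib)
qed

lemma mact_zero: "mact v p (\<lambda>z. 0) = (\<lambda>z. 0)"
  by (simp add: mact_def fun_eq_iff split: prod.split)

lemma wact_zero: "wact v P (\<lambda>z. 0) = (\<lambda>z. 0)"
  by (rule ext) (simp add: wact_def mact_zero)

text \<open>The operators that annihilate a given series form a left ideal, so only generators of a left
  ideal have to be tested.\<close>

lemma annihilator_left_ideal:
  fixes v :: "complex ^ 'n::finite"
  assumes gen: "\<And>x. x \<in> X \<Longrightarrow> finite {p. x p \<noteq> 0} \<and> wact v x \<Psi> = (\<lambda>z. 0)"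
    and P: "P \<in> left_ideal_gen weyl_algebra X"
  shows "wact v P \<Psi> = (\<lambda>z. 0)"
proof -
  let ?I = "{P. finite {p. P p \<noteq> 0} \<and> wact v P \<Psi> = (\<lambda>z. 0)}"
  let ?G = "add_monoid (weyl_algebra :: 'n weyl ring)"
  have fin_add: "finite {p. (P + Q) p \<noteq> 0}" if "finite {p. P p \<noteq> 0}" "finite {p. Q p \<noteq> 0}"
    for P Q :: "'n weyl"
    by (rule finite_subset[of _ "{p. P p \<noteq> 0} \<union> {p. Q p \<noteq> 0}"]) (use that in \<open>auto simp: plus_coeff\<close>)
  have neg: "(\<lambda>m. - P m) + P = (\<lambda>m. 0)" for P :: "'n weyl"
    by (simp add: fun_eq_iff plus_coeff)
  interpret G: group ?G
  proof (rule groupI)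
    fix P assume "P \<in> carrier ?G"
    then show "\<exists>Q\<in>carrier ?G. Q \<otimes>\<^bsub>?G\<^esub> P = \<one>\<^bsub>?G\<^esub>"
      using neg[of P] by (intro bexI[of _ "\<lambda>m. - P m"]) (simp_all add: weyl_ring)
  next
    fix P Q R assume "P \<in> carrier ?G" "Q \<in> carrier ?G"
    then show "P \<otimes>\<^bsub>?G\<^esub> Q \<in> carrier ?G" by (simp add: weyl_ring fin_add)
    show "P \<otimes>\<^bsub>?G\<^esub> Q \<otimes>\<^bsub>?G\<^esub> R = P \<otimes>\<^bsub>?G\<^esub> (Q \<otimes>\<^bsub>?G\<^esub> R)" by (simp add: weyl_ring add.assoc)
  next
    fix P :: "'n weyl"
    have "(\<lambda>m. 0) + P = P" by (rule ext) (simp add: plus_coeff)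
    then show "\<one>\<^bsub>?G\<^esub> \<otimes>\<^bsub>?G\<^esub> P = P" by (simp add: weyl_ring)
  qed (simp add: weyl_ring)
  have "subgroup ?I ?G"
  proof (rule G.subgroupI)
    show "?I \<subseteq> carrier ?G" by (auto simp: weyl_ring)
    have "(\<lambda>p. 0) \<in> ?I" by (simp add: wact_def fun_eq_iff)
    then show "?I \<noteq> {}" by (rule ex_in_conv[THEN iffD1, OF exI])
  next
    fix P assume P: "P \<in> ?I"
    have "inv\<^bsub>?G\<^esub> P = (\<lambda>m. - P m)"
      by (rule G.inv_equality) (use P in \<open>auto simp: weyl_ring neg\<close>)
    moreover have "wact v (\<lambda>m. - P m) \<Psi> z = 0" for z
    proof -
      have "wact v (\<lambda>m. - P m) \<Psi> z + wact v P \<Psi> z = wact v (\<lambda>m. 0) \<Psi> z"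
        using P wact_add[of "\<lambda>m. - P m" P v \<Psi> z] by (simp add: neg)
      then show ?thesis using P by (simp add: wact_def[of v "\<lambda>m. 0"])
    qed
    ultimately show "inv\<^bsub>?G\<^esub> P \<in> ?I" using P by auto
  next
    fix P Q assume "P \<in> ?I" "Q \<in> ?I"
    then show "P \<otimes>\<^bsub>?G\<^esub> Q \<in> ?I" by (auto simp: weyl_ring fin_add wact_add fun_eq_iff)
  qed
  then have "additive_subgroup ?I weyl_algebra" by (rule additive_subgroup.intro)
  moreover have "a \<otimes>\<^bsub>weyl_algebra\<^esub> x \<in> ?I" if "a \<in> carrier weyl_algebra" "x \<in> ?I" for a x
  proof -
    have f: "finite {p. a p \<noteq> 0}" "finite {p. x p \<noteq> 0}" and w: "wact v x \<Psi> = (\<lambda>z. 0)"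
      using that by (auto simp: weyl_ring)
    have "wact v (a \<otimes>\<^bsub>weyl_algebra\<^esub> x) \<Psi> = (\<lambda>z. 0)"
      by (rule ext) (simp only: wact_mult(2)[OF f] w wact_zero)
    with wact_mult(1)[OF f] show ?thesis by simp
  qed
  moreover have "X \<subseteq> ?I" using gen by blast
  ultimately have "?I \<in> {I. additive_subgroup I weyl_algebra
      \<and> (\<forall>a\<in>carrier weyl_algebra. \<forall>x\<in>I. a \<otimes>\<^bsub>weyl_algebra\<^esub> x \<in> I) \<and> X \<subseteq> I}" by blast
  then have "P \<in> ?I" using P unfolding left_ideal_gen_def by blast
  then show ?thesis by simp
qed

definition dact :: "complex ^ 'n \<Rightarrow> ('n \<Rightarrow>\<^sub>0 nat) \<Rightarrow> (int ^ 'n \<Rightarrow> 'n dual) \<Rightarrow> int ^ 'n::finite \<Rightarrow> 'n dual" where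
  "dact v b \<Psi> z = ctr (fser (shift v (z + ivec b)) b) (\<Psi> (z + ivec b))"

lemma mact_dact: "mact v (0, b) \<Psi> = dact v b \<Psi>"
  by (simp add: mact_def dact_def fun_eq_iff)

lemma dact_add:
  fixes v :: "complex ^ 'n::finite"
  shows "dact v (a + b) \<Psi> = dact v a (dact v b \<Psi>)"
proof
  fix z
  have l: "{k :: 'n \<Rightarrow>\<^sub>0 nat. leq k a \<and> leq k 0} = {0}"
    by (auto simp: leq_def intro!: poly_mapping_eqI)
  show "dact v (a + b) \<Psi> z = dact v a (dact v b \<Psi>) z"
    using mact_comp[of v 0 a 0 b \<Psi> z] unfolding mact_dact l by (simp add: binom_def mact_dact)
qed

lemma wact_partials:
  assumes "finite {b. f b \<noteq> 0}"
  shows "finite {p. weyl_of_partials f p \<noteq> 0}"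
    and "wact v (weyl_of_partials f) \<Psi> z = (\<Sum>b | f b \<noteq> 0. ctr (const (f b)) (dact v b \<Psi> z))"
proof -
  have "weyl_of_partials f x = (\<Sum>t | t \<in> {b. f b \<noteq> 0} \<and> (0, t) = x. f t)" for x
  proof (cases x)
    case (Pair a b)
    have "{t. f t \<noteq> 0 \<and> (0, t) = x} = (if a = 0 \<and> f b \<noteq> 0 then {b} else {})" using Pair by auto
    then show ?thesis using Pair by (simp add: weyl_of_partials_def)
  qed
  note * = this
  show "finite {p. weyl_of_partials f p \<noteq> 0}" by (rule wact_gather(1)[OF assms *])
  show "wact v (weyl_of_partials f) \<Psi> z = (\<Sum>b | f b \<noteq> 0. ctr (const (f b)) (dact v b \<Psi> z))"
    unfolding wact_gather(2)[OF assms *] mact_dact ..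
qed


section \<open>The hypergeometric equations for a logarithmic series\<close>

lemma fser_single: "fser c (Poly_Mapping.single j 1) = lin j (c $ j)"
proof -
  have "fser c (Poly_Mapping.single j 1) = (\<Prod>k\<in>UNIV. if k = j then lin j (c $ j) else 1)"
    unfolding fser_def by (rule prod.cong) (auto simp: lookup_single ff_Suc)
  then show ?thesis by (simp add: prod.delta)
qed

lemma wact_euler:
  fixes v :: "complex ^ 'n::finite"
  shows "wact v (euler_op A \<beta> i) \<Psi> z
    = ctr (linear_rel A i + const ((\<Sum>j\<in>UNIV. of_int (A $ i $ j) * (v $ j + of_int (z $ j))) - \<beta> $ i)) (\<Psi> z)"
    and finite_euler: "finite {p. euler_op A \<beta> i p \<noteq> 0}"
proof -
  let ?e = "\<lambda>j. Poly_Mapping.single j (1 :: nat)"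
  define H where "H = (\<lambda>t. case t of None \<Rightarrow> (0, 0) | Some j \<Rightarrow> (?e j :: 'n \<Rightarrow>\<^sub>0 nat, ?e j))"
  define f where "f = (\<lambda>t. case t of None \<Rightarrow> - \<beta> $ i | Some j \<Rightarrow> of_int (A $ i $ j))"
  have opt: "(\<Sum>t\<in>UNIV. g t) = g None + (\<Sum>j\<in>UNIV. g (Some j))" for g :: "'n option \<Rightarrow> 'z::comm_monoid_add"
    unfolding UNIV_option_conv by (simp add: sum.reindex)
  have P: "euler_op A \<beta> i x = (\<Sum>t | t \<in> UNIV \<and> H t = x. f t)" for x
  proof -
    have "(\<Sum>t | t \<in> UNIV \<and> H t = x. f t) = (\<Sum>t\<in>UNIV. if H t = x then f t else 0)"
      using sum.inter_filter[of UNIV f "\<lambda>t. H t = x"] by simp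
    also have "\<dots> = (if (0, 0) = x then - \<beta> $ i else 0) + (\<Sum>j\<in>UNIV. if (?e j, ?e j) = x then of_int (A $ i $ j) else 0)"
      unfolding opt by (simp add: H_def f_def cong: if_cong)
    also have "\<dots> = euler_op A \<beta> i x"
    proof -
      obtain a b where x: "x = (a, b)" by (cases x)
      have "(?e j, ?e j) = x \<longleftrightarrow> a = ?e j \<and> b = ?e j" "(0, 0) = x \<longleftrightarrow> a = 0 \<and> b = 0" for j
        unfolding x by auto
      then show ?thesis unfolding euler_op_def by (simp add: x)
    qed
    finally show ?thesis by simp
  qed
  show "finite {p. euler_op A \<beta> i p \<noteq> 0}" by (rule wact_gather(1)[OF _ P]) simp
  have m: "mact v (H None) \<Psi> z = \<Psi> z" "mact v (H (Some j)) \<Psi> z = ctr (lin j (v $ j + of_int (z $ j))) (\<Psi> z)" for j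
    by (simp_all add: H_def mact_def fser_single[unfolded One_nat_def] shift_def)
  have "wact v (euler_op A \<beta> i) \<Psi> z = (\<Sum>t\<in>UNIV. ctr (const (f t)) (mact v (H t) \<Psi> z))"
    by (rule wact_gather(2)[OF _ P]) simp
  also have "\<dots> = ctr (const (- \<beta> $ i) + (\<Sum>j\<in>UNIV. const (of_int (A $ i $ j)) * lin j (v $ j + of_int (z $ j)))) (\<Psi> z)"
    unfolding opt m by (simp add: f_def ctr_add_left ctr_sum_left ctr_times)
  also have "const (- \<beta> $ i) + (\<Sum>j\<in>UNIV. const (of_int (A $ i $ j)) * lin j (v $ j + of_int (z $ j)))
      = linear_rel A i + const ((\<Sum>j\<in>UNIV. of_int (A $ i $ j) * (v $ j + of_int (z $ j))) - \<beta> $ i)"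
  proof -
    let ?S = "\<Sum>j\<in>UNIV. of_int (A $ i $ j) * (v $ j + of_int (z $ j))"
    have "(\<Sum>j\<in>UNIV. const (of_int (A $ i $ j)) * lin j (v $ j + of_int (z $ j))) = const ?S + linear_rel A i"
      unfolding lin_def linear_rel_def distrib_left[where 'a = "'n series"] sum.distrib const_mult[symmetric] const_sum[symmetric] ..
    moreover have "const (?S - \<beta> $ i) = const (- \<beta> $ i) + (const ?S :: 'n series)"
      unfolding const_add[symmetric] by simp
    ultimately show ?thesis by (simp only: add_ac)
  qed
  finally show "wact v (euler_op A \<beta> i) \<Psi> z
    = ctr (linear_rel A i + const ((\<Sum>j\<in>UNIV. of_int (A $ i $ j) * (v $ j + of_int (z $ j))) - \<beta> $ i)) (\<Psi> z)" .
qed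

lemma wact_binomial:
  "wact v (weyl_of_partials (mon p - mon q)) \<Psi> z = dact v p \<Psi> z - dact v q \<Psi> z"
proof (cases "p = q")
  case False
  have m1: "ctr (const (- 1)) P = - P" for P :: "'a dual"
  proof -
    have "ctr (const (- 1)) P + ctr 1 P = 0" unfolding ctr_add_left[symmetric] const_1[symmetric] const_add[symmetric] by simp
    then show ?thesis by (simp add: eq_neg_iff_add_eq_0)
  qed
  have s: "{b. (mon p - mon q) b \<noteq> (0::complex)} = {p, q}" using False by (auto simp: mon_def)

  show ?thesis
    using wact_partials(2)[of "mon p - mon q" v \<Psi> z] False
    by (simp only: s) (simp add: m1 mon_def)
qed (simp add: wact_def weyl_of_partials_def zero_coeff case_prod_unfold)

lemma wact_partials_times:
  assumes c: "finite {b. c b \<noteq> 0}" and f: "finite {b. f b \<noteq> 0}"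
  shows "wact v (weyl_of_partials (c * f)) \<Psi> z = wact v (weyl_of_partials c) (wact v (weyl_of_partials f) \<Psi>) z"
proof -
  let ?T = "{a. c a \<noteq> 0} \<times> {b. f b \<noteq> 0}"
  have P: "weyl_of_partials (c * f) x = (\<Sum>t | t \<in> ?T \<and> (0, fst t + snd t) = x. c (fst t) * f (snd t))" for x
  proof (cases x)
    case (Pair a m)
    show ?thesis
    proof (cases "a = 0")
      case True
      have "finite {p. fst p + snd p = m}" using finite_decomp[of m] by (simp add: case_prod_unfold)
      then have "(c * f) m = (\<Sum>t | t \<in> ?T \<and> (0, fst t + snd t) = x. c (fst t) * f (snd t))"
        unfolding times_coeff case_prod_unfold
        by (rule sum.mono_neutral_right) (use True Pair in auto)
      then show ?thesis using True Pair by (simp add: weyl_of_partials_def)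
    next
      case False
      then have "{t. t \<in> ?T \<and> (0, fst t + snd t) = x} = {}" using Pair by auto
      then show ?thesis using False Pair by (simp only: sum.empty) (simp add: weyl_of_partials_def)
    qed
  qed
  have T: "finite ?T" using c f by simp
  have "wact v (weyl_of_partials (c * f)) \<Psi> z = (\<Sum>t\<in>?T. ctr (const (c (fst t) * f (snd t))) (mact v (0, fst t + snd t) \<Psi> z))"
    by (rule wact_gather(2)[OF T P])
  also have "\<dots> = (\<Sum>a | c a \<noteq> 0. \<Sum>b | f b \<noteq> 0. ctr (const (c a)) (ctr (const (f b)) (dact v a (dact v b \<Psi>) z)))"
    unfolding sum.cartesian_product by (simp add: mact_dact dact_add const_mult ctr_times case_prod_unfold)
  also have "\<dots> = wact v (weyl_of_partials c) (wact v (weyl_of_partials f) \<Psi>) z"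
  proof -
    have "dact v a (wact v (weyl_of_partials f) \<Psi>) z = (\<Sum>b | f b \<noteq> 0. ctr (const (f b)) (dact v a (dact v b \<Psi>) z))" for a
      unfolding dact_def[of v a] wact_partials(2)[OF f] ctr_sum_right by (simp add: ctr_commute)
    then show ?thesis unfolding wact_partials(2)[OF c] by (simp add: ctr_sum_right)
  qed
  finally show ?thesis .
qed

lemma toric_ideal_annihilates:
  fixes v :: "complex ^ 'n::finite"
  assumes b: "\<And>u. u \<in> lattice A \<Longrightarrow> dact v (pos_part u) \<Psi> = dact v (neg_part u) \<Psi>"
    and f: "f \<in> toric_ideal A"
  shows "finite {b. f b \<noteq> 0}" "wact v (weyl_of_partials f) \<Psi> = (\<lambda>z. 0)"
proof -
  let ?T = "{f. finite {b. f b \<noteq> 0} \<and> wact v (weyl_of_partials f) \<Psi> = (\<lambda>z. 0)}"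
  let ?R = "mpoly_ring UNIV :: 'n series ring"
  have car: "carrier ?R = {f :: 'n series. finite {b. f b \<noteq> 0}}"
    by (simp add: mpoly_ring_simps)
  have "ideal ?T ?R"
  proof (rule mpoly.idealI_ops)
    show "?T \<subseteq> carrier ?R" unfolding car by blast
    show "0 \<in> ?T" by (auto simp: zero_coeff wact_def weyl_of_partials_def fun_eq_iff case_prod_unfold)
  next
    fix f g assume f: "f \<in> ?T" and g: "g \<in> ?T"
    then have "f + g \<in> carrier (mpoly_ring UNIV)" by (intro mpoly.closed) (auto simp: car)
    moreover have "weyl_of_partials (f + g) = weyl_of_partials f + weyl_of_partials g"
      by (auto simp: weyl_of_partials_def fun_eq_iff plus_coeff)
    moreover have "wact v (weyl_of_partials f + weyl_of_partials g) \<Psi> z = 0" for z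
      using f g by (simp add: wact_add wact_partials(1))
    ultimately show "f + g \<in> ?T" by (simp add: car fun_eq_iff[of "wact v _ \<Psi>"])
  next
    fix f c assume f: "f \<in> ?T" and c: "c \<in> carrier ?R"
    have "c * f \<in> carrier (mpoly_ring UNIV)" using f c by (intro mpoly.closed) (auto simp: car)
    moreover have "wact v (weyl_of_partials (c * f)) \<Psi> z = 0" for z
      using f c by (simp add: wact_partials_times car wact_zero)
    ultimately show "c * f \<in> ?T" by (auto simp: car)
  qed
  moreover have "mon (pos_part u) \<ominus>\<^bsub>mpoly_ring UNIV\<^esub> mon (neg_part u) \<in> ?T" if u: "u \<in> lattice A" for u
  proof -
    have m: "mon p \<in> carrier (mpoly_ring UNIV)" for p :: "'n \<Rightarrow>\<^sub>0 nat"
      unfolding car mon_def by (auto intro: finite_subset[of _ "{p}"])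
    have "mon (pos_part u) \<ominus>\<^bsub>mpoly_ring UNIV\<^esub> mon (neg_part u) \<in> carrier (mpoly_ring UNIV)"
      by (intro mpoly.minus_closed m)
    then show ?thesis using b[OF u] by (simp add: mpoly.a_minus_eq[OF m m] car wact_binomial fun_eq_iff)
  qed
  ultimately have "toric_ideal A \<subseteq> ?T"
    unfolding toric_ideal_def by (intro mpoly.genideal_minimal) blast+
  then show "finite {b. f b \<noteq> 0}" "wact v (weyl_of_partials f) \<Psi> = (\<lambda>z. 0)" using f by auto
qed

text \<open>Every exponent \<open>v + z\<close> with \<open>z\<close> in the lattice satisfies \<open>A (v + z) = \<beta>\<close>, so the Euler
  operators lose their constant part and leave the linear relations \<open>A t\<close>; the toric ideal is
  generated by binomials.\<close>

lemma hypergeometric_iff: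
  fixes v :: "complex ^ 'n::finite"
  assumes \<beta>: "map_matrix of_int A *v v = \<beta>" and supp: "\<And>z. \<Psi> z \<noteq> 0 \<Longrightarrow> z \<in> lattice A"
  shows "(\<forall>P\<in>hypergeometric_ideal A \<beta>. wact v P \<Psi> = (\<lambda>z. 0)) \<longleftrightarrow>
    (\<forall>z i. ctr (linear_rel A i) (\<Psi> z) = 0) \<and>
    (\<forall>u\<in>lattice A. dact v (pos_part u) \<Psi> = dact v (neg_part u) \<Psi>)"
proof -
  have eul: "wact v (euler_op A \<beta> i) \<Psi> z = ctr (linear_rel A i) (\<Psi> z)" for i z
  proof (cases "z \<in> lattice A")
    case True
    have "(\<Sum>j\<in>UNIV. of_int (A $ i $ j) * of_int (z $ j)) = (of_int ((A *v z) $ i) :: complex)"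
      by (simp add: matrix_vector_mult_def)
    also have "\<dots> = 0" using True by (simp add: lattice_def)
    finally have "(\<Sum>j\<in>UNIV. of_int (A $ i $ j) * (v $ j + of_int (z $ j))) = \<beta> $ i"
      unfolding \<beta>[symmetric] by (simp add: distrib_left sum.distrib matrix_vector_mult_def map_matrix_def)
    then show ?thesis unfolding wact_euler by simp
  next
    case False
    then have "\<Psi> z = 0" using supp by blast
    then show ?thesis unfolding wact_euler by simp
  qed
  let ?X = "weyl_of_partials ` toric_ideal A \<union> range (euler_op A \<beta>)"
  have X: "?X \<subseteq> hypergeometric_ideal A \<beta>" unfolding hypergeometric_ideal_def left_ideal_gen_def by blast
  show ?thesis
  proof
    assume *: "\<forall>P\<in>hypergeometric_ideal A \<beta>. wact v P \<Psi> = (\<lambda>z. 0)"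
    have "ctr (linear_rel A i) (\<Psi> z) = 0" for i z
    proof -
      have "euler_op A \<beta> i \<in> hypergeometric_ideal A \<beta>" using X by blast
      then show ?thesis using * eul[of i z] by simp
    qed
    moreover have "dact v (pos_part u) \<Psi> z = dact v (neg_part u) \<Psi> z" if u: "u \<in> lattice A" for u z
    proof -
      have m: "mon p \<in> carrier (mpoly_ring UNIV)" for p :: "'n \<Rightarrow>\<^sub>0 nat"
        unfolding mpoly_ring_simps mps_ring_simps mon_def by (auto intro: finite_subset[of _ "{p}"])
      have "{mon (pos_part u) \<ominus>\<^bsub>mpoly_ring UNIV\<^esub> mon (neg_part u) |u. u \<in> lattice A} \<subseteq> toric_ideal A"
        unfolding toric_ideal_def by (rule mpoly.genideal_self) (auto intro!: mpoly.minus_closed m)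
      then have "mon (pos_part u) - mon (neg_part u) \<in> toric_ideal A" using u by (auto simp: mpoly.a_minus_eq[OF m m])
      then have "weyl_of_partials (mon (pos_part u) - mon (neg_part u)) \<in> hypergeometric_ideal A \<beta>" using X by blast
      then have "wact v (weyl_of_partials (mon (pos_part u) - mon (neg_part u))) \<Psi> z = 0" using * by simp
      then show ?thesis by (simp add: wact_binomial)
    qed
    ultimately show "(\<forall>z i. ctr (linear_rel A i) (\<Psi> z) = 0) \<and>
      (\<forall>u\<in>lattice A. dact v (pos_part u) \<Psi> = dact v (neg_part u) \<Psi>)" by (auto simp: fun_eq_iff)
  next
    assume *: "(\<forall>z i. ctr (linear_rel A i) (\<Psi> z) = 0) \<and>
      (\<forall>u\<in>lattice A. dact v (pos_part u) \<Psi> = dact v (neg_part u) \<Psi>)"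
    have "finite {p. x p \<noteq> 0} \<and> wact v x \<Psi> = (\<lambda>z. 0)" if "x \<in> ?X" for x
      using that
    proof
      assume "x \<in> weyl_of_partials ` toric_ideal A"
      then obtain f where f: "f \<in> toric_ideal A" and x: "x = weyl_of_partials f" by blast
      have t: "finite {b. f b \<noteq> 0}" "wact v (weyl_of_partials f) \<Psi> = (\<lambda>z. 0)"
        using toric_ideal_annihilates[OF _ f] * by blast+
      show ?thesis unfolding x using wact_partials(1)[OF t(1)] t(2) by blast
    next
      assume "x \<in> range (euler_op A \<beta>)"
      then show ?thesis using * finite_euler eul by (auto simp: fun_eq_iff)
    qed
    then show "\<forall>P\<in>hypergeometric_ideal A \<beta>. wact v P \<Psi> = (\<lambda>z. 0)"
      unfolding hypergeometric_ideal_def using annihilator_left_ideal by blast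
  qed
qed


section \<open>Normalisation by units\<close>

text \<open>The inverse is the geometric series.\<close>

lemma lin_invertible:
  assumes "x \<noteq> 0"
  shows "\<exists>g. lin j x * g = 1"
proof
  let ?e = "Poly_Mapping.single j (1 :: nat)"
  define g where "g = (\<lambda>m. if Poly_Mapping.keys m \<subseteq> {j} then (- 1) ^ lookup m j / x ^ (lookup m j + 1) else 0)"
  show "lin j x * g = 1"
  proof
    fix m
    have l: "(lin j x * g) m = x * g m + (mon ?e * g) m"
      by (simp add: lin_def var_def distrib_right plus_coeff const_coeff)
    show "(lin j x * g) m = 1 m"
    proof (cases "lookup m j = 0")
      case True
      have "(mon ?e * g) m = 0"
        by (rule mon_times_coeff_zero) (use True in \<open>auto simp: lookup_add\<close>)
      moreover have "Poly_Mapping.keys m \<subseteq> {j} \<longleftrightarrow> m = 0"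
      proof
        assume "Poly_Mapping.keys m \<subseteq> {j}"
        then show "m = 0" using True by (intro poly_mapping_eqI) (auto simp: in_keys_iff)
      qed simp
      ultimately show ?thesis unfolding l using assms by (simp add: g_def one_fun_def)
    next
      case False
      define q where "q = m - ?e"
      have m: "m = ?e + q"
        using False by (intro poly_mapping_eqI) (auto simp: q_def lookup_add lookup_minus lookup_single when_def)
      have "Poly_Mapping.keys (?e + q) \<subseteq> {j} \<longleftrightarrow> Poly_Mapping.keys q \<subseteq> {j}" by (simp add: keys_add_nat)
      moreover have "lookup (?e + q) j = lookup q j + 1" by (simp add: lookup_add)
      moreover have "(mon ?e * g) (?e + q) = g q" by (rule mon_times_coeff_add)
      moreover have "?e + q \<noteq> 0" using False m by auto
      ultimately show ?thesis unfolding l unfolding m using assms by (simp add: g_def one_fun_def field_simps)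
    qed
  qed
qed

text \<open>The unit part of \<open>x + t\<^sub>j\<close>: the factor that remains when a bare variable is split off.\<close>

definition nz :: "'n \<Rightarrow> complex \<Rightarrow> 'n series" where
  "nz j x = (if x = 0 then 1 else lin j x)"

definition nz_inv :: "'n \<Rightarrow> complex \<Rightarrow> 'n series" where
  "nz_inv j x = (if x = 0 then 1 else SOME g. lin j x * g = 1)"

lemma nz_inverse: "nz j x * nz_inv j x = 1"
  unfolding nz_def nz_inv_def using someI_ex[OF lin_invertible[of x j]] by auto

lemma lin_nz: "lin j x = (if x = 0 then var j else 1) * nz j x"
  by (simp add: nz_def) (simp add: lin_def)

text \<open>A solution of \<open>G(n) = nz(v\<^sub>j + n) G(n - 1)\<close>.  Up to bare variables it is
  \<open>\<Gamma>(v\<^sub>j + t\<^sub>j + n + 1) / \<Gamma>(v\<^sub>j + t\<^sub>j + 1)\<close>.\<close>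

definition gfac :: "complex ^ 'n \<Rightarrow> 'n \<Rightarrow> int \<Rightarrow> 'n series" where
  "gfac v j n = (if n \<ge> 0 then \<Prod>i<nat n. nz j (v $ j + of_nat i + 1) else \<Prod>i<nat (- n). nz_inv j (v $ j - of_nat i))"

definition gfac_inv :: "complex ^ 'n \<Rightarrow> 'n \<Rightarrow> int \<Rightarrow> 'n series" where
  "gfac_inv v j n = (if n \<ge> 0 then \<Prod>i<nat n. nz_inv j (v $ j + of_nat i + 1) else \<Prod>i<nat (- n). nz j (v $ j - of_nat i))"

lemma gfac_inverse: "gfac v j n * gfac_inv v j n = 1"
  unfolding gfac_def gfac_inv_def
  by (auto simp: prod.distrib[symmetric] nz_inverse mult.commute[of "nz_inv _ _"])

lemma gfac_rec: "gfac v j n = nz j (v $ j + of_int n) * gfac v j (n - 1)"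
proof (cases "n \<ge> 1")
  case True
  define k where "k = nat (n - 1)"
  have c: "(n \<ge> 0) = True" "(n - 1 \<ge> 0) = True" "nat n = Suc k" "nat (n - 1) = k"
    using True by (auto simp: k_def)
  have e: "v $ j + of_int n = v $ j + of_nat k + 1" using True by (simp add: k_def)
  show ?thesis unfolding gfac_def c if_True e prod.lessThan_Suc by (rule mult.commute)
next
  case False
  define k where "k = nat (- n)"
  have n: "n = - int k" using False by (simp add: k_def)
  have "gfac v j n = (\<Prod>i<k. nz_inv j (v $ j - of_nat i))" unfolding n gfac_def by simp
  moreover have "gfac v j (n - 1) = (\<Prod>i<Suc k. nz_inv j (v $ j - of_nat i))"
  proof -
    have "nat (- (n - 1)) = Suc k" "\<not> n - 1 \<ge> 0" unfolding n by simp_all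
    then show ?thesis unfolding gfac_def by (simp only: if_False)
  qed
  moreover have "nz j (v $ j + of_int n) * nz_inv j (v $ j - of_nat k) = 1" unfolding n by (simp add: nz_inverse)
  ultimately show ?thesis by (simp only: prod.lessThan_Suc mult.left_commute[of "nz _ _"] mult_1_right)
qed

definition negint :: "complex \<Rightarrow> bool" where
  "negint x \<longleftrightarrow> (\<exists>k::int. k < 0 \<and> x = of_int k)"

lemma nsupp_negint: "nsupp z = {j. negint (z $ j)}"
  by (simp add: nsupp_def negint_def)

lemma negint_minus_one: "negint (x - 1) \<longleftrightarrow> negint x \<or> x = 0"
proof
  assume "negint (x - 1)"
  then obtain k :: int where "k < 0" "x - 1 = of_int k" by (auto simp: negint_def)
  then have x: "x = of_int (k + 1)" and k: "k + 1 < 0 \<or> k + 1 = 0" by (auto simp: algebra_simps)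
  from k show "negint x \<or> x = 0"
  proof
    assume "k + 1 < 0"
    with x show ?thesis unfolding negint_def by blast
  next
    assume "k + 1 = 0"
    with x have "x = 0" by (simp only: of_int_0)
    then show ?thesis by simp
  qed
next
  assume "negint x \<or> x = 0"
  then show "negint (x - 1)"
  proof
    assume "negint x"
    then obtain k :: int where "k < 0" "x = of_int k" by (auto simp: negint_def)
    then have "k - 1 < 0 \<and> x - 1 = of_int (k - 1)" by simp
    then show ?thesis unfolding negint_def by blast
  next
    assume "x = 0"
    then have "(-1::int) < 0 \<and> x - 1 = of_int (-1)" by simp
    then show ?thesis unfolding negint_def by blast
  qed
qed

lemma negint_minus_nat: "negint x \<Longrightarrow> negint (x - of_nat k)"
proof (induction k)
  case (Suc k)
  have e: "x - of_nat (Suc k) = x - of_nat k - 1" by simp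
  show ?case unfolding e negint_minus_one using Suc by simp
qed simp

lemma not_negint_nat: "\<not> negint (of_nat p)"
proof
  assume "negint (of_nat p)"
  then obtain k :: int where k: "k < 0" "complex_of_int (int p) = of_int k" by (auto simp: negint_def)
  then have "int p = k" by (simp only: of_int_eq_iff)
  with k show False by simp
qed

lemma ff_gfac:
  assumes x: "x = v $ j + of_int n"
  shows "ff (lin j x) p * gfac v j (n - int p) = (if negint (x - of_nat p) \<and> \<not> negint x then var j else 1) * gfac v j n"
proof (induction p)
  case 0
  show ?case by simp
next
  case (Suc p)
  let ?c = "\<lambda>p. if negint (x - of_nat p) \<and> \<not> negint x then var j else 1 :: 'a series"
  let ?d = "if x - of_nat p = 0 then var j else 1 :: 'a series"
  have g: "gfac v j (n - int p) = nz j (x - of_nat p) * gfac v j (n - int (Suc p))"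
    using gfac_rec[of v j "n - int p"] by (simp add: x algebra_simps)
  have s: "x - of_nat (Suc p) = x - of_nat p - 1" by simp
  have c: "?c (Suc p) = ?d * ?c p"
  proof (cases "x - of_nat p = 0")
    case True
    then have "x = of_nat p" by simp
    then have "\<not> negint x" "\<not> negint (x - of_nat p)" using not_negint_nat[of p] not_negint_nat[of 0] by simp_all
    then show ?thesis using True unfolding s negint_minus_one by simp
  next
    case False
    then show ?thesis unfolding s negint_minus_one by simp
  qed
  have "ff (lin j x) (Suc p) * gfac v j (n - int (Suc p))
      = ?d * (ff (lin j x) p * (nz j (x - of_nat p) * gfac v j (n - int (Suc p))))"
    unfolding ff_Suc lin_shift(2)[symmetric] by (subst (2) lin_nz) (simp only: mult_ac)
  also have "\<dots> = ?d * (?c p * gfac v j n)" unfolding g[symmetric] Suc.IH ..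
  also have "\<dots> = ?c (Suc p) * gfac v j n" unfolding c by (simp only: mult.assoc)
  finally show ?case .
qed

definition unit_at :: "complex ^ 'n \<Rightarrow> int ^ 'n \<Rightarrow> 'n::finite series" where
  "unit_at v z = (\<Prod>j\<in>UNIV. gfac v j (z $ j))"

definition unit_inv_at :: "complex ^ 'n \<Rightarrow> int ^ 'n \<Rightarrow> 'n::finite series" where
  "unit_inv_at v z = (\<Prod>j\<in>UNIV. gfac_inv v j (z $ j))"

lemma unit_at_inverse: "unit_at v z * unit_inv_at v z = 1"
  by (simp add: unit_at_def unit_inv_at_def prod.distrib[symmetric] gfac_inverse)

lemma unit_at_zero: "unit_at v 0 = 1" "unit_inv_at v 0 = 1"
  by (simp_all add: unit_at_def unit_inv_at_def gfac_def gfac_inv_def)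

abbreviation Isupp :: "complex ^ 'n \<Rightarrow> int ^ 'n \<Rightarrow> 'n set" where
  "Isupp v z \<equiv> nsupp (shift v z)"

lemma t_prod_if: "(\<Prod>j\<in>UNIV. if j \<in> C then var j else 1) = t_prod C" for C :: "'n::finite set"
  unfolding t_prod_eq by (simp add: prod.If_cases)

text \<open>A falling factorial has a factor with zero constant term in the variable \<open>t\<^sub>j\<close> exactly if the
  \<open>j\<close>-th exponent passes from a nonnegative to a negative integer.  All other factors are units,
  and these telescope.\<close>

lemma fser_unit_at:
  "fser (shift v z) p * unit_at v (z - ivec p) = t_prod (Isupp v (z - ivec p) - Isupp v z) * unit_at v z"
proof -
  let ?C = "Isupp v (z - ivec p) - Isupp v z"
  have "fser (shift v z) p * unit_at v (z - ivec p)
      = (\<Prod>j\<in>UNIV. ff (lin j (shift v z $ j)) (lookup p j) * gfac v j (z $ j - int (lookup p j)))"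
    by (simp add: fser_def unit_at_def prod.distrib)
  also have "\<dots> = (\<Prod>j\<in>UNIV. (if j \<in> ?C then var j else 1) * gfac v j (z $ j))"
  proof (rule prod.cong[OF refl])
    fix j
    have "j \<in> ?C \<longleftrightarrow> negint (shift v z $ j - of_nat (lookup p j)) \<and> \<not> negint (shift v z $ j)"
      by (simp add: nsupp_negint shift_def algebra_simps)
    then show "ff (lin j (shift v z $ j)) (lookup p j) * gfac v j (z $ j - int (lookup p j))
        = (if j \<in> ?C then var j else 1) * gfac v j (z $ j)"
      using ff_gfac[of "shift v z $ j" v j "z $ j" "lookup p j"] by (simp add: shift_def)
  qed
  also have "\<dots> = t_prod ?C * unit_at v z"
    unfolding prod.distrib t_prod_if unit_at_def ..
  finally show ?thesis .
qed

lemma dact_unit: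
  assumes "\<And>z. \<Psi> z = ctr (unit_inv_at v z) (q z)"
  shows "dact v b \<Psi> y = ctr (unit_inv_at v y) (ctr (t_prod (Isupp v y - Isupp v (y + ivec b))) (q (y + ivec b)))"
proof -
  let ?z = "y + ivec b"
  let ?t = "t_prod (Isupp v y - Isupp v ?z)"
  have "fser (shift v ?z) b * unit_at v y = ?t * unit_at v ?z"
    using fser_unit_at[of v ?z b] by simp
  then have "(fser (shift v ?z) b * unit_at v y) * (unit_inv_at v y * unit_inv_at v ?z)
      = (?t * unit_at v ?z) * (unit_inv_at v y * unit_inv_at v ?z)" by simp
  then have "fser (shift v ?z) b * unit_inv_at v ?z * (unit_at v y * unit_inv_at v y)
      = unit_inv_at v y * ?t * (unit_at v ?z * unit_inv_at v ?z)" by (simp only: mult_ac)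
  then have "fser (shift v ?z) b * unit_inv_at v ?z = unit_inv_at v y * ?t" by (simp add: unit_at_inverse)
  then show ?thesis unfolding dact_def assms ctr_times[symmetric] by simp
qed

lemma ctr_unit_cancel: "ctr (unit_inv_at v z) P = ctr (unit_inv_at v z) Q \<longleftrightarrow> P = Q"
proof
  assume "ctr (unit_inv_at v z) P = ctr (unit_inv_at v z) Q"
  then have "ctr (unit_at v z) (ctr (unit_inv_at v z) P) = ctr (unit_at v z) (ctr (unit_inv_at v z) Q)" by simp
  then show "P = Q" unfolding ctr_times[symmetric] unit_at_inverse by simp
qed simp

text \<open>The vector \<open>y\<close> is the componentwise minimum of \<open>z\<close> and \<open>z'\<close>, and lowering an exponent preserves
  negative integers.\<close>

lemma nsupp_meet:
  assumes "y = z - ivec (pos_part u)" "y = z' - ivec (neg_part u)"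
  shows "Isupp v y = Isupp v z \<union> Isupp v z'"
proof -
  have "j \<in> Isupp v y \<longleftrightarrow> j \<in> Isupp v z \<or> j \<in> Isupp v z'" for j
  proof -
    have a: "shift v y $ j = shift v z $ j - of_nat (nat (u $ j))"
      unfolding assms(1) by (simp add: shift_def lookup_pos_part)
    have b: "shift v y $ j = shift v z' $ j - of_nat (nat (- (u $ j)))"
      unfolding assms(2) by (simp add: shift_def lookup_neg_part)
    have "shift v y $ j = shift v z $ j \<or> shift v y $ j = shift v z' $ j"
      by (cases "u $ j \<ge> 0") (simp add: b, simp add: a)
    moreover have "negint (shift v z $ j) \<Longrightarrow> negint (shift v y $ j)" unfolding a by (rule negint_minus_nat)
    moreover have "negint (shift v z' $ j) \<Longrightarrow> negint (shift v y $ j)" unfolding b by (rule negint_minus_nat)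
    ultimately show ?thesis unfolding nsupp_negint by auto
  qed
  then show ?thesis by blast
qed

lemma pos_neg: "ivec (pos_part u) - ivec (neg_part u) = u"
  by (simp add: vec_eq_iff lookup_pos_part lookup_neg_part)

text \<open>Equating the two sides of \<open>\<partial>\<^bsup>u\<^sub>+\<^esup> = \<partial>\<^bsup>u\<^sub>-\<^esup>\<close> compares the values at two
  exponents \<open>z\<close> and \<open>z' = z - u\<close> through their componentwise minimum.  Once the units are removed,
  only the monomials in the variables that become negative on the way remain.\<close>

lemma toric_equations_iff:
  assumes q: "\<And>z. \<Psi> z = ctr (unit_inv_at v z) (q z)"
  shows "(\<forall>u\<in>lattice A. dact v (pos_part u) \<Psi> = dact v (neg_part u) \<Psi>) \<longleftrightarrow>
    (\<forall>z z'. z - z' \<in> lattice A \<longrightarrow> ctr (t_prod (Isupp v z' - Isupp v z)) (q z) = ctr (t_prod (Isupp v z - Isupp v z')) (q z'))"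
proof -
  have eq: "dact v (pos_part u) \<Psi> y = dact v (neg_part u) \<Psi> y \<longleftrightarrow>
      ctr (t_prod (Isupp v z' - Isupp v z)) (q z) = ctr (t_prod (Isupp v z - Isupp v z')) (q z')"
    if "z = y + ivec (pos_part u)" "z' = y + ivec (neg_part u)" for u y z z'
  proof -
    have m: "Isupp v y = Isupp v z \<union> Isupp v z'" by (rule nsupp_meet[of _ _ u]) (simp_all add: that)
    have "Isupp v y - Isupp v z = Isupp v z' - Isupp v z" "Isupp v y - Isupp v z' = Isupp v z - Isupp v z'"
      unfolding m by auto
    then show ?thesis unfolding dact_unit[OF q] that[symmetric] ctr_unit_cancel by simp
  qed
  show ?thesis
  proof (intro iffI allI impI ballI ext)
    fix z z' assume *: "\<forall>u\<in>lattice A. dact v (pos_part u) \<Psi> = dact v (neg_part u) \<Psi>" and zz: "z - z' \<in> lattice A"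
    let ?y = "z - ivec (pos_part (z - z'))"
    have "z' = ?y + ivec (neg_part (z - z'))"
      using pos_neg[of "z - z'"] by (simp add: algebra_simps)
    then show "ctr (t_prod (Isupp v z' - Isupp v z)) (q z) = ctr (t_prod (Isupp v z - Isupp v z')) (q z')"
      using eq[of z ?y "z - z'" z'] bspec[OF * zz] by simp
  next
    fix u y
    assume *: "\<forall>z z'. z - z' \<in> lattice A \<longrightarrow> ctr (t_prod (Isupp v z' - Isupp v z)) (q z) = ctr (t_prod (Isupp v z - Isupp v z')) (q z')"
      and u: "u \<in> lattice A"
    have "(y + ivec (pos_part u)) - (y + ivec (neg_part u)) \<in> lattice A" using u by (simp add: pos_neg)
    with * show "dact v (pos_part u) \<Psi> y = dact v (neg_part u) \<Psi> y"
      using eq[OF refl refl, of u y] by blast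
  qed
qed

lemma poly_of_eq_0: "poly_of P = (\<lambda>c. 0) \<longleftrightarrow> P = 0"
  by (auto simp: poly_of_def fun_eq_iff poly_mapping_eqI)

text \<open>The families that arise from logarithmic solutions of the hypergeometric system by removing
  the units.\<close>

definition normalised :: "int ^ 'n ^ 'd \<Rightarrow> complex ^ 'n \<Rightarrow> 'n set set \<Rightarrow> (int ^ 'n \<Rightarrow> 'n::finite dual) \<Rightarrow> bool" where
  "normalised A v N q \<longleftrightarrow> (\<forall>z. q z \<noteq> 0 \<longrightarrow> z \<in> lattice A \<and> Isupp v z \<in> N) \<and>
     (\<forall>z i. ctr (linear_rel A i) (q z) = 0) \<and>
     (\<forall>z z'. z - z' \<in> lattice A \<longrightarrow> ctr (t_prod (Isupp v z' - Isupp v z)) (q z) = ctr (t_prod (Isupp v z - Isupp v z')) (q z'))"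

lemma ambient_space_normalised:
  fixes v :: "complex ^ 'n::finite"
  assumes \<beta>: "map_matrix of_int A *v v = \<beta>"
  shows "ambient_space A \<beta> v N = {poly_of (q 0) |q. normalised A v N q}"
proof (intro equalityI subsetI)
  fix p assume "p \<in> ambient_space A \<beta> v N"
  then obtain \<phi> where p: "p = \<phi> 0" and car: "\<And>z. \<phi> z \<in> carrier (mpoly_ring UNIV)"
    and supp: "\<And>z. \<phi> z \<noteq> (\<lambda>c. 0) \<Longrightarrow> z \<in> lattice A \<and> Isupp v z \<in> N"
    and ann: "\<And>P. P \<in> hypergeometric_ideal A \<beta> \<Longrightarrow> weyl_act v P \<phi> = (\<lambda>z c. 0)"
    unfolding ambient_space_def by blast
  define \<Psi> where "\<Psi> z = dual_of (\<phi> z)" for z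
  define q where "q z = ctr (unit_at v z) (\<Psi> z)" for z
  have \<phi>: "\<phi> = log_family \<Psi>"
    using car by (auto simp: \<Psi>_def poly_of_dual_of mpoly_ring_simps fun_eq_iff)
  have \<Psi>q: "\<Psi> z = ctr (unit_inv_at v z) (q z)" for z
    by (simp add: q_def ctr_times[symmetric] mult.commute[of "unit_inv_at v z"] unit_at_inverse)
  have s: "z \<in> lattice A \<and> Isupp v z \<in> N" if "\<Psi> z \<noteq> 0" for z
    using supp[of z] that unfolding \<phi> poly_of_eq_0 by blast
  have "\<forall>P\<in>hypergeometric_ideal A \<beta>. wact v P \<Psi> = (\<lambda>z. 0)"
    using ann unfolding \<phi> weyl_act_family zero_family by (auto simp: fun_eq_iff)
  then have h: "(\<forall>z i. ctr (linear_rel A i) (\<Psi> z) = 0) \<and>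
    (\<forall>u\<in>lattice A. dact v (pos_part u) \<Psi> = dact v (neg_part u) \<Psi>)"
    using hypergeometric_iff[OF \<beta>, of \<Psi>] s by blast
  have "normalised A v N q"
    unfolding normalised_def toric_equations_iff[OF \<Psi>q, symmetric]
  proof (intro conjI allI impI)
    fix z assume "q z \<noteq> 0"
    then have "\<Psi> z \<noteq> 0" by (auto simp: q_def)
    then show "z \<in> lattice A" "Isupp v z \<in> N" using s by blast+
  next
    fix z i
    show "ctr (linear_rel A i) (q z) = 0" unfolding q_def ctr_commute[of "linear_rel A i"] using h by simp
  qed (use h in blast)
  moreover have "p = poly_of (q 0)" unfolding p \<phi> by (simp add: q_def unit_at_zero)
  ultimately show "p \<in> {poly_of (q 0) |q. normalised A v N q}" by blast
next
  fix p assume "p \<in> {poly_of (q 0) |q. normalised A v N q}"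
  then obtain q where p: "p = poly_of (q 0)" and n: "normalised A v N q" by blast
  define \<Psi> where "\<Psi> z = ctr (unit_inv_at v z) (q z)" for z
  have s: "z \<in> lattice A \<and> Isupp v z \<in> N" if "\<Psi> z \<noteq> 0" for z
  proof -
    have "q z \<noteq> 0" using that by (auto simp: \<Psi>_def)
    then show ?thesis using n unfolding normalised_def by blast
  qed
  have l: "\<forall>z i. ctr (linear_rel A i) (\<Psi> z) = 0"
    using n unfolding \<Psi>_def ctr_commute[of "linear_rel A _"] normalised_def by simp
  have "\<forall>u\<in>lattice A. dact v (pos_part u) \<Psi> = dact v (neg_part u) \<Psi>"
    unfolding toric_equations_iff[OF \<Psi>_def] using n unfolding normalised_def by blast
  then have h: "\<forall>P\<in>hypergeometric_ideal A \<beta>. wact v P \<Psi> = (\<lambda>z. 0)"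
    using hypergeometric_iff[OF \<beta>, of \<Psi>] s l by blast
  have 1: "\<forall>z. log_family \<Psi> z \<in> carrier (mpoly_ring UNIV)"
    by (simp add: poly_of_carrier)
  have 2: "\<forall>z. log_family \<Psi> z \<noteq> (\<lambda>c. 0) \<longrightarrow> z \<in> lattice A \<and> Isupp v z \<in> N"
    using s unfolding poly_of_eq_0 by blast
  have 3: "\<forall>P\<in>hypergeometric_ideal A \<beta>. weyl_act v P (log_family \<Psi>) = (\<lambda>z c. 0)"
    using h unfolding weyl_act_family zero_family by (simp add: fun_eq_iff)
  have 4: "p = log_family \<Psi> 0" unfolding p \<Psi>_def by (simp add: unit_at_zero)
  show "p \<in> ambient_space A \<beta> v N" unfolding ambient_space_def mem_Collect_eq
    by (intro exI[of _ "log_family \<Psi>"] conjI 1 2 3 4)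
qed


section \<open>The ambient coefficient space\<close>

definition chi :: "'n set \<Rightarrow> 'n::finite \<Rightarrow>\<^sub>0 nat" where
  "chi J = (\<Sum>j\<in>J. Poly_Mapping.single j 1)"

lemma t_prod_mon: "t_prod J = mon (chi J)"
  unfolding t_prod_eq var_def prod_mon chi_def ..

lemma lookup_chi: "lookup (chi J) j = (if j \<in> J then 1 else 0)"
proof -
  have "lookup (\<Sum>i\<in>J. Poly_Mapping.single i 1) j = (\<Sum>i\<in>J. if i = j then 1 else 0 :: nat)" if "finite J"
    using that by (induction J rule: finite_induct) (auto simp: lookup_add lookup_single when_def)
  then show ?thesis by (simp add: chi_def)
qed

lemma t_prod_mult: "X \<inter> Y = {} \<Longrightarrow> t_prod X * t_prod Y = t_prod (X \<union> Y)" for X :: "'n::finite set"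
  unfolding t_prod_eq by (rule prod.union_disjoint[symmetric]) auto

lemma lookup_ctr_t_prod: "lookup (ctr (t_prod J) P) m = lookup P (m + chi J)"
  by (simp add: t_prod_mon lookup_ctr mon_times_mon pair_mon)

definition M_gens :: "'n set set \<Rightarrow> 'n set set" where
  "M_gens N = (\<lambda>I. I - \<Inter>N) ` N"

lemma M_ideal_gens: "M_ideal N = genideal Rhat (t_prod ` M_gens N)" for N :: "'n::finite set set"
  unfolding M_ideal_def M_gens_def by (rule arg_cong[of _ _ "genideal Rhat"]) blast

lemma annihil_prod:
  fixes P :: "'n::finite dual"
  assumes U: "ideal U Rhat" and X: "finite X"
  shows "P \<in> annihil (ideal_prod Rhat U (genideal Rhat X)) \<longleftrightarrow> (\<forall>x\<in>X. ctr x P \<in> annihil U)"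
proof
  assume *: "P \<in> annihil (ideal_prod Rhat U (genideal Rhat X))"
  show "\<forall>x\<in>X. ctr x P \<in> annihil U"
  proof
    fix x assume "x \<in> X"
    then have x: "x \<in> genideal Rhat X" using mps.genideal_self[of X UNIV] by auto
    have "f * x \<in> ideal_prod Rhat U (genideal Rhat X)" if "f \<in> U" for f
      using ideal_prod.prod[OF that x, of Rhat] by (simp add: mps_ring_simps(1))
    then show "ctr x P \<in> annihil U" using * by (simp add: annihil_def pair_ctr)
  qed
next
  assume *: "\<forall>x\<in>X. ctr x P \<in> annihil U"
  have "pair f P = 0" if "f \<in> ideal_prod Rhat U (genideal Rhat X)" for f
    using that
  proof (induction f rule: ideal_prod.induct)
    case (prod i j)
    then obtain a where j: "j = (\<Sum>x\<in>X. a x * x)" using genideal_Rhat[OF X] by auto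
    have "pair (i * (a x * x)) P = 0" if "x \<in> X" for x
    proof -
      have "a x * i \<in> U" using mps.idealD(3)[OF U prod(1)] by simp
      then have "pair (a x * i) (ctr x P) = 0" using * that by (simp add: annihil_def)
      then show ?thesis by (simp add: pair_ctr mult_ac)
    qed
    then show ?case unfolding mps_ring_simps(1) j sum_distrib_left pair_sum_left by simp
  next
    case (sum s1 s2)
    then show ?case by (simp add: mps_ring_simps pair_add_left)
  qed
  then show "P \<in> annihil (ideal_prod Rhat U (genideal Rhat X))" by (simp add: annihil_def)
qed

context gale
begin

lemma annihil_U_iff: "P \<in> annihil (U_ideal A) \<longleftrightarrow> (\<forall>i. ctr (linear_rel A i) P = 0)"
  unfolding U_ideal_eq by (subst annihil_genideal) auto

lemma annihil_Q_iff:
  "P \<in> annihil (Q_ideal A v N) \<longleftrightarrow>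
    (\<forall>I\<in>N. \<forall>i. ctr (linear_rel A i) (ctr (t_prod (I - \<Inter>N)) P) = 0) \<and>
    (\<forall>I\<in>N. \<forall>J\<in>nsupps A v - N. ctr (t_prod ((I \<union> J) - \<Inter>N)) P = 0)"
proof -
  have M: "ideal (M_ideal N) Rhat" unfolding M_ideal_gens by (rule mps.genideal_ideal) simp
  have "ideal (ideal_prod Rhat (U_ideal A) (M_ideal N)) Rhat"
    by (rule mps.ideal_prod_is_ideal[OF U_ideal_ideal M])
  then have "P \<in> annihil (Q_ideal A v N) \<longleftrightarrow> P \<in> annihil (ideal_prod Rhat (U_ideal A) (M_ideal N)) \<and> P \<in> annihil (P_ideal A v N)"
    unfolding Q_ideal_def by (simp add: annihil_add P_ideal_ideal)
  also have "\<dots> \<longleftrightarrow> (\<forall>X\<in>M_gens N. ctr (t_prod X) P \<in> annihil (U_ideal A)) \<and> (\<forall>X\<in>P_gens v N. ctr (t_prod X) P = 0)"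
  proof -
    have f: "finite (t_prod ` M_gens N)" "finite (t_prod ` P_gens v N)" by auto
    show ?thesis unfolding M_ideal_gens P_ideal_gens annihil_prod[OF U_ideal_ideal f(1)] annihil_genideal[OF f(2)] by simp
  qed
  finally show ?thesis unfolding annihil_U_iff M_gens_def P_gens_def by blast
qed

text \<open>By the toric equations, the normalised value at \<open>z\<close> depends on \<open>z\<close> only through the negative
  support \<open>I\<close>.  The resulting functionals \<open>s\<^sub>I\<close> satisfy
  \<open>t\<^bsup>J - I\<^esup> s\<^sub>I = t\<^bsup>I - J\<^esup> s\<^sub>J\<close>.  These are the syzygies between the monomial generators of
  \<open>M\<close>, so the \<open>s\<^sub>I\<close> glue to one functional \<open>P\<close> with \<open>s\<^sub>I = t\<^bsup>I - K\<^esup> P\<close> for the intersection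
  \<open>K\<close> of the family.  The linear relations then say that \<open>P\<close> kills \<open>U M\<close>, and the vanishing outside
  the family says that it kills the ideal generated by the monomials for \<open>I \<union> J\<close>.\<close>

theorem ambient_space_eq:
  assumes \<beta>: "map_matrix of_int A *v v = \<beta>" and v: "nsupp v \<in> N" and N: "N \<subseteq> nsupps A v"
  shows "ambient_space A \<beta> v N = (\<lambda>P. poly_of (ctr (e_elem v N) P)) ` annihil (Q_ideal A v N)"
  unfolding ambient_space_normalised[OF \<beta>]
proof (intro equalityI subsetI)
  fix p assume "p \<in> (\<lambda>P. poly_of (ctr (e_elem v N) P)) ` annihil (Q_ideal A v N)"
  then obtain P where p: "p = poly_of (ctr (e_elem v N) P)" and "P \<in> annihil (Q_ideal A v N)" by blast
  then have lin: "\<And>I i. I \<in> N \<Longrightarrow> ctr (linear_rel A i) (ctr (t_prod (I - \<Inter>N)) P) = 0"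
    and van: "\<And>I J. I \<in> N \<Longrightarrow> J \<in> nsupps A v - N \<Longrightarrow> ctr (t_prod ((I \<union> J) - \<Inter>N)) P = 0"
    unfolding annihil_Q_iff by blast+
  define q where "q z = (if z \<in> lattice A \<and> Isupp v z \<in> N then ctr (t_prod (Isupp v z - \<Inter>N)) P else 0)" for z
  have q: "ctr (t_prod (Isupp v z' - Isupp v z)) (q z)
      = (if Isupp v z \<in> N then ctr (t_prod ((Isupp v z \<union> Isupp v z') - \<Inter>N)) P else 0)"
    if "z \<in> lattice A" for z z'
  proof (cases "Isupp v z \<in> N")
    case True
    have "(Isupp v z' - Isupp v z) \<union> (Isupp v z - \<Inter>N) = (Isupp v z \<union> Isupp v z') - \<Inter>N"
      "(Isupp v z' - Isupp v z) \<inter> (Isupp v z - \<Inter>N) = {}" using True by auto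
    then have "t_prod (Isupp v z' - Isupp v z) * t_prod (Isupp v z - \<Inter>N) = t_prod ((Isupp v z \<union> Isupp v z') - \<Inter>N)"
      by (simp add: t_prod_mult)
    then show ?thesis using that True by (simp add: q_def ctr_times[symmetric])
  qed (simp add: q_def)
  have "normalised A v N q"
    unfolding normalised_def
  proof (intro conjI allI impI)
    fix z assume "q z \<noteq> 0"
    then show "z \<in> lattice A" "Isupp v z \<in> N" by (auto simp: q_def split: if_splits)
  next
    fix z i show "ctr (linear_rel A i) (q z) = 0" by (simp add: q_def lin)
  next
    fix z z' assume d: "z - z' \<in> lattice A"
    have L: "z \<in> lattice A \<longleftrightarrow> z' \<in> lattice A"
      using d by (simp add: lattice_def matrix_vector_mult_diff_distrib)
    show "ctr (t_prod (Isupp v z' - Isupp v z)) (q z) = ctr (t_prod (Isupp v z - Isupp v z')) (q z')"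
    proof (cases "z \<in> lattice A")
      case True
      then have z: "z \<in> lattice A" "z' \<in> lattice A" using L by auto
      then have "Isupp v z \<in> nsupps A v" "Isupp v z' \<in> nsupps A v" by (auto simp: nsupps_def)
      then show ?thesis unfolding q[OF z(1)] q[OF z(2)]
        using van[of "Isupp v z" "Isupp v z'"] van[of "Isupp v z'" "Isupp v z"] by (auto simp: Un_commute)
    next
      case False
      then show ?thesis using L by (simp add: q_def)
    qed
  qed
  moreover have "ctr (e_elem v N) P = q 0"
  proof -
    have "(0 :: int ^ 'n) \<in> lattice A" "shift v 0 = v" by (simp_all add: lattice_def shift_def vec_eq_iff)
    then show ?thesis using v by (simp add: q_def e_elem_def)
  qed
  ultimately show "p \<in> {poly_of (q 0) |q. normalised A v N q}" unfolding p by auto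
next
  fix p assume "p \<in> {poly_of (q 0) |q. normalised A v N q}"
  then obtain q where p: "p = poly_of (q 0)" and q: "normalised A v N q" by blast
  note q = q[unfolded normalised_def]
  have supp: "z \<in> lattice A \<and> Isupp v z \<in> N" if "q z \<noteq> 0" for z using q that by blast
  have lin: "ctr (linear_rel A i) (q z) = 0" for z i using q by blast
  have ex: "ctr (t_prod (Isupp v z' - Isupp v z)) (q z) = ctr (t_prod (Isupp v z - Isupp v z')) (q z')"
    if "z \<in> lattice A" "z' \<in> lattice A" for z z'
  proof -
    have "z - z' \<in> lattice A" using that by (simp add: lattice_def matrix_vector_mult_diff_distrib)
    then show ?thesis using q by blast
  qed
  have "\<exists>z. z \<in> lattice A \<and> Isupp v z = I" if "I \<in> nsupps A v" for I
    using that by (auto simp: nsupps_def)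
  then obtain pt where pt: "\<And>I. I \<in> nsupps A v \<Longrightarrow> pt I \<in> lattice A" "\<And>I. I \<in> nsupps A v \<Longrightarrow> Isupp v (pt I) = I"
    by metis
  \<comment> \<open>By the exchange relation for equal supports, the choice of the lattice point is immaterial.\<close>
  define s where "s I = q (pt I)" for I
  have exs: "ctr (t_prod (J - I)) (s I) = ctr (t_prod (I - J)) (s J)" if "I \<in> nsupps A v" "J \<in> nsupps A v" for I J
    using ex[of "pt I" "pt J"] pt that by (simp add: s_def)
  have zero: "s J = 0" if "J \<in> nsupps A v" "J \<notin> N" for J
    using supp[of "pt J"] pt that by (auto simp: s_def)
  let ?c = "\<lambda>I. chi (I - \<Inter>N)"
  \<comment> \<open>A coefficient at a common multiple of two generators is prescribed consistently by both.\<close>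
  have well: "lookup (s I) k = lookup (s I') k'" if I: "I \<in> N" "I' \<in> N" and m: "k + ?c I = k' + ?c I'" for I I' k k'
  proof -
    have lk: "lookup k j + (if j \<in> I - \<Inter>N then 1 else 0) = lookup k' j + (if j \<in> I' - \<Inter>N then 1 else 0)" for j
      using arg_cong[OF m, of "\<lambda>m. lookup m j"] by (simp add: lookup_add lookup_chi)
    have sub: "j \<in> I \<and> j \<in> I'" if "j \<in> \<Inter>N" for j using that I by blast
    \<comment> \<open>The common exponent is the least common multiple of the two monomials plus \<open>d\<close>.\<close>
    define d where "d = k - chi (I' - I)"
    have k: "k = d + chi (I' - I)"
    proof (rule poly_mapping_eqI)
      fix j show "lookup k j = lookup (d + chi (I' - I)) j"
        using lk[of j] sub[of j] by (cases "j \<in> I"; cases "j \<in> I'"; cases "j \<in> \<Inter>N")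
          (simp_all add: d_def lookup_add lookup_minus lookup_chi del: Inter_iff)
    qed
    have k': "k' = d + chi (I - I')"
    proof (rule poly_mapping_eqI)
      fix j show "lookup k' j = lookup (d + chi (I - I')) j"
        using lk[of j] sub[of j] by (cases "j \<in> I"; cases "j \<in> I'"; cases "j \<in> \<Inter>N")
          (simp_all add: d_def lookup_add lookup_minus lookup_chi del: Inter_iff)
    qed
    have "lookup (s I) k = lookup (ctr (t_prod (I' - I)) (s I)) d" unfolding k lookup_ctr_t_prod ..
    also have "\<dots> = lookup (s I') k'" unfolding k' lookup_ctr_t_prod[symmetric] using exs[of I I'] I N by (metis subsetD)
    finally show ?thesis .
  qed
  define F where "F = (\<Union>I\<in>N. (\<lambda>k. k + ?c I) ` Poly_Mapping.keys (s I))"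
  define g where "g m = (if \<exists>I k. I \<in> N \<and> m = k + ?c I
      then case (SOME (I, k). I \<in> N \<and> m = k + ?c I) of (I, k) \<Rightarrow> lookup (s I) k else 0)" for m
  have g: "g (k + ?c I) = lookup (s I) k" if "I \<in> N" for I k
  proof -
    have ex: "\<exists>p. case p of (I', k') \<Rightarrow> I' \<in> N \<and> k + ?c I = k' + ?c I'"
      by (rule exI[of _ "(I, k)"]) (simp add: that)
    obtain I' k' where p: "(SOME (I', k'). I' \<in> N \<and> k + ?c I = k' + ?c I') = (I', k')" by (rule prod.exhaust)
    have "I' \<in> N \<and> k + ?c I = k' + ?c I'" using someI_ex[OF ex] unfolding p by simp
    then have "lookup (s I') k' = lookup (s I) k" using well[OF _ that, of I' k' k] by simp
    moreover have "\<exists>I' k'. I' \<in> N \<and> k + ?c I = k' + ?c I'"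
      by (intro exI[of _ I] exI[of _ k]) (simp add: that)
    ultimately show ?thesis unfolding g_def p by simp
  qed
  define P where "P = Abs_poly_mapping g"
  have "{m. g m \<noteq> 0} \<subseteq> F"
  proof
    fix m assume "m \<in> {m. g m \<noteq> 0}"
    then have m: "g m \<noteq> 0" by simp
    have "\<exists>I k. I \<in> N \<and> m = k + ?c I"
    proof (rule ccontr)
      assume "\<not> (\<exists>I k. I \<in> N \<and> m = k + ?c I)"
      then show False using m unfolding g_def by (simp only: if_False)
    qed
    then obtain I k where I: "I \<in> N" "m = k + ?c I" by blast
    then have "k \<in> Poly_Mapping.keys (s I)" using m g[OF I(1), of k] by (simp add: in_keys_iff)
    then show "m \<in> F" unfolding F_def using I by blast
  qed
  moreover have "finite F" unfolding F_def by (intro finite_UN_I finite_imageI finite_class.finite finite_keys)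
  ultimately have lP: "lookup P = g" unfolding P_def by (simp add: finite_subset)
  have cP: "ctr (t_prod (I - \<Inter>N)) P = s I" if "I \<in> N" for I
    by (rule poly_mapping_eqI) (simp add: lookup_ctr_t_prod lP g[OF that])
  have "P \<in> annihil (Q_ideal A v N)"
    unfolding annihil_Q_iff
  proof (intro conjI ballI allI)
    fix I i assume I: "I \<in> N"
    show "ctr (linear_rel A i) (ctr (t_prod (I - \<Inter>N)) P) = 0" unfolding cP[OF I] s_def by (rule lin)
  next
    fix I J assume I: "I \<in> N" and J: "J \<in> nsupps A v - N"
    have "(J - I) \<union> (I - \<Inter>N) = (I \<union> J) - \<Inter>N" "(J - I) \<inter> (I - \<Inter>N) = {}" using I by auto
    then have "ctr (t_prod ((I \<union> J) - \<Inter>N)) P = ctr (t_prod (J - I)) (ctr (t_prod (I - \<Inter>N)) P)"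
      by (simp add: t_prod_mult ctr_times[symmetric])
    also have "\<dots> = ctr (t_prod (I - J)) (s J)" unfolding cP[OF I] using exs[of I J] I J N by (metis DiffD1 subsetD)
    also have "\<dots> = 0" using zero J by simp
    finally show "ctr (t_prod ((I \<union> J) - \<Inter>N)) P = 0" .
  qed
  moreover have "ctr (e_elem v N) P = q 0"
  proof -
    have z: "(0 :: int ^ 'n) \<in> lattice A" "shift v 0 = v" by (simp_all add: lattice_def shift_def vec_eq_iff)
    have "ctr (t_prod {}) (q (pt (nsupp v))) = ctr (t_prod {}) (q 0)"
      using ex[OF pt(1) z(1), of "nsupp v"] pt(2)[of "nsupp v"] v N z(2) by auto
    then have "s (nsupp v) = q 0" by (simp add: s_def t_prod_eq)
    then show ?thesis unfolding e_elem_def cP[OF v] .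
  qed
  ultimately show "p \<in> (\<lambda>P. poly_of (ctr (e_elem v N) P)) ` annihil (Q_ideal A v N)" unfolding p by (intro image_eqI[of _ _ P]) simp_all
qed

end


section \<open>The comparison theorem\<close>

lemma homog_t_prod: "homog (total_degree (chi J)) (t_prod J)"
  unfolding t_prod_mon by (rule homog_mon)

lemma homog_ideal_t_prods: "homog_ideal (genideal Rhat (t_prod ` X))" for X :: "'n::finite set set"
  unfolding homog_ideal_def using homog_t_prod by (intro exI[of _ "t_prod ` X"]) auto

lemma e_elem_in_M: "nsupp v \<in> N \<Longrightarrow> e_elem v N \<in> M_ideal N"
  unfolding M_ideal_gens e_elem_def M_gens_def
  using mps.genideal_self[of "t_prod ` (\<lambda>I. I - \<Inter>N) ` N" UNIV] by auto

context gale
begin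

lemma P_subset_M: "P_ideal A v N \<subseteq> M_ideal N"
  unfolding P_ideal_gens
proof (rule mps.genideal_minimal)
  show M: "ideal (M_ideal N) Rhat" unfolding M_ideal_gens by (rule mps.genideal_ideal) simp
  show "t_prod ` P_gens v N \<subseteq> M_ideal N"
  proof
    fix f assume "f \<in> t_prod ` P_gens v N"
    then obtain I J where f: "f = t_prod ((I \<union> J) - \<Inter>N)" and I: "I \<in> N" by (auto simp: P_gens_def)
    have "(J - I) \<union> (I - \<Inter>N) = (I \<union> J) - \<Inter>N" "(J - I) \<inter> (I - \<Inter>N) = {}" using I by auto
    then have "f = t_prod (J - I) * t_prod (I - \<Inter>N)" unfolding f by (simp add: t_prod_mult)
    moreover have "t_prod (I - \<Inter>N) \<in> M_ideal N"
      unfolding M_ideal_gens M_gens_def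
      using mps.genideal_self[of "t_prod ` (\<lambda>I. I - \<Inter>N) ` N" UNIV] I by auto
    ultimately show "f \<in> M_ideal N" using mps.idealD(3)[OF M] by simp
  qed
qed

lemma M_ideal_ideal: "ideal (M_ideal N) Rhat"
  unfolding M_ideal_gens by (rule mps.genideal_ideal) simp

lemma comparison_instance:
  assumes "nsupp v \<in> N"
  shows "ideal_comparison Rhat (Shat r) (Phi r B) (U_ideal A) (M_ideal N) (P_ideal A v N) (e_elem v N)"
proof (intro ideal_comparison.intro ideal_comparison_axioms.intro)
  show "ring_hom_cring Rhat (Shat r) (Phi r B)" by (rule Phi_hom)
  show "Phi r B ` carrier Rhat = carrier (Shat r)" by (rule Phi_surj)
  show "Phi r B f = \<zero>\<^bsub>Shat r\<^esub> \<longleftrightarrow> f \<in> U_ideal A" for f unfolding mps_ring_simps by (rule Phi_kernel)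
  show "ideal (U_ideal A) Rhat" by (rule U_ideal_ideal)
  show "ideal (M_ideal N) Rhat" by (rule M_ideal_ideal)
  show "ideal (P_ideal A v N) Rhat" by (rule P_ideal_ideal)
  show "P_ideal A v N \<subseteq> M_ideal N" by (rule P_subset_M)
  show "e_elem v N \<in> M_ideal N" by (rule e_elem_in_M[OF assms])
qed

text \<open>The two spaces are the images of \<open>(U + P)\<^sup>\<bottom>\<close> and \<open>Q\<^sup>\<bottom>\<close> under contraction with \<open>e\<close>.
  If some \<open>f e\<close> lies in \<open>U + P\<close> but not in \<open>Q\<close>, a functional that kills \<open>Q\<close> and not \<open>f e\<close> contracts to
  a polynomial outside the smaller space.  Conversely, if no such \<open>f\<close> exists, a functional that kills
  \<open>Q\<close> vanishes on the multiples of \<open>e\<close> in \<open>U + P\<close>, and its restriction to the multiples of \<open>e\<close> extends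
  to a functional that kills \<open>U + P\<close>.\<close>

lemma coefficient_spaces_equal_iff:
  assumes \<beta>: "map_matrix of_int A *v v = \<beta>" and v: "nsupp v \<in> N" and N: "N \<subseteq> nsupps A v"
  shows "intrinsic_space A r B v N = ambient_space A \<beta> v N \<longleftrightarrow>
    colon_ideal Rhat (U_ideal A <+>\<^bsub>Rhat\<^esub> P_ideal A v N) (e_elem v N) \<subseteq> colon_ideal Rhat (Q_ideal A v N) (e_elem v N)"
proof -
  let ?W = "U_ideal A <+>\<^bsub>Rhat\<^esub> P_ideal A v N" and ?e = "e_elem v N"
  have hP: "homog_ideal (P_ideal A v N)" unfolding P_ideal_gens by (rule homog_ideal_t_prods)
  have hM: "homog_ideal (M_ideal N)" unfolding M_ideal_gens by (rule homog_ideal_t_prods)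
  have hW: "homog_ideal ?W" by (rule homog_ideal_add[OF homog_U_ideal hP])
  have hQ: "homog_ideal (Q_ideal A v N)"
    unfolding Q_ideal_def by (intro homog_ideal_add homog_ideal_prod homog_U_ideal hP hM)
  have QW: "Q_ideal A v N \<subseteq> ?W"
  proof -
    have "ideal_prod Rhat (U_ideal A) (M_ideal N) \<subseteq> U_ideal A"
      using mps.ideal_prod_inter[OF U_ideal_ideal M_ideal_ideal] by blast
    then show ?thesis unfolding Q_ideal_def set_add_Rhat by blast
  qed
  have colon: "f \<in> colon_ideal Rhat I x \<longleftrightarrow> f * x \<in> I" for f x and I :: "'n series set"
    by (simp add: colon_ideal_def mps_ring_simps)
  note spaces = intrinsic_space_eq[OF v] ambient_space_eq[OF \<beta> v N]
  show ?thesis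
  proof
    assume eq: "intrinsic_space A r B v N = ambient_space A \<beta> v N"
    show "colon_ideal Rhat ?W ?e \<subseteq> colon_ideal Rhat (Q_ideal A v N) ?e"
    proof
      fix f assume f: "f \<in> colon_ideal Rhat ?W ?e"
      show "f \<in> colon_ideal Rhat (Q_ideal A v N) ?e"
      proof (rule ccontr)
        assume "f \<notin> colon_ideal Rhat (Q_ideal A v N) ?e"
        then have "f * ?e \<notin> Q_ideal A v N" by (simp add: colon)
        then obtain P where P: "P \<in> annihil (Q_ideal A v N)" "pair (f * ?e) P \<noteq> 0" by (rule separation[OF hQ])
        then have "poly_of (ctr ?e P) \<in> intrinsic_space A r B v N" unfolding eq spaces by blast
        then obtain P' where P': "P' \<in> annihil ?W" "ctr ?e P = ctr ?e P'" unfolding spaces by (auto simp: poly_of_inject)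
        have "pair (f * ?e) P = pair f (ctr ?e P')" unfolding P'(2)[symmetric] by (simp add: pair_ctr)
        also have "\<dots> = pair (f * ?e) P'" by (simp add: pair_ctr)
        also have "\<dots> = 0" using P'(1) f by (simp add: annihil_def colon)
        finally show False using P(2) by simp
      qed
    qed
  next
    assume sub: "colon_ideal Rhat ?W ?e \<subseteq> colon_ideal Rhat (Q_ideal A v N) ?e"
    have "annihil ?W \<subseteq> annihil (Q_ideal A v N)" using QW by (auto simp: annihil_def)
    then have "intrinsic_space A r B v N \<subseteq> ambient_space A \<beta> v N" unfolding spaces by blast
    moreover have "poly_of (ctr ?e P) \<in> intrinsic_space A r B v N" if P: "P \<in> annihil (Q_ideal A v N)" for P
    proof -
      have "pair (g * ?e) P = 0" if "g * ?e \<in> ?W" for g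
      proof -
        have "g * ?e \<in> Q_ideal A v N" using that sub by (auto simp: colon[symmetric])
        then show ?thesis using P by (simp add: annihil_def)
      qed
      then obtain P' where "P' \<in> annihil ?W" "ctr ?e P' = ctr ?e P"
        using extend_annihilator[OF hW homog_t_prod[of "nsupp v - \<Inter>N", folded e_elem_def], of P] by blast
      then show ?thesis unfolding spaces by (metis imageI)
    qed
    ultimately show "intrinsic_space A r B v N = ambient_space A \<beta> v N" unfolding spaces by blast
  qed
qed

end

theorem theorem3p3:
  fixes A :: "int ^ 'n::finite ^ 'd::finite"
    and \<beta> :: "complex ^ 'd"
    and w :: "real ^ 'n"
    and v :: "complex ^ 'n"
    and N :: "'n set set"
    and r :: nat
    and B :: "nat \<Rightarrow> int ^ 'n"
  assumes "homogeneous_matrix A"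
    and "generic_direction A \<beta> w"
    and "fake_exponent A \<beta> w v"
    and "nsupp_family A w v N"
    and "r = CARD('n) - CARD('d)"
    and "gale_dual A r B"
  shows "let R = (Rhat :: 'n series ring); S = Shat r; \<Phi> = Phi r B;
      e = e_elem v N; U = U_ideal A; M = M_ideal N; P = P_ideal A v N; Q = Q_ideal A v N;
      D = D_module A v N; G = G_module A r B v N; E = E_module A v N; T = T_module A v N;
      D\<^sub>S = module_via R \<Phi> D; E\<^sub>S = module_via R \<Phi> E; T\<^sub>S = module_via R \<Phi> T;
      J = colon_ideal R (U <+>\<^bsub>R\<^esub> P) e; K = colon_ideal R Q e;
      X = ideal_quot R (U \<inter> M) (ideal_prod R U M);
      Tor = Tor1 R (quot_module (ring_mod R) U) (quot_module (ring_mod R) M)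
    in
      (Module.module S D\<^sub>S \<and> Module.module S G \<and> Module.module S E\<^sub>S \<and> Module.module S T\<^sub>S \<and>
       (\<exists>f\<in>mod_iso S D\<^sub>S G. \<exists>g\<in>mod_iso S G E\<^sub>S. \<exists>h\<in>mod_hom S E\<^sub>S T\<^sub>S.
          (\<forall>a\<in>J. f (K +>\<^bsub>R\<^esub> a) = \<Phi> ` K +>\<^bsub>S\<^esub> \<Phi> a) \<and>
          (\<forall>a\<in>J. g (\<Phi> ` K +>\<^bsub>S\<^esub> \<Phi> a) = (cgenideal R e \<inter> Q) +>\<^bsub>R\<^esub> (e \<otimes>\<^bsub>R\<^esub> a)) \<and>
          (\<forall>b \<in> cgenideal R e \<inter> ((U \<inter> M) <+>\<^bsub>R\<^esub> P). h ((cgenideal R e \<inter> Q) +>\<^bsub>R\<^esub> b) = Q +>\<^bsub>R\<^esub> b) \<and>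
          inj_on h (carrier E\<^sub>S) \<and>
          submodule {Y \<in> carrier T\<^sub>S. \<exists>c\<in>carrier R. e \<otimes>\<^bsub>R\<^esub> c \<in> Y} S T\<^sub>S \<and>
          bij_betw (h \<circ> g \<circ> f) (carrier D\<^sub>S)
            {Y \<in> carrier T\<^sub>S. \<exists>c\<in>carrier R. e \<otimes>\<^bsub>R\<^esub> c \<in> Y})) \<and>
      (ordered_family A v N \<longrightarrow>
         (intrinsic_space A r B v N = ambient_space A \<beta> v N \<longleftrightarrow> carrier D = {\<zero>\<^bsub>D\<^esub>})) \<and>
      (Module.module R Tor \<and> Module.module R X \<and> Module.module R T \<and>
       (\<exists>\<tau>\<in>mod_iso R Tor X. \<exists>\<pi>\<in>mod_hom R X T.
          (\<forall>a \<in> U \<inter> M. \<pi> (ideal_prod R U M +>\<^bsub>R\<^esub> a) = Q +>\<^bsub>R\<^esub> a) \<and>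
          \<pi> ` carrier X = carrier T \<and>
          \<pi> \<circ> \<tau> \<in> mod_hom R Tor T \<and> (\<pi> \<circ> \<tau>) ` carrier Tor = carrier T)) \<and>
      (U \<inter> M \<subseteq> Q \<longrightarrow> carrier D = {\<zero>\<^bsub>D\<^esub>})"
proof -
  have \<beta>: "map_matrix of_int A *v v = \<beta>" using assms(3) by (simp add: fake_exponent_def)
  have v: "nsupp v \<in> N" and N: "N \<subseteq> nsupps A v"
    using assms(4) by (auto simp: nsupp_family_def distinguished_nsupps_def)
  interpret g: gale A r B by (rule gale.intro[OF assms(6)])
  interpret c: ideal_comparison Rhat "Shat r" "Phi r B" "U_ideal A" "M_ideal N" "P_ideal A v N" "e_elem v N"
    by (rule g.comparison_instance[OF v])
  have Q: "Q_ideal A v N = c.Q" unfolding Q_ideal_def c.Q_def ..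
  have defs: "D_module A v N = c.D" "G_module A r B v N = c.G" "E_module A v N = c.E" "T_module A v N = c.T"
    unfolding D_module_def G_module_def E_module_def T_module_def Pi_ideal_def m_elem_def Q
      c.D_def c.G_def c.E_def c.T_def c.J_def c.K_def c.W_def by (rule refl)+
  have spaces: "intrinsic_space A r B v N = ambient_space A \<beta> v N \<longleftrightarrow> carrier c.D = {\<zero>\<^bsub>c.D\<^esub>}"
    using g.coefficient_spaces_equal_iff[OF \<beta> v N] unfolding c.D_trivial Q c.J_def c.K_def .
  let ?X = "ideal_quot Rhat (U_ideal A \<inter> M_ideal N) (ideal_prod Rhat (U_ideal A) (M_ideal N))"
  let ?Tor = "Tor1 Rhat (quot_module (ring_mod Rhat) (U_ideal A)) (quot_module (ring_mod Rhat) (M_ideal N))"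
  have Tor: "Module.module Rhat ?Tor" by (rule Tor1_cyclic_cyclic(1)[OF mps.cring c.U c.M])
  obtain \<tau> where \<tau>: "\<tau> \<in> mod_iso Rhat ?Tor ?X" using Tor1_cyclic_cyclic(2)[OF mps.cring c.U c.M] by blast
  obtain \<pi> where \<pi>: "\<pi> \<in> mod_hom Rhat ?X c.T"
    "\<And>a. a \<in> U_ideal A \<inter> M_ideal N \<Longrightarrow> \<pi> (ideal_prod Rhat (U_ideal A) (M_ideal N) +>\<^bsub>Rhat\<^esub> a) = c.Q +>\<^bsub>Rhat\<^esub> a"
    "\<pi> ` carrier ?X = carrier c.T" by (rule c.quotient_of_intersection) blast
  have X: "Module.module Rhat ?X"
    by (rule ideal_quot_module[OF mps.cring mps.i_intersect[OF c.U c.M] mps.ideal_prod_is_ideal[OF c.U c.M]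
          mps.ideal_prod_inter[OF c.U c.M]])
  have \<tau>': "\<tau> \<in> mod_hom Rhat ?Tor ?X" "\<tau> ` carrier ?Tor = carrier ?X"
    using \<tau> by (auto simp: mod_iso_def bij_betw_def)
  have comp: "\<pi> \<circ> \<tau> \<in> mod_hom Rhat ?Tor c.T" by (rule mod_hom_comp[OF \<tau>'(1) \<pi>(1)])
  have im: "(\<pi> \<circ> \<tau>) ` carrier ?Tor = carrier c.T" unfolding image_comp[symmetric] \<tau>'(2) \<pi>(3) ..
  have third: "Module.module Rhat ?Tor \<and> Module.module Rhat ?X \<and> Module.module Rhat c.T \<and>
       (\<exists>\<tau>\<in>mod_iso Rhat ?Tor ?X. \<exists>\<pi>\<in>mod_hom Rhat ?X c.T.
          (\<forall>a \<in> U_ideal A \<inter> M_ideal N. \<pi> (ideal_prod Rhat (U_ideal A) (M_ideal N) +>\<^bsub>Rhat\<^esub> a) = c.Q +>\<^bsub>Rhat\<^esub> a) \<and>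
          \<pi> ` carrier ?X = carrier c.T \<and>
          \<pi> \<circ> \<tau> \<in> mod_hom Rhat ?Tor c.T \<and> (\<pi> \<circ> \<tau>) ` carrier ?Tor = carrier c.T)"
    using Tor X c.T_mod \<tau> \<pi> comp im by blast
  show ?thesis
    unfolding Let_def defs Q
    by (intro conjI impI c.comparison[unfolded c.J_def c.K_def c.W_def] spaces third c.trivial_if_intersection_small)
qed

end
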